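(* Let $\gamma\in\Gamma_{1,1}:=(-\infty,-1)\cup(0,\infty)$, $s,\theta\in(0,1)$, and $p,p_1\in[1,\infty]$ satisfy $$s=1-\theta\quad\text{and}\quad\frac1p=1-\theta+\frac\theta{p_1}.$$ Assume that $X$ is a ball Banach function space having an absolutely continuous norm and that either (a) the Hardy--Littlewood maximal operator $M$ is bounded on $X'$, or (b) $M$ is endpoint bounded on $X'$ and the centered ball average operators $\{\mathcal{B}_r\}_{r\in(0,\infty)}$ are uniformly bounded on $X$. Then the following statements hold. (i) If $p_1\in[1,\infty)$, then there exists a positive constant $C$ such that, for any $f\in\dot W^{1,X}$, $$\sup_{\lambda\in(0,\infty)}\lambda\left\|\int_{\mathbb{R}^n}\mathbf{1}_{E_{\lambda,\frac\gamma p+s-1}[f]}(\cdot,y)|\cdot-y|^{\gamma-n}\,dy\right\|_X^{\frac1p}\le C\|f\|_{X^{p_1}}^\theta\left\|\,|\nabla f|\,\right\|_X^{1-\theta}.$$ (ii) If $p_1=\infty$, then there exists a positive constant $C$ such that, for any $f\in\dot W^{1,X}$, $$\sup_{\lambda\in(0,\infty)}\lambda\left\|\int_{\mathbb{R}^n}\mathbf{1}_{E_{\lambda,\frac\gamma p+s-1}[f]}(\cdot,y)|\cdot-y|^{\gamma-n}\,dy\right\|_X^{\frac1p}\le C\|f\|_{L^\infty}^\theta\left\|\,|\nabla f|\,\right\|_X^{1-\theta}.$$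
   Context: Everything is on $\mathbb{R}^n$; $\mathscr{M}$ is the set of all measurable functions. $E_{\lambda,b}[f]:=\{(x,y)\in\mathbb{R}^n\times\mathbb{R}^n:x\ne y,\ |f(x)-f(y)|>\lambda|x-y|^{1+b}\}$. A quasi-Banach space $X\subset\mathscr{M}$, with quasi-norm making sense (possibly $\infty$) on all of $\mathscr{M}$, is a ball Banach function space if: (1) $\|f\|_X=0$ implies $f=0$ a.e.; (2) $|g|\le|f|$ a.e. implies $\|g\|_X\le\|f\|_X$; (3) $0\le f_m\uparrow f$ a.e. implies $\|f_m\|_X\uparrow\|f\|_X$; (4) $\mathbf{1}_B\in X$ for every ball $B$; (5) $\|f+g\|_X\le\|f\|_X+\|g\|_X$ for $f,g\in X$; (6) for each ball $B$ there is $C_{(B)}>0$ with $\int_B|f|\,dx\le C_{(B)}\|f\|_X$ for $f\in X$. For $r\in(0,\infty)$, $X^r:=\{f\in\mathscr{M}:|f|^r\in X\}$ with $\|f\|_{X^r}:=\|\,|f|^r\|_X^{1/r}$. $X':=\{f\in\mathscr{M}:\|f\|_{X'}:=\sup_{\|g\|_X=1}\|fg\|_{L^1}<\infty\}$. $X$ has an absolutely continuous norm if $\|f\mathbf{1}_{E_j}\|_X\to0$ for every $f\in X$ and every sequence of measurable sets with $\mathbf{1}_{E_j}\to0$ a.e. $M(f)(x):=\sup_{Q\ni x}\frac1{|Q|}\int_Q|f|$ over cubes $Q$; $\mathcal{B}_r(f)(x):=\frac1{|B(x,r)|}\int_{B(x,r)}|f|$. $M$ is endpoint bounded on $X'$ if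 there is a sequence $\{\theta_m\}_{m\in\mathbb{N}}\subset(0,1)$ with $\theta_m\to1$ such that, for each $m$, $X^{\frac1{\theta_m}}$ is a ball Banach function space, $M$ is bounded on $(X^{\frac1{\theta_m}})'$, and $\lim_{m\to\infty}\|M\|_{(X^{1/\theta_m})'\to(X^{1/\theta_m})'}<\infty$. $\dot W^{1,X}$ is the set of all distributions $f$ with $|\nabla f|\in X$; such $f$ are automatically locally integrable functions. The right-hand sides are allowed to be $\infty$. *)

theory Defs
  imports "HOL-Analysis.Analysis" "HOL-Probability.Essential_Supremum"
begin

text \<open>
  Throughout, \<open>\<real>\<^sup>n\<close> is an arbitrary type \<open>'a :: euclidean_space\<close>, measurable means Lebesgue
  measurable, and functions are real valued. A (quasi-)normed function space \<open>X\<close> is represented by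
  its quasi-norm, an \<open>ennreal\<close>-valued functional that makes sense on all measurable functions; the
  space itself consists of the measurable functions on which the quasi-norm is finite. The values
  of the functional at non-measurable functions are irrelevant.
\<close>

definition fspace :: "(('a::euclidean_space \<Rightarrow> real) \<Rightarrow> ennreal) \<Rightarrow> ('a \<Rightarrow> real) set" where
  "fspace X = {f \<in> borel_measurable lebesgue. X f < top}"

text \<open>Real powers on \<open>[0,\<infinity>]\<close>, used for positive exponents only.\<close>

definition epowr :: "ennreal \<Rightarrow> real \<Rightarrow> ennreal" where
  "epowr x a = (if x = top then top else ennreal (enn2real x powr a))"

text \<open>
  The quasi-norm of a \<open>[0,\<infinity>]\<close>-valued function. If the function is infinite on a set of positive
  measure, then the value \<open>\<infinity>\<close> is forced by the Fatou property and local integrability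
  (the third and the last axiom of ball Banach function spaces below).
\<close>

definition enorm :: "(('a::euclidean_space \<Rightarrow> real) \<Rightarrow> ennreal) \<Rightarrow> ('a \<Rightarrow> ennreal) \<Rightarrow> ennreal" where
  "enorm X h = (if AE x in lebesgue. h x < top then X (\<lambda>x. enn2real (h x)) else top)"


locale quasi_banach_function_space =
  fixes X :: "('a::euclidean_space \<Rightarrow> real) \<Rightarrow> ennreal"
  assumes norm_eq_0D: "f \<in> borel_measurable lebesgue \<Longrightarrow> X f = 0 \<Longrightarrow> AE x in lebesgue. f x = 0"
    and norm_scale: "f \<in> borel_measurable lebesgue \<Longrightarrow> X (\<lambda>x. c * f x) = ennreal \<bar>c\<bar> * X f"
    and quasi_triangle: "\<exists>K::real. \<forall>f \<in> borel_measurable lebesgue. \<forall>g \<in> borel_measurable lebesgue.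
          X (\<lambda>x. f x + g x) \<le> ennreal K * (X f + X g)"
    and complete: "(\<And>m::nat. F m \<in> fspace X) \<Longrightarrow>
          (\<And>e::real. e > 0 \<Longrightarrow> \<exists>N. \<forall>i\<ge>N. \<forall>j\<ge>N. X (\<lambda>x. F i x - F j x) < ennreal e) \<Longrightarrow>
          \<exists>f \<in> fspace X. (\<lambda>m. X (\<lambda>x. F m x - f x)) \<longlonglongrightarrow> 0"

locale ball_banach_function_space = quasi_banach_function_space X
  for X :: "('a::euclidean_space \<Rightarrow> real) \<Rightarrow> ennreal" +
  assumes norm_mono: "f \<in> borel_measurable lebesgue \<Longrightarrow> g \<in> borel_measurable lebesgue \<Longrightarrow>
          AE x in lebesgue. \<bar>g x\<bar> \<le> \<bar>f x\<bar> \<Longrightarrow> X g \<le> X f"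
    and norm_Fatou: "(\<And>m::nat. F m \<in> borel_measurable lebesgue) \<Longrightarrow> f \<in> borel_measurable lebesgue \<Longrightarrow>
          AE x in lebesgue. (\<forall>m. 0 \<le> F m x) \<and> incseq (\<lambda>m. F m x) \<and> (\<lambda>m. F m x) \<longlonglongrightarrow> f x \<Longrightarrow>
          incseq (\<lambda>m. X (F m)) \<and> (\<lambda>m. X (F m)) \<longlonglongrightarrow> X f"
    and indicator_ball: "r > 0 \<Longrightarrow> indicator (ball z r) \<in> fspace X"
    and triangle: "f \<in> fspace X \<Longrightarrow> g \<in> fspace X \<Longrightarrow> X (\<lambda>x. f x + g x) \<le> X f + X g"
    and integral_ball: "r > 0 \<Longrightarrow> \<exists>C::real. C > 0 \<and> (\<forall>f \<in> fspace X.
          (\<integral>\<^sup>+x\<in>ball z r. ennreal \<bar>f x\<bar> \<partial>lebesgue) \<le> ennreal C * X f)"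

definition absolutely_continuous_norm ::
  "(('a::euclidean_space \<Rightarrow> real) \<Rightarrow> ennreal) \<Rightarrow> bool" where
  "absolutely_continuous_norm X \<longleftrightarrow>
     (\<forall>f \<in> fspace X. \<forall>E :: nat \<Rightarrow> 'a set.
        (\<forall>j. E j \<in> sets lebesgue) \<longrightarrow>
        (AE x in lebesgue. (\<lambda>j. indicator (E j) x :: real) \<longlonglongrightarrow> 0) \<longrightarrow>
        (\<lambda>j. X (\<lambda>x. f x * indicator (E j) x)) \<longlonglongrightarrow> 0)"

definition power_norm ::
  "(('a::euclidean_space \<Rightarrow> real) \<Rightarrow> ennreal) \<Rightarrow> real \<Rightarrow> ('a \<Rightarrow> real) \<Rightarrow> ennreal" where
  "power_norm X r f = epowr (X (\<lambda>x. \<bar>f x\<bar> powr r)) (1 / r)"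

definition associate_norm ::
  "(('a::euclidean_space \<Rightarrow> real) \<Rightarrow> ennreal) \<Rightarrow> ('a \<Rightarrow> real) \<Rightarrow> ennreal" where
  "associate_norm X f =
     (SUP g \<in> {g \<in> borel_measurable lebesgue. X g = 1}. \<integral>\<^sup>+x. ennreal \<bar>f x * g x\<bar> \<partial>lebesgue)"

definition Linfty_norm :: "('a::euclidean_space \<Rightarrow> real) \<Rightarrow> ennreal" where
  "Linfty_norm f = esssup lebesgue (\<lambda>x. ennreal \<bar>f x\<bar>)"


definition average :: "'a::euclidean_space set \<Rightarrow> ('a \<Rightarrow> real) \<Rightarrow> ennreal" where
  "average A f = (\<integral>\<^sup>+y\<in>A. ennreal \<bar>f y\<bar> \<partial>lebesgue) / emeasure lebesgue A"

definition cubes :: "'a::euclidean_space set set" where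
  "cubes = {cbox c (c + t *\<^sub>R One) |c t. t > 0}"

definition HL_maximal :: "('a::euclidean_space \<Rightarrow> real) \<Rightarrow> 'a \<Rightarrow> ennreal" where
  "HL_maximal f x = (SUP Q \<in> {Q \<in> cubes. x \<in> Q}. average Q f)"

definition ball_average :: "real \<Rightarrow> ('a::euclidean_space \<Rightarrow> real) \<Rightarrow> 'a \<Rightarrow> ennreal" where
  "ball_average r f x = average (ball x r) f"

text \<open>
  The operator norm on \<open>X\<close> of an operator with \<open>[0,\<infinity>]\<close>-valued images: the least constant in
  the norm inequality, which is \<open>\<infinity>\<close> if the operator is unbounded.
\<close>

definition op_norm ::
  "(('a::euclidean_space \<Rightarrow> real) \<Rightarrow> ennreal) \<Rightarrow> (('a \<Rightarrow> real) \<Rightarrow> 'a \<Rightarrow> ennreal) \<Rightarrow> ennreal" where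
  "op_norm X T = Inf {C. \<forall>f \<in> fspace X. enorm X (T f) \<le> C * X f}"

definition bounded_operator ::
  "(('a::euclidean_space \<Rightarrow> real) \<Rightarrow> ennreal) \<Rightarrow> (('a \<Rightarrow> real) \<Rightarrow> 'a \<Rightarrow> ennreal) \<Rightarrow> bool" where
  "bounded_operator X T \<longleftrightarrow> (\<exists>C::real. \<forall>f \<in> fspace X. enorm X (T f) \<le> ennreal C * X f)"

definition ball_averages_uniformly_bounded ::
  "(('a::euclidean_space \<Rightarrow> real) \<Rightarrow> ennreal) \<Rightarrow> bool" where
  "ball_averages_uniformly_bounded X \<longleftrightarrow>
     (\<exists>C::real. \<forall>r>0. \<forall>f \<in> fspace X. enorm X (ball_average r f) \<le> ennreal C * X f)"

definition endpoint_bounded_on_associate ::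
  "(('a::euclidean_space \<Rightarrow> real) \<Rightarrow> ennreal) \<Rightarrow> bool" where
  "endpoint_bounded_on_associate X \<longleftrightarrow>
     (\<exists>\<theta> :: nat \<Rightarrow> real.
        (\<forall>m. \<theta> m \<in> {0<..<1}) \<and> \<theta> \<longlonglongrightarrow> 1 \<and>
        (\<forall>m. ball_banach_function_space (power_norm X (1 / \<theta> m)) \<and>
             bounded_operator (associate_norm (power_norm X (1 / \<theta> m))) HL_maximal) \<and>
        (\<exists>L. L < top \<and> (\<lambda>m. op_norm (associate_norm (power_norm X (1 / \<theta> m))) HL_maximal) \<longlonglongrightarrow> L))"


fun iter_partial :: "'a::euclidean_space list \<Rightarrow> ('a \<Rightarrow> real) \<Rightarrow> 'a \<Rightarrow> real" where
  "iter_partial [] \<phi> = \<phi>"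
| "iter_partial (b # bs) \<phi> = (\<lambda>x. frechet_derivative (iter_partial bs \<phi>) (at x) b)"

text \<open>
  \<open>C\<^sub>c\<^sup>\<infinity>\<close>: all iterated partial derivatives are (Frechet) differentiable everywhere, hence
  continuous.
\<close>

definition test_function :: "('a::euclidean_space \<Rightarrow> real) \<Rightarrow> bool" where
  "test_function \<phi> \<longleftrightarrow>
     compact (closure {x. \<phi> x \<noteq> 0}) \<and>
     (\<forall>bs. set bs \<subseteq> Basis \<longrightarrow> (\<forall>x. iter_partial bs \<phi> differentiable at x))"

text \<open>
  A distribution is a linear functional on test functions which, on the test functions supported
  in a fixed compact set, is dominated by finitely many of the seminorms
  \<open>sup |\<partial>\<^sup>\<alpha> \<phi>|\<close>. Its values outside the test functions are irrelevant.
\<close>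

definition distribution :: "(('a::euclidean_space \<Rightarrow> real) \<Rightarrow> real) \<Rightarrow> bool" where
  "distribution T \<longleftrightarrow>
     (\<forall>\<phi> \<psi> c d. test_function \<phi> \<longrightarrow> test_function \<psi> \<longrightarrow>
        T (\<lambda>x. c * \<phi> x + d * \<psi> x) = c * T \<phi> + d * T \<psi>) \<and>
     (\<forall>K. compact K \<longrightarrow> (\<exists>(k::nat) (C::real). \<forall>\<phi> B. test_function \<phi> \<longrightarrow> {x. \<phi> x \<noteq> 0} \<subseteq> K \<longrightarrow>
        (\<forall>bs x. set bs \<subseteq> Basis \<longrightarrow> length bs \<le> k \<longrightarrow> \<bar>iter_partial bs \<phi> x\<bar> \<le> B) \<longrightarrow>
        \<bar>T \<phi>\<bar> \<le> C * B))"

definition locally_integrable :: "('a::euclidean_space \<Rightarrow> real) \<Rightarrow> bool" where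
  "locally_integrable f \<longleftrightarrow>
     f \<in> borel_measurable lebesgue \<and> (\<forall>K. compact K \<longrightarrow> f absolutely_integrable_on K)"

definition dist_of :: "('a::euclidean_space \<Rightarrow> real) \<Rightarrow> ('a \<Rightarrow> real) \<Rightarrow> real" where
  "dist_of f \<phi> = (LINT x|lebesgue. f x * \<phi> x)"

definition dist_partial ::
  "'a::euclidean_space \<Rightarrow> (('a \<Rightarrow> real) \<Rightarrow> real) \<Rightarrow> ('a \<Rightarrow> real) \<Rightarrow> real" where
  "dist_partial b T \<phi> = - T (iter_partial [b] \<phi>)"

definition has_gradient ::
  "(('a::euclidean_space \<Rightarrow> real) \<Rightarrow> real) \<Rightarrow> ('a \<Rightarrow> 'a) \<Rightarrow> bool" where
  "has_gradient T g \<longleftrightarrow>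
     (\<forall>b\<in>Basis. locally_integrable (\<lambda>x. g x \<bullet> b) \<and>
        (\<forall>\<phi>. test_function \<phi> \<longrightarrow> dist_partial b T \<phi> = dist_of (\<lambda>x. g x \<bullet> b) \<phi>))"

text \<open>The function representing the distributional gradient is unique up to null sets.\<close>

definition dist_gradient :: "(('a::euclidean_space \<Rightarrow> real) \<Rightarrow> real) \<Rightarrow> 'a \<Rightarrow> 'a" where
  "dist_gradient T = (SOME g. has_gradient T g)"

definition homogeneous_sobolev ::
  "(('a::euclidean_space \<Rightarrow> real) \<Rightarrow> ennreal) \<Rightarrow> (('a \<Rightarrow> real) \<Rightarrow> real) set" where
  "homogeneous_sobolev X =
     {T. distribution T \<and> (\<exists>g. has_gradient T g) \<and> (\<lambda>x. norm (dist_gradient T x)) \<in> fspace X}"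

text \<open>
  Elements of the homogeneous Sobolev space are regular distributions, so that the space can be
  regarded as a space of locally integrable functions.
\<close>

definition sobolev_functions ::
  "(('a::euclidean_space \<Rightarrow> real) \<Rightarrow> ennreal) \<Rightarrow> ('a \<Rightarrow> real) set" where
  "sobolev_functions X = {f. locally_integrable f \<and> dist_of f \<in> homogeneous_sobolev X}"

abbreviation grad :: "('a::euclidean_space \<Rightarrow> real) \<Rightarrow> 'a \<Rightarrow> 'a" where
  "grad f \<equiv> dist_gradient (dist_of f)"


definition E_set :: "real \<Rightarrow> real \<Rightarrow> ('a::euclidean_space \<Rightarrow> real) \<Rightarrow> ('a \<times> 'a) set" where
  "E_set l b f = {(x, y). x \<noteq> y \<and> \<bar>f x - f y\<bar> > l * norm (x - y) powr (1 + b)}"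

definition E_integral ::
  "real \<Rightarrow> real \<Rightarrow> real \<Rightarrow> ('a::euclidean_space \<Rightarrow> real) \<Rightarrow> 'a \<Rightarrow> ennreal" where
  "E_integral \<gamma> l b f x =
     (\<integral>\<^sup>+y. indicator (E_set l b f) (x, y) * ennreal (norm (x - y) powr (\<gamma> - real DIM('a))) \<partial>lebesgue)"

end

(*
  Both hypotheses on the maximal operator yield M bounded on X': under endpoint boundedness, Young's
  inequality compares the norms of X and of X^(1/theta_m) on truncations as theta_m -> 1. Since
  X = X'', which is proved by an L^2 projection onto the unit ball, every norm estimate reduces to
  integral estimates against a weight w, with M applied to w a bounded number of times.

  The core is the weak type estimate for the sets E_{lambda,gamma}[f], where the right-hand side is
  the norm of |grad f| alone. For gamma > 0, if |f(x) - f(y)| > lambda |x-y|^(1+gamma), then by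
  pigeonhole one of the balls of radius 2^-j |x-y| around x or y carries much of |grad f|, and a
  Vitali covering sums up.
  For gamma < -1 the large scales dominate: at each scale, one uses only the levels of f near its
  median on a ball, and discards the levels that a larger scale already uses, so that the pieces of
  |grad f| charged at different scales are disjoint. Mollification passes to Sobolev functions.

  Finally |f(x) - f(y)| = |f(x) - f(y)|^(1-theta) |f(x) - f(y)|^theta puts the level set inside the
  union of a level set of the core estimate and one controlled by the size of |f| alone; the two
  thresholds are chosen so that their contributions balance.
*)

theory Submission imports Defs begin

section \<open>The maximal function\<close>

text \<open>The space \<open>X\<close> is accessible only through its axioms, and the only operator
  bound available acts on the associate side. Hence every average that falls on the gradient is
  moved by Tonelli to the weight, and constants must be uniform in the weight. Smooth functions are
  not approximated in the norm of \<open>X\<close>: almost everywhere convergence of mollifications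
  and Fatou suffice, because bad pairs are described by a strict inequality. The sign of
  \<open>\<gamma>\<close> matters through the threshold l * r^(1+\<open>\<gamma>\<close>). For
  \<open>\<gamma>\<close> > 0 a bad pair is paid for by one ball, possibly much smaller than the
  distance of the pair, on which the gradient is unusually dense. For \<open>\<gamma>\<close> < -1
  the threshold falls as r grows, so along a sparse sequence of scales all larger scales together
  occupy a small part of the levels relevant at the present one. Exploiting this needs a gradient
  inequality localised to an arbitrary Borel set of levels, a one-dimensional area formula along
  segments; this is why \<open>upper_gradient\<close> mentions such sets.\<close>

lemma AE_lebesgue_iff_lborel: "(AE x in lebesgue. P x) \<longleftrightarrow> (AE x in lborel. P x)"
  by (rule AE_completion_iff)

text \<open>Weights take values in \<open>ennreal\<close>, so that \<open>maximal\<close> maps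
  weights to weights and can be iterated without any finiteness; \<open>HL_maximal\<close> acts on
  real functions but has extended values.\<close>

definition maximal :: "('a::euclidean_space \<Rightarrow> ennreal) \<Rightarrow> 'a \<Rightarrow> ennreal" where
  "maximal w x = (SUP Q \<in> {Q \<in> cubes. x \<in> Q}. (\<integral>\<^sup>+y\<in>Q. w y \<partial>lborel) / emeasure lborel Q)"

lemma HL_maximal_eq: "HL_maximal h = maximal (\<lambda>y. ennreal \<bar>h y\<bar>)"
proof
  fix x
  have "emeasure lebesgue Q = emeasure lborel Q" if "Q \<in> cubes" for Q :: "'a set"
    using that by (auto simp: cubes_def)
  then show "HL_maximal h x = maximal (\<lambda>y. ennreal \<bar>h y\<bar>) x"
    unfolding HL_maximal_def maximal_def average_def nn_integral_completion
    by (intro SUP_cong) auto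
qed

lemma maximal_cong_AE:
  assumes "AE x in lborel. v x = w x"
  shows "maximal v = maximal w"
proof
  fix x
  have "(\<integral>\<^sup>+y\<in>Q. v y \<partial>lborel) = (\<integral>\<^sup>+y\<in>Q. w y \<partial>lborel)" for Q
    by (rule nn_integral_cong_AE) (use assms in eventually_elim, auto)
  then show "maximal v x = maximal w x"
    by (simp add: maximal_def)
qed

lemma maximal_mono:
  assumes "\<And>x. v x \<le> w x"
  shows "maximal v x \<le> maximal w x"
  unfolding maximal_def
  by (intro SUP_mono' divide_right_mono_ennreal nn_integral_mono mult_right_mono assms) auto

lemma emeasure_cube:
  assumes "t > 0"
  shows "emeasure lborel (cbox c (c + t *\<^sub>R One :: 'a::euclidean_space)) = ennreal (t ^ DIM('a))"
  using assms by (subst emeasure_lborel_cbox) (auto simp: inner_simps)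

lemma average_cube_le_maximal:
  assumes "t > 0" "x \<in> cbox c (c + t *\<^sub>R One :: 'a::euclidean_space)"
  shows "(\<integral>\<^sup>+y\<in>cbox c (c + t *\<^sub>R One). w y \<partial>lborel) \<le> ennreal (t ^ DIM('a)) * maximal w x"
proof -
  let ?Q = "cbox c (c + t *\<^sub>R One)"
  have "(\<integral>\<^sup>+y\<in>?Q. w y \<partial>lborel) / emeasure lborel ?Q \<le> maximal w x"
    unfolding maximal_def using assms by (intro SUP_upper) (auto simp: cubes_def)
  then have "ennreal (t ^ DIM('a)) * ((\<integral>\<^sup>+y\<in>?Q. w y \<partial>lborel) / ennreal (t ^ DIM('a)))
      \<le> ennreal (t ^ DIM('a)) * maximal w x"
    unfolding emeasure_cube[OF assms(1)] by (rule mult_left_mono) simp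
  moreover have "ennreal (t ^ DIM('a)) * (b / ennreal (t ^ DIM('a))) = b" for b
    using assms(1) by (simp add: ennreal_times_divide ennreal_mult_divide_eq mult.commute)
  ultimately show ?thesis by simp
qed

text \<open>The ball lies in the cube of side 2 R about its centre. The maximal function is
  uncentred, so every point \<open>y\<close> of the closed ball may serve as evaluation
  point.\<close>

lemma ball_le_maximal:
  fixes x y :: "'a::euclidean_space"
  assumes "R > 0" "dist x y \<le> R"
  shows "(\<integral>\<^sup>+z\<in>cball x R. w z \<partial>lborel) \<le> ennreal ((2 * R) ^ DIM('a)) * maximal w y"
proof -
  let ?Q = "cbox (x - R *\<^sub>R One) (x - R *\<^sub>R One + (2 * R) *\<^sub>R One)"
  have sub: "cball x R \<subseteq> ?Q"
  proof
    fix z assume z: "z \<in> cball x R"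
    have "\<bar>(z - x) \<bullet> b\<bar> \<le> R" if "b \<in> Basis" for b
      using Basis_le_norm[OF that, of "z - x"] z by (simp add: dist_norm norm_minus_commute)
    then show "z \<in> ?Q" by (force simp: mem_box inner_simps abs_le_iff)
  qed
  have "(\<integral>\<^sup>+z\<in>cball x R. w z \<partial>lborel) \<le> (\<integral>\<^sup>+z\<in>?Q. w z \<partial>lborel)"
    using sub by (intro nn_integral_mono) (auto simp: indicator_def)
  also have "\<dots> \<le> ennreal ((2 * R) ^ DIM('a)) * maximal w y"
    using sub assms by (intro average_cube_le_maximal) auto
  finally show ?thesis .
qed

text \<open>Averages over slightly enlarged cubes show that the superlevel sets are open.\<close>

lemma open_superlevel_maximal: "open {x :: 'a::euclidean_space. maximal w x > a}"
  unfolding open_contains_ball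
proof
  fix x :: 'a assume "x \<in> {x. maximal w x > a}"
  then obtain c t where t: "t > 0" "x \<in> cbox c (c + t *\<^sub>R One)"
    and a: "a < (\<integral>\<^sup>+y\<in>cbox c (c + t *\<^sub>R One). w y \<partial>lborel) / ennreal (t ^ DIM('a))"
    by (auto simp: maximal_def less_SUP_iff cubes_def emeasure_cube)
  let ?I = "\<integral>\<^sup>+y\<in>cbox c (c + t *\<^sub>R One). w y \<partial>lborel"
  have div: "?I / ennreal u = ?I * ennreal (inverse u)" if "u > 0" for u
    using that by (simp add: divide_ennreal_def inverse_ennreal)
  have "((\<lambda>d. ?I * ennreal (inverse ((t + 2 * d) ^ DIM('a)))) \<longlongrightarrow>
      ?I * ennreal (inverse ((t + 2 * 0) ^ DIM('a)))) (at_right 0)"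
    using t(1) by (intro tendsto_mult_ennreal tendsto_ennrealI tendsto_intros) auto
  then have "\<forall>\<^sub>F d in at_right 0. a < ?I * ennreal (inverse ((t + 2 * d) ^ DIM('a)))"
    by (rule order_tendstoD) (use a t(1) in \<open>simp add: div\<close>)
  moreover have pos: "\<forall>\<^sub>F d::real in at_right 0. d > 0" by (rule eventually_at_right_less)
  ultimately have "\<forall>\<^sub>F d in at_right 0. a < ?I / ennreal ((t + 2 * d) ^ DIM('a))"
    by eventually_elim (use t(1) in \<open>simp add: div\<close>)
  moreover note pos
  ultimately obtain d where d: "d > 0" "a < ?I / ennreal ((t + 2 * d) ^ DIM('a))"
    using eventually_happens'[OF _ eventually_conj, of "at_right (0::real)"] by auto
  let ?Q = "cbox (c - d *\<^sub>R One) (c - d *\<^sub>R One + (t + 2 * d) *\<^sub>R One)"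
  have "ball x d \<subseteq> {x. maximal w x > a}"
  proof
    fix z assume z: "z \<in> ball x d"
    have "\<bar>(z - x) \<bullet> b\<bar> \<le> d" if "b \<in> Basis" for b
      using Basis_le_norm[OF that, of "z - x"] z by (simp add: dist_norm norm_minus_commute)
    then have "z \<in> ?Q" using t(2) by (force simp: mem_box inner_simps abs_le_iff)
    have "cbox c (c + t *\<^sub>R One) \<subseteq> ?Q" using d(1)
      by (force simp: mem_box inner_simps)
    then have "?I \<le> (\<integral>\<^sup>+y\<in>?Q. w y \<partial>lborel)"
      by (intro nn_integral_mono) (auto simp: indicator_def)
    then have "?I / ennreal ((t + 2 * d) ^ DIM('a)) \<le>
        (\<integral>\<^sup>+y\<in>?Q. w y \<partial>lborel) / ennreal ((t + 2 * d) ^ DIM('a))"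
      by (rule divide_right_mono_ennreal)
    also have "\<dots> = (\<integral>\<^sup>+y\<in>?Q. w y \<partial>lborel) / emeasure lborel ?Q"
      using t(1) d(1) by (subst emeasure_cube) auto
    also have "\<dots> \<le> maximal w z"
      unfolding maximal_def
    proof (rule SUP_upper)
      have "?Q \<in> cubes" unfolding cubes_def mem_Collect_eq
        by (rule exI[of _ "c - d *\<^sub>R One"], rule exI[of _ "t + 2 * d"]) (use t(1) d(1) in simp)
      then show "?Q \<in> {Q \<in> cubes. z \<in> Q}" using \<open>z \<in> ?Q\<close> by simp
    qed
    finally show "z \<in> {x. maximal w x > a}" using d(2) by auto
  qed
  then show "\<exists>d>0. ball x d \<subseteq> {x. maximal w x > a}"
    using d(1) by auto
qed

lemma borel_measurable_maximal [measurable]: "maximal w \<in> borel_measurable borel"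
  by (rule borel_measurableI_greater) (auto intro!: borel_open open_superlevel_maximal)

text \<open>Monotone convergence takes the limit out of each average, and two suprema commute.
  Truncated weights thus determine the maximal function of a general weight.\<close>

lemma maximal_SUP:
  assumes "\<And>n. w n \<in> borel_measurable borel" "incseq w"
  shows "maximal (\<lambda>x. SUP n. w n x) x = (SUP n. maximal (w n) x)"
proof -
  have "(\<integral>\<^sup>+y\<in>Q. (SUP n. w n y) \<partial>lborel) = (SUP n. \<integral>\<^sup>+y\<in>Q. w n y \<partial>lborel)" if "Q \<in> cubes" for Q
  proof -
    have [measurable]: "Q \<in> sets borel" using that by (auto simp: cubes_def)
    have "(\<integral>\<^sup>+y\<in>Q. (SUP n. w n y) \<partial>lborel) = (\<integral>\<^sup>+y. (SUP n. w n y * indicator Q y) \<partial>lborel)"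
      by (intro nn_integral_cong) (simp add: SUP_mult_right_ennreal)
    also have "\<dots> = (SUP n. \<integral>\<^sup>+y\<in>Q. w n y \<partial>lborel)"
      using assms by (intro nn_integral_monotone_convergence_SUP)
        (auto simp: incseq_def le_fun_def intro!: mult_right_mono)
    finally show ?thesis .
  qed
  then have "maximal (\<lambda>x. SUP n. w n x) x =
      (SUP Q\<in>{Q \<in> cubes. x \<in> Q}. SUP n. (\<integral>\<^sup>+y\<in>Q. w n y \<partial>lborel) / emeasure lborel Q)"
    unfolding maximal_def by (intro SUP_cong) (auto simp: SUP_divide_ennreal)
  also have "\<dots> = (SUP n. maximal (w n) x)"
    unfolding maximal_def by (rule SUP_commute)
  finally show ?thesis .
qed

section \<open>Sums over countable index sets as integrals for counting measure\<close>

lemma nn_integral_countable_eq_suminf: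
  assumes "countable I"
  shows "(\<integral>\<^sup>+i. g i \<partial>count_space I) = (\<Sum>n. g (from_nat_into I n) * indicator (to_nat_on I ` I) n)"
proof -
  have "(\<integral>\<^sup>+i. g i \<partial>count_space I) = (\<integral>\<^sup>+n. g (from_nat_into I n) \<partial>count_space (to_nat_on I ` I))"
    using assms by (intro nn_integral_bij_count_space[symmetric])
      (auto simp: bij_betw_def inj_on_def image_image)
  then show ?thesis by (simp add: nn_integral_count_space_indicator nn_integral_count_space_nat)
qed

lemma borel_measurable_countable_sum:
  assumes "countable I" "\<And>i. i \<in> I \<Longrightarrow> F i \<in> borel_measurable M"
  shows "(\<lambda>x. \<integral>\<^sup>+i. F i x \<partial>count_space I) \<in> borel_measurable M"
proof (cases "I = {}")
  case False
  then have [measurable]: "F (from_nat_into I n) \<in> borel_measurable M" for n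
    by (intro assms from_nat_into)
  show ?thesis unfolding nn_integral_countable_eq_suminf[OF assms(1)] by measurable
qed (simp add: nn_integral_empty)

text \<open>Selected balls and pairs of a scale and a net point form countable sets without a
  natural order. An enumeration reduces the exchange of sum and integral to the case of
  series.\<close>

lemma tonelli_countable:
  assumes "countable I" "\<And>i. i \<in> I \<Longrightarrow> F i \<in> borel_measurable M"
  shows "(\<integral>\<^sup>+x. (\<integral>\<^sup>+i. F i x \<partial>count_space I) \<partial>M) = (\<integral>\<^sup>+i. (\<integral>\<^sup>+x. F i x \<partial>M) \<partial>count_space I)"
proof (cases "I = {}")
  case False
  then have [measurable]: "F (from_nat_into I n) \<in> borel_measurable M" for n
    by (intro assms from_nat_into)
  show ?thesis unfolding nn_integral_countable_eq_suminf[OF assms(1)]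
    by (subst nn_integral_suminf) (auto simp: nn_integral_multc)
qed (simp add: nn_integral_empty)

lemma sets_cball [measurable]: "cball c r \<in> sets (borel :: 'a::euclidean_space measure)"
  by simp

lemma pred_cball [measurable (raw)]:
  fixes c :: "'a::euclidean_space"
  shows "f \<in> borel_measurable M \<Longrightarrow> Measurable.pred M (\<lambda>x. f x \<in> cball c r)"
  unfolding mem_cball by measurable

lemma ennreal_scale_le:
  assumes "ennreal a * x \<le> ennreal b * y" "a > 0" "b \<ge> 0" "c \<ge> 0"
  shows "ennreal c * x \<le> ennreal (c * b / a) * y"
proof -
  have "ennreal c * x = ennreal (c / a) * (ennreal a * x)"
    using assms by (simp add: mult.assoc[symmetric] ennreal_mult[symmetric])
  also have "\<dots> \<le> ennreal (c / a) * (ennreal b * y)"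
    by (intro mult_left_mono assms) simp
  also have "\<dots> = ennreal (c * b / a) * y"
    using assms by (simp add: mult.assoc[symmetric] ennreal_mult[symmetric])
  finally show ?thesis .
qed

lemma maximal_one_le: "maximal (\<lambda>_. 1) y \<le> (1::ennreal)"
  unfolding maximal_def
proof (rule SUP_least)
  fix Q :: "'a set" assume "Q \<in> {Q \<in> cubes. y \<in> Q}"
  then obtain c t where Q: "Q = cbox c (c + t *\<^sub>R One)" "t > 0" by (auto simp: cubes_def)
  show "(\<integral>\<^sup>+z\<in>Q. 1 \<partial>lborel) / emeasure lborel Q \<le> 1"
    unfolding Q using Q(2) by (simp add: emeasure_cube ennreal_divide_self del: emeasure_lborel_cbox_eq)
qed

section \<open>Truncated power kernels and the maximal function\<close>

lemma powr_le_comparable: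
  fixes u r a :: real
  assumes "r > 0" "r / 4 \<le> u" "u \<le> r"
  shows "u powr a \<le> 4 powr \<bar>a\<bar> * r powr a"
proof (cases "a \<ge> 0")
  case True
  have "u powr a \<le> r powr a" using assms True by (intro powr_mono2) auto
  also have "\<dots> \<le> 4 powr \<bar>a\<bar> * r powr a"
    using ge_one_powr_ge_zero[of 4 "\<bar>a\<bar>"] mult_right_mono[of 1 "4 powr \<bar>a\<bar>" "r powr a"] by simp
  finally show ?thesis .
next
  case False
  have "u powr a \<le> (r / 4) powr a" using assms False by (intro powr_mono2') auto
  also have "\<dots> = 4 powr \<bar>a\<bar> * r powr a"
    using assms False by (simp add: powr_divide powr_minus field_simps)
  finally show ?thesis .
qed

text \<open>For \<open>\<gamma>\<close> > 0 the truncation selects the ball of radius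
  \<open>T powr (1 / \<gamma>)\<close>, for \<open>\<gamma>\<close> < 0 its exterior (the centre has
  kernel value 0). Both are cut into dyadic shells on which the kernel is comparable with a
  constant. A shell of outer radius rho contributes rho^\<open>\<gamma>\<close> times an average of
  \<open>w\<close>, and these factors form a convergent geometric series for either sign.\<close>

lemma kernel_bound:
  fixes \<gamma> :: real
  assumes "\<gamma> \<noteq> 0"
  obtains C where "C > 0"
    "\<And>w T y. w \<in> borel_measurable borel \<Longrightarrow> T > 0 \<Longrightarrow>
      (\<integral>\<^sup>+x. indicator {x. norm (x - y) powr \<gamma> \<le> T} x * ennreal (norm (x - y) powr (\<gamma> - DIM('a))) * w x \<partial>lborel)
      \<le> ennreal (C * T) * maximal w (y :: 'a::euclidean_space)"
proof
  define n where "n = DIM('a)"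
  define q where "q = 2 powr (- \<bar>\<gamma>\<bar>)"
  define C0 where "C0 = 4 powr \<bar>\<gamma> - n\<bar>"
  define C where "C = C0 * 2 ^ n * 2 powr \<gamma> * (1 / (1 - q))"
  have q: "0 < q" "q < 1" using assms by (auto simp: q_def powr_less_one)
  show "C > 0" using q by (auto simp: C_def C0_def)
  fix w :: "'a \<Rightarrow> ennreal" and T :: real and y :: 'a
  assume [measurable]: "w \<in> borel_measurable borel" and T: "T > 0"
  define R where "R = T powr (1 / \<gamma>)"
  \<comment> \<open>The radii shrink for positive and grow for negative \<open>\<gamma>\<close>, so
    \<open>\<rho> k powr \<gamma>\<close> decays in both cases. The initial factor 2 lets the same
    rounding down serve both directions: \<open>u\<close> ends up between
    \<open>\<rho> k / 4\<close> and \<open>\<rho> k\<close>.\<close>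
  define \<rho> where "\<rho> k = 2 * R * 2 powr (- sgn \<gamma> * real k)" for k :: nat
  have R: "R > 0" "R powr \<gamma> = T" using T assms by (auto simp: R_def powr_powr)
  have \<rho>: "\<rho> k > 0" for k using R by (auto simp: \<rho>_def)
  have \<rho>pow: "\<rho> k powr \<gamma> = 2 powr \<gamma> * T * q ^ k" for k
  proof -
    have "\<rho> k powr \<gamma> = 2 powr \<gamma> * T * 2 powr (- sgn \<gamma> * real k * \<gamma>)"
      using R by (simp add: \<rho>_def powr_mult powr_powr)
    also have "- sgn \<gamma> * real k * \<gamma> = - \<bar>\<gamma>\<bar> * real k"
      by (simp add: sgn_if)
    also have "2 powr (- \<bar>\<gamma>\<bar> * real k) = q ^ k"
      by (simp add: q_def powr_realpow[symmetric] powr_powr)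
    finally show ?thesis .
  qed
  have cover: "\<exists>k. \<rho> k / 4 \<le> u \<and> u \<le> \<rho> k" if u: "u > 0" "u powr \<gamma> \<le> T" for u
  proof -
    define l where "l = sgn \<gamma> * log 2 (R / u)"
    have "\<gamma> * ln u \<le> \<gamma> * ln R"
      using u R by (metis ln_le_cancel_iff ln_powr powr_gt_zero less_irrefl)
    then have "l \<ge> 0"
      using u R assms by (auto simp: l_def log_def ln_div sgn_if zero_le_divide_iff field_simps)
    define k where "k = nat \<lfloor>l\<rfloor>"
    have k: "real k \<le> l" "l < real k + 1" using \<open>l \<ge> 0\<close> by (auto simp: k_def)
    have ueq: "u = R * 2 powr (- sgn \<gamma> * l)"
    proof -
      have "- sgn \<gamma> * l = - log 2 (R / u)" using assms by (simp add: l_def sgn_if)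
      then have "2 powr (- sgn \<gamma> * l) = inverse (R / u)" using u(1) R(1) by (simp only: powr_minus) simp
      then show ?thesis using u(1) R(1) by simp
    qed
    show ?thesis
    proof (intro exI[of _ k] conjI)
      have "2 powr (1 - sgn \<gamma> * k) \<le> 2 powr (2 - sgn \<gamma> * l)"
        using k by (intro powr_mono) (auto simp: sgn_if)
      then have "2 * 2 powr (- sgn \<gamma> * k) \<le> 4 * 2 powr (- sgn \<gamma> * l)"
        by (simp add: powr_diff powr_minus field_simps)
      then show "\<rho> k / 4 \<le> u" using R by (simp add: \<rho>_def ueq)
      have "2 powr (- sgn \<gamma> * l) \<le> 2 powr (1 - sgn \<gamma> * k)"
        using k by (intro powr_mono) (auto simp: sgn_if)
      then have "2 powr (- sgn \<gamma> * l) \<le> 2 * 2 powr (- sgn \<gamma> * k)"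
        by (simp add: powr_diff powr_minus field_simps)
      then show "u \<le> \<rho> k" using R by (simp add: \<rho>_def ueq)
    qed
  qed
  let ?a = "\<lambda>k. C0 * \<rho> k powr (\<gamma> - n)"
  have "(\<integral>\<^sup>+x. indicator {x. norm (x - y) powr \<gamma> \<le> T} x * ennreal (norm (x - y) powr (\<gamma> - DIM('a))) * w x \<partial>lborel)
      \<le> (\<integral>\<^sup>+x. (\<Sum>k. ennreal (?a k) * (w x * indicator (cball y (\<rho> k)) x)) \<partial>lborel)"
  proof (rule nn_integral_mono)
    fix x
    show "indicator {x. norm (x - y) powr \<gamma> \<le> T} x * ennreal (norm (x - y) powr (\<gamma> - DIM('a))) * w x
      \<le> (\<Sum>k. ennreal (?a k) * (w x * indicator (cball y (\<rho> k)) x))"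
    proof (cases "norm (x - y) powr \<gamma> \<le> T \<and> x \<noteq> y")
      case True
      then obtain k where k: "\<rho> k / 4 \<le> norm (x - y)" "norm (x - y) \<le> \<rho> k"
        using cover[of "norm (x - y)"] by auto
      have "norm (x - y) powr (\<gamma> - n) \<le> ?a k"
        unfolding C0_def by (rule powr_le_comparable[OF \<rho> k])
      then have "ennreal (norm (x - y) powr (\<gamma> - n)) * w x \<le> ennreal (?a k) * (w x * indicator (cball y (\<rho> k)) x)"
        using k by (auto simp: dist_norm norm_minus_commute intro!: mult_right_mono ennreal_leI)
      also have "\<dots> \<le> (\<Sum>k. ennreal (?a k) * (w x * indicator (cball y (\<rho> k)) x))"
        using sum_le_suminf[of "\<lambda>k. ennreal (?a k) * (w x * indicator (cball y (\<rho> k)) x)" "{k}"] by simp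
      finally show ?thesis using True by (simp add: n_def)
    qed auto
  qed
  also have "\<dots> = (\<Sum>k. ennreal (?a k) * (\<integral>\<^sup>+x\<in>cball y (\<rho> k). w x \<partial>lborel))"
    by (subst nn_integral_suminf, measurable) (intro suminf_cong nn_integral_cmult, measurable)
  also have "\<dots> \<le> (\<Sum>k. ennreal (C0 * 2 ^ n * 2 powr \<gamma> * T * q ^ k) * maximal w y)"
  proof (rule suminf_le)
    fix k
    have "ennreal (?a k) * (\<integral>\<^sup>+x\<in>cball y (\<rho> k). w x \<partial>lborel) \<le> ennreal (?a k) * (ennreal ((2 * \<rho> k) ^ n) * maximal w y)"
      unfolding n_def by (intro mult_left_mono ball_le_maximal \<rho>) (auto intro: less_imp_le[OF \<rho>])
    also have "\<dots> = ennreal (?a k * (2 * \<rho> k) ^ n) * maximal w y"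
      using \<rho>[of k] by (simp add: mult.assoc[symmetric] ennreal_mult[symmetric] C0_def)
    also have "?a k * (2 * \<rho> k) ^ n = C0 * 2 ^ n * 2 powr \<gamma> * T * q ^ k"
      using \<rho>[of k] \<rho>pow[of k] by (simp add: powr_diff powr_realpow power_mult_distrib)
    finally show "ennreal (?a k) * (\<integral>\<^sup>+x\<in>cball y (\<rho> k). w x \<partial>lborel) \<le>
      ennreal (C0 * 2 ^ n * 2 powr \<gamma> * T * q ^ k) * maximal w y" .
  qed auto
  also have "\<dots> = (\<Sum>k. ennreal (C0 * 2 ^ n * 2 powr \<gamma> * T * q ^ k)) * maximal w y"
    by (rule ennreal_suminf_multc)
  also have "(\<Sum>k. ennreal (C0 * 2 ^ n * 2 powr \<gamma> * T * q ^ k)) = ennreal (C * T)"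
  proof -
    have "(\<lambda>k. C0 * 2 ^ n * 2 powr \<gamma> * T * q ^ k) sums (C0 * 2 ^ n * 2 powr \<gamma> * T * (1 / (1 - q)))"
      using q by (intro sums_mult geometric_sums) auto
    then show ?thesis using q T
      by (intro suminf_ennreal_eq) (auto simp: C_def C0_def mult_ac)
  qed
  finally show "(\<integral>\<^sup>+x. indicator {x. norm (x - y) powr \<gamma> \<le> T} x * ennreal (norm (x - y) powr (\<gamma> - DIM('a))) * w x \<partial>lborel)
      \<le> ennreal (C * T) * maximal w y" .
qed

lemma nn_integral_dilation:
  fixes x :: "'a::euclidean_space"
  assumes [measurable]: "H \<in> borel_measurable borel" and "t > 0"
  shows "(\<integral>\<^sup>+y. H (x + t *\<^sub>R (y - x)) \<partial>lborel) = ennreal (1 / t ^ DIM('a)) * (\<integral>\<^sup>+z. H z \<partial>lborel)"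
proof -
  have "(\<integral>\<^sup>+z. H z \<partial>lborel) = (\<integral>\<^sup>+y. ennreal (t ^ DIM('a)) * H (x + t *\<^sub>R (y - x)) \<partial>lborel)"
    using assms(2)
    by (subst lborel_affine[of t "x - t *\<^sub>R x"])
      (simp_all add: nn_integral_density nn_integral_distr algebra_simps)
  also have "\<dots> = ennreal (t ^ DIM('a)) * (\<integral>\<^sup>+y. H (x + t *\<^sub>R (y - x)) \<partial>lborel)"
    by (rule nn_integral_cmult) measurable
  finally show ?thesis
    using assms(2) by (simp add: mult.assoc[symmetric] ennreal_mult[symmetric])
qed

section \<open>Upper gradients and positive exponents\<close>

text \<open>Besides the usual inequality (\<open>b = UNIV\<close>), the part of the variation of \<open>f\<close> with values in
  \<open>b\<close> is controlled by \<open>G\<close> on the preimage of \<open>b\<close>, so that disjoint sets of levels can be treated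
  separately.\<close>

definition upper_gradient :: "('a::euclidean_space \<Rightarrow> real) \<Rightarrow> ('a \<Rightarrow> ennreal) \<Rightarrow> bool" where
  "upper_gradient f G \<longleftrightarrow> continuous_on UNIV f \<and> G \<in> borel_measurable borel \<and>
     (\<forall>x y. \<forall>\<alpha> \<beta>. \<forall>b \<in> sets borel. min (f x) (f y) \<le> \<alpha> \<longrightarrow> \<beta> \<le> max (f x) (f y) \<longrightarrow>
        emeasure lborel (b \<inter> {\<alpha>..\<beta>}) \<le> ennreal (norm (x - y)) *
          (\<integral>\<^sup>+t\<in>{0..1}. indicator b (f (x + t *\<^sub>R (y - x))) * G (x + t *\<^sub>R (y - x)) \<partial>lborel))"

lemma upper_gradientD:
  assumes "upper_gradient f G"
  shows "f \<in> borel_measurable borel" "G \<in> borel_measurable borel"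
    "ennreal \<bar>f x - f y\<bar> \<le> ennreal (norm (x - y)) * (\<integral>\<^sup>+t\<in>{0..1}. G (x + t *\<^sub>R (y - x)) \<partial>lborel)"
proof -
  show "f \<in> borel_measurable borel" "G \<in> borel_measurable borel"
    using assms by (auto simp: upper_gradient_def borel_measurable_continuous_onI)
  let ?a = "min (f x) (f y)" and ?b = "max (f x) (f y)"
  have "emeasure lborel (UNIV \<inter> {?a..?b}) \<le> ennreal (norm (x - y)) *
          (\<integral>\<^sup>+t\<in>{0..1}. indicator UNIV (f (x + t *\<^sub>R (y - x))) * G (x + t *\<^sub>R (y - x)) \<partial>lborel)"
    using assms[unfolded upper_gradient_def, THEN conjunct2, THEN conjunct2, rule_format, of UNIV x y ?a ?b]
    by simp
  moreover have "?b - ?a = \<bar>f x - f y\<bar>" by auto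
  ultimately show "ennreal \<bar>f x - f y\<bar> \<le> ennreal (norm (x - y)) * (\<integral>\<^sup>+t\<in>{0..1}. G (x + t *\<^sub>R (y - x)) \<partial>lborel)"
    by simp
qed

text \<open>The condition on \<open>\<rho>\<close> says that \<open>G\<close> has large mass in a
  ball. On a selected ball it bounds \<open>r powr \<gamma>\<close> by that mass divided by
  \<open>\<mu> * r ^ DIM('a)\<close>; what is left is an average of \<open>u\<close> over the
  fivefold ball, which \<open>maximal u\<close> dominates at every point of the small ball. The
  small balls are disjoint, so the masses add up to a single integral. The fivefold ball sits in a
  cube of side 10 r, whence \<open>10 ^ DIM('a)\<close>.\<close>

lemma Vitali_selection:
  fixes G :: "'a::euclidean_space \<Rightarrow> ennreal" and \<gamma> \<mu> N :: real
  assumes [measurable]: "G \<in> borel_measurable borel" and "\<mu> > 0"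
  obtains C :: "('a \<times> real) set" where "countable C" "\<And>c r. (c, r) \<in> C \<Longrightarrow> r > 0"
    "\<And>x \<rho>. 0 < \<rho> \<Longrightarrow> \<rho> \<le> N \<Longrightarrow> ennreal (\<mu> * \<rho> powr (\<gamma> + DIM('a))) \<le> (\<integral>\<^sup>+z\<in>cball x \<rho>. G z \<partial>lborel) \<Longrightarrow>
        \<exists>(c, r)\<in>C. x \<in> cball c (5 * r) \<and> \<rho> \<le> 5 * r"
    "\<And>u. u \<in> borel_measurable borel \<Longrightarrow>
      (\<integral>\<^sup>+i. (ennreal (snd i powr \<gamma>) * (\<integral>\<^sup>+z\<in>cball (fst i) (5 * snd i). u z \<partial>lborel)) \<partial>count_space C)
      \<le> ennreal (10 ^ DIM('a) / \<mu>) * (\<integral>\<^sup>+z. G z * maximal u z \<partial>lborel)"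
proof -
  define K where "K = {(x, \<rho>). 0 < \<rho> \<and> \<rho> \<le> N \<and>
    ennreal (\<mu> * \<rho> powr (\<gamma> + DIM('a))) \<le> (\<integral>\<^sup>+z\<in>cball x \<rho>. G z \<partial>lborel)}"
  have K01: "0 < snd i \<and> snd i \<le> N" if "i \<in> K" for i
    using that by (simp add: K_def case_prod_unfold)
  \<comment> \<open>The covering lemma requires bounded radii, which is the purpose of
    \<open>N\<close>; the constants obtained do not depend on it.\<close>
  obtain C where C: "countable C" "C \<subseteq> K"
     "pairwise (\<lambda>i j. disjnt (cball (fst i) (snd i)) (cball (fst j) (snd j))) C"
     "\<And>i. i \<in> K \<Longrightarrow> \<exists>j. j \<in> C \<and> \<not> disjnt (cball (fst i) (snd i)) (cball (fst j) (snd j)) \<and>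
                        cball (fst i) (snd i) \<subseteq> ball (fst j) (5 * snd j)"
    by (rule Vitali_covering_lemma_cballs_balls[where a=fst, OF K01]) (assumption, blast)
  show ?thesis
  proof (rule that[OF C(1)])
    show "r > 0" if "(c, r) \<in> C" for c r using that C(2) by (auto simp: K_def)
    show "\<exists>(c, r)\<in>C. x \<in> cball c (5 * r) \<and> \<rho> \<le> 5 * r" if "0 < \<rho>" "\<rho> \<le> N"
      "ennreal (\<mu> * \<rho> powr (\<gamma> + DIM('a))) \<le> (\<integral>\<^sup>+z\<in>cball x \<rho>. G z \<partial>lborel)" for x \<rho>
    proof -
      have "(x, \<rho>) \<in> K" using that by (auto simp: K_def)
      then obtain j where j: "j \<in> C" "cball x \<rho> \<subseteq> ball (fst j) (5 * snd j)" using C(4) by fastforce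
      then have "dist x (fst j) + \<rho> < 5 * snd j"
        using that(1) by (auto simp: cball_subset_ball_iff)
      then have "x \<in> cball (fst j) (5 * snd j) \<and> \<rho> \<le> 5 * snd j"
        using that(1) zero_le_dist[of x "fst j"] unfolding mem_cball dist_commute[of "fst j"] by linarith
      then show ?thesis using j(1) by (auto simp: case_prod_unfold)
    qed
    fix u :: "'a \<Rightarrow> ennreal" assume [measurable]: "u \<in> borel_measurable borel"
    have "(\<integral>\<^sup>+i. (ennreal (snd i powr \<gamma>) * (\<integral>\<^sup>+z\<in>cball (fst i) (5 * snd i). u z \<partial>lborel)) \<partial>count_space C)
      \<le> (\<integral>\<^sup>+i. (\<integral>\<^sup>+z. ennreal (10 ^ DIM('a) / \<mu>) * (G z * maximal u z) * indicator (cball (fst i) (snd i)) z \<partial>lborel) \<partial>count_space C)"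
    proof (rule nn_integral_mono)
      fix i assume "i \<in> space (count_space C)"
      then obtain c r where i: "i = (c, r)" and ir: "(c, r) \<in> C" by (cases i) auto
      then have r: "r > 0" and big: "ennreal (\<mu> * r powr (\<gamma> + DIM('a))) \<le> (\<integral>\<^sup>+z\<in>cball c r. G z \<partial>lborel)"
        using C(2) by (auto simp: K_def)
      define J where "J = (\<integral>\<^sup>+z\<in>cball c (5 * r). u z \<partial>lborel)"
      have "ennreal (\<mu> * r powr (\<gamma> + DIM('a))) * J \<le> (\<integral>\<^sup>+z\<in>cball c r. G z \<partial>lborel) * J"
        by (intro mult_right_mono big) simp
      also have "\<dots> = (\<integral>\<^sup>+z. G z * indicator (cball c r) z * J \<partial>lborel)"
        by (rule nn_integral_multc[symmetric]) measurable
      also have "\<dots> \<le> (\<integral>\<^sup>+z. ennreal ((10 * r) ^ DIM('a)) * (G z * maximal u z * indicator (cball c r) z) \<partial>lborel)"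
      proof (rule nn_integral_mono)
        fix z
        have "J \<le> ennreal ((10 * r) ^ DIM('a)) * maximal u z" if "z \<in> cball c r"
          using ball_le_maximal[of "5 * r" c z u] r that by (simp add: J_def)
        then show "G z * indicator (cball c r) z * J \<le> ennreal ((10 * r) ^ DIM('a)) * (G z * maximal u z * indicator (cball c r) z)"
          using mult_left_mono[of J "ennreal ((10 * r) ^ DIM('a)) * maximal u z" "G z"]
          by (auto simp: indicator_def mult_ac)
      qed
      also have "\<dots> = ennreal ((10 * r) ^ DIM('a)) * (\<integral>\<^sup>+z. G z * maximal u z * indicator (cball c r) z \<partial>lborel)"
        by (rule nn_integral_cmult) measurable
      finally have "ennreal (r powr \<gamma>) * J \<le>
          ennreal (r powr \<gamma> * (10 * r) ^ DIM('a) / (\<mu> * r powr (\<gamma> + DIM('a)))) * (\<integral>\<^sup>+z. G z * maximal u z * indicator (cball c r) z \<partial>lborel)"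
        using r assms(2) by (intro ennreal_scale_le) auto
      also have "r powr \<gamma> * (10 * r) ^ DIM('a) / (\<mu> * r powr (\<gamma> + DIM('a))) = 10 ^ DIM('a) / \<mu>"
        using r assms(2) by (simp add: powr_add powr_realpow power_mult_distrib)
      also have "ennreal (10 ^ DIM('a) / \<mu>) * (\<integral>\<^sup>+z. G z * maximal u z * indicator (cball c r) z \<partial>lborel)
        = (\<integral>\<^sup>+z. ennreal (10 ^ DIM('a) / \<mu>) * (G z * maximal u z * indicator (cball c r) z) \<partial>lborel)"
        by (rule nn_integral_cmult[symmetric]) measurable
      finally show "ennreal (snd i powr \<gamma>) * (\<integral>\<^sup>+z\<in>cball (fst i) (5 * snd i). u z \<partial>lborel) \<le>
        (\<integral>\<^sup>+z. ennreal (10 ^ DIM('a) / \<mu>) * (G z * maximal u z) * indicator (cball (fst i) (snd i)) z \<partial>lborel)"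
        by (simp add: i J_def mult.assoc)
    qed
    also have "\<dots> = (\<integral>\<^sup>+z. (\<integral>\<^sup>+i. ennreal (10 ^ DIM('a) / \<mu>) * (G z * maximal u z) * indicator (cball (fst i) (snd i)) z \<partial>count_space C) \<partial>lborel)"
      by (rule tonelli_countable[symmetric]) (use C in auto)
    \<comment> \<open>By disjointness each \<open>z\<close> lies in at most one of the unexpanded
      balls, so the indicators add up to at most 1.\<close>
    also have "\<dots> \<le> (\<integral>\<^sup>+z. ennreal (10 ^ DIM('a) / \<mu>) * (G z * maximal u z) \<partial>lborel)"
    proof (rule nn_integral_mono)
      fix z
      let ?D = "{i \<in> C. z \<in> cball (fst i) (snd i)}"
      have sub: "i = j" if "i \<in> ?D" "j \<in> ?D" for i j
        using that C(3) unfolding pairwise_def disjnt_def by blast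
      have "(\<integral>\<^sup>+i. indicator (cball (fst i) (snd i)) z \<partial>count_space C) = (\<integral>\<^sup>+i. indicator ?D i \<partial>count_space C)"
        by (intro nn_integral_cong) (auto simp: indicator_def)
      also have "\<dots> = emeasure (count_space C) ?D" by (subst nn_integral_indicator) auto
      also have "\<dots> \<le> 1"
      proof (cases "?D = {}")
        case False
        then obtain i where "?D = {i}" using sub by blast
        then show ?thesis by (subst emeasure_count_space_finite) auto
      next
        case True
        show ?thesis unfolding True by simp
      qed
      finally have "(\<integral>\<^sup>+i. indicator (cball (fst i) (snd i)) z \<partial>count_space C) \<le> (1::ennreal)" .
      then show "(\<integral>\<^sup>+i. ennreal (10 ^ DIM('a) / \<mu>) * (G z * maximal u z) * indicator (cball (fst i) (snd i)) z \<partial>count_space C)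
        \<le> ennreal (10 ^ DIM('a) / \<mu>) * (G z * maximal u z)"
        using mult_left_mono[of _ 1 "ennreal (10 ^ DIM('a) / \<mu>) * (G z * maximal u z)"]
        by (subst nn_integral_cmult) auto
    qed
    also have "\<dots> = ennreal (10 ^ DIM('a) / \<mu>) * (\<integral>\<^sup>+z. G z * maximal u z \<partial>lborel)"
      by (rule nn_integral_cmult) measurable
    finally show "(\<integral>\<^sup>+i. (ennreal (snd i powr \<gamma>) * (\<integral>\<^sup>+z\<in>cball (fst i) (5 * snd i). u z \<partial>lborel)) \<partial>count_space C)
      \<le> ennreal (10 ^ DIM('a) / \<mu>) * (\<integral>\<^sup>+z. G z * maximal u z \<partial>lborel)" .
  qed
qed

text \<open>Substituting $z = x + t (y - x)$ and integrating in $x$ first leaves an average of $w$ over a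
  ball of radius comparable to $t R$, whatever $t$ is.\<close>

lemma segment_integral_ball:
  fixes x :: "'a::euclidean_space"
  assumes [measurable]: "\<Phi> \<in> borel_measurable borel" and t: "0 < t" and R: "R > 0"
  shows "(\<integral>\<^sup>+y\<in>cball x R. \<Phi> (x + t *\<^sub>R (y - x)) \<partial>lborel)
      = ennreal (1 / t ^ DIM('a)) * (\<integral>\<^sup>+z\<in>cball x (t * R). \<Phi> z \<partial>lborel)"
proof -
  have "(\<integral>\<^sup>+y\<in>cball x R. \<Phi> (x + t *\<^sub>R (y - x)) \<partial>lborel) =
      (\<integral>\<^sup>+y. (\<lambda>z. \<Phi> z * indicator (cball x (t * R)) z) (x + t *\<^sub>R (y - x)) \<partial>lborel)"
  proof (intro nn_integral_cong)
    fix y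
    have "dist x (x + t *\<^sub>R (y - x)) = t * dist x y"
      using t by (simp add: dist_norm norm_minus_commute)
    then have "x + t *\<^sub>R (y - x) \<in> cball x (t * R) \<longleftrightarrow> y \<in> cball x R"
      using t by simp
    then show "\<Phi> (x + t *\<^sub>R (y - x)) * indicator (cball x R) y =
        (\<lambda>z. \<Phi> z * indicator (cball x (t * R)) z) (x + t *\<^sub>R (y - x))"
      by (simp add: indicator_def)
  qed
  also have "\<dots> = ennreal (1 / t ^ DIM('a)) * (\<integral>\<^sup>+z\<in>cball x (t * R). \<Phi> z \<partial>lborel)"
    by (rule nn_integral_dilation[OF _ t]) measurable
  finally show ?thesis .
qed

text \<open>The segment inequality is integrated over the endpoint \<open>y\<close> and the
  integrals are exchanged. For fixed \<open>t\<close> the points x + t (y - x) fill the ball of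
  radius t r with Jacobian t^-n. At t = 0 this degenerates, so that null set of parameters is
  dropped.\<close>

lemma ball_oscillation_le:
  fixes f :: "'a::euclidean_space \<Rightarrow> real"
  assumes fG: "upper_gradient f G" and r: "r > 0"
  shows "(\<integral>\<^sup>+y\<in>cball x r. ennreal \<bar>f x - f y\<bar> \<partial>lborel) \<le>
     ennreal r * (\<integral>\<^sup>+t\<in>{0<..1}. ennreal (1 / t ^ DIM('a)) * (\<integral>\<^sup>+z\<in>cball x (t * r). G z \<partial>lborel) \<partial>lborel)"
proof -
  note [measurable] = upper_gradientD(1,2)[OF fG]
  have "(\<integral>\<^sup>+y\<in>cball x r. ennreal \<bar>f x - f y\<bar> \<partial>lborel) \<le>
     (\<integral>\<^sup>+y. ennreal r * (\<integral>\<^sup>+t. G (x + t *\<^sub>R (y - x)) * indicator {0<..1} t * indicator (cball x r) y \<partial>lborel) \<partial>lborel)"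
  proof (rule nn_integral_mono)
    fix y
    show "ennreal \<bar>f x - f y\<bar> * indicator (cball x r) y \<le>
       ennreal r * (\<integral>\<^sup>+t. G (x + t *\<^sub>R (y - x)) * indicator {0<..1} t * indicator (cball x r) y \<partial>lborel)"
    proof (cases "y \<in> cball x r")
      case True
      have "ennreal \<bar>f x - f y\<bar> \<le> ennreal (norm (x - y)) * (\<integral>\<^sup>+t\<in>{0..1}. G (x + t *\<^sub>R (y - x)) \<partial>lborel)"
        by (rule upper_gradientD(3)[OF fG])
      also have "(\<integral>\<^sup>+t\<in>{0..1}. G (x + t *\<^sub>R (y - x)) \<partial>lborel) = (\<integral>\<^sup>+t\<in>{0<..1}. G (x + t *\<^sub>R (y - x)) \<partial>lborel)"
        by (intro nn_integral_cong_AE) (use AE_lborel_singleton[of "0::real"] in \<open>eventually_elim, auto simp: indicator_def\<close>)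
      also have "ennreal (norm (x - y)) * \<dots> \<le> ennreal r * \<dots>"
        using True by (intro mult_right_mono ennreal_leI) (auto simp: dist_norm)
      finally show ?thesis using True by simp
    qed simp
  qed
  also have "\<dots> = ennreal r * (\<integral>\<^sup>+y. (\<integral>\<^sup>+t. G (x + t *\<^sub>R (y - x)) * indicator {0<..1} t * indicator (cball x r) y \<partial>lborel) \<partial>lborel)"
    by (rule nn_integral_cmult) measurable
  also have "(\<integral>\<^sup>+y. (\<integral>\<^sup>+t. G (x + t *\<^sub>R (y - x)) * indicator {0<..1} t * indicator (cball x r) y \<partial>lborel) \<partial>lborel)
      = (\<integral>\<^sup>+t. (\<integral>\<^sup>+y. G (x + t *\<^sub>R (y - x)) * indicator {0<..1} t * indicator (cball x r) y \<partial>lborel) \<partial>lborel)"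
    by (rule lborel_pair.Fubini') measurable
  also have "\<dots> = (\<integral>\<^sup>+t\<in>{0<..1}. ennreal (1 / t ^ DIM('a)) * (\<integral>\<^sup>+z\<in>cball x (t * r). G z \<partial>lborel) \<partial>lborel)"
  proof (rule nn_integral_cong)
    fix t :: real
    show "(\<integral>\<^sup>+y. G (x + t *\<^sub>R (y - x)) * indicator {0<..1} t * indicator (cball x r) y \<partial>lborel) =
      ennreal (1 / t ^ DIM('a)) * (\<integral>\<^sup>+z\<in>cball x (t * r). G z \<partial>lborel) * indicator {0<..1} t"
    proof (cases "t \<in> {0<..1}")
      case True
      then show ?thesis using segment_integral_ball[of G t r x] r by simp
    qed simp
  qed
  finally show ?thesis .
qed

text \<open>If every dyadic ball carried less than the stated share,
  \<open>ball_oscillation_le\<close>, split at the dyadic values of \<open>t\<close>, would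
  contradict \<open>big\<close>. The weights (3/2)^j have a ratio strictly between 1 and 2: below 2,
  so that they are summable against parameter intervals of length 2^-(j+1); above 1, so that their
  reciprocals are summable when the contributions of all generations are added later.\<close>

lemma dyadic_ball_large:
  fixes f :: "'a::euclidean_space \<Rightarrow> real"
  assumes fG: "upper_gradient f G" and r: "r > 0" and a: "a > 0"
    and big: "ennreal (a * r ^ DIM('a)) < (\<integral>\<^sup>+y\<in>cball x r. ennreal \<bar>f x - f y\<bar> \<partial>lborel)"
  obtains j :: nat where
    "ennreal (a / (2 * 2 ^ DIM('a)) * (3/2) ^ j * (r / 2 ^ j) ^ DIM('a) / r) \<le> (\<integral>\<^sup>+z\<in>cball x (r / 2 ^ j). G z \<partial>lborel)"
proof (rule ccontr)
  let ?n = "DIM('a)"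
  note [measurable] = upper_gradientD(1,2)[OF fG]
  define J where "J \<rho> = (\<integral>\<^sup>+z\<in>cball x \<rho>. G z \<partial>lborel)" for \<rho>
  define B where "B j = a / (2 * 2 ^ ?n) * (3/2) ^ j * (r / 2 ^ j) ^ ?n / r" for j :: nat
  define D where "D j = a / 2 * (3/2) ^ j * r ^ ?n / r" for j :: nat
  assume "\<not> thesis"
  then have small: "J (r / 2 ^ j) < ennreal (B j)" for j using that not_le unfolding J_def B_def by blast
  have "(\<integral>\<^sup>+t\<in>{0<..1}. ennreal (1 / t ^ ?n) * J (t * r) \<partial>lborel)
      \<le> (\<integral>\<^sup>+t. (\<Sum>j. ennreal (D j) * indicator {1 / 2 ^ Suc j .. 1 / 2 ^ j :: real} t) \<partial>lborel)"
  proof (rule nn_integral_mono)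
    fix t :: real
    show "ennreal (1 / t ^ ?n) * J (t * r) * indicator {0<..1} t
      \<le> (\<Sum>j. ennreal (D j) * indicator {1 / 2 ^ Suc j .. 1 / 2 ^ j} t)"
    proof (cases "t \<in> {0<..1}")
      case True
      define j where "j = (LEAST j. 1 / 2 ^ Suc j < t)"
      have ex: "\<exists>j. 1 / 2 ^ Suc j < t"
      proof -
        obtain n where "(1/2) ^ n < t" using True real_arch_pow_inv[of t "1/2"] by auto
        moreover have "(1/2) ^ Suc n \<le> (1/2 :: real) ^ n" by simp
        ultimately show ?thesis by (intro exI[of _ n]) (simp add: power_divide)
      qed
      then have j1: "1 / 2 ^ Suc j < t" unfolding j_def by (rule LeastI_ex)
      have j2: "t \<le> 1 / 2 ^ j"
      proof (cases j)
        case (Suc i)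
        then have "\<not> 1 / 2 ^ Suc i < t" using not_less_Least[of i "\<lambda>j. 1 / 2 ^ Suc j < t"] by (simp add: j_def)
        then show ?thesis using Suc by simp
      qed (use True in simp)
      have "ennreal (1 / t ^ ?n) * J (t * r) \<le> ennreal ((2 ^ Suc j) ^ ?n) * J (r / 2 ^ j)"
      proof (intro mult_mono ennreal_leI)
        have "1 / t \<le> 2 ^ Suc j" using j1 True by (simp add: field_simps)
        then have "(1 / t) ^ ?n \<le> (2 ^ Suc j) ^ ?n" using True by (intro power_mono) auto
        then show "1 / t ^ ?n \<le> (2 ^ Suc j) ^ ?n" by (simp add: power_divide)
        have "t * r \<le> r / 2 ^ j" using mult_right_mono[OF j2, of r] r by simp
        then show "J (t * r) \<le> J (r / 2 ^ j)" unfolding J_def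
          by (intro nn_integral_mono mult_left_mono) (auto simp: indicator_def)
      qed auto
      also have "\<dots> \<le> ennreal ((2 ^ Suc j) ^ ?n) * ennreal (B j)"
        by (intro mult_left_mono less_imp_le[OF small]) simp
      also have "\<dots> = ennreal (D j)"
        using a r by (subst ennreal_mult[symmetric])
          (auto simp: B_def D_def power_mult_distrib power_divide power_mult[symmetric] mult.commute field_simps)
      also have "\<dots> = (\<Sum>j\<in>{j}. ennreal (D j) * indicator {1 / 2 ^ Suc j .. 1 / 2 ^ j} t)"
        using j1 j2 by simp
      also have "\<dots> \<le> (\<Sum>j. ennreal (D j) * indicator {1 / 2 ^ Suc j .. 1 / 2 ^ j} t)"
        by (rule sum_le_suminf) auto
      finally show ?thesis using True by simp
    qed simp
  qed
  also have "\<dots> = (\<Sum>j. ennreal (D j * (1 / 2 ^ Suc j)))"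
  proof (subst nn_integral_suminf, measurable, rule suminf_cong)
    fix j :: nat
    have "D j \<ge> 0" using a r by (simp add: D_def)
    then show "(\<integral>\<^sup>+t. ennreal (D j) * indicator {1 / 2 ^ Suc j .. 1 / 2 ^ j :: real} t \<partial>lborel) = ennreal (D j * (1 / 2 ^ Suc j))"
      by (subst nn_integral_cmult_indicator) (auto simp: ennreal_mult[symmetric] field_simps)
  qed
  \<comment> \<open>The series has ratio 3/4 and adds up, after multiplication by \<open>r\<close>,
    to exactly the value that \<open>big\<close> exceeds strictly. This fixes the constant
    \<open>a / (2 * 2 ^ DIM('a))\<close> in the claim.\<close>
  also have "\<dots> = ennreal (a * r ^ ?n / r)"
  proof -
    have "(\<lambda>j. a / 4 * r ^ ?n / r * (3/4) ^ j) sums (a / 4 * r ^ ?n / r * (1 / (1 - 3/4)))"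
      by (intro sums_mult geometric_sums) auto
    moreover have "D j * (1 / 2 ^ Suc j) = a / 4 * r ^ ?n / r * (3/4) ^ j" for j
    proof -
      have "(3/4::real) ^ j = (3/2) ^ j * (1/2) ^ j" by (simp flip: power_mult_distrib)
      then show ?thesis by (simp add: D_def power_divide mult_ac)
    qed
    ultimately show ?thesis
      using a r by (intro suminf_ennreal_eq) auto
  qed
  finally have "ennreal r * (\<integral>\<^sup>+t\<in>{0<..1}. ennreal (1 / t ^ ?n) * J (t * r) \<partial>lborel) \<le> ennreal r * ennreal (a * r ^ ?n / r)"
    by (intro mult_left_mono) auto
  then have "(\<integral>\<^sup>+y\<in>cball x r. ennreal \<bar>f x - f y\<bar> \<partial>lborel) \<le> ennreal r * ennreal (a * r ^ ?n / r)"
    using ball_oscillation_le[OF fG r, of x] unfolding J_def by order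
  also have "\<dots> = ennreal (a * r ^ ?n)" using a r by (simp add: ennreal_mult[symmetric])
  finally show False using big by simp
qed

text \<open>The ball of half the radius about the midpoint lies in both balls, and the triangle
  inequality through its points \<open>z\<close> is integrated over it. Hence a large difference
  shows as a large oscillation seen from at least one of the two points.\<close>

lemma pair_difference_le:
  fixes f :: "'a::euclidean_space \<Rightarrow> real"
  assumes [measurable]: "f \<in> borel_measurable borel" and r: "r = norm (x - y)"
  shows "ennreal \<bar>f x - f y\<bar> * ennreal (unit_ball_vol DIM('a) * (r / 2) ^ DIM('a)) \<le>
    (\<integral>\<^sup>+z\<in>cball x r. ennreal \<bar>f x - f z\<bar> \<partial>lborel) + (\<integral>\<^sup>+z\<in>cball y r. ennreal \<bar>f y - f z\<bar> \<partial>lborel)"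
proof -
  define m where "m = midpoint x y"
  have sub: "cball m (r / 2) \<subseteq> cball x r" "cball m (r / 2) \<subseteq> cball y r"
  proof -
    have "dist m x = r / 2" "dist m y = r / 2"
      using r dist_midpoint[of x y] by (simp_all add: m_def dist_norm)
    then show "cball m (r / 2) \<subseteq> cball x r" "cball m (r / 2) \<subseteq> cball y r"
      by (simp_all add: cball_subset_cball_iff)
  qed
  have "ennreal \<bar>f x - f y\<bar> * ennreal (unit_ball_vol DIM('a) * (r / 2) ^ DIM('a)) =
      ennreal \<bar>f x - f y\<bar> * emeasure lborel (cball m (r / 2))"
    using r by (subst emeasure_cball) auto
  also have "\<dots> = (\<integral>\<^sup>+z\<in>cball m (r / 2). ennreal \<bar>f x - f y\<bar> \<partial>lborel)"
    by (subst nn_integral_cmult_indicator) auto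
  also have "\<dots> \<le> (\<integral>\<^sup>+z. ennreal \<bar>f x - f z\<bar> * indicator (cball x r) z + ennreal \<bar>f y - f z\<bar> * indicator (cball y r) z \<partial>lborel)"
  proof (rule nn_integral_mono)
    fix z
    have "ennreal \<bar>f x - f y\<bar> \<le> ennreal \<bar>f x - f z\<bar> + ennreal \<bar>f y - f z\<bar>"
      using ennreal_leI[of "\<bar>f x - f y\<bar>" "\<bar>f x - f z\<bar> + \<bar>f y - f z\<bar>"] by simp
    then show "ennreal \<bar>f x - f y\<bar> * indicator (cball m (r / 2)) z
      \<le> ennreal \<bar>f x - f z\<bar> * indicator (cball x r) z + ennreal \<bar>f y - f z\<bar> * indicator (cball y r) z"
      using sub by (auto simp: indicator_def)
  qed
  also have "\<dots> = (\<integral>\<^sup>+z\<in>cball x r. ennreal \<bar>f x - f z\<bar> \<partial>lborel) + (\<integral>\<^sup>+z\<in>cball y r. ennreal \<bar>f y - f z\<bar> \<partial>lborel)"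
    by (rule nn_integral_add) measurable
  finally show ?thesis .
qed

lemma power_powr_commute:
  fixes a \<gamma> :: real
  assumes "a > 0"
  shows "(a ^ j) powr \<gamma> = (a powr \<gamma>) ^ j"
  using assms by (simp add: powr_powr mult.commute flip: powr_realpow)

text \<open>The double maximal function appears because \<open>w\<close> is first averaged by the kernel and then over
  the balls selected by the covering argument.\<close>

lemma weak_estimate_pos:
  fixes \<gamma> :: real
  assumes \<gamma>: "\<gamma> > 0"
  obtains K where "K > 0"
    "\<And>f G w l. upper_gradient f G \<Longrightarrow> w \<in> borel_measurable borel \<Longrightarrow> l > 0 \<Longrightarrow>
      (\<integral>\<^sup>+x. (\<integral>\<^sup>+y. w x * (indicator {p. l * norm (fst p - snd p) powr (1 + \<gamma>) < \<bar>f (fst p) - f (snd p)\<bar>} (x, y) *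
          ennreal (norm (x - y) powr (\<gamma> - DIM('a)))) \<partial>lborel) \<partial>lborel)
      \<le> ennreal (K / l) * ((\<integral>\<^sup>+z. G z * maximal w (z :: 'a::euclidean_space) \<partial>lborel) +
          (\<integral>\<^sup>+z. G z * maximal (maximal w) z \<partial>lborel))"
proof -
  define n where "n = DIM('a)"
  define V where "V = unit_ball_vol (real n)"
  have V: "V > 0" by (simp add: V_def)
  obtain Kk where Kk: "Kk > 0"
    "\<And>w T y. w \<in> borel_measurable borel \<Longrightarrow> T > 0 \<Longrightarrow>
      (\<integral>\<^sup>+x. indicator {x. norm (x - y) powr \<gamma> \<le> T} x * ennreal (norm (x - y) powr (\<gamma> - DIM('a))) * w x \<partial>lborel)
      \<le> ennreal (Kk * T) * maximal w (y :: 'a)"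
    by (rule kernel_bound[OF less_imp_neq[OF \<gamma>, symmetric], where 'a='a]) blast
  define K0 where "K0 = Kk * 5 powr \<gamma> * 10 ^ n * (4 * 4 ^ n) / V"
  have K0: "K0 > 0" using Kk V by (simp add: K0_def)
  show ?thesis
  proof (rule that[of "3 * K0"])
    show "3 * K0 > 0" using K0 by simp
    fix f :: "'a \<Rightarrow> real" and G w :: "'a \<Rightarrow> ennreal" and l :: real
    assume fG: "upper_gradient f G" and [measurable]: "w \<in> borel_measurable borel" and l: "l > 0"
    note [measurable] = upper_gradientD(1,2)[OF fG]
    define ker where "ker p = ennreal (norm p powr (\<gamma> - n))" for p :: 'a
    have [measurable]: "ker \<in> borel_measurable borel" unfolding ker_def by measurable
    define E where "E = {p. l * norm (fst p - snd p) powr (1 + \<gamma>) < \<bar>f (fst p) - f (snd p)\<bar>}"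
    have [measurable]: "E \<in> sets (borel \<Otimes>\<^sub>M borel)"
    proof -
      have "Measurable.pred (borel \<Otimes>\<^sub>M borel) (\<lambda>p. l * norm (fst p - snd p) powr (1 + \<gamma>) < \<bar>f (fst p) - f (snd p)\<bar>)"
        by measurable
      then show ?thesis by (simp add: pred_def E_def space_pair_measure)
    qed
    define S where "S = (\<integral>\<^sup>+z. G z * maximal w z \<partial>lborel) + (\<integral>\<^sup>+z. G z * maximal (maximal w) z \<partial>lborel)"
    \<comment> \<open>The share granted by \<open>dyadic_ball_large\<close>, rewritten in terms of
      the radius r / 2^j of the ball itself: replacing r^\<open>\<gamma>\<close> by a power of that
      radius costs the factor \<open>(2 powr \<gamma>) ^ j\<close>. The result has the form of the
      threshold in \<open>Vitali_selection\<close>.\<close>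
    define \<mu> where "\<mu> j = l * V / (4 * 4 ^ n) * (3/2) ^ j * (2 powr \<gamma>) ^ j" for j :: nat
    have \<mu>: "\<mu> j > 0" for j using l V by (simp add: \<mu>_def)
    define J where "J x \<rho> = (\<integral>\<^sup>+z\<in>cball x \<rho>. G z \<partial>lborel)" for x \<rho>
    have large: "\<exists>j. (\<exists>z\<in>{x, y}. ennreal (\<mu> j * (norm (x - y) / 2 ^ j) powr (\<gamma> + n)) \<le> J z (norm (x - y) / 2 ^ j))"
      if "(x, y) \<in> E" for x y
    proof -
      define r where "r = norm (x - y)"
      have r: "r > 0" using that by (auto simp: r_def E_def)
      \<comment> \<open>By \<open>pair_difference_le\<close> the two oscillations together exceed l
        * r^(1+\<open>\<gamma>\<close>) * V * (r/2)^n, which equals 2 * a * r^n; so one of them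
        exceeds a * r^n.\<close>
      define a where "a = l * r powr (1 + \<gamma>) * V / 2 ^ n / 2"
      have a: "a > 0" using r l V by (simp add: a_def)
      define A where "A z = (\<integral>\<^sup>+u\<in>cball z r. ennreal \<bar>f z - f u\<bar> \<partial>lborel)" for z
      have "\<exists>z\<in>{x, y}. ennreal (a * r ^ n) < A z"
      proof (rule ccontr)
        assume "\<not> ?thesis"
        then have "A x \<le> ennreal (a * r ^ n)" "A y \<le> ennreal (a * r ^ n)" by (auto simp: not_less)
        then have "A x + A y \<le> ennreal (a * r ^ n) + ennreal (a * r ^ n)" by (rule add_mono)
        then have "ennreal \<bar>f x - f y\<bar> * ennreal (V * (r / 2) ^ n) \<le> ennreal (a * r ^ n) + ennreal (a * r ^ n)"
          using pair_difference_le[of f r x y] r_def unfolding A_def V_def n_def by (meson order_trans upper_gradientD(1)[OF fG])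
        also have "\<dots> = ennreal (2 * (a * r ^ n))" using a r by (simp add: ennreal_plus[symmetric] del: ennreal_plus)
        finally have "\<bar>f x - f y\<bar> * (V * (r / 2) ^ n) \<le> 2 * (a * r ^ n)"
          using a r V by (simp add: ennreal_mult[symmetric])
        also have "\<dots> = (l * r powr (1 + \<gamma>)) * (V * (r / 2) ^ n)" by (simp add: a_def power_divide)
        finally have "\<bar>f x - f y\<bar> \<le> l * r powr (1 + \<gamma>)" using V r by simp
        then show False using that by (simp add: E_def r_def)
      qed
      then obtain z where z: "z \<in> {x, y}" "ennreal (a * r ^ n) < A z" by blast
      obtain j where j: "ennreal (a / (2 * 2 ^ n) * (3/2) ^ j * (r / 2 ^ j) ^ n / r) \<le> J z (r / 2 ^ j)"
        using dyadic_ball_large[OF fG r a, of z] z(2) unfolding A_def J_def n_def by metis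
      have "a / (2 * 2 ^ n) * (3/2) ^ j * (r / 2 ^ j) ^ n / r = \<mu> j * (r / 2 ^ j) powr (\<gamma> + n)"
      proof -
        have "(2::real) ^ n * 2 ^ n = 4 ^ n" by (simp flip: power_mult_distrib)
        moreover have "(r / 2 ^ j) powr (\<gamma> + n) = r powr \<gamma> / (2 powr \<gamma>) ^ j * (r / 2 ^ j) ^ n"
        proof -
          have "(r / 2 ^ j) powr \<gamma> = r powr \<gamma> / (2 powr \<gamma>) ^ j"
            using r by (simp add: powr_divide power_powr_commute)
          then show ?thesis using r by (simp add: powr_add powr_realpow)
        qed
        ultimately show ?thesis using r by (simp add: a_def \<mu>_def powr_add field_simps)
      qed
      then show ?thesis using z(1) j unfolding r_def by metis
    qed
    \<comment> \<open>Pairs are first restricted to distance at most \<open>N\<close>, which bounds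
      the radii of the balls to be selected. The bound is free of \<open>N\<close>, so monotone
      convergence removes the restriction.\<close>
    have bound_N: "(\<integral>\<^sup>+x. (\<integral>\<^sup>+y. w x * (indicator (E \<inter> {p. norm (fst p - snd p) \<le> real N}) (x, y) * ker (x - y)) \<partial>lborel) \<partial>lborel)
       \<le> ennreal (3 * K0 / l) * S" for N :: nat
    proof -
      define good where "good j C \<longleftrightarrow> countable C \<and> (\<forall>c r. (c, r) \<in> C \<longrightarrow> r > 0) \<and>
        (\<forall>x \<rho>. 0 < \<rho> \<longrightarrow> \<rho> \<le> real N \<longrightarrow> ennreal (\<mu> j * \<rho> powr (\<gamma> + n)) \<le> J x \<rho> \<longrightarrow>
            (\<exists>(c, r)\<in>C. x \<in> cball c (5 * r) \<and> \<rho> \<le> 5 * r)) \<and>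
        (\<forall>u. u \<in> borel_measurable borel \<longrightarrow>
          (\<integral>\<^sup>+i. (ennreal (snd i powr \<gamma>) * (\<integral>\<^sup>+z\<in>cball (fst i) (5 * snd i). u z \<partial>lborel)) \<partial>count_space C)
          \<le> ennreal (10 ^ n / \<mu> j) * (\<integral>\<^sup>+z. G z * maximal u z \<partial>lborel))" for j and C :: "('a \<times> real) set"
      have ex: "\<exists>C. good j C" for j
      proof (rule Vitali_selection[where N="real N" and \<gamma>=\<gamma>, OF upper_gradientD(2)[OF fG] \<mu>[of j]], fold n_def J_def)
        fix C :: "('a \<times> real) set"
        assume C0: "countable C" "\<And>c r. (c, r) \<in> C \<Longrightarrow> r > 0"
          "\<And>x \<rho>. 0 < \<rho> \<Longrightarrow> \<rho> \<le> real N \<Longrightarrow> ennreal (\<mu> j * \<rho> powr (\<gamma> + n)) \<le> J x \<rho> \<Longrightarrow>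
            (\<exists>(c, r)\<in>C. x \<in> cball c (5 * r) \<and> \<rho> \<le> 5 * r)"
          "\<And>u. u \<in> borel_measurable borel \<Longrightarrow>
            (\<integral>\<^sup>+i. (ennreal (snd i powr \<gamma>) * (\<integral>\<^sup>+z\<in>cball (fst i) (5 * snd i). u z \<partial>lborel)) \<partial>count_space C)
            \<le> ennreal (10 ^ n / \<mu> j) * (\<integral>\<^sup>+z. G z * maximal u z \<partial>lborel)"
        show ?thesis unfolding good_def
          by (intro exI[of _ C] conjI allI impI) (assumption | rule C0)+
      qed
      define C where "C j = (SOME C. good j C)" for j
      have good: "good j (C j)" for j unfolding C_def using ex by (rule someI_ex)
      note C = good[unfolded good_def, THEN conjunct1]
        good[unfolded good_def, THEN conjunct2, THEN conjunct1, rule_format]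
        good[unfolded good_def, THEN conjunct2, THEN conjunct2, THEN conjunct1, rule_format]
        good[unfolded good_def, THEN conjunct2, THEN conjunct2, THEN conjunct2, rule_format]
      \<comment> \<open>As \<open>\<gamma>\<close> > 0, a pair whose scaled distance is at most
        \<open>5 * snd i\<close> has its distance to the power \<open>\<gamma>\<close> below
        \<open>T j i\<close>. This is the truncation at which the kernel bound is applied.\<close>
      define T where "T j i = (5 * 2 ^ j * snd i) powr \<gamma>" for j :: nat and i :: "'a \<times> real"
      define k where "k j i x = indicator {p. norm p powr \<gamma> \<le> T j i} x * ker x" for j i and x :: 'a
      have [measurable]: "k j i \<in> borel_measurable borel" for j i
        unfolding k_def by measurable
      define B where "B i = cball (fst i) (5 * snd i)" for i :: "'a \<times> real"
      have [measurable]: "B i \<in> sets borel" for i by (simp add: B_def)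
      \<comment> \<open>Two terms, because either endpoint may be the one in the ball. If it is
        \<open>x\<close>, the kernel is integrated over \<open>y\<close> against the constant 1 and
        \<open>w\<close> survives. If it is \<open>y\<close>, the kernel is integrated over
        \<open>x\<close> against \<open>w\<close>, which produces \<open>maximal w\<close>.\<close>
      define F where "F j i x y = w x * (indicator (B i) x * k j i (x - y)) + w x * (indicator (B i) y * k j i (x - y))" for j i x y
      have F [measurable]: "(\<lambda>(x, y). F j i x y) \<in> borel_measurable (borel \<Otimes>\<^sub>M borel)" for j i
        unfolding F_def by measurable
      define H where "H j x y = (\<integral>\<^sup>+i. F j i x y \<partial>count_space (C j))" for j x y
      have H [measurable]: "(\<lambda>p. H j (fst p) (snd p)) \<in> borel_measurable (borel \<Otimes>\<^sub>M borel)" for j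
        unfolding H_def by (rule borel_measurable_countable_sum[OF C(1)]) measurable
      have "(\<integral>\<^sup>+x. (\<integral>\<^sup>+y. w x * (indicator (E \<inter> {p. norm (fst p - snd p) \<le> real N}) (x, y) * ker (x - y)) \<partial>lborel) \<partial>lborel)
        \<le> (\<integral>\<^sup>+x. (\<integral>\<^sup>+y. (\<Sum>j. H j (fst (x, y)) (snd (x, y))) \<partial>lborel) \<partial>lborel)"
      proof (intro nn_integral_mono)
        fix x y :: 'a
        show "w x * (indicator (E \<inter> {p. norm (fst p - snd p) \<le> real N}) (x, y) * ker (x - y)) \<le> (\<Sum>j. H j (fst (x, y)) (snd (x, y)))"
        proof (cases "(x, y) \<in> E \<and> norm (x - y) \<le> real N")
          case True
          then obtain j z where z: "z \<in> {x, y}" "ennreal (\<mu> j * (norm (x - y) / 2 ^ j) powr (\<gamma> + n)) \<le> J z (norm (x - y) / 2 ^ j)"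
            using large by blast
          have pos: "norm (x - y) > 0" using True by (auto simp: E_def)
          have "norm (x - y) / 2 ^ j \<le> norm (x - y) / 1" by (intro divide_left_mono) auto
          then have "\<exists>(c, r)\<in>C j. z \<in> cball c (5 * r) \<and> norm (x - y) / 2 ^ j \<le> 5 * r"
            using True pos by (intro C(3) z(2)) auto
          then obtain i where i: "i \<in> C j" "z \<in> B i" "norm (x - y) / 2 ^ j \<le> 5 * snd i"
            by (auto simp: B_def)
          have "norm (x - y) \<le> 5 * 2 ^ j * snd i" using i(3) by (simp add: field_simps)
          then have "norm (x - y) powr \<gamma> \<le> T j i" unfolding T_def using \<gamma> by (intro powr_mono2) auto
          then have keq: "k j i (x - y) = ker (x - y)" by (simp add: k_def)
          have "w x * ker (x - y) \<le> F j i x y"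
            using z(1) i(2) by (auto simp: F_def keq indicator_def)
          also have "\<dots> \<le> H j x y"
            unfolding H_def by (rule nn_integral_ge_point[OF i(1)])
          also have "\<dots> = (\<Sum>j\<in>{j}. H j x y)" by simp
          also have "\<dots> \<le> (\<Sum>j. H j x y)" by (rule sum_le_suminf) auto
          finally show ?thesis using True by simp
        qed (auto simp: indicator_def)
      qed
      also have "\<dots> = (\<Sum>j. \<integral>\<^sup>+x. (\<integral>\<^sup>+y. H j (fst (x, y)) (snd (x, y)) \<partial>lborel) \<partial>lborel)"
        by (subst nn_integral_suminf[symmetric], measurable)
          (intro nn_integral_cong nn_integral_suminf, measurable)
      also have "\<dots> \<le> (\<Sum>j. ennreal (K0 / l * (2/3) ^ j) * S)"
      proof (rule suminf_le)
        fix j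
        have "(\<integral>\<^sup>+x. (\<integral>\<^sup>+y. H j (fst (x, y)) (snd (x, y)) \<partial>lborel) \<partial>lborel) =
           (\<integral>\<^sup>+x. (\<integral>\<^sup>+i. (\<integral>\<^sup>+y. F j i x y \<partial>lborel) \<partial>count_space (C j)) \<partial>lborel)"
          unfolding H_def fst_conv snd_conv by (intro nn_integral_cong tonelli_countable C(1)) measurable
        also have "\<dots> = (\<integral>\<^sup>+i. (\<integral>\<^sup>+x. (\<integral>\<^sup>+y. F j i x y \<partial>lborel) \<partial>lborel) \<partial>count_space (C j))"
          by (intro tonelli_countable C(1)) measurable
        also have "\<dots> \<le> (\<integral>\<^sup>+i. ennreal (Kk * (5 * 2 ^ j) powr \<gamma>) * (ennreal (snd i powr \<gamma>) * (\<integral>\<^sup>+z\<in>B i. w z \<partial>lborel) +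
             ennreal (snd i powr \<gamma>) * (\<integral>\<^sup>+z\<in>B i. maximal w z \<partial>lborel)) \<partial>count_space (C j))"
        proof (rule nn_integral_mono)
          fix i assume "i \<in> space (count_space (C j))"
          then have ri: "snd i > 0" using C(2)[of "fst i" "snd i" j] by simp
          then have T: "T j i > 0" by (simp add: T_def)
          have "(\<integral>\<^sup>+x. (\<integral>\<^sup>+y. F j i x y \<partial>lborel) \<partial>lborel) =
            (\<integral>\<^sup>+x. (\<integral>\<^sup>+y. w x * (indicator (B i) x * k j i (x - y)) \<partial>lborel) + (\<integral>\<^sup>+y. w x * (indicator (B i) y * k j i (x - y)) \<partial>lborel) \<partial>lborel)"
            unfolding F_def by (intro nn_integral_cong nn_integral_add) measurable
          also have "\<dots> = (\<integral>\<^sup>+x. (\<integral>\<^sup>+y. w x * (indicator (B i) x * k j i (x - y)) \<partial>lborel) \<partial>lborel) +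
              (\<integral>\<^sup>+x. (\<integral>\<^sup>+y. w x * (indicator (B i) y * k j i (x - y)) \<partial>lborel) \<partial>lborel)"
            by (rule nn_integral_add) measurable
          also have "(\<integral>\<^sup>+x. (\<integral>\<^sup>+y. w x * (indicator (B i) y * k j i (x - y)) \<partial>lborel) \<partial>lborel) =
             (\<integral>\<^sup>+y. (\<integral>\<^sup>+x. w x * (indicator (B i) y * k j i (x - y)) \<partial>lborel) \<partial>lborel)"
            by (rule lborel_pair.Fubini') measurable
          also have "\<dots> \<le> (\<integral>\<^sup>+y. ennreal (Kk * T j i) * (maximal w y * indicator (B i) y) \<partial>lborel)"
          proof (rule nn_integral_mono)
            fix y
            have "(\<integral>\<^sup>+x. w x * (indicator (B i) y * k j i (x - y)) \<partial>lborel) =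
               (\<integral>\<^sup>+x. indicator (B i) y * (indicator {x. norm (x - y) powr \<gamma> \<le> T j i} x * ennreal (norm (x - y) powr (\<gamma> - DIM('a))) * w x) \<partial>lborel)"
              by (intro nn_integral_cong) (simp add: k_def ker_def n_def mult_ac indicator_def)
            also have "\<dots> = indicator (B i) y * (\<integral>\<^sup>+x. (indicator {x. norm (x - y) powr \<gamma> \<le> T j i} x * ennreal (norm (x - y) powr (\<gamma> - DIM('a))) * w x) \<partial>lborel)"
              by (rule nn_integral_cmult) measurable
            also have "\<dots> \<le> indicator (B i) y * (ennreal (Kk * T j i) * maximal w y)"
              by (intro mult_left_mono Kk(2) T) auto
            finally show "(\<integral>\<^sup>+x. w x * (indicator (B i) y * k j i (x - y)) \<partial>lborel) \<le> ennreal (Kk * T j i) * (maximal w y * indicator (B i) y)"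
              by (simp add: mult_ac)
          qed
          also have "\<dots> = ennreal (Kk * T j i) * (\<integral>\<^sup>+z\<in>B i. maximal w z \<partial>lborel)"
            by (rule nn_integral_cmult) measurable
          also have "(\<integral>\<^sup>+x. (\<integral>\<^sup>+y. w x * (indicator (B i) x * k j i (x - y)) \<partial>lborel) \<partial>lborel) \<le>
              (\<integral>\<^sup>+x. ennreal (Kk * T j i) * (w x * indicator (B i) x) \<partial>lborel)"
          proof (rule nn_integral_mono)
            fix x
            have "(\<integral>\<^sup>+y. w x * (indicator (B i) x * k j i (x - y)) \<partial>lborel) =
               (\<integral>\<^sup>+y. (w x * indicator (B i) x) * (indicator {y. norm (y - x) powr \<gamma> \<le> T j i} y * ennreal (norm (y - x) powr (\<gamma> - DIM('a))) * 1) \<partial>lborel)"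
              by (intro nn_integral_cong) (simp add: k_def ker_def n_def mult_ac indicator_def norm_minus_commute)
            also have "\<dots> = (w x * indicator (B i) x) * (\<integral>\<^sup>+y. (indicator {y. norm (y - x) powr \<gamma> \<le> T j i} y * ennreal (norm (y - x) powr (\<gamma> - DIM('a))) * 1) \<partial>lborel)"
              by (rule nn_integral_cmult) measurable
            also have "\<dots> \<le> (w x * indicator (B i) x) * (ennreal (Kk * T j i) * maximal (\<lambda>_. 1) x)"
              by (intro mult_left_mono Kk(2) T) auto
            also have "\<dots> \<le> (w x * indicator (B i) x) * (ennreal (Kk * T j i) * 1)"
              by (intro mult_left_mono maximal_one_le) auto
            finally show "(\<integral>\<^sup>+y. w x * (indicator (B i) x * k j i (x - y)) \<partial>lborel) \<le> ennreal (Kk * T j i) * (w x * indicator (B i) x)"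
              by (simp add: mult_ac)
          qed
          also have "\<dots> = ennreal (Kk * T j i) * (\<integral>\<^sup>+z\<in>B i. w z \<partial>lborel)"
            by (rule nn_integral_cmult) measurable
          finally have "(\<integral>\<^sup>+x. (\<integral>\<^sup>+y. F j i x y \<partial>lborel) \<partial>lborel) \<le>
            ennreal (Kk * T j i) * (\<integral>\<^sup>+z\<in>B i. w z \<partial>lborel) + ennreal (Kk * T j i) * (\<integral>\<^sup>+z\<in>B i. maximal w z \<partial>lborel)"
            by (simp add: add_mono)
          moreover have "ennreal (Kk * T j i) = ennreal (Kk * (5 * 2 ^ j) powr \<gamma>) * ennreal (snd i powr \<gamma>)"
            using ri Kk(1) by (simp add: T_def powr_mult ennreal_mult[symmetric])
          ultimately show "(\<integral>\<^sup>+x. (\<integral>\<^sup>+y. F j i x y \<partial>lborel) \<partial>lborel) \<le>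
             ennreal (Kk * (5 * 2 ^ j) powr \<gamma>) * (ennreal (snd i powr \<gamma>) * (\<integral>\<^sup>+z\<in>B i. w z \<partial>lborel) +
             ennreal (snd i powr \<gamma>) * (\<integral>\<^sup>+z\<in>B i. maximal w z \<partial>lborel))"
            by (simp add: distrib_left mult.assoc)
        qed
        also have "\<dots> = ennreal (Kk * (5 * 2 ^ j) powr \<gamma>) * ((\<integral>\<^sup>+i. ennreal (snd i powr \<gamma>) * (\<integral>\<^sup>+z\<in>B i. w z \<partial>lborel) \<partial>count_space (C j)) +
             (\<integral>\<^sup>+i. ennreal (snd i powr \<gamma>) * (\<integral>\<^sup>+z\<in>B i. maximal w z \<partial>lborel) \<partial>count_space (C j)))"
          by (simp add: nn_integral_cmult nn_integral_add)
        also have "\<dots> \<le> ennreal (Kk * (5 * 2 ^ j) powr \<gamma>) *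
             (ennreal (10 ^ n / \<mu> j) * (\<integral>\<^sup>+z. G z * maximal w z \<partial>lborel) +
              ennreal (10 ^ n / \<mu> j) * (\<integral>\<^sup>+z. G z * maximal (maximal w) z \<partial>lborel))"
          unfolding B_def by (intro mult_left_mono add_mono C(4)) auto
        also have "\<dots> = ennreal (Kk * (5 * 2 ^ j) powr \<gamma> * (10 ^ n / \<mu> j)) * S"
          using Kk(1) \<mu>[of j] by (simp add: S_def distrib_left mult.assoc[symmetric] ennreal_mult[symmetric])
        \<comment> \<open>The powers of \<open>2 powr \<gamma>\<close> from the enlarged balls and
          from \<open>\<mu> j\<close> cancel; the surplus (3/2)^j gained by the pigeonhole argument
          makes the sum over \<open>j\<close> converge.\<close>
        also have "Kk * (5 * 2 ^ j) powr \<gamma> * (10 ^ n / \<mu> j) = K0 / l * (2/3) ^ j"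
        proof -
          have "(5 * 2 ^ j) powr \<gamma> = 5 powr \<gamma> * (2 powr \<gamma>) ^ j"
            by (simp add: powr_mult power_powr_commute)
          moreover have "(2/3 :: real) ^ j = 1 / (3/2) ^ j" by (simp add: power_divide)
          ultimately show ?thesis using V l by (simp add: K0_def \<mu>_def field_simps)
        qed
        finally show "(\<integral>\<^sup>+x. (\<integral>\<^sup>+y. H j (fst (x, y)) (snd (x, y)) \<partial>lborel) \<partial>lborel) \<le> ennreal (K0 / l * (2/3) ^ j) * S" .
      qed auto
      also have "\<dots> = (\<Sum>j. ennreal (K0 / l * (2/3) ^ j)) * S"
        by (rule ennreal_suminf_multc)
      also have "(\<Sum>j. ennreal (K0 / l * (2/3) ^ j)) = ennreal (3 * K0 / l)"
      proof -
        have "(\<lambda>j. K0 / l * (2/3) ^ j) sums (K0 / l * (1 / (1 - 2/3)))"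
          by (intro sums_mult geometric_sums) auto
        then show ?thesis using K0 l by (intro suminf_ennreal_eq) (auto simp: mult_ac)
      qed
      finally show ?thesis .
    qed
    have "(\<integral>\<^sup>+x. (\<integral>\<^sup>+y. w x * (indicator E (x, y) * ker (x - y)) \<partial>lborel) \<partial>lborel) =
      (\<integral>\<^sup>+x. (\<integral>\<^sup>+y. (SUP N. w x * (indicator (E \<inter> {p. norm (fst p - snd p) \<le> real N}) (x, y) * ker (x - y))) \<partial>lborel) \<partial>lborel)"
    proof (intro nn_integral_cong antisym)
      fix x y :: 'a
      obtain N :: nat where "norm (x - y) \<le> real N" using real_arch_simple by blast
      then have "w x * (indicator E (x, y) * ker (x - y)) = w x * (indicator (E \<inter> {p. norm (fst p - snd p) \<le> real N}) (x, y) * ker (x - y))"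
        by (simp add: indicator_def)
      then show "w x * (indicator E (x, y) * ker (x - y)) \<le> (SUP N. w x * (indicator (E \<inter> {p. norm (fst p - snd p) \<le> real N}) (x, y) * ker (x - y)))"
        by (intro SUP_upper2[of N]) auto
      show "(SUP N. w x * (indicator (E \<inter> {p. norm (fst p - snd p) \<le> real N}) (x, y) * ker (x - y))) \<le> w x * (indicator E (x, y) * ker (x - y))"
        by (intro SUP_least mult_left_mono mult_right_mono) (auto simp: indicator_def)
    qed
    also have "\<dots> = (\<integral>\<^sup>+x. (SUP N. \<integral>\<^sup>+y. w x * (indicator (E \<inter> {p. norm (fst p - snd p) \<le> real N}) (x, y) * ker (x - y)) \<partial>lborel) \<partial>lborel)"
      by (intro nn_integral_cong nn_integral_monotone_convergence_SUP)
        (auto simp: incseq_def le_fun_def indicator_def)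
    also have "\<dots> = (SUP N. (\<integral>\<^sup>+x. (\<integral>\<^sup>+y. w x * (indicator (E \<inter> {p. norm (fst p - snd p) \<le> real N}) (x, y) * ker (x - y)) \<partial>lborel) \<partial>lborel))"
    proof (intro nn_integral_monotone_convergence_SUP)
      show "incseq (\<lambda>N x. \<integral>\<^sup>+y. w x * (indicator (E \<inter> {p. norm (fst p - snd p) \<le> real N}) (x, y) * ker (x - y)) \<partial>lborel)"
        by (intro monoI le_funI nn_integral_mono mult_left_mono mult_right_mono) (auto simp: indicator_def)
    qed measurable
    also have "\<dots> \<le> ennreal (3 * K0 / l) * S" by (intro SUP_least bound_N)
    finally show "(\<integral>\<^sup>+x. (\<integral>\<^sup>+y. w x * (indicator {p. l * norm (fst p - snd p) powr (1 + \<gamma>) < \<bar>f (fst p) - f (snd p)\<bar>} (x, y) *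
          ennreal (norm (x - y) powr (\<gamma> - DIM('a)))) \<partial>lborel) \<partial>lborel)
      \<le> ennreal (3 * K0 / l) * ((\<integral>\<^sup>+z. G z * maximal w z \<partial>lborel) + (\<integral>\<^sup>+z. G z * maximal (maximal w) z \<partial>lborel))"
      by (simp add: E_def ker_def S_def n_def)
  qed
qed

section \<open>Negative exponents\<close>

text \<open>For fixed \<open>t\<close> the point z = x + t (y - x) stays in the ball by convexity.
  Passing from y to z costs t^-n, but for given z the point x is confined to the ball of radius 2 t
  P about z, where \<open>w\<close> integrates to at most (4 t P)^n * \<open>maximal w z\<close>.
  The powers of t cancel, so the bound is uniform in t.\<close>

lemma segment_Poincare:
  fixes c :: "'a::euclidean_space"
  assumes [measurable]: "\<Phi> \<in> borel_measurable borel" "w \<in> borel_measurable borel" and P: "P > 0" and t: "0 < t" "t \<le> 1"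
  shows "(\<integral>\<^sup>+x. (\<integral>\<^sup>+y. w x * indicator (cball c P) x * indicator (cball c P) y * \<Phi> (x + t *\<^sub>R (y - x)) \<partial>lborel) \<partial>lborel)
    \<le> ennreal ((4 * P) ^ DIM('a)) * (\<integral>\<^sup>+z. indicator (cball c P) z * \<Phi> z * maximal w z \<partial>lborel)"
proof -
  let ?n = "DIM('a)" and ?B = "cball c P"
  have inner: "(\<integral>\<^sup>+y. w x * indicator ?B x * indicator ?B y * \<Phi> (x + t *\<^sub>R (y - x)) \<partial>lborel) \<le>
     (\<integral>\<^sup>+z. ennreal (1 / t ^ ?n) * (w x * (\<Phi> z * indicator ?B z * indicator (cball z (t * (2 * P))) x)) \<partial>lborel)" for x
  proof (cases "x \<in> ?B")
    case True
    have "(\<integral>\<^sup>+y. w x * indicator ?B x * indicator ?B y * \<Phi> (x + t *\<^sub>R (y - x)) \<partial>lborel) \<le>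
       (\<integral>\<^sup>+y. w x * ((\<lambda>z. \<Phi> z * indicator ?B z) (x + t *\<^sub>R (y - x)) * indicator (cball x (2 * P)) y) \<partial>lborel)"
    proof (rule nn_integral_mono)
      fix y
      show "w x * indicator ?B x * indicator ?B y * \<Phi> (x + t *\<^sub>R (y - x)) \<le>
        w x * ((\<lambda>z. \<Phi> z * indicator ?B z) (x + t *\<^sub>R (y - x)) * indicator (cball x (2 * P)) y)"
      proof (cases "y \<in> ?B")
        case y: True
        have "(1 - t) *\<^sub>R x + t *\<^sub>R y \<in> ?B"
          using convexD[OF convex_cball True y, of "1 - t" t] t by simp
        moreover have "(1 - t) *\<^sub>R x + t *\<^sub>R y = x + t *\<^sub>R (y - x)" by (simp add: algebra_simps)
        ultimately have "x + t *\<^sub>R (y - x) \<in> ?B" by simp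
        moreover have "dist x y \<le> 2 * P" using True y dist_triangle2[of x y c] by (simp add: dist_commute)
        ultimately show ?thesis by (simp add: indicator_def)
      qed simp
    qed
    also have "\<dots> = w x * (\<integral>\<^sup>+y. (\<lambda>z. \<Phi> z * indicator ?B z) (x + t *\<^sub>R (y - x)) * indicator (cball x (2 * P)) y \<partial>lborel)"
      by (rule nn_integral_cmult) measurable
    also have "\<dots> = w x * (ennreal (1 / t ^ ?n) * (\<integral>\<^sup>+z\<in>cball x (t * (2 * P)). \<Phi> z * indicator ?B z \<partial>lborel))"
      using P t by (subst segment_integral_ball) auto
    also have "\<dots> = (w x * ennreal (1 / t ^ ?n)) * (\<integral>\<^sup>+z\<in>cball x (t * (2 * P)). \<Phi> z * indicator ?B z \<partial>lborel)"
      by (simp add: mult.assoc)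
    also have "\<dots> = (\<integral>\<^sup>+z. (w x * ennreal (1 / t ^ ?n)) * (\<Phi> z * indicator ?B z * indicator (cball x (t * (2 * P))) z) \<partial>lborel)"
      by (rule nn_integral_cmult[symmetric]) measurable
    also have "\<dots> = (\<integral>\<^sup>+z. ennreal (1 / t ^ ?n) * (w x * (\<Phi> z * indicator ?B z * indicator (cball z (t * (2 * P))) x)) \<partial>lborel)"
      by (intro nn_integral_cong) (auto simp: indicator_def dist_commute mult_ac)
    finally show ?thesis .
  qed simp
  have "(\<integral>\<^sup>+x. (\<integral>\<^sup>+y. w x * indicator ?B x * indicator ?B y * \<Phi> (x + t *\<^sub>R (y - x)) \<partial>lborel) \<partial>lborel)
    \<le> (\<integral>\<^sup>+x. (\<integral>\<^sup>+z. ennreal (1 / t ^ ?n) * (w x * (\<Phi> z * indicator ?B z * indicator (cball z (t * (2 * P))) x)) \<partial>lborel) \<partial>lborel)"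
    by (rule nn_integral_mono) (rule inner)
  also have "\<dots> = (\<integral>\<^sup>+z. (\<integral>\<^sup>+x. ennreal (1 / t ^ ?n) * (w x * (\<Phi> z * indicator ?B z * indicator (cball z (t * (2 * P))) x)) \<partial>lborel) \<partial>lborel)"
  proof (rule lborel_pair.Fubini')
    have "(\<lambda>p. indicator {p. dist (fst p) (snd p) \<le> t * (2 * P)} p :: ennreal) \<in> borel_measurable (lborel \<Otimes>\<^sub>M lborel :: ('a \<times> 'a) measure)"
      by measurable
    then have [measurable]: "(\<lambda>p. indicator (cball (fst p) (t * (2 * P))) (snd p) :: ennreal) \<in> borel_measurable (lborel \<Otimes>\<^sub>M lborel :: ('a \<times> 'a) measure)"
      by (simp add: indicator_def)
    show "(\<lambda>(z, x). ennreal (1 / t ^ ?n) * (w x * (\<Phi> z * indicator ?B z * indicator (cball z (t * (2 * P))) x)))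
      \<in> borel_measurable (lborel \<Otimes>\<^sub>M lborel)"
      unfolding case_prod_unfold by measurable
  qed
  also have "\<dots> \<le> (\<integral>\<^sup>+z. ennreal ((4 * P) ^ ?n) * (indicator ?B z * \<Phi> z * maximal w z) \<partial>lborel)"
  proof (rule nn_integral_mono)
    fix z
    have "(\<integral>\<^sup>+x. ennreal (1 / t ^ ?n) * (w x * (\<Phi> z * indicator ?B z * indicator (cball z (t * (2 * P))) x)) \<partial>lborel) =
      (\<integral>\<^sup>+x. (ennreal (1 / t ^ ?n) * \<Phi> z * indicator ?B z) * (w x * indicator (cball z (t * (2 * P))) x) \<partial>lborel)"
      by (intro nn_integral_cong) (simp add: mult_ac)
    also have "\<dots> = (ennreal (1 / t ^ ?n) * \<Phi> z * indicator ?B z) * (\<integral>\<^sup>+x\<in>cball z (t * (2 * P)). w x \<partial>lborel)"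
      by (rule nn_integral_cmult) measurable
    also have "\<dots> \<le> (ennreal (1 / t ^ ?n) * \<Phi> z * indicator ?B z) * (ennreal ((2 * (t * (2 * P))) ^ ?n) * maximal w z)"
      using P t by (intro mult_left_mono ball_le_maximal) auto
    also have "\<dots> = (ennreal (1 / t ^ ?n) * ennreal ((2 * (t * (2 * P))) ^ ?n)) * (indicator ?B z * \<Phi> z * maximal w z)"
      by (simp add: mult_ac)
    also have "ennreal (1 / t ^ ?n) * ennreal ((2 * (t * (2 * P))) ^ ?n) = ennreal ((4 * P) ^ ?n)"
    proof -
      have "2 * (t * (2 * P)) = t * (4 * P)" by simp
      then have "1 / t ^ ?n * (2 * (t * (2 * P))) ^ ?n = (4 * P) ^ ?n"
        using t by (simp only: power_mult_distrib) simp
      then show ?thesis using P t by (simp add: ennreal_mult[symmetric])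
    qed
    finally show "(\<integral>\<^sup>+x. ennreal (1 / t ^ ?n) * (w x * (\<Phi> z * indicator ?B z * indicator (cball z (t * (2 * P))) x)) \<partial>lborel)
      \<le> ennreal ((4 * P) ^ ?n) * (indicator ?B z * \<Phi> z * maximal w z)" .
  qed
  also have "\<dots> = ennreal ((4 * P) ^ ?n) * (\<integral>\<^sup>+z. indicator ?B z * \<Phi> z * maximal w z \<partial>lborel)"
    by (rule nn_integral_cmult) measurable
  finally show ?thesis .
qed

text \<open>Each segment from \<open>A1\<close> to \<open>A2\<close> crosses all levels between
  \<open>\<alpha>\<close> and \<open>\<beta>\<close>; the localised inequality in
  \<open>upper_gradient\<close> therefore forces the gradient over levels in \<open>b\<close> to be
  large on it. Integrating over both endpoints, with weight in the first, leaves the situation of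
  \<open>segment_Poincare\<close>, where 2 P bounds the length of the segment.\<close>

lemma level_separation:
  fixes c :: "'a::euclidean_space"
  assumes fG: "upper_gradient f G" and [measurable]: "w \<in> borel_measurable borel" and P: "P > 0"
    and [measurable]: "b \<in> sets borel" "A1 \<in> sets borel" "A2 \<in> sets borel"
    and A: "A1 \<subseteq> cball c P" "A2 \<subseteq> cball c P"
    and sep: "\<And>x y. x \<in> A1 \<Longrightarrow> y \<in> A2 \<Longrightarrow> min (f x) (f y) \<le> \<alpha> \<and> \<beta> \<le> max (f x) (f y)"
    and \<kappa>: "\<kappa> \<le> emeasure lborel (b \<inter> {\<alpha>..\<beta>})"
  shows "\<kappa> * (\<integral>\<^sup>+x\<in>A1. w x \<partial>lborel) * emeasure lborel A2 \<le>
    ennreal (2 * P * (4 * P) ^ DIM('a)) * (\<integral>\<^sup>+z. indicator (cball c P) z * (indicator b (f z) * G z) * maximal w z \<partial>lborel)"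
proof -
  let ?n = "DIM('a)" and ?B = "cball c P"
  note [measurable] = upper_gradientD(1,2)[OF fG]
  define \<Phi> where "\<Phi> z = indicator b (f z) * G z" for z
  have [measurable]: "\<Phi> \<in> borel_measurable borel" unfolding \<Phi>_def by measurable
  have "\<kappa> * (\<integral>\<^sup>+x\<in>A1. w x \<partial>lborel) * emeasure lborel A2 = (\<integral>\<^sup>+x. \<kappa> * (w x * indicator A1 x) * emeasure lborel A2 \<partial>lborel)"
    by (simp add: nn_integral_cmult nn_integral_multc)
  also have "\<dots> = (\<integral>\<^sup>+x. (\<integral>\<^sup>+y. \<kappa> * (w x * indicator A1 x) * indicator A2 y \<partial>lborel) \<partial>lborel)"
    by (intro nn_integral_cong nn_integral_cmult_indicator[symmetric]) simp
  also have "\<dots> \<le> (\<integral>\<^sup>+x. (\<integral>\<^sup>+y. (\<integral>\<^sup>+t. ennreal (2 * P) * (indicator {0<..1} t * (w x * indicator ?B x * indicator ?B y * \<Phi> (x + t *\<^sub>R (y - x)))) \<partial>lborel) \<partial>lborel) \<partial>lborel)"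
  proof (intro nn_integral_mono)
    fix x y
    show "\<kappa> * (w x * indicator A1 x) * indicator A2 y \<le>
      (\<integral>\<^sup>+t. ennreal (2 * P) * (indicator {0<..1} t * (w x * indicator ?B x * indicator ?B y * \<Phi> (x + t *\<^sub>R (y - x)))) \<partial>lborel)"
    proof (cases "x \<in> A1 \<and> y \<in> A2")
      case True
      then have B: "x \<in> ?B" "y \<in> ?B" using A by auto
      have "norm (x - y) \<le> 2 * P" using B dist_triangle2[of x y c] by (simp add: dist_commute dist_norm)
      have "\<kappa> \<le> ennreal (norm (x - y)) * (\<integral>\<^sup>+t\<in>{0..1}. indicator b (f (x + t *\<^sub>R (y - x))) * G (x + t *\<^sub>R (y - x)) \<partial>lborel)"
        using fG[unfolded upper_gradient_def, THEN conjunct2, THEN conjunct2, rule_format, of b x y \<alpha> \<beta>] sep[of x y] True \<kappa> by auto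
      also have "(\<integral>\<^sup>+t\<in>{0..1}. indicator b (f (x + t *\<^sub>R (y - x))) * G (x + t *\<^sub>R (y - x)) \<partial>lborel) =
          (\<integral>\<^sup>+t\<in>{0<..1}. \<Phi> (x + t *\<^sub>R (y - x)) \<partial>lborel)"
        by (intro nn_integral_cong_AE) (use AE_lborel_singleton[of "0::real"] in \<open>eventually_elim, auto simp: indicator_def \<Phi>_def\<close>)
      also have "ennreal (norm (x - y)) * \<dots> \<le> ennreal (2 * P) * \<dots>"
        using \<open>norm (x - y) \<le> 2 * P\<close> by (intro mult_right_mono ennreal_leI) auto
      finally have "\<kappa> * w x \<le> (ennreal (2 * P) * (\<integral>\<^sup>+t\<in>{0<..1}. \<Phi> (x + t *\<^sub>R (y - x)) \<partial>lborel)) * w x"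
        by (rule mult_right_mono) simp
      also have "\<dots> = (ennreal (2 * P) * w x) * (\<integral>\<^sup>+t\<in>{0<..1}. \<Phi> (x + t *\<^sub>R (y - x)) \<partial>lborel)"
        by (simp add: mult_ac)
      also have "\<dots> = (\<integral>\<^sup>+t. (ennreal (2 * P) * w x) * (\<Phi> (x + t *\<^sub>R (y - x)) * indicator {0<..1} t) \<partial>lborel)"
        by (rule nn_integral_cmult[symmetric]) measurable
      also have "\<dots> = (\<integral>\<^sup>+t. ennreal (2 * P) * (indicator {0<..1} t * (w x * indicator ?B x * indicator ?B y * \<Phi> (x + t *\<^sub>R (y - x)))) \<partial>lborel)"
        using B by (intro nn_integral_cong) (simp add: mult_ac)
      finally show ?thesis using True by simp
    qed auto
  qed
  also have "\<dots> = (\<integral>\<^sup>+x. (\<integral>\<^sup>+t. (\<integral>\<^sup>+y. ennreal (2 * P) * (indicator {0<..1} t * (w x * indicator ?B x * indicator ?B y * \<Phi> (x + t *\<^sub>R (y - x)))) \<partial>lborel) \<partial>lborel) \<partial>lborel)"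
    by (intro nn_integral_cong lborel_pair.Fubini') measurable
  also have "\<dots> = (\<integral>\<^sup>+t. (\<integral>\<^sup>+x. (\<integral>\<^sup>+y. ennreal (2 * P) * (indicator {0<..1} t * (w x * indicator ?B x * indicator ?B y * \<Phi> (x + t *\<^sub>R (y - x)))) \<partial>lborel) \<partial>lborel) \<partial>lborel)"
    by (rule lborel_pair.Fubini') measurable
  also have "\<dots> \<le> (\<integral>\<^sup>+t. (ennreal (2 * P) * (ennreal ((4 * P) ^ ?n) * (\<integral>\<^sup>+z. indicator ?B z * \<Phi> z * maximal w z \<partial>lborel))) * indicator {0<..1::real} t \<partial>lborel)"
  proof (rule nn_integral_mono)
    fix t :: real
    show "(\<integral>\<^sup>+x. (\<integral>\<^sup>+y. ennreal (2 * P) * (indicator {0<..1} t * (w x * indicator ?B x * indicator ?B y * \<Phi> (x + t *\<^sub>R (y - x)))) \<partial>lborel) \<partial>lborel)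
      \<le> (ennreal (2 * P) * (ennreal ((4 * P) ^ ?n) * (\<integral>\<^sup>+z. indicator ?B z * \<Phi> z * maximal w z \<partial>lborel))) * indicator {0<..1} t"
    proof (cases "t \<in> {0<..1}")
      case True
      have "(\<integral>\<^sup>+x. (\<integral>\<^sup>+y. ennreal (2 * P) * (indicator {0<..1} t * (w x * indicator ?B x * indicator ?B y * \<Phi> (x + t *\<^sub>R (y - x)))) \<partial>lborel) \<partial>lborel)
        = ennreal (2 * P) * (\<integral>\<^sup>+x. (\<integral>\<^sup>+y. w x * indicator ?B x * indicator ?B y * \<Phi> (x + t *\<^sub>R (y - x)) \<partial>lborel) \<partial>lborel)"
        using True by (subst nn_integral_cmult[symmetric], measurable)
          (intro nn_integral_cong, subst nn_integral_cmult[symmetric], measurable)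
      also have "\<dots> \<le> ennreal (2 * P) * (ennreal ((4 * P) ^ ?n) * (\<integral>\<^sup>+z. indicator ?B z * \<Phi> z * maximal w z \<partial>lborel))"
        using True P by (intro mult_left_mono segment_Poincare) auto
      finally show ?thesis using True by simp
    qed simp
  qed
  also have "\<dots> = ennreal (2 * P * (4 * P) ^ ?n) * (\<integral>\<^sup>+z. indicator ?B z * \<Phi> z * maximal w z \<partial>lborel)"
    using P by (subst nn_integral_cmult_indicator) (auto simp: ennreal_mult mult.assoc)
  finally show ?thesis by (simp add: \<Phi>_def)
qed

text \<open>The median is the infimum of the levels whose sublevel sets fill half of the ball.
  Continuity of the measure along decreasing sets gives the first inequality by approaching
  \<open>m\<close> from above and the second by approaching it from below. Values of
  \<open>f\<close> on the compact ball are bounded, which makes the infimum meaningful.\<close>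

lemma median_exists:
  fixes f :: "'a::euclidean_space \<Rightarrow> real"
  assumes f: "continuous_on UNIV f" and P: "P > 0"
  obtains m where "emeasure lborel (cball c P) \<le> 2 * emeasure lborel {x \<in> cball c P. f x \<le> m}"
    "emeasure lborel (cball c P) \<le> 2 * emeasure lborel {x \<in> cball c P. m \<le> f x}"
proof -
  define B where "B = cball c P"
  have [measurable]: "B \<in> sets borel" by (simp add: B_def)
  have [measurable]: "f \<in> borel_measurable borel" by (rule borel_measurable_continuous_onI[OF f])
  have fin: "emeasure lborel B < \<infinity>" unfolding B_def by (rule emeasure_lborel_cball_finite)
  have pos: "emeasure lborel B > 0" unfolding B_def using P by (subst emeasure_cball) auto
  have sub: "emeasure lborel {x \<in> B. Q x} < \<infinity>" for Q
    by (rule le_less_trans[OF _ fin]) (auto intro!: emeasure_mono)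
  have ne: "B \<noteq> {}" using P by (simp add: B_def)
  have cB: "compact (f ` B)" unfolding B_def
    by (rule compact_continuous_image) (auto intro: continuous_on_subset[OF f])
  then obtain u l where u: "\<And>x. x \<in> B \<Longrightarrow> f x \<le> u" and l: "\<And>x. x \<in> B \<Longrightarrow> l \<le> f x"
    using compact_imp_bounded[of "f ` B"] bounded_imp_bdd_above bounded_imp_bdd_below
    unfolding bdd_above_def bdd_below_def by (metis image_eqI)
  define S where "S = {t. emeasure lborel B \<le> 2 * emeasure lborel {x \<in> B. f x \<le> t}}"
  have uS: "u \<in> S"
  proof -
    have "{x \<in> B. f x \<le> u} = B" using u by auto
    then show ?thesis by (simp add: S_def mult_2)
  qed
  have lS: "l \<le> t" if "t \<in> S" for t
  proof (rule ccontr)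
    assume "\<not> l \<le> t"
    then have e: "{x \<in> B. f x \<le> t} = {}" using l by force
    show False using that pos unfolding S_def mem_Collect_eq e by simp
  qed
  define m where "m = Inf S"
  have bdd: "bdd_below S" using lS by (auto simp: bdd_below_def)
  have up: "t \<in> S" if "m < t" for t
  proof -
    have "\<exists>s\<in>S. s < t" by (rule cInf_lessD) (use that uS in \<open>auto simp: m_def\<close>)
    then obtain s where "s \<in> S" "s < t" by blast
    then have "emeasure lborel {x \<in> B. f x \<le> s} \<le> emeasure lborel {x \<in> B. f x \<le> t}"
      by (intro emeasure_mono) auto
    then have "2 * emeasure lborel {x \<in> B. f x \<le> s} \<le> 2 * emeasure lborel {x \<in> B. f x \<le> t}"
      by (rule mult_left_mono) simp
    then show ?thesis using \<open>s \<in> S\<close> unfolding S_def mem_Collect_eq by (rule order_trans[rotated])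
  qed
  have down: "t \<notin> S" if "t < m" for t
    using that cInf_lower[OF _ bdd, of t] by (auto simp: m_def)
  have "(\<lambda>i. emeasure lborel {x \<in> B. f x \<le> m + 1 / Suc i}) \<longlonglongrightarrow> emeasure lborel (\<Inter>i. {x \<in> B. f x \<le> m + 1 / Suc i})"
  proof (intro Lim_emeasure_decseq)
    show "decseq (\<lambda>i. {x \<in> B. f x \<le> m + 1 / Suc i})"
      by (intro decseq_SucI) (auto elim!: order_trans intro!: divide_left_mono)
    show "range (\<lambda>i. {x \<in> B. f x \<le> m + 1 / Suc i}) \<subseteq> sets lborel" by auto
    show "emeasure lborel {x \<in> B. f x \<le> m + 1 / Suc i} \<noteq> \<infinity>" for i using sub by (metis less_irrefl)
  qed
  also have "(\<Inter>i. {x \<in> B. f x \<le> m + 1 / Suc i}) = {x \<in> B. f x \<le> m}"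
  proof (intro antisym subsetI)
    fix x assume x: "x \<in> (\<Inter>i. {x \<in> B. f x \<le> m + 1 / Suc i})"
    have "f x \<le> m" 
    proof (rule field_le_epsilon)
      fix e :: real assume "e > 0"
      then obtain i where "1 / Suc i < e" using nat_approx_posE by blast
      then show "f x \<le> m + e" using x by (auto dest!: spec[of _ i])
    qed
    then show "x \<in> {x \<in> B. f x \<le> m}" using x by auto
  qed (auto intro: order_trans)
  finally have lim1: "(\<lambda>i. 2 * emeasure lborel {x \<in> B. f x \<le> m + 1 / Suc i}) \<longlonglongrightarrow> 2 * emeasure lborel {x \<in> B. f x \<le> m}"
    by (intro tendsto_mult_ennreal) auto
  have 1: "emeasure lborel B \<le> 2 * emeasure lborel {x \<in> B. f x \<le> m}"
    by (rule LIMSEQ_le_const[OF lim1]) (use up in \<open>auto simp: S_def\<close>)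
  \<comment> \<open>Below the infimum a sublevel set has less than half of the measure, so the
    complementary superlevel set has at least half.\<close>
  have half: "emeasure lborel B \<le> 2 * emeasure lborel {x \<in> B. f x \<ge> m - 1 / Suc i}" for i
  proof -
    let ?t = "m - 1 / Suc i"
    have a: "2 * emeasure lborel {x \<in> B. f x \<le> ?t} < emeasure lborel B" using down[of ?t] by (simp add: S_def)
    have "emeasure lborel B \<le> emeasure lborel ({x \<in> B. f x \<le> ?t} \<union> {x \<in> B. f x \<ge> ?t})" by (intro emeasure_mono) auto
    also have "\<dots> \<le> emeasure lborel {x \<in> B. f x \<le> ?t} + emeasure lborel {x \<in> B. f x \<ge> ?t}" by (intro emeasure_subadditive) auto
    finally have "2 * emeasure lborel B \<le> 2 * (emeasure lborel {x \<in> B. f x \<le> ?t} + emeasure lborel {x \<in> B. f x \<ge> ?t})"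
      by (rule mult_left_mono) simp
    then have "emeasure lborel B + emeasure lborel B \<le> 2 * emeasure lborel {x \<in> B. f x \<le> ?t} + 2 * emeasure lborel {x \<in> B. f x \<ge> ?t}"
      by (simp add: distrib_left mult_2)
    also have "\<dots> \<le> emeasure lborel B + 2 * emeasure lborel {x \<in> B. f x \<ge> ?t}"
      using a by (intro add_right_mono) simp
    finally show ?thesis using fin by (auto simp: ennreal_add_left_cancel_le)
  qed
  have "(\<lambda>i. emeasure lborel {x \<in> B. m - 1 / Suc i \<le> f x}) \<longlonglongrightarrow> emeasure lborel (\<Inter>i. {x \<in> B. m - 1 / Suc i \<le> f x})"
  proof (intro Lim_emeasure_decseq)
    show "decseq (\<lambda>i. {x \<in> B. m - 1 / Suc i \<le> f x})"
    proof (intro decseq_SucI subsetI)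
      fix i x assume x: "x \<in> {x \<in> B. m - 1 / Suc (Suc i) \<le> f x}"
      have "1 / real (Suc (Suc i)) \<le> 1 / Suc i" by (intro divide_left_mono) auto
      then show "x \<in> {x \<in> B. m - 1 / Suc i \<le> f x}" using x by auto
    qed
    show "range (\<lambda>i. {x \<in> B. m - 1 / Suc i \<le> f x}) \<subseteq> sets lborel" by auto
    show "emeasure lborel {x \<in> B. m - 1 / Suc i \<le> f x} \<noteq> \<infinity>" for i using sub by (metis less_irrefl)
  qed
  also have "(\<Inter>i. {x \<in> B. m - 1 / Suc i \<le> f x}) = {x \<in> B. m \<le> f x}"
  proof (intro antisym subsetI)
    fix x assume x: "x \<in> (\<Inter>i. {x \<in> B. m - 1 / Suc i \<le> f x})"
    have "m \<le> f x" 
    proof (rule field_le_epsilon)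
      fix e :: real assume "e > 0"
      then obtain i where "1 / Suc i < e" using nat_approx_posE by blast
      moreover have "m - 1 / Suc i \<le> f x" using x by blast
      ultimately show "m \<le> f x + e" by linarith
    qed
    then show "x \<in> {x \<in> B. m \<le> f x}" using x by auto
  next
    fix x assume x: "x \<in> {x \<in> B. m \<le> f x}"
    have "m - 1 / real (Suc i) \<le> f x" for i
      by (rule order_trans[of _ m]) (use x in auto)
    then show "x \<in> (\<Inter>i. {x \<in> B. m - 1 / Suc i \<le> f x})" using x by auto
  qed
  finally have lim2: "(\<lambda>i. 2 * emeasure lborel {x \<in> B. m - 1 / Suc i \<le> f x}) \<longlonglongrightarrow> 2 * emeasure lborel {x \<in> B. m \<le> f x}"
    by (intro tendsto_mult_ennreal) auto
  have 2: "emeasure lborel B \<le> 2 * emeasure lborel {x \<in> B. m \<le> f x}"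
    by (rule LIMSEQ_le_const[OF lim2]) (use half in auto)
  show ?thesis using that 1 2 unfolding B_def by blast
qed

text \<open>Vitali selection among all balls of radius \<open>r\<close>: comparing volumes of the
  disjoint balls counts the centres near a point, and the fivefold balls cover the space.\<close>

lemma net_exists:
  assumes r: "r > 0"
  obtains A :: "'a::euclidean_space set" where "countable A" "\<And>x. \<exists>c\<in>A. dist c x \<le> 5 * r"
    "\<And>z R. R \<ge> 0 \<Longrightarrow> finite {c \<in> A. dist c z \<le> R} \<and>
      real (card {c \<in> A. dist c z \<le> R}) * r ^ DIM('a) \<le> (R + r) ^ DIM('a)"
proof -
  have K: "0 < r \<and> r \<le> r" if "i \<in> UNIV" for i :: 'a using r by simp
  obtain A :: "'a set" where A: "countable A" "pairwise (\<lambda>i j. disjnt (cball i r) (cball j r)) A"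
     "\<And>i. i \<in> UNIV \<Longrightarrow> \<exists>j. j \<in> A \<and> \<not> disjnt (cball i r) (cball j r) \<and> cball i r \<subseteq> ball j (5 * r)"
    by (rule Vitali_covering_lemma_cballs_balls[where a="\<lambda>i. i" and r="\<lambda>_. r" and K=UNIV, OF K]) (assumption, blast)
  let ?V = "unit_ball_vol (real DIM('a))"
  have card_le: "real (card F) * r ^ DIM('a) \<le> (R + r) ^ DIM('a)"
    if F: "finite F" "F \<subseteq> {c \<in> A. dist c z \<le> R}" and R: "R \<ge> 0" for F z R
  proof -
    have "of_nat (card F) * ennreal (?V * r ^ DIM('a)) = (\<Sum>c\<in>F. emeasure lborel (cball c r))"
      using r by (simp add: emeasure_cball)
    also have "\<dots> = emeasure lborel (\<Union>c\<in>F. cball c r)"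
    proof (rule sum_emeasure)
      show "disjoint_family_on (\<lambda>c. cball c r) F"
        using F A(2) unfolding disjoint_family_on_def pairwise_def disjnt_def by blast
    qed (use F in auto)
    also have "\<dots> \<le> emeasure lborel (cball z (R + r))"
    proof (intro emeasure_mono UN_least subsetI)
      fix c y assume "c \<in> F" "y \<in> cball c r"
      then have "dist c z \<le> R" "dist c y \<le> r" using F by auto
      then show "y \<in> cball z (R + r)" using dist_triangle[of z y c] by (simp add: dist_commute)
    qed simp
    also have "\<dots> = ennreal (?V * (R + r) ^ DIM('a))" using r R by (intro emeasure_cball) simp
    finally have "real (card F) * (?V * r ^ DIM('a)) \<le> ?V * (R + r) ^ DIM('a)"
      using r R by (simp add: ennreal_of_nat_eq_real_of_nat ennreal_mult[symmetric])
    then show ?thesis by (simp add: mult.left_commute)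
  qed
  show ?thesis
  proof (rule that[OF A(1)])
    show "\<exists>c\<in>A. dist c x \<le> 5 * r" for x
    proof -
      obtain j where "j \<in> A" "cball x r \<subseteq> ball j (5 * r)" using A(3)[of x] by auto
      moreover have "x \<in> cball x r" using r by simp
      ultimately have "x \<in> ball j (5 * r)" by blast
      then show ?thesis using \<open>j \<in> A\<close> by (intro bexI[of _ j]) auto
    qed
    fix z :: 'a and R :: real assume R: "R \<ge> 0"
    have fin: "finite {c \<in> A. dist c z \<le> R}"
    proof (rule ccontr)
      assume inf: "infinite {c \<in> A. dist c z \<le> R}"
      obtain N :: nat where N: "(R + r) ^ DIM('a) / r ^ DIM('a) < real N" using reals_Archimedean2 by blast
      obtain F where F: "F \<subseteq> {c \<in> A. dist c z \<le> R}" "finite F" "card F = N"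
        using infinite_arbitrarily_large[OF inf, of N] by blast
      then have "real N * r ^ DIM('a) \<le> (R + r) ^ DIM('a)" using card_le[OF F(2,1) R] by simp
      then show False using N r by (simp add: field_simps)
    qed
    then show "finite {c \<in> A. dist c z \<le> R} \<and> real (card {c \<in> A. dist c z \<le> R}) * r ^ DIM('a) \<le> (R + r) ^ DIM('a)"
      using card_le[OF fin subset_refl R] by blast
  qed
qed

text \<open>Points with \<open>f\<close> above m + \<open>\<tau>\<close>/2 are compared with the
  half of the ball where \<open>f\<close> is at most \<open>m\<close>, and symmetrically below. The
  levels in between fill half of the band, an interval of length \<open>\<tau>\<close>/2; at most
  \<open>\<tau>\<close>/4 of them is lost to \<open>R\<close>, so \<open>\<tau>\<close>/4 remains in
  \<open>b\<close> for \<open>level_separation\<close>.\<close>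

lemma median_excess_le:
  fixes c :: "'a::euclidean_space"
  assumes fG: "upper_gradient f G" and [measurable]: "w \<in> borel_measurable borel" and P: "P > 0" and \<tau>: "\<tau> > 0"
    and [measurable]: "R \<in> sets borel" and R: "emeasure lborel R \<le> ennreal (\<tau> / 4)"
    and m: "emeasure lborel (cball c P) \<le> 2 * emeasure lborel {x \<in> cball c P. f x \<le> m}"
    "emeasure lborel (cball c P) \<le> 2 * emeasure lborel {x \<in> cball c P. m \<le> f x}"
    and b: "b = {m - \<tau> / 2 .. m + \<tau> / 2} - R"
  shows "(\<integral>\<^sup>+x\<in>{x \<in> cball c P. \<tau> / 2 < \<bar>f x - m\<bar>}. w x \<partial>lborel) \<le>
    ennreal (32 * 4 ^ DIM('a) * P / (\<tau> * unit_ball_vol DIM('a))) *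
    (\<integral>\<^sup>+z. indicator (cball c P) z * (indicator b (f z) * G z) * maximal w z \<partial>lborel)"
proof -
  let ?n = "DIM('a)" and ?B = "cball c P"
  define V where "V = unit_ball_vol (real ?n)"
  have V: "V > 0" by (simp add: V_def)
  note [measurable] = upper_gradientD(1,2)[OF fG]
  have [measurable]: "b \<in> sets borel" by (simp add: b)
  define I where "I = (\<integral>\<^sup>+z. indicator (cball c P) z * (indicator b (f z) * G z) * maximal w z \<partial>lborel)"
  define c0 where "c0 = 2 * P * (4 * P) ^ ?n"
  have c0: "c0 > 0" using P by (simp add: c0_def)
  have half: "ennreal (\<tau> / 4) \<le> emeasure lborel (b \<inter> {\<alpha>..\<alpha> + \<tau> / 2})" if "m - \<tau> / 2 \<le> \<alpha>" "\<alpha> \<le> m" for \<alpha>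
  proof -
    have "{\<alpha>..\<alpha> + \<tau> / 2} \<subseteq> (b \<inter> {\<alpha>..\<alpha> + \<tau> / 2}) \<union> R" using that by (auto simp: b)
    then have "emeasure lborel {\<alpha>..\<alpha> + \<tau> / 2} \<le> emeasure lborel ((b \<inter> {\<alpha>..\<alpha> + \<tau> / 2}) \<union> R)"
      by (rule emeasure_mono) simp
    also have "\<dots> \<le> emeasure lborel (b \<inter> {\<alpha>..\<alpha> + \<tau> / 2}) + emeasure lborel R"
      by (rule emeasure_subadditive) simp_all
    also have "\<dots> \<le> emeasure lborel (b \<inter> {\<alpha>..\<alpha> + \<tau> / 2}) + ennreal (\<tau> / 4)"
      by (intro add_left_mono R)
    finally have "ennreal (\<tau> / 4) + ennreal (\<tau> / 4) \<le> emeasure lborel (b \<inter> {\<alpha>..\<alpha> + \<tau> / 2}) + ennreal (\<tau> / 4)"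
      using \<tau> by (simp add: ennreal_plus[symmetric] del: ennreal_plus)
    then show ?thesis by (simp add: ennreal_add_left_cancel_le add.commute)
  qed
  have side: "ennreal (\<tau> / 4) * (\<integral>\<^sup>+x\<in>Y. w x \<partial>lborel) * emeasure lborel ?B \<le> 2 * (ennreal c0 * I)"
    if [measurable]: "Y \<in> sets borel" "Z \<in> sets borel" and A: "Y \<subseteq> ?B" "Z \<subseteq> ?B" 
      and sep: "\<And>x y. x \<in> Y \<Longrightarrow> y \<in> Z \<Longrightarrow> min (f x) (f y) \<le> \<alpha> \<and> \<alpha> + \<tau> / 2 \<le> max (f x) (f y)"
      and \<alpha>: "m - \<tau> / 2 \<le> \<alpha>" "\<alpha> \<le> m" and Z: "emeasure lborel ?B \<le> 2 * emeasure lborel Z" for Y Z \<alpha>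
  proof -
    have "ennreal (\<tau> / 4) * (\<integral>\<^sup>+x\<in>Y. w x \<partial>lborel) * emeasure lborel ?B \<le>
       ennreal (\<tau> / 4) * (\<integral>\<^sup>+x\<in>Y. w x \<partial>lborel) * (2 * emeasure lborel Z)"
      by (intro mult_left_mono Z) simp
    also have "\<dots> = 2 * (ennreal (\<tau> / 4) * (\<integral>\<^sup>+x\<in>Y. w x \<partial>lborel) * emeasure lborel Z)"
      by (simp add: mult_ac)
    also have "\<dots> \<le> 2 * (ennreal c0 * I)"
      unfolding c0_def I_def
      by (intro mult_left_mono level_separation[OF fG _ P _ _ _ A sep half]) (use \<alpha> in auto)
    finally show ?thesis .
  qed
  let ?U = "{x \<in> ?B. m + \<tau> / 2 < f x}" and ?L = "{x \<in> ?B. f x < m - \<tau> / 2}"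
  have U: "ennreal (\<tau> / 4) * (\<integral>\<^sup>+x\<in>?U. w x \<partial>lborel) * emeasure lborel ?B \<le> 2 * (ennreal c0 * I)"
    by (rule side[where Z="{x \<in> ?B. f x \<le> m}" and \<alpha>=m]) (use \<tau> m in auto)
  have L: "ennreal (\<tau> / 4) * (\<integral>\<^sup>+x\<in>?L. w x \<partial>lborel) * emeasure lborel ?B \<le> 2 * (ennreal c0 * I)"
    by (rule side[where Z="{x \<in> ?B. m \<le> f x}" and \<alpha>="m - \<tau> / 2"]) (use \<tau> m in auto)
  have "(\<integral>\<^sup>+x\<in>{x \<in> ?B. \<tau> / 2 < \<bar>f x - m\<bar>}. w x \<partial>lborel) \<le> (\<integral>\<^sup>+x. w x * indicator ?U x + w x * indicator ?L x \<partial>lborel)"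
    by (intro nn_integral_mono) (auto simp: indicator_def abs_if split: if_splits)
  also have "\<dots> = (\<integral>\<^sup>+x\<in>?U. w x \<partial>lborel) + (\<integral>\<^sup>+x\<in>?L. w x \<partial>lborel)"
    by (rule nn_integral_add) measurable
  finally have "ennreal (\<tau> / 4) * emeasure lborel ?B * (\<integral>\<^sup>+x\<in>{x \<in> ?B. \<tau> / 2 < \<bar>f x - m\<bar>}. w x \<partial>lborel) \<le>
      ennreal (\<tau> / 4) * emeasure lborel ?B * ((\<integral>\<^sup>+x\<in>?U. w x \<partial>lborel) + (\<integral>\<^sup>+x\<in>?L. w x \<partial>lborel))"
    by (rule mult_left_mono) simp
  also have "\<dots> \<le> 2 * (ennreal c0 * I) + 2 * (ennreal c0 * I)"
    using add_mono[OF U L] by (simp add: distrib_left mult_ac)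
  also have "\<dots> = ennreal (4 * c0) * I"
    using c0 by (simp add: ennreal_mult mult.assoc flip: distrib_right)
  also have "ennreal (\<tau> / 4) * emeasure lborel ?B = ennreal (\<tau> / 4 * (V * P ^ ?n))"
    using P \<tau> unfolding emeasure_cball[OF less_imp_le[OF P]] V_def by (subst ennreal_mult) auto
  finally have "ennreal (\<tau> / 4 * (V * P ^ ?n)) * (\<integral>\<^sup>+x\<in>{x \<in> ?B. \<tau> / 2 < \<bar>f x - m\<bar>}. w x \<partial>lborel) \<le> ennreal (4 * c0) * I" .
  then have "ennreal 1 * (\<integral>\<^sup>+x\<in>{x \<in> ?B. \<tau> / 2 < \<bar>f x - m\<bar>}. w x \<partial>lborel) \<le>
     ennreal (1 * (4 * c0) / (\<tau> / 4 * (V * P ^ ?n))) * I"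
    using P \<tau> V c0 by (intro ennreal_scale_le) auto
  also have "1 * (4 * c0) / (\<tau> / 4 * (V * P ^ ?n)) = 32 * 4 ^ ?n * P / (\<tau> * V)"
    using P by (simp add: c0_def power_mult_distrib)
  finally show ?thesis by (simp add: I_def V_def)
qed

text \<open>If two values differ by more than \<open>\<tau>\<close>, one of them is farther than
  \<open>\<tau>\<close>/2 from the median. If it is the value at \<open>x\<close>, then
  \<open>y\<close> is free and contributes the volume of the ball. If it is the value at
  \<open>y\<close>, the integral of \<open>w\<close> over the ball is at most (2 P)^n *
  \<open>maximal w y\<close>, and the excess estimate is used with the weight
  \<open>maximal w\<close>.\<close>

lemma ball_pairs_le:
  fixes c :: "'a::euclidean_space"
  assumes fG: "upper_gradient f G" and [measurable]: "w \<in> borel_measurable borel" and P: "P > 0" and \<tau>: "\<tau> > 0"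
    and R: "R \<in> sets borel" "emeasure lborel R \<le> ennreal (\<tau> / 4)"
    and m: "emeasure lborel (cball c P) \<le> 2 * emeasure lborel {x \<in> cball c P. f x \<le> m}"
    "emeasure lborel (cball c P) \<le> 2 * emeasure lborel {x \<in> cball c P. m \<le> f x}"
    and b: "b = {m - \<tau> / 2 .. m + \<tau> / 2} - R"
    and K: "K = (unit_ball_vol DIM('a) + 2 ^ DIM('a)) * (32 * 4 ^ DIM('a)) / unit_ball_vol DIM('a)"
  shows "(\<integral>\<^sup>+x. (\<integral>\<^sup>+y. w x * (indicator (cball c P) x * indicator (cball c P) y * indicator {p. \<tau> < \<bar>f (fst p) - f (snd p)\<bar>} (x, y)) \<partial>lborel) \<partial>lborel)
    \<le> ennreal (K * P ^ Suc DIM('a) / \<tau>) *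
    (\<integral>\<^sup>+z. indicator (cball c P) z * indicator b (f z) * (G z * maximal w z + G z * maximal (maximal w) z) \<partial>lborel)"
proof -
  let ?n = "DIM('a)" and ?B = "cball c P"
  define V where "V = unit_ball_vol (real ?n)"
  have V: "V > 0" by (simp add: V_def)
  note [measurable] = upper_gradientD(1,2)[OF fG] R(1)
  have [measurable]: "b \<in> sets borel" by (simp add: b)
  define I where "I u = (\<integral>\<^sup>+z. indicator ?B z * (indicator b (f z) * G z) * maximal u z \<partial>lborel)" for u
  define D where "D = {x \<in> ?B. \<tau> / 2 < \<bar>f x - m\<bar>}"
  have [measurable]: "D \<in> sets borel" by (simp add: D_def)
  define C where "C = 32 * 4 ^ ?n * P / (\<tau> * V)"
  have C: "C > 0" using P \<tau> V by (simp add: C_def)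
  have excess: "(\<integral>\<^sup>+x\<in>D. u x \<partial>lborel) \<le> ennreal C * I u" if "u \<in> borel_measurable borel" for u
    unfolding D_def C_def I_def V_def by (rule median_excess_le[OF fG that P \<tau> R m b])
  have "(\<integral>\<^sup>+x. (\<integral>\<^sup>+y. w x * (indicator ?B x * indicator ?B y * indicator {p. \<tau> < \<bar>f (fst p) - f (snd p)\<bar>} (x, y)) \<partial>lborel) \<partial>lborel)
    \<le> (\<integral>\<^sup>+x. (\<integral>\<^sup>+y. (w x * indicator D x) * indicator ?B y + (w x * indicator ?B x) * indicator D y \<partial>lborel) \<partial>lborel)"
  proof (intro nn_integral_mono)
    fix x y
    show "w x * (indicator ?B x * indicator ?B y * indicator {p. \<tau> < \<bar>f (fst p) - f (snd p)\<bar>} (x, y))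
      \<le> (w x * indicator D x) * indicator ?B y + (w x * indicator ?B x) * indicator D y"
    proof (cases "x \<in> ?B \<and> y \<in> ?B \<and> \<tau> < \<bar>f x - f y\<bar>")
      case True
      then have "x \<in> D \<or> y \<in> D" unfolding D_def mem_Collect_eq by linarith
      then show ?thesis using True by (auto simp: indicator_def)
    qed (auto simp: indicator_def)
  qed
  also have "\<dots> = (\<integral>\<^sup>+x. (w x * indicator D x) * emeasure lborel ?B + (w x * indicator ?B x) * emeasure lborel D \<partial>lborel)"
  proof (rule nn_integral_cong)
    fix x
    have "(\<integral>\<^sup>+y. (w x * indicator D x) * indicator ?B y + (w x * indicator ?B x) * indicator D y \<partial>lborel) =
       (\<integral>\<^sup>+y. (w x * indicator D x) * indicator ?B y \<partial>lborel) + (\<integral>\<^sup>+y. (w x * indicator ?B x) * indicator D y \<partial>lborel)"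
      by (rule nn_integral_add) measurable
    then show "(\<integral>\<^sup>+y. (w x * indicator D x) * indicator ?B y + (w x * indicator ?B x) * indicator D y \<partial>lborel) =
      (w x * indicator D x) * emeasure lborel ?B + (w x * indicator ?B x) * emeasure lborel D"
      by (subst (asm) (1 2) nn_integral_cmult_indicator) auto
  qed
  also have "\<dots> = (\<integral>\<^sup>+x\<in>D. w x \<partial>lborel) * emeasure lborel ?B + (\<integral>\<^sup>+x\<in>?B. w x \<partial>lborel) * emeasure lborel D"
    by (subst nn_integral_add) (auto simp: nn_integral_multc)
  also have "(\<integral>\<^sup>+x\<in>?B. w x \<partial>lborel) * emeasure lborel D = (\<integral>\<^sup>+y. (\<integral>\<^sup>+x\<in>?B. w x \<partial>lborel) * indicator D y \<partial>lborel)"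
    by (rule nn_integral_cmult_indicator[symmetric]) simp
  also have "\<dots> \<le> (\<integral>\<^sup>+y. ennreal ((2 * P) ^ ?n) * (maximal w y * indicator D y) \<partial>lborel)"
    using ball_le_maximal[OF P, of c _ w] by (intro nn_integral_mono) (auto simp: indicator_def D_def)
  also have "\<dots> = ennreal ((2 * P) ^ ?n) * (\<integral>\<^sup>+y\<in>D. maximal w y \<partial>lborel)"
    by (rule nn_integral_cmult) measurable
  also have "\<dots> \<le> ennreal ((2 * P) ^ ?n) * (ennreal C * I (maximal w))"
    by (intro mult_left_mono excess) auto
  also have "\<dots> = ennreal (2 ^ ?n * P ^ ?n * C) * I (maximal w)"
    using P C by (simp add: ennreal_mult[symmetric] mult.assoc[symmetric] power_mult_distrib)
  also have "\<dots> \<le> ennreal ((V + 2 ^ ?n) * P ^ ?n * C) * I (maximal w)"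
    using P C V by (intro mult_right_mono ennreal_leI) auto
  also have "(\<integral>\<^sup>+x\<in>D. w x \<partial>lborel) * emeasure lborel ?B \<le> ennreal C * I w * emeasure lborel ?B"
    by (intro mult_right_mono excess) auto
  also have "\<dots> = ennreal (V * P ^ ?n * C) * I w"
    using P C V by (simp add: emeasure_cball V_def[symmetric] ennreal_mult mult_ac)
  also have "\<dots> \<le> ennreal ((V + 2 ^ ?n) * P ^ ?n * C) * I w"
    using P C V by (intro mult_right_mono ennreal_leI) auto
  finally have "(\<integral>\<^sup>+x. (\<integral>\<^sup>+y. w x * (indicator ?B x * indicator ?B y * indicator {p. \<tau> < \<bar>f (fst p) - f (snd p)\<bar>} (x, y)) \<partial>lborel) \<partial>lborel)
    \<le> ennreal ((V + 2 ^ ?n) * P ^ ?n * C) * I w + ennreal ((V + 2 ^ ?n) * P ^ ?n * C) * I (maximal w)"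
    by (simp add: add_mono)
  also have "\<dots> = ennreal ((V + 2 ^ ?n) * P ^ ?n * C) * (I w + I (maximal w))"
    by (simp add: distrib_left)
  also have "I w + I (maximal w) = (\<integral>\<^sup>+z. indicator ?B z * indicator b (f z) * (G z * maximal w z + G z * maximal (maximal w) z) \<partial>lborel)"
    unfolding I_def by (subst nn_integral_add[symmetric]) (auto simp: distrib_left mult_ac)
  also have "(V + 2 ^ ?n) * P ^ ?n * C = K * P ^ Suc ?n / \<tau>"
    by (simp add: K C_def V_def mult_ac)
  finally show ?thesis .
qed

text \<open>At scale $\rho_k$ only those levels near the median are used that are not near the median of
  any neighbouring ball of a larger scale. As $\tau_k$ decreases geometrically this removes few
  levels, and every pair of a point and a level is charged at a single scale.\<close>

lemma weak_estimate_neg: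
  fixes \<gamma> :: real
  assumes \<gamma>: "\<gamma> < -1"
  obtains K where "K > 0"
    "\<And>f G w l. upper_gradient f G \<Longrightarrow> w \<in> borel_measurable borel \<Longrightarrow> l > 0 \<Longrightarrow>
      (\<integral>\<^sup>+x. (\<integral>\<^sup>+y. w x * (indicator {p. l * norm (fst p - snd p) powr (1 + \<gamma>) < \<bar>f (fst p) - f (snd p)\<bar>} (x, y) *
          ennreal (norm (x - y) powr (\<gamma> - DIM('a)))) \<partial>lborel) \<partial>lborel)
      \<le> ennreal (K / l) * ((\<integral>\<^sup>+z. G z * maximal w (z :: 'a::euclidean_space) \<partial>lborel) +
          (\<integral>\<^sup>+z. G z * maximal (maximal w) z \<partial>lborel))"
proof -
  define n where "n = DIM('a)"
  define K1 where "K1 = (unit_ball_vol n + 2 ^ n) * (32 * 4 ^ n) / unit_ball_vol n"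
  have K1: "K1 > 0" by (simp add: K1_def add_pos_pos)
  \<comment> \<open>A ball meets the bands of at most 21^n net balls at each larger scale, and the
    bands shrink by \<open>q\<close> per scale. With 21^n * q = 1/5 and q at most 1/5, the removed
    levels add up to at most (1/5) / (1 - q), that is 1/4, of the present band, as
    \<open>ball_pairs_le\<close> demands.\<close>
  define q :: real where "q = 1 / (5 * 21 ^ n)"
  have q: "0 < q" "q < 1" "q \<le> 1 / 5"
    by (auto simp: q_def divide_simps) (use one_le_power[of "21::real" n] in linarith)
  \<comment> \<open>Ratio of consecutive scales. As 1 + \<open>\<gamma>\<close> is negative,
    \<open>L\<close> exceeds 1 and the thresholds shrink by the factor \<open>q\<close> from each
    scale to the next larger one.\<close>
  define L where "L = q powr (1 / (1 + \<gamma>))"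
  have Lq: "L powr (1 + \<gamma>) = q" using \<gamma> q by (simp add: L_def powr_powr)
  have L: "L > 1"
  proof -
    have "ln q < 0" using q by simp
    then have "(1 / (1 + \<gamma>)) * ln q > 0" using \<gamma> by (intro mult_neg_neg) auto
    then show ?thesis using q by (simp add: L_def powr_def)
  qed
  define \<rho> where "\<rho> k = L powr real_of_int k" for k :: int
  have \<rho>: "\<rho> k > 0" for k using L by (simp add: \<rho>_def)
  have \<rho>_mono: "\<rho> k \<le> \<rho> k'" if "k \<le> k'" for k k' using L that by (simp add: \<rho>_def)
  have \<rho>q: "\<rho> (k + int i) powr (1 + \<gamma>) = \<rho> k powr (1 + \<gamma>) * q ^ i" for k i
  proof -
    have "\<rho> (k + int i) = \<rho> k * L ^ i" using L by (simp add: \<rho>_def powr_add powr_realpow)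
    then show ?thesis using L \<rho>[of k] by (simp add: powr_mult power_powr_commute Lq)
  qed
  \<comment> \<open>The nets come from \<open>net_exists\<close> with radius
    \<open>\<rho> k / 5\<close>, so their points are \<open>\<rho> k\<close>-dense, and (D + 1/5)
    divided by 1/5 gives the base 5 D + 1 of the counting bound.\<close>
  define net where "net k A \<longleftrightarrow> countable A \<and> (\<forall>x. \<exists>c\<in>A. dist c x \<le> \<rho> k) \<and>
    (\<forall>z D. D \<ge> 0 \<longrightarrow> finite {c \<in> A. dist c z \<le> D * \<rho> k} \<and> real (card {c \<in> A. dist c z \<le> D * \<rho> k}) \<le> (5 * D + 1) ^ n)"
    for k and A :: "'a set"
  have "\<exists>A. net k A" for k
  proof -
    have "\<rho> k / 5 > 0" using \<rho>[of k] by simp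
    then obtain A :: "'a set" where A: "countable A" "\<And>x. \<exists>c\<in>A. dist c x \<le> 5 * (\<rho> k / 5)" "\<And>z R. R \<ge> 0 \<Longrightarrow> finite {c \<in> A. dist c z \<le> R} \<and>
      real (card {c \<in> A. dist c z \<le> R}) * (\<rho> k / 5) ^ DIM('a) \<le> (R + \<rho> k / 5) ^ DIM('a)"
      by (rule net_exists) blast
    have "finite {c \<in> A. dist c z \<le> D * \<rho> k} \<and> real (card {c \<in> A. dist c z \<le> D * \<rho> k}) \<le> (5 * D + 1) ^ n" if "D \<ge> 0" for z D
    proof -
      have "D * \<rho> k + \<rho> k / 5 = (5 * D + 1) * (\<rho> k / 5)" by (simp add: field_simps)
      then have "(D * \<rho> k + \<rho> k / 5) ^ n = (5 * D + 1) ^ n * (\<rho> k / 5) ^ n" by (simp only: power_mult_distrib)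
      then have "finite {c \<in> A. dist c z \<le> D * \<rho> k} \<and>
        real (card {c \<in> A. dist c z \<le> D * \<rho> k}) * (\<rho> k / 5) ^ n \<le> (5 * D + 1) ^ n * (\<rho> k / 5) ^ n"
        using A(3)[of "D * \<rho> k" z] that \<rho>[of k] unfolding n_def by simp
      then show ?thesis using \<rho>[of k] by (simp add: mult_le_cancel_right)
    qed
    then show ?thesis using A(1,2) unfolding net_def by (intro exI[of _ A]) auto
  qed
  then obtain A where "\<And>k. net k (A k)" by metis
  then have A: "\<And>k. countable (A k)" "\<And>k x. \<exists>c\<in>A k. dist c x \<le> \<rho> k"
    "\<And>k z D. D \<ge> 0 \<Longrightarrow> finite {c \<in> A k. dist c z \<le> D * \<rho> k}"
    "\<And>k z D. D \<ge> 0 \<Longrightarrow> real (card {c \<in> A k. dist c z \<le> D * \<rho> k}) \<le> (5 * D + 1) ^ n"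
    by (simp_all add: net_def)
  define I where "I = (SIGMA k:(UNIV::int set). A k)"
  have I: "countable I" unfolding I_def by (intro countable_SIGMA A(1)) auto
  define K2 where "K2 = L powr (n - \<gamma>) * K1 * 2 ^ Suc n"
  have K2: "K2 > 0" using L K1 by (simp add: K2_def)
  show ?thesis
  proof (rule that[of "K2 * 11 ^ n"])
    show "K2 * 11 ^ n > 0" using K2 by simp
    fix f :: "'a \<Rightarrow> real" and G w :: "'a \<Rightarrow> ennreal" and l :: real
    assume fG: "upper_gradient f G" and [measurable]: "w \<in> borel_measurable borel" and l: "l > 0"
    note [measurable] = upper_gradientD(1,2)[OF fG]
    define \<tau> where "\<tau> k = l * \<rho> k powr (1 + \<gamma>)" for k
    have \<tau>: "\<tau> k > 0" for k using l \<rho>[of k] by (simp add: \<tau>_def)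
    have \<tau>q: "\<tau> (k + int i) = \<tau> k * q ^ i" for k i by (simp add: \<tau>_def \<rho>q)
    define med where "med k c m \<longleftrightarrow> emeasure lborel (cball c (2 * \<rho> k)) \<le> 2 * emeasure lborel {x \<in> cball c (2 * \<rho> k). f x \<le> m} \<and>
      emeasure lborel (cball c (2 * \<rho> k)) \<le> 2 * emeasure lborel {x \<in> cball c (2 * \<rho> k). m \<le> f x}" for k c m
    have med_ex: "\<exists>m. med k c m" for k c
    proof -
      have cont: "continuous_on UNIV f" using fG by (simp add: upper_gradient_def)
      have pos: "2 * \<rho> k > 0" using \<rho>[of k] by simp
      show ?thesis
      proof (rule median_exists[OF cont pos, of c])
        fix m
        assume "emeasure lborel (cball c (2 * \<rho> k)) \<le> 2 * emeasure lborel {x \<in> cball c (2 * \<rho> k). f x \<le> m}"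
          "emeasure lborel (cball c (2 * \<rho> k)) \<le> 2 * emeasure lborel {x \<in> cball c (2 * \<rho> k). m \<le> f x}"
        then show ?thesis unfolding med_def by (intro exI[of _ m] conjI)
      qed
    qed
    define m where "m k c = (SOME m. med k c m)" for k c
    have "med k c (m k c)" for k c unfolding m_def using med_ex by (rule someI_ex)
    note m = this[unfolded med_def, THEN conjunct1] this[unfolded med_def, THEN conjunct2]
    define band where "band k c = {m k c - \<tau> k / 2 .. m k c + \<tau> k / 2}" for k c
    \<comment> \<open>Balls of radius \<open>2 * \<rho>\<close> at two scales that share a point
      have centres at distance at most four times the larger \<open>\<rho>\<close>. This is the
      origin of 4 and thus of 21 = 5 * 4 + 1.\<close>
    define near where "near k c i = {c' \<in> A (k + int (Suc i)). dist c' c \<le> 4 * \<rho> (k + int (Suc i))}" for k c i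
    define Rm where "Rm k c = (\<Union>i. \<Union>c'\<in>near k c i. band (k + int (Suc i)) c')" for k c
    have finn: "finite (near k c i)" and cardn: "real (card (near k c i)) \<le> 21 ^ n" for k c i
      using A(3)[of 4 "k + int (Suc i)" c] A(4)[of 4 "k + int (Suc i)" c] unfolding near_def by auto
    have band_sets: "band k c \<in> sets borel" for k c by (simp add: band_def)
    have near_sets: "(\<Union>c'\<in>near k c i. band (k + int (Suc i)) c') \<in> sets borel" for k c i
      by (rule sets.finite_UN[OF finn band_sets])
    have Rm_sets [measurable]: "Rm k c \<in> sets borel" for k c
      unfolding Rm_def by (rule sets.countable_nat_UN) (use near_sets in blast)
    have Rm: "emeasure lborel (Rm k c) \<le> ennreal (\<tau> k / 4)" for k c
    proof -
      have "emeasure lborel (Rm k c) \<le> (\<Sum>i. emeasure lborel (\<Union>c'\<in>near k c i. band (k + int (Suc i)) c'))"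
        unfolding Rm_def by (rule emeasure_subadditive_countably) (use near_sets in auto)
      also have "\<dots> \<le> (\<Sum>i. ennreal (21 ^ n * \<tau> k * q * q ^ i))"
      proof (rule suminf_le)
        fix i
        have "emeasure lborel (\<Union>c'\<in>near k c i. band (k + int (Suc i)) c') \<le> (\<Sum>c'\<in>near k c i. emeasure lborel (band (k + int (Suc i)) c'))"
          by (rule emeasure_subadditive_finite[OF finn]) (use band_sets in auto)
        also have "\<dots> = (\<Sum>c'\<in>near k c i. ennreal (\<tau> (k + int (Suc i))))"
          using \<tau>[of "k + int (Suc i)"] unfolding band_def by (intro sum.cong) auto
        also have "\<dots> = ennreal (real (card (near k c i)) * \<tau> (k + int (Suc i)))"
          by (simp add: ennreal_of_nat_eq_real_of_nat ennreal_mult less_imp_le[OF \<tau>])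
        also have "\<dots> \<le> ennreal (21 ^ n * \<tau> (k + int (Suc i)))"
          by (intro ennreal_leI mult_right_mono cardn less_imp_le[OF \<tau>])
        also have "21 ^ n * \<tau> (k + int (Suc i)) = 21 ^ n * \<tau> k * q * q ^ i"
          unfolding \<tau>q by simp
        finally show "emeasure lborel (\<Union>c'\<in>near k c i. band (k + int (Suc i)) c') \<le> ennreal (21 ^ n * \<tau> k * q * q ^ i)" .
      qed auto
      also have "\<dots> = ennreal (21 ^ n * \<tau> k * q * (1 / (1 - q)))"
      proof -
        have "(\<lambda>i. 21 ^ n * \<tau> k * q * q ^ i) sums (21 ^ n * \<tau> k * q * (1 / (1 - q)))"
          using q by (intro sums_mult geometric_sums) auto
        then show ?thesis using q \<tau>[of k] by (intro suminf_ennreal_eq) auto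
      qed
      also have "\<dots> \<le> ennreal (\<tau> k / 4)"
      proof (rule ennreal_leI)
        have q5: "21 ^ n * q = 1 / 5" by (simp add: q_def)
        have "21 ^ n * \<tau> k * q * (1 / (1 - q)) = \<tau> k * ((21 ^ n * q) / (1 - q))" by simp
        also have "\<dots> = \<tau> k * ((1 / 5) / (1 - q))" unfolding q5 ..
        also have "\<dots> \<le> \<tau> k * (1 / 4)"
          using q \<tau>[of k] by (intro mult_left_mono) (auto simp: field_simps)
        finally show "21 ^ n * \<tau> k * q * (1 / (1 - q)) \<le> \<tau> k / 4" by simp
      qed
      finally show ?thesis .
    qed
    define b where "b k c = band k c - Rm k c" for k c
    have [measurable]: "b k c \<in> sets borel" for k c unfolding b_def band_def by measurable
    \<comment> \<open>Within one scale, at most 11^n net points lie at distance at most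
      \<open>2 * \<rho>\<close> from \<open>z\<close>, where 11 = 5 * 2 + 1. Different scales
      exclude each other: the band of the larger one has been removed from the levels of the smaller
      one.\<close>
    have count: "emeasure (count_space I) {i \<in> I. z \<in> cball (snd i) (2 * \<rho> (fst i)) \<and> t \<in> b (fst i) (snd i)} \<le> ennreal (11 ^ n)"
      (is "emeasure _ ?Z \<le> _") for z t
    proof (cases "?Z = {}")
      case False
      then obtain i0 where i0: "i0 \<in> ?Z" by blast
      have less: False if kc: "(k, c) \<in> ?Z" "(k', c') \<in> ?Z" and kk: "k < k'" for k c k' c'
      proof -
        define i where "i = nat (k' - k - 1)"
        have k': "k' = k + int (Suc i)" using kk by (simp add: i_def)
        have "dist c' c \<le> 2 * \<rho> k' + 2 * \<rho> k" using kc dist_triangle[of c' c z] by (auto simp: dist_commute)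
        also have "\<dots> \<le> 4 * \<rho> k'" using \<rho>_mono[of k k'] kk by simp
        finally have "c' \<in> near k c i" using kc unfolding near_def k'[symmetric] by (auto simp: I_def)
        moreover have "t \<in> band k' c'" using kc by (simp add: b_def)
        ultimately have "t \<in> Rm k c" unfolding Rm_def k' by blast
        then show False using kc by (simp add: b_def)
      qed
      have same: "fst i = fst i0" if "i \<in> ?Z" for i
        using less[of "fst i" "snd i" "fst i0" "snd i0"] less[of "fst i0" "snd i0" "fst i" "snd i"] i0 that
        by (cases "fst i" "fst i0" rule: linorder_cases) auto
      let ?S = "{c \<in> A (fst i0). dist c z \<le> 2 * \<rho> (fst i0)}"
      have "?Z \<subseteq> Pair (fst i0) ` ?S"
      proof
        fix i assume i: "i \<in> ?Z"
        then have "i = (fst i0, snd i)" using same[OF i] by (metis prod.collapse)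
        moreover have "snd i \<in> ?S" using i same[OF i] by (auto simp: I_def)
        ultimately show "i \<in> Pair (fst i0) ` ?S" by blast
      qed
      moreover have finS: "finite ?S" by (rule A(3)) simp
      ultimately have finZ: "finite ?Z" and "card ?Z \<le> card ?S"
        using finite_surj[of ?S ?Z "Pair (fst i0)"] surj_card_le[of ?S ?Z "Pair (fst i0)"] by auto
      then have "real (card ?Z) \<le> 11 ^ n" using A(4)[of 2 "fst i0" z] by simp
      moreover have "emeasure (count_space I) ?Z = of_nat (card ?Z)" using finZ by (subst emeasure_count_space_finite) auto
      ultimately show ?thesis by (simp add: ennreal_of_nat_eq_real_of_nat)
    next
      case True
      show ?thesis unfolding True by simp
    qed
    define ker where "ker p = ennreal (norm p powr (\<gamma> - n))" for p :: 'a
    define E where "E = {p. l * norm (fst p - snd p) powr (1 + \<gamma>) < \<bar>f (fst p) - f (snd p)\<bar>}"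
    define Q where "Q z = G z * maximal w z + G z * maximal (maximal w) z" for z
    have [measurable]: "Q \<in> borel_measurable borel" unfolding Q_def by measurable
    define B where "B i = cball (snd i) (2 * \<rho> (fst i))" for i :: "int \<times> 'a"
    have [measurable]: "B i \<in> sets borel" for i by (simp add: B_def)
    \<comment> \<open>The exponent \<open>\<gamma> - n\<close> is negative, so on pairs farther
      apart than \<open>\<rho> (k - 1)\<close> the kernel is bounded by its value at that inner
      radius. The loss compared with \<open>\<rho> k\<close> is the factor
      \<open>L powr (n - \<gamma>)\<close> in \<open>K2\<close>.\<close>
    define Ck where "Ck k = \<rho> (k - 1) powr (\<gamma> - n)" for k
    define F where "F i x y = ennreal (Ck (fst i)) * (w x * (indicator (B i) x * indicator (B i) y *
      indicator {p. \<tau> (fst i) < \<bar>f (fst p) - f (snd p)\<bar>} (x, y)))" for i :: "int \<times> 'a" and x y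
    have ind [measurable]: "(\<lambda>p. indicator {p. \<tau> k < \<bar>f (fst p) - f (snd p)\<bar>} p :: ennreal) \<in> borel_measurable (borel \<Otimes>\<^sub>M borel)" for k
      by measurable
    have F [measurable]: "(\<lambda>p. F i (fst p) (snd p)) \<in> borel_measurable (borel \<Otimes>\<^sub>M borel)" for i
      unfolding F_def by measurable
    have "(\<integral>\<^sup>+x. (\<integral>\<^sup>+y. w x * (indicator E (x, y) * ker (x - y)) \<partial>lborel) \<partial>lborel) \<le>
        (\<integral>\<^sup>+x. (\<integral>\<^sup>+y. (\<integral>\<^sup>+i. F i (fst (x, y)) (snd (x, y)) \<partial>count_space I) \<partial>lborel) \<partial>lborel)"
    proof (intro nn_integral_mono)
      fix x y
      show "w x * (indicator E (x, y) * ker (x - y)) \<le> (\<integral>\<^sup>+i. F i (fst (x, y)) (snd (x, y)) \<partial>count_space I)"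
      proof (cases "(x, y) \<in> E")
        case True
        define u where "u = norm (x - y)"
        have u: "u > 0" using True by (auto simp: u_def E_def)
        \<comment> \<open>The scale with \<open>\<rho> (k - 1)\<close> < u and u at most
          \<open>\<rho> k\<close>. A net point within \<open>\<rho> k\<close> of \<open>x\<close>
          then has both points in its ball of radius \<open>2 * \<rho> k\<close>.\<close>
        define k where "k = \<lceil>log L u\<rceil>"
        have k: "log L u \<le> real_of_int k" "real_of_int (k - 1) < log L u" by (auto simp: k_def) linarith
        have u1: "u \<le> \<rho> k" using k(1) u L by (simp add: \<rho>_def log_le_iff)
        have u2: "\<rho> (k - 1) < u" using k(2) u L by (simp add: \<rho>_def less_log_iff)
        obtain c where c: "c \<in> A k" "dist c x \<le> \<rho> k" using A(2) by blast
        have "dist c y \<le> 2 * \<rho> k" using dist_triangle[of c y x] c(2) u1 by (simp add: u_def dist_norm)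
        then have yB: "y \<in> B (k, c)" by (simp add: B_def)
        have xB: "x \<in> B (k, c)" using c(2) \<rho>[of k] by (simp add: B_def)
        \<comment> \<open>As 1 + \<open>\<gamma>\<close> is negative, the threshold at the outer
          radius \<open>\<rho> k\<close> is the smaller one, so the difference of a bad pair exceeds
          it.\<close>
        have "\<tau> k \<le> l * u powr (1 + \<gamma>)" unfolding \<tau>_def using l u u1 \<gamma> by (intro mult_left_mono powr_mono2') auto
        then have big: "\<tau> k < \<bar>f x - f y\<bar>" using True by (simp add: E_def u_def)
        have "u powr (\<gamma> - n) \<le> Ck k" unfolding Ck_def using u2 \<gamma> \<rho>[of "k - 1"] by (intro powr_mono2') auto
        then have "w x * ker (x - y) \<le> w x * ennreal (Ck k)"
          unfolding ker_def u_def by (intro mult_left_mono ennreal_leI) auto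
        also have "\<dots> = F (k, c) x y" using xB yB big by (simp add: F_def mult.commute)
        also have "\<dots> \<le> (\<integral>\<^sup>+i. F i x y \<partial>count_space I)"
          by (rule nn_integral_ge_point) (use c in \<open>simp add: I_def\<close>)
        finally show ?thesis using True by simp
      qed auto
    qed
    also have "\<dots> = (\<integral>\<^sup>+x. (\<integral>\<^sup>+i. (\<integral>\<^sup>+y. F i (fst (x, y)) (snd (x, y)) \<partial>lborel) \<partial>count_space I) \<partial>lborel)"
      by (intro nn_integral_cong tonelli_countable I) measurable
    also have "\<dots> = (\<integral>\<^sup>+i. (\<integral>\<^sup>+x. (\<integral>\<^sup>+y. F i (fst (x, y)) (snd (x, y)) \<partial>lborel) \<partial>lborel) \<partial>count_space I)"
      by (intro tonelli_countable I) measurable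
    also have "\<dots> \<le> (\<integral>\<^sup>+i. ennreal (K2 / l) * (\<integral>\<^sup>+z. indicator (B i) z * indicator (b (fst i) (snd i)) (f z) * Q z \<partial>lborel) \<partial>count_space I)"
    proof (rule nn_integral_mono)
      fix i :: "int \<times> 'a"
      obtain k c where i: "i = (k, c)" by (cases i)
      have Ck: "Ck k \<ge> 0" by (simp add: Ck_def)
      have "(\<integral>\<^sup>+x. (\<integral>\<^sup>+y. F i (fst (x, y)) (snd (x, y)) \<partial>lborel) \<partial>lborel) =
        ennreal (Ck k) * (\<integral>\<^sup>+x. (\<integral>\<^sup>+y. w x * (indicator (cball c (2 * \<rho> k)) x * indicator (cball c (2 * \<rho> k)) y *
      indicator {p. \<tau> k < \<bar>f (fst p) - f (snd p)\<bar>} (x, y)) \<partial>lborel) \<partial>lborel)"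
        unfolding F_def B_def i fst_conv snd_conv
        by (subst nn_integral_cmult[symmetric], measurable)
          (intro nn_integral_cong, subst nn_integral_cmult[symmetric], measurable)
      also have "\<dots> \<le> ennreal (Ck k) * (ennreal (K1 * (2 * \<rho> k) ^ Suc DIM('a) / \<tau> k) *
        (\<integral>\<^sup>+z. indicator (cball c (2 * \<rho> k)) z * indicator (b k c) (f z) * Q z \<partial>lborel))"
        unfolding Q_def
      proof (intro mult_left_mono ball_pairs_le[OF fG _ _ \<tau> Rm_sets Rm m])
        show "0 < 2 * \<rho> k" using \<rho>[of k] by simp
        show "b k c = {m k c - \<tau> k / 2..m k c + \<tau> k / 2} - Rm k c" by (simp add: b_def band_def)
        show "K1 = (unit_ball_vol DIM('a) + 2 ^ DIM('a)) * (32 * 4 ^ DIM('a)) / unit_ball_vol DIM('a)"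
          by (simp add: K1_def n_def)
      qed auto
      also have "\<dots> = ennreal (Ck k * (K1 * (2 * \<rho> k) ^ Suc n / \<tau> k)) *
        (\<integral>\<^sup>+z. indicator (cball c (2 * \<rho> k)) z * indicator (b k c) (f z) * Q z \<partial>lborel)"
        using Ck K1 \<rho>[of k] \<tau>[of k] unfolding n_def mult.assoc[symmetric] by (subst ennreal_mult) auto
      also have "Ck k * (K1 * (2 * \<rho> k) ^ Suc n / \<tau> k) = K2 / l"
      proof -
        have "Ck k = \<rho> k powr (\<gamma> - n) * L powr (n - \<gamma>)"
          using L by (simp add: Ck_def \<rho>_def powr_powr flip: powr_add) (simp add: algebra_simps)
        moreover have "(2 * \<rho> k) ^ Suc n = 2 ^ Suc n * \<rho> k powr (n + 1)"
          using \<rho>[of k] powr_realpow[OF \<rho>[of k], of "Suc n"] by (simp add: power_mult_distrib add.commute)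
        moreover have "\<rho> k powr (\<gamma> - n) * \<rho> k powr (n + 1) = \<rho> k powr (1 + \<gamma>)"
          by (simp add: add.commute flip: powr_add)
        ultimately have "Ck k * (K1 * (2 * \<rho> k) ^ Suc n) = K2 * \<rho> k powr (1 + \<gamma>)"
          unfolding K2_def by (metis (no_types, opaque_lifting) mult.assoc mult.commute mult.left_commute)
        then have "Ck k * (K1 * (2 * \<rho> k) ^ Suc n / \<tau> k) = K2 * \<rho> k powr (1 + \<gamma>) / \<tau> k" by simp
        then show ?thesis using \<rho>[of k] by (simp add: \<tau>_def)
      qed
      finally show "(\<integral>\<^sup>+x. (\<integral>\<^sup>+y. F i (fst (x, y)) (snd (x, y)) \<partial>lborel) \<partial>lborel) \<le>
        ennreal (K2 / l) * (\<integral>\<^sup>+z. indicator (B i) z * indicator (b (fst i) (snd i)) (f z) * Q z \<partial>lborel)"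
        by (simp add: B_def i)
    qed
    also have "\<dots> = ennreal (K2 / l) * (\<integral>\<^sup>+i. (\<integral>\<^sup>+z. indicator (B i) z * indicator (b (fst i) (snd i)) (f z) * Q z \<partial>lborel) \<partial>count_space I)"
      by (rule nn_integral_cmult) simp
    also have "(\<integral>\<^sup>+i. (\<integral>\<^sup>+z. indicator (B i) z * indicator (b (fst i) (snd i)) (f z) * Q z \<partial>lborel) \<partial>count_space I) =
      (\<integral>\<^sup>+z. (\<integral>\<^sup>+i. indicator (B i) z * indicator (b (fst i) (snd i)) (f z) * Q z \<partial>count_space I) \<partial>lborel)"
      by (intro tonelli_countable[symmetric] I) measurable
    also have "\<dots> \<le> (\<integral>\<^sup>+z. ennreal (11 ^ n) * Q z \<partial>lborel)"
    proof (rule nn_integral_mono)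
      fix z
      have "(\<integral>\<^sup>+i. indicator (B i) z * indicator (b (fst i) (snd i)) (f z) * Q z \<partial>count_space I) =
        (\<integral>\<^sup>+i. indicator {i \<in> I. z \<in> cball (snd i) (2 * \<rho> (fst i)) \<and> f z \<in> b (fst i) (snd i)} i * Q z \<partial>count_space I)"
        by (intro nn_integral_cong) (auto simp: indicator_def B_def)
      also have "\<dots> = emeasure (count_space I) {i \<in> I. z \<in> cball (snd i) (2 * \<rho> (fst i)) \<and> f z \<in> b (fst i) (snd i)} * Q z"
        by (subst nn_integral_multc) (auto simp del: emeasure_count_space)
      also have "\<dots> \<le> ennreal (11 ^ n) * Q z" by (intro mult_right_mono count) simp
      finally show "(\<integral>\<^sup>+i. indicator (B i) z * indicator (b (fst i) (snd i)) (f z) * Q z \<partial>count_space I) \<le> ennreal (11 ^ n) * Q z" .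
    qed
    also have "\<dots> = ennreal (11 ^ n) * (\<integral>\<^sup>+z. Q z \<partial>lborel)" by (rule nn_integral_cmult) measurable
    also have "(\<integral>\<^sup>+z. Q z \<partial>lborel) = (\<integral>\<^sup>+z. G z * maximal w z \<partial>lborel) + (\<integral>\<^sup>+z. G z * maximal (maximal w) z \<partial>lborel)"
      unfolding Q_def by (rule nn_integral_add) measurable
    finally have "(\<integral>\<^sup>+x. (\<integral>\<^sup>+y. w x * (indicator E (x, y) * ker (x - y)) \<partial>lborel) \<partial>lborel) \<le>
      ennreal (K2 / l) * (ennreal (11 ^ n) * ((\<integral>\<^sup>+z. G z * maximal w z \<partial>lborel) + (\<integral>\<^sup>+z. G z * maximal (maximal w) z \<partial>lborel)))"
      by (simp add: mult_left_mono)
    also have "\<dots> = ennreal (K2 * 11 ^ n / l) * ((\<integral>\<^sup>+z. G z * maximal w z \<partial>lborel) + (\<integral>\<^sup>+z. G z * maximal (maximal w) z \<partial>lborel))"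
      using K2 l by (simp add: mult.assoc[symmetric] ennreal_mult[symmetric])
    finally show "(\<integral>\<^sup>+x. (\<integral>\<^sup>+y. w x * (indicator {p. l * norm (fst p - snd p) powr (1 + \<gamma>) < \<bar>f (fst p) - f (snd p)\<bar>} (x, y) *
          ennreal (norm (x - y) powr (\<gamma> - DIM('a)))) \<partial>lborel) \<partial>lborel)
      \<le> ennreal (K2 * 11 ^ n / l) * ((\<integral>\<^sup>+z. G z * maximal w z \<partial>lborel) + (\<integral>\<^sup>+z. G z * maximal (maximal w) z \<partial>lborel))"
      by (simp add: E_def ker_def n_def)
  qed
qed

section \<open>Level sets along lines\<close>

text \<open>A smooth minimum and its derivative, regularised by d^4 and shifted by d, where d = 1 /
  (k + 1). The shift dominates the root d^2 of the regularisation, so at s = a the derivatives tend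
  to 0 instead of 1/2. Convergence to the indicator of the open half-line thus holds at every point,
  and no null set of times has to be excluded when \<open>s\<close> is replaced by a
  function.\<close>

lemma tendsto_smooth_min:
  fixes s a :: real
  shows "(\<lambda>k. (s + a - sqrt ((s - a + 1 / real (Suc k))\<^sup>2 + (1 / real (Suc k)) ^ 4)) / 2) \<longlonglongrightarrow> min s a"
    and "(\<lambda>k. (1 - (s - a + 1 / real (Suc k)) / sqrt ((s - a + 1 / real (Suc k))\<^sup>2 + (1 / real (Suc k)) ^ 4)) / 2)
      \<longlonglongrightarrow> indicator {..<a} s"
proof -
  have \<delta>: "(\<lambda>k. 1 / real (Suc k)) \<longlonglongrightarrow> 0" by (rule LIMSEQ_Suc[OF lim_const_over_n])
  have "(\<lambda>k. (s + a - sqrt ((s - a + 1 / real (Suc k))\<^sup>2 + (1 / real (Suc k)) ^ 4)) / 2)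
      \<longlonglongrightarrow> (s + a - sqrt ((s - a + 0)\<^sup>2 + 0 ^ 4)) / 2"
    by (intro tendsto_intros \<delta>) auto
  also have "(s + a - sqrt ((s - a + 0)\<^sup>2 + 0 ^ 4)) / 2 = min s a" by (simp add: min_def abs_if)
  finally show "(\<lambda>k. (s + a - sqrt ((s - a + 1 / real (Suc k))\<^sup>2 + (1 / real (Suc k)) ^ 4)) / 2) \<longlonglongrightarrow> min s a" .
  show "(\<lambda>k. (1 - (s - a + 1 / real (Suc k)) / sqrt ((s - a + 1 / real (Suc k))\<^sup>2 + (1 / real (Suc k)) ^ 4)) / 2)
      \<longlonglongrightarrow> indicator {..<a} s"
  proof (cases "s = a")
    case False
    have "(\<lambda>k. (1 - (s - a + 1 / real (Suc k)) / sqrt ((s - a + 1 / real (Suc k))\<^sup>2 + (1 / real (Suc k)) ^ 4)) / 2)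
      \<longlonglongrightarrow> (1 - (s - a + 0) / sqrt ((s - a + 0)\<^sup>2 + 0 ^ 4)) / 2"
      using False by (intro tendsto_intros \<delta>) auto
    also have "(1 - (s - a + 0) / sqrt ((s - a + 0)\<^sup>2 + 0 ^ 4)) / 2 = indicator {..<a} s"
      using False by (auto simp: indicator_def abs_if field_simps)
    finally show ?thesis .
  next
    case True
    have eq: "(1 - d / sqrt (d\<^sup>2 + d ^ 4)) / 2 = (1 - 1 / sqrt (1 + d\<^sup>2)) / 2" if "d > 0" for d :: real
    proof -
      have "d\<^sup>2 + d ^ 4 = d\<^sup>2 * (1 + d\<^sup>2)" by (simp add: algebra_simps power2_eq_square power4_eq_xxxx)
      then have "sqrt (d\<^sup>2 + d ^ 4) = d * sqrt (1 + d\<^sup>2)" using that by (simp add: real_sqrt_mult)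
      then show ?thesis using that by simp
    qed
    have eq': "(1 - 1 / real (Suc k) / sqrt ((1 / real (Suc k))\<^sup>2 + (1 / real (Suc k)) ^ 4)) / 2 =
        (1 - 1 / sqrt (1 + (1 / real (Suc k))\<^sup>2)) / 2" for k
      by (rule eq) simp
    have "(\<lambda>k. (1 - 1 / sqrt (1 + (1 / real (Suc k))\<^sup>2)) / 2) \<longlonglongrightarrow> (1 - 1 / sqrt (1 + 0\<^sup>2)) / 2"
      by (intro tendsto_intros \<delta>) auto
    then show ?thesis unfolding True diff_self add_0_left eq' by simp
  qed
qed

text \<open>The fundamental theorem of calculus for the truncation of \<open>g\<close> at
  \<open>a\<close>: it holds for the smooth minima, whose derivatives are bounded by 1, and passes
  to the limit by dominated convergence.\<close>

lemma integral_below_level: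
  fixes g g' :: "real \<Rightarrow> real"
  assumes d: "\<And>t. (g has_real_derivative g' t) (at t)" and c: "continuous_on UNIV g'"
  shows "(LINT t|lborel. indicator {0..1} t * (indicator {..<a} (g t) * g' t)) = min (g 1) a - min (g 0) a"
proof -
  define \<delta> where "\<delta> k = 1 / real (Suc k)" for k
  define \<Psi> where "\<Psi> k s = (s + a - sqrt ((s - a + \<delta> k)\<^sup>2 + \<delta> k ^ 4)) / 2" for k s
  define \<psi> where "\<psi> k s = (1 - (s - a + \<delta> k) / sqrt ((s - a + \<delta> k)\<^sup>2 + \<delta> k ^ 4)) / 2" for k s
  have pos: "(s - a + \<delta> k)\<^sup>2 + \<delta> k ^ 4 > 0" for s k
    by (intro add_nonneg_pos) (simp_all add: \<delta>_def)
  have gc: "continuous_on UNIV g"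
    using d by (intro continuous_at_imp_continuous_on) (auto intro: DERIV_isCont)
  have [measurable]: "g \<in> borel_measurable borel" "g' \<in> borel_measurable borel"
    using gc c by (auto intro: borel_measurable_continuous_onI)
  have \<psi>c: "continuous_on UNIV (\<psi> k)" for k
    unfolding \<psi>_def by (intro continuous_intros) (auto simp: less_imp_neq[OF pos, symmetric])
  have [measurable]: "\<psi> k \<in> borel_measurable borel" for k
    by (rule borel_measurable_continuous_onI[OF \<psi>c])
  have \<psi>b: "\<bar>\<psi> k s\<bar> \<le> 1" for k s
  proof -
    have "\<bar>s - a + \<delta> k\<bar> = sqrt ((s - a + \<delta> k)\<^sup>2)" by simp
    also have "\<dots> \<le> sqrt ((s - a + \<delta> k)\<^sup>2 + \<delta> k ^ 4)" by (intro real_sqrt_le_mono) (simp add: \<delta>_def)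
    finally have "\<bar>(s - a + \<delta> k) / sqrt ((s - a + \<delta> k)\<^sup>2 + \<delta> k ^ 4)\<bar> \<le> 1"
      using pos[of s k] by (simp add: abs_divide divide_le_eq)
    moreover have "\<bar>(1 - X) / 2\<bar> \<le> 1" if "\<bar>X\<bar> \<le> 1" for X :: real
      using that by (auto simp: abs_le_iff)
    ultimately show ?thesis unfolding \<psi>_def by blast
  qed
  have d\<Psi>: "((\<lambda>t. \<Psi> k (g t)) has_real_derivative \<psi> k (g t) * g' t) (at t)" for k t
  proof -
    have "(\<Psi> k has_real_derivative \<psi> k s) (at s)" for s
      unfolding \<Psi>_def \<psi>_def using pos[of s k]
      by (auto intro!: derivative_eq_intros simp: field_simps)
    then show ?thesis by (rule DERIV_chain2[OF _ d])
  qed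
  have "(LINT t|lborel. indicator {0..1} t * (\<psi> k (g t) * g' t)) = \<Psi> k (g 1) - \<Psi> k (g 0)" for k
  proof -
    have "(LBINT t. (\<psi> k (g t) * g' t) * indicator {0..1} t) = \<Psi> k (g 1) - \<Psi> k (g 0)"
    proof (rule integral_FTC_Icc_real)
      fix t :: real
      show "((\<lambda>t. \<Psi> k (g t)) has_real_derivative \<psi> k (g t) * g' t) (at t)" by (rule d\<Psi>)
      show "isCont (\<lambda>t. \<psi> k (g t) * g' t) t"
        using \<psi>c gc c by (intro continuous_intros isCont_o2[of _ g "\<psi> k"]) (auto simp: continuous_on_eq_continuous_at)
    qed simp
    then show ?thesis by (simp add: mult.commute)
  qed
  moreover have "(\<lambda>k. LINT t|lborel. indicator {0..1} t * (\<psi> k (g t) * g' t)) \<longlonglongrightarrow>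
      (LINT t|lborel. indicator {0..1} t * (indicator {..<a} (g t) * g' t))"
  proof (rule integral_dominated_convergence[where w="\<lambda>t. indicator {0..1} t * \<bar>g' t\<bar>"])
    have "set_integrable lborel {0..1} (\<lambda>t. \<bar>g' t\<bar>)"
      by (rule borel_integrable_atLeastAtMost') (intro continuous_intros continuous_on_subset[OF c], simp)
    then show "integrable lborel (\<lambda>t. indicator {0..1} t * \<bar>g' t\<bar>)" by (simp add: set_integrable_def)
    show "AE t in lborel. (\<lambda>k. indicator {0..1} t * (\<psi> k (g t) * g' t)) \<longlonglongrightarrow> indicator {0..1} t * (indicator {..<a} (g t) * g' t)"
      unfolding \<psi>_def \<delta>_def by (intro always_eventually allI tendsto_mult tendsto_smooth_min tendsto_const)
    show "AE t in lborel. norm (indicator {0..1} t * (\<psi> k (g t) * g' t)) \<le> indicator {0..1} t * \<bar>g' t\<bar>" for k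
      using mult_right_mono[OF \<psi>b, of "\<bar>g' _\<bar>"]
      by (intro always_eventually allI) (auto simp: indicator_def abs_mult)
  qed measurable
  moreover have "(\<lambda>k. \<Psi> k (g 1) - \<Psi> k (g 0)) \<longlonglongrightarrow> min (g 1) a - min (g 0) a"
    unfolding \<Psi>_def \<delta>_def by (intro tendsto_diff tendsto_smooth_min)
  ultimately show ?thesis by (auto intro: LIMSEQ_unique)
qed

text \<open>The signed version of the area formula is an identity between (differences of) measures in the
  set of levels, so that it suffices to check it on half-lines.\<close>

lemma level_set_measure_le:
  fixes g g' :: "real \<Rightarrow> real"
  assumes d: "\<And>t. (g has_real_derivative g' t) (at t)" and c: "continuous_on UNIV g'"
    and b: "b \<in> sets borel" and \<alpha>: "min (g 0) (g 1) \<le> \<alpha>" and \<beta>: "\<beta> \<le> max (g 0) (g 1)"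
  shows "emeasure lborel (b \<inter> {\<alpha>..\<beta>}) \<le> (\<integral>\<^sup>+t\<in>{0..1}. indicator b (g t) * ennreal \<bar>g' t\<bar> \<partial>lborel)"
proof -
  have gc: "continuous_on UNIV g"
    using d by (intro continuous_at_imp_continuous_on) (auto intro: DERIV_isCont)
  have [measurable]: "g \<in> borel_measurable borel" "g' \<in> borel_measurable borel"
    using gc c by (auto intro: borel_measurable_continuous_onI)
  define N where "N h b = (\<integral>\<^sup>+t. indicator {0..1} t * (indicator b (g t) * ennreal (h t)) \<partial>lborel)" for h b
  define e where "e u v b = emeasure lborel (b \<inter> {u..v})" for u v :: real and b
  \<comment> \<open>The signed identity with positive and negative parts distributed so that only
    sums of \<open>ennreal\<close> values occur. At most one of the two \<open>e\<close> terms is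
    nonzero, according to the order of \<open>g 0\<close> and \<open>g 1\<close>.\<close>
  define Eq where "Eq b \<longleftrightarrow> N g' b + e (g 1) (g 0) b = N (\<lambda>t. - g' t) b + e (g 0) (g 1) b" for b
  have int: "set_integrable lborel {0..1} g'"
    by (rule borel_integrable_atLeastAtMost') (rule continuous_on_subset[OF c], simp)
  have Nfin: "N h b < \<infinity>" if "h = g' \<or> h = (\<lambda>t. - g' t)" for h b
  proof -
    have "N h b \<le> (\<integral>\<^sup>+t. ennreal (norm (indicator {0..1} t *\<^sub>R g' t)) \<partial>lborel)"
      unfolding N_def using that by (intro nn_integral_mono) (auto simp: indicator_def ennreal_leI)
    also have "\<dots> < \<infinity>" using int by (simp add: set_integrable_def integrable_iff_bounded)
    finally show ?thesis .
  qed
  have efin: "e u v b < \<infinity>" for u v b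
  proof -
    have "e u v b \<le> emeasure lborel {u..v}" unfolding e_def by (cases "b \<inter> {u..v} \<in> sets lborel") (auto intro: emeasure_mono simp: emeasure_notin_sets)
    also have "\<dots> < \<infinity>" by (cases "u \<le> v") auto
    finally show ?thesis .
  qed
  have EqI: "Eq b" if [measurable]: "b \<in> sets borel" and
    eq: "(LINT t|lborel. indicator {0..1} t * (indicator b (g t) * g' t)) = measure lborel (b \<inter> {g 0..g 1}) - measure lborel (b \<inter> {g 1..g 0})" for b
  proof -
    have "integrable lborel (\<lambda>t. indicator {0..1} t * (indicator b (g t) * g' t))"
      by (rule Bochner_Integration.integrable_bound[OF int[unfolded set_integrable_def]]) (auto simp: indicator_def)
    then have "(LINT t|lborel. indicator {0..1} t * (indicator b (g t) * g' t)) = enn2real (N g' b) - enn2real (N (\<lambda>t. - g' t) b)"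
      unfolding N_def by (subst real_lebesgue_integral_def) (auto intro!: arg_cong2[where f="(-)"] arg_cong[where f=enn2real] nn_integral_cong simp: indicator_def)
    then have "enn2real (N g' b) + measure lborel (b \<inter> {g 1..g 0}) = enn2real (N (\<lambda>t. - g' t) b) + measure lborel (b \<inter> {g 0..g 1})"
      using eq by linarith
    then have "ennreal (enn2real (N g' b)) + ennreal (measure lborel (b \<inter> {g 1..g 0})) = ennreal (enn2real (N (\<lambda>t. - g' t) b)) + ennreal (measure lborel (b \<inter> {g 0..g 1}))"
      by (simp flip: ennreal_plus)
    moreover have "ennreal (measure lborel (b \<inter> {u..v})) = e u v b" for u v
      using efin[of u v b] unfolding e_def by (intro emeasure_eq_ennreal_measure[symmetric]) auto
    ultimately show ?thesis using Nfin[of g' b] Nfin[of "\<lambda>t. - g' t" b] by (simp add: Eq_def)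
  qed
  have m: "measure lborel {u..v} = (if u \<le> v then v - u else 0)" for u v :: real by simp
  have half: "Eq {..<a}" for a
  proof (rule EqI)
    have "measure lborel ({..<a} \<inter> {u..v}) = (if u \<le> v then min v a - min u a else 0)" for u v :: real
    proof (cases "v < a")
      case True
      then have eq: "{..<a} \<inter> {u..v} = {u..v}" by auto
      show ?thesis unfolding eq using True by (simp add: min_def)
    next
      case False
      then have eq: "{..<a} \<inter> {u..v} = {u..<a}" by auto
      show ?thesis unfolding eq using False by (simp add: min_def)
    qed
    then show "(LINT t|lborel. indicator {0..1} t * (indicator {..<a} (g t) * g' t)) =
      measure lborel ({..<a} \<inter> {g 0..g 1}) - measure lborel ({..<a} \<inter> {g 1..g 0})"
      unfolding integral_below_level[OF d c] by auto
  qed simp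
  \<comment> \<open>On the unit interval \<open>g\<close> is bounded, so a half-line beyond its
    maximum acts like the whole line. The complement step of the induction needs this case.\<close>
  have all: "Eq UNIV"
  proof -
    obtain M where M: "\<And>t. t \<in> {0..1} \<Longrightarrow> g t < M"
    proof -
      have "compact (g ` {0..1})" by (intro compact_continuous_image continuous_on_subset[OF gc]) auto
      then obtain B where B: "\<forall>x\<in>g ` {0..1}. norm x \<le> B" using compact_imp_bounded bounded_iff by blast
      show ?thesis
      proof (rule that[of "B + 1"])
        fix t :: real assume "t \<in> {0..1}"
        then have "\<bar>g t\<bar> \<le> B" using B by auto
        then show "g t < B + 1" by linarith
      qed
    qed
    have "N h UNIV = N h {..<M}" for h unfolding N_def using M by (intro nn_integral_cong) (auto simp: indicator_def)
    moreover have "{..<M} \<inter> {g 0..g 1} = {g 0..g 1}" "{..<M} \<inter> {g 1..g 0} = {g 1..g 0}"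
      using M[of 0] M[of 1] by auto
    ultimately show ?thesis using half[of M] by (simp add: Eq_def e_def)
  qed
  have sets_eq: "sets borel = sigma_sets UNIV (range (lessThan :: real \<Rightarrow> real set))"
    unfolding borel_Iio by (rule sets_measure_of) simp
  have stable: "Int_stable (range (lessThan :: real \<Rightarrow> real set))"
  proof -
    have "{..<a} \<inter> {..<b} = {..<min a b}" for a b :: real by auto
    then show ?thesis by (auto simp: Int_stable_def)
  qed
  have "range lessThan \<subseteq> Pow (UNIV :: real set)" by simp
  from stable this b[unfolded sets_eq] have "Eq b"
  proof (induction b rule: sigma_sets_induct_disjoint)
    case (basic A)
    then show ?case using half by auto
  next
    case empty
    show ?case by (simp add: Eq_def N_def e_def)
  next
    case (compl A)
    then have [measurable]: "A \<in> sets borel" by (simp add: sets_eq)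
    have Nsplit: "N h UNIV = N h A + N h (UNIV - A)" if [measurable]: "h \<in> borel_measurable borel" for h
      unfolding N_def by (subst nn_integral_add[symmetric]) (auto intro!: nn_integral_cong simp: indicator_def)
    have esplit: "e u v UNIV = e u v A + e u v (UNIV - A)" for u v
      unfolding e_def by (subst plus_emeasure) (auto intro!: arg_cong[where f="emeasure lborel"])
    \<comment> \<open>Both sides are split over \<open>A\<close> and its complement. The parts on
      \<open>A\<close> agree and are finite, so they can be cancelled.\<close>
    have "(N g' A + e (g 1) (g 0) A) + (N g' (UNIV - A) + e (g 1) (g 0) (UNIV - A)) =
      (N (\<lambda>t. - g' t) A + e (g 0) (g 1) A) + (N (\<lambda>t. - g' t) (UNIV - A) + e (g 0) (g 1) (UNIV - A))"
      using all unfolding Eq_def by (simp add: Nsplit esplit ac_simps)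
    then have "(N g' A + e (g 1) (g 0) A) + (N g' (UNIV - A) + e (g 1) (g 0) (UNIV - A)) =
      (N g' A + e (g 1) (g 0) A) + (N (\<lambda>t. - g' t) (UNIV - A) + e (g 0) (g 1) (UNIV - A))"
      using compl unfolding Eq_def by simp
    moreover have "N g' A + e (g 1) (g 0) A \<noteq> \<infinity>" using Nfin[of g' A] efin[of "g 1" "g 0" A] by (auto simp: less_top)
    ultimately show ?case unfolding Eq_def ennreal_add_left_cancel by simp
  next
    case (union A)
    then have [measurable]: "\<And>i. A i \<in> sets borel" by (auto simp: sets_eq)
    have Nsum: "N h (\<Union>i. A i) = (\<Sum>i. N h (A i))" if [measurable]: "h \<in> borel_measurable borel" for h
    proof -
      have "N h (\<Union>i. A i) = (\<integral>\<^sup>+t. (\<Sum>i. indicator {0..1} t * (indicator (A i) (g t) * ennreal (h t))) \<partial>lborel)"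
        unfolding N_def using suminf_indicator[OF union(1)] by (intro nn_integral_cong) (simp add: ennreal_suminf_cmult ennreal_suminf_multc)
      also have "\<dots> = (\<Sum>i. N h (A i))" unfolding N_def by (rule nn_integral_suminf) measurable
      finally show ?thesis .
    qed
    have esum: "e u v (\<Union>i. A i) = (\<Sum>i. e u v (A i))" for u v
    proof -
      have eq: "(\<Union>i. A i) \<inter> {u..v} = (\<Union>i. A i \<inter> {u..v})" by auto
      have "disjoint_family (\<lambda>i. A i \<inter> {u..v})" using union(1) by (auto simp: disjoint_family_on_def)
      then show ?thesis unfolding e_def eq
        by (intro suminf_emeasure[symmetric]) auto
    qed
    show ?case using union(3) unfolding Eq_def by (simp add: Nsum esum suminf_add)
  qed
  then have Eq: "N g' b + e (g 1) (g 0) b = N (\<lambda>t. - g' t) b + e (g 0) (g 1) b" by (simp add: Eq_def)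
  have Nle: "N h b \<le> (\<integral>\<^sup>+t\<in>{0..1}. indicator b (g t) * ennreal \<bar>g' t\<bar> \<partial>lborel)" if "h = g' \<or> h = (\<lambda>t. - g' t)" for h
    unfolding N_def using that by (intro nn_integral_mono) (auto simp: indicator_def intro!: ennreal_leI)
  have e0: "e u v b = 0" if "v \<le> u" for u v
  proof -
    have "e u v b \<le> emeasure lborel {u..v}" unfolding e_def using b by (intro emeasure_mono) auto
    also have "\<dots> = 0" using that by (cases "u = v") auto
    finally show ?thesis by simp
  qed
  show ?thesis
  proof (cases "g 0 \<le> g 1")
    case True
    have "emeasure lborel (b \<inter> {\<alpha>..\<beta>}) \<le> e (g 0) (g 1) b"
      unfolding e_def using b \<alpha> \<beta> True by (intro emeasure_mono) auto
    also have "\<dots> \<le> N (\<lambda>t. - g' t) b + e (g 0) (g 1) b" by simp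
    also have "\<dots> = N g' b" using Eq e0[OF True] by simp
    also note Nle[of g']
    finally show ?thesis by simp
  next
    case False
    have "emeasure lborel (b \<inter> {\<alpha>..\<beta>}) \<le> e (g 1) (g 0) b"
      unfolding e_def using b \<alpha> \<beta> False by (intro emeasure_mono) auto
    also have "\<dots> \<le> N g' b + e (g 1) (g 0) b" by simp
    also have "\<dots> = N (\<lambda>t. - g' t) b" using Eq e0[of "g 1" "g 0"] False by simp
    also note Nle[of "\<lambda>t. - g' t"]
    finally show ?thesis by simp
  qed
qed

section \<open>Mollification\<close>

text \<open>For k = 0 this is the standard smooth function vanishing on the negative half-line. The
  further members make the family closed, up to linear combinations, under differentiation.\<close>

definition flat :: "nat \<Rightarrow> real \<Rightarrow> real" where
  "flat k t = (if t \<le> 0 then 0 else exp (- 1 / t) / t ^ k)"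

text \<open>The term of order k + 2 in the exponential series of 1/t beats t^-k and leaves two
  powers of \<open>t\<close>, which is what makes the difference quotient at 0 vanish.\<close>

lemma flat_le:
  assumes "t > 0"
  shows "flat k t \<le> fact (k + 2) * t ^ 2"
proof -
  have "(1 / t) ^ (k + 2) / fact (k + 2) \<le> exp (1 / t)"
  proof -
    have s: "(\<lambda>n. (1 / t) ^ n /\<^sub>R fact n) sums exp (1 / t)" by (rule exp_converges)
    have "sum (\<lambda>n. (1 / t) ^ n /\<^sub>R fact n) {k + 2} \<le> (\<Sum>n. (1 / t) ^ n /\<^sub>R fact n)"
      using s assms by (intro sum_le_suminf) (auto simp: sums_iff)
    then show ?thesis using s by (simp add: sums_iff divide_inverse mult.commute)
  qed
  then have "inverse (exp (1 / t)) \<le> inverse ((1 / t) ^ (k + 2) / fact (k + 2))"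
    using assms by (intro le_imp_inverse_le) auto
  then have "exp (- 1 / t) \<le> fact (k + 2) * t ^ (k + 2)"
    using exp_minus[of "1 / t"] by (simp only: minus_divide_left inverse_divide power_divide power_one divide_divide_eq_right div_by_1)
  then have "exp (- 1 / t) / t ^ k \<le> fact (k + 2) * t ^ (k + 2) / t ^ k"
    using assms by (intro divide_right_mono) auto
  also have "\<dots> = fact (k + 2) * t ^ 2" using assms by (simp add: power_add power2_eq_square)
  finally show ?thesis using assms by (simp add: flat_def)
qed

lemma flat_nonneg: "flat k t \<ge> 0" by (simp add: flat_def)

lemma DERIV_flat: "(flat k has_real_derivative flat (k + 2) t - k * flat (k + 1) t) (at t)"
proof -
  consider "t > 0" | "t < 0" | "t = 0" by linarith
  then show ?thesis
  proof cases
    case 1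
    have "((\<lambda>t. exp (- 1 / t)) has_real_derivative exp (- 1 / t) * (1 / t\<^sup>2)) (at t)"
      using 1 by (auto intro!: derivative_eq_intros simp: power2_eq_square)
    from DERIV_divide[OF this DERIV_pow[of k t]]
    have "((\<lambda>t. exp (- 1 / t) / t ^ k) has_real_derivative
        (exp (- 1 / t) * (1 / t\<^sup>2) * t ^ k - exp (- 1 / t) * (real k * t ^ (k - Suc 0))) / (t ^ k * t ^ k)) (at t)"
      using 1 by simp
    also have "(exp (- 1 / t) * (1 / t\<^sup>2) * t ^ k - exp (- 1 / t) * (real k * t ^ (k - Suc 0))) / (t ^ k * t ^ k)
        = flat (k + 2) t - k * flat (k + 1) t"
      using 1 by (cases k) (simp_all add: flat_def power2_eq_square field_simps)
    finally have "((\<lambda>t. exp (- 1 / t) / t ^ k) has_real_derivative flat (k + 2) t - k * flat (k + 1) t) (at t)" .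
    then show ?thesis
      by (rule has_field_derivative_transform_within_open[where S="{0<..}"]) (use 1 in \<open>auto simp: flat_def\<close>)
  next
    case 2
    have "((\<lambda>_. 0) has_real_derivative flat (k + 2) t - k * flat (k + 1) t) (at t)"
      using 2 by (simp add: flat_def)
    then show ?thesis
      by (rule has_field_derivative_transform_within_open[where S="{..<0}"]) (use 2 in \<open>auto simp: flat_def\<close>)
  next
    case 3
    have "((\<lambda>h. (flat k (0 + h) - flat k 0) / h) \<longlongrightarrow> 0) (at 0)"
    proof (rule Lim_null_comparison)
      have "norm ((flat k (0 + h) - flat k 0) / h) \<le> fact (k + 2) * \<bar>h\<bar>" if "h \<noteq> 0" for h
      proof (cases "h > 0")
        case True
        then show ?thesis using flat_le[of h k] flat_nonneg[of k h]
          by (simp add: flat_def[of _ 0] power2_eq_square field_simps)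
      next
        case False
        then have "flat k (0 + h) = 0" "flat k 0 = 0" by (simp_all add: flat_def)
        then show ?thesis by (simp only: diff_self div_0 norm_zero) (intro mult_nonneg_nonneg, simp_all)
      qed
      then show "\<forall>\<^sub>F h in at 0. norm ((flat k (0 + h) - flat k 0) / h) \<le> fact (k + 2) * \<bar>h\<bar>"
        by (auto simp: eventually_at_filter)
      have "((\<lambda>h. fact (k + 2) * \<bar>h\<bar>) \<longlongrightarrow> fact (k + 2) * \<bar>0 :: real\<bar>) (at 0)" by (intro tendsto_intros)
      then show "((\<lambda>h::real. fact (k + 2) * \<bar>h\<bar>) \<longlongrightarrow> (0::real)) (at 0)" by simp
    qed
    then show ?thesis using 3 by (simp add: DERIV_def flat_def[of _ 0])
  qed
qed

lemma continuous_flat: "continuous_on UNIV (flat k)"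
  by (intro continuous_at_imp_continuous_on ballI DERIV_isCont[OF DERIV_flat])

text \<open>A class of explicit expressions that contains the bump and is closed under partial
  derivatives. Since its members are differentiable everywhere, all iterated partial derivatives of
  a bump are handled by one induction.\<close>

inductive smooth_term :: "'a::euclidean_space \<Rightarrow> real \<Rightarrow> ('a \<Rightarrow> real) \<Rightarrow> bool" for c e where
  const: "smooth_term c e (\<lambda>_. r)"
| lin: "smooth_term c e (\<lambda>x. x \<bullet> b)"
| flat_ball: "smooth_term c e (\<lambda>x. flat k (1 - (x - c) \<bullet> (x - c) / e\<^sup>2))"
| add: "smooth_term c e \<phi> \<Longrightarrow> smooth_term c e \<psi> \<Longrightarrow> smooth_term c e (\<lambda>x. \<phi> x + \<psi> x)"
| mult: "smooth_term c e \<phi> \<Longrightarrow> smooth_term c e \<psi> \<Longrightarrow> smooth_term c e (\<lambda>x. \<phi> x * \<psi> x)"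

lemma has_derivative_flat_ball:
  "((\<lambda>x. flat k (1 - (x - c) \<bullet> (x - c) / e\<^sup>2)) has_derivative
    (\<lambda>h. (flat (k + 2) (1 - (x - c) \<bullet> (x - c) / e\<^sup>2) - k * flat (k + 1) (1 - (x - c) \<bullet> (x - c) / e\<^sup>2)) *
       ((-2 / e\<^sup>2) * (h \<bullet> x + - (h \<bullet> c))))) (at (x :: 'a::euclidean_space))"
proof -
  let ?q = "\<lambda>x. 1 - (x - c) \<bullet> (x - c) / e\<^sup>2"
  have "((\<lambda>x. 1 - inverse (e\<^sup>2) * ((x - c) \<bullet> (x - c))) has_derivative
      (\<lambda>h. 0 - inverse (e\<^sup>2) * ((x - c) \<bullet> (h - 0) + (h - 0) \<bullet> (x - c)))) (at x)"
    by (intro has_derivative_diff has_derivative_const has_derivative_mult_right has_derivative_inner has_derivative_ident)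
  moreover have "(\<lambda>x. 1 - inverse (e\<^sup>2) * ((x - c) \<bullet> (x - c))) = ?q"
    by (simp add: divide_inverse mult.commute)
  moreover have "(\<lambda>h. 0 - inverse (e\<^sup>2) * ((x - c) \<bullet> (h - 0) + (h - 0) \<bullet> (x - c))) = (\<lambda>h. (-2 / e\<^sup>2) * (h \<bullet> x + - (h \<bullet> c)))"
    by (simp add: fun_eq_iff inner_diff_left inner_diff_right inner_commute divide_inverse algebra_simps)
  ultimately have "(?q has_derivative (\<lambda>h. (-2 / e\<^sup>2) * (h \<bullet> x + - (h \<bullet> c)))) (at x)" by simp
  from has_derivative_compose[OF this DERIV_flat[of k "?q x", unfolded has_field_derivative_def]]
  show ?thesis by simp
qed

lemma smooth_term_derivative:
  assumes "smooth_term c e \<phi>"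
  shows "\<exists>D. (\<forall>x. (\<phi> has_derivative D x) (at x)) \<and> (\<forall>b. smooth_term c e (\<lambda>x. D x b))"
  using assms
proof induction
  case (const r)
  show ?case by (intro exI[of _ "\<lambda>_ _. 0"]) (auto intro: smooth_term.const)
next
  case (lin b)
  show ?case
    by (intro exI[of _ "\<lambda>_ h. h \<bullet> b"] conjI allI smooth_term.const) (auto intro!: derivative_eq_intros)
next
  case (flat_ball k)
  show ?case
  proof (intro exI conjI allI)
    fix x show "((\<lambda>x. flat k (1 - (x - c) \<bullet> (x - c) / e\<^sup>2)) has_derivative
      (\<lambda>x h. (flat (k + 2) (1 - (x - c) \<bullet> (x - c) / e\<^sup>2) - k * flat (k + 1) (1 - (x - c) \<bullet> (x - c) / e\<^sup>2)) *
       ((-2 / e\<^sup>2) * (h \<bullet> x + - (h \<bullet> c)))) x) (at x)"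
      by (rule has_derivative_flat_ball)
    fix b
    have "smooth_term c e (\<lambda>x. (flat (k + 2) (1 - (x - c) \<bullet> (x - c) / e\<^sup>2) + (- real k) * flat (k + 1) (1 - (x - c) \<bullet> (x - c) / e\<^sup>2)) *
       ((-2 / e\<^sup>2) * (x \<bullet> b + - (b \<bullet> c))))"
      by (intro smooth_term.intros)
    then show "smooth_term c e (\<lambda>x. (\<lambda>h. (flat (k + 2) (1 - (x - c) \<bullet> (x - c) / e\<^sup>2) - k * flat (k + 1) (1 - (x - c) \<bullet> (x - c) / e\<^sup>2)) *
       ((-2 / e\<^sup>2) * (h \<bullet> x + - (h \<bullet> c)))) b)"
      by (simp add: inner_commute)
  qed
next
  case (add \<phi> \<psi>)
  then obtain D1 D2 where D: "\<And>x. (\<phi> has_derivative D1 x) (at x)" "\<And>b. smooth_term c e (\<lambda>x. D1 x b)"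
    "\<And>x. (\<psi> has_derivative D2 x) (at x)" "\<And>b. smooth_term c e (\<lambda>x. D2 x b)" by blast
  show ?case
    by (intro exI[of _ "\<lambda>x h. D1 x h + D2 x h"] conjI allI has_derivative_add D smooth_term.add)
next
  case (mult \<phi> \<psi>)
  then obtain D1 D2 where D: "\<And>x. (\<phi> has_derivative D1 x) (at x)" "\<And>b. smooth_term c e (\<lambda>x. D1 x b)"
    "\<And>x. (\<psi> has_derivative D2 x) (at x)" "\<And>b. smooth_term c e (\<lambda>x. D2 x b)" by blast
  show ?case
    by (intro exI[of _ "\<lambda>x h. \<phi> x * D2 x h + D1 x h * \<psi> x"] conjI allI has_derivative_mult D smooth_term.add smooth_term.mult mult.hyps)
qed

lemma smooth_term_iter_partial: "smooth_term c e \<phi> \<Longrightarrow> smooth_term c e (iter_partial bs \<phi>)"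
proof (induction bs)
  case (Cons b bs)
  then obtain D where D: "\<And>x. (iter_partial bs \<phi> has_derivative D x) (at x)" "\<And>b. smooth_term c e (\<lambda>x. D x b)"
    using smooth_term_derivative by blast
  have "iter_partial (b # bs) \<phi> = (\<lambda>x. D x b)"
    using frechet_derivative_at[OF D(1)] by (simp add: fun_eq_iff)
  then show ?case using D(2) by simp
qed simp

section \<open>Bump functions as test functions and mollifiers\<close>

definition bump :: "real \<Rightarrow> 'a::euclidean_space \<Rightarrow> 'a \<Rightarrow> real" where
  "bump e c x = flat 0 (1 - (x - c) \<bullet> (x - c) / e\<^sup>2)"

lemma bump_eq_0: "e > 0 \<Longrightarrow> norm (x - c) \<ge> e \<Longrightarrow> flat k (1 - (x - c) \<bullet> (x - c) / e\<^sup>2) = 0"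
  using power_mono[of e "norm (x - c)" 2] by (simp add: flat_def dot_square_norm)

lemma bump_outside: "e > 0 \<Longrightarrow> norm (x - c) \<ge> e \<Longrightarrow> bump e c x = 0"
  unfolding bump_def by (rule bump_eq_0)

lemma bump_nonneg: "bump e c x \<ge> 0" by (simp add: bump_def flat_nonneg)

lemma bump_le_1: "bump e c x \<le> 1"
  by (simp add: bump_def flat_def)

lemma bump_commute: "bump e c x = bump e x c"
  unfolding bump_def by (simp add: inner_diff_left inner_diff_right inner_commute algebra_simps)

lemma test_function_bump: "e > 0 \<Longrightarrow> test_function (bump e c)"
  unfolding test_function_def
proof (intro conjI allI impI)
  assume e: "e > 0"
  have "{x. bump e c x \<noteq> 0} \<subseteq> cball c e"
    using bump_outside[OF e, where c=c] by (force simp: dist_norm norm_minus_commute)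
  then have "closure {x. bump e c x \<noteq> 0} \<subseteq> cball c e" by (rule closure_minimal) simp
  then show "compact (closure {x. bump e c x \<noteq> 0})"
    by (meson compact_eq_bounded_closed bounded_subset bounded_cball closed_closure)
  fix bs x
  have "smooth_term c e (bump e c)" unfolding bump_def by (rule smooth_term.flat_ball)
  then have "smooth_term c e (iter_partial bs (bump e c))" by (rule smooth_term_iter_partial)
  then show "iter_partial bs (bump e c) differentiable at x"
    using smooth_term_derivative unfolding differentiable_def by blast
qed

lemma iter_partial_bump:
  "iter_partial [b] (bump e c) x = flat 2 (1 - (x - c) \<bullet> (x - c) / e\<^sup>2) * ((-2 / e\<^sup>2) * (b \<bullet> x + - (b \<bullet> c)))"
proof -
  have "(bump e c has_derivative (\<lambda>h. flat 2 (1 - (x - c) \<bullet> (x - c) / e\<^sup>2) * ((-2 / e\<^sup>2) * (h \<bullet> x + - (h \<bullet> c))))) (at x)"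
    using has_derivative_flat_ball[of 0 c e x] unfolding bump_def by (simp add: numeral_2_eq_2)
  from frechet_derivative_at[OF this] show ?thesis by (simp add: fun_eq_iff)
qed

lemma continuous_bump: "continuous_on UNIV (\<lambda>x. bump e (c x) (d x))" if "continuous_on UNIV c" "continuous_on UNIV d"
  unfolding bump_def divide_inverse
  by (intro continuous_on_compose2[OF continuous_flat] continuous_on_diff continuous_on_const continuous_on_mult
      continuous_on_inner that) auto

lemma borel_measurable_bump [measurable]:
  assumes [measurable]: "c \<in> borel_measurable M" "d \<in> borel_measurable M"
  shows "(\<lambda>x. bump e (c x) (d x)) \<in> borel_measurable M"
proof -
  have [measurable]: "flat 0 \<in> borel_measurable borel" by (rule borel_measurable_continuous_onI[OF continuous_flat])
  show ?thesis unfolding bump_def by measurable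
qed

text \<open>The normalising constant: dividing a bump of radius \<open>e\<close> by
  \<open>e ^ DIM('a) * bump_mass TYPE('a)\<close> gives it integral 1. It depends on the dimension
  only, hence the type argument.\<close>

definition bump_mass :: "'a::euclidean_space itself \<Rightarrow> real" where
  "bump_mass _ = enn2real (\<integral>\<^sup>+x. ennreal (bump 1 0 (x :: 'a)) \<partial>lborel)"

lemma bump_mass:
  shows "bump_mass TYPE('a::euclidean_space) > 0"
    and "e > 0 \<Longrightarrow> (\<integral>\<^sup>+x. ennreal (bump e c (x::'a)) \<partial>lborel) = ennreal (e ^ DIM('a) * bump_mass TYPE('a))"
proof -
  let ?I = "\<integral>\<^sup>+x. ennreal (bump 1 0 (x :: 'a)) \<partial>lborel"
  have "?I \<le> (\<integral>\<^sup>+x. indicator (cball 0 1) (x :: 'a) \<partial>lborel)"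
  proof (rule nn_integral_mono)
    fix x :: 'a
    show "ennreal (bump 1 0 x) \<le> indicator (cball 0 1) x"
      using bump_outside[of 1 x 0] bump_le_1[of 1 0 x] by (cases "norm x \<le> 1") (auto simp: indicator_def)
  qed
  also have "\<dots> < \<infinity>" using emeasure_lborel_cball_finite[of "0::'a" 1] by simp
  finally have fin: "?I < \<infinity>" .
  have "?I \<noteq> 0"
  proof
    assume "?I = 0"
    then have "AE x :: 'a in lborel. ennreal (bump 1 0 x) = 0" by (subst (asm) nn_integral_0_iff_AE) auto
    moreover have pos1: "bump 1 0 x > 0" if "norm x < 1" for x :: 'a
      using that power_strict_mono[of "norm x" 1 2] by (simp add: bump_def flat_def dot_square_norm)
    moreover have "x \<notin> ball 0 1" if "ennreal (bump 1 0 x) = 0" for x :: 'a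
      using that pos1[of x] by (cases "norm x < 1") (auto simp: ennreal_eq_0_iff)
    ultimately have "AE x :: 'a in lborel. x \<notin> ball 0 1" by (auto elim: eventually_mono)
    moreover have "ball (0::'a) 1 = {x. norm x < 1}" by auto
    ultimately have "emeasure lborel (ball (0::'a) 1) = 0" by (subst (asm) AE_iff_measurable[OF _ refl]) auto
    then show False using unit_ball_vol_pos[of "real DIM('a)"] by (subst (asm) emeasure_ball) auto
  qed
  then show pos: "bump_mass TYPE('a) > 0" using fin by (simp add: bump_mass_def enn2real_positive_iff zero_less_iff_neq_zero)
  assume e: "e > 0"
  have I: "?I = ennreal (bump_mass TYPE('a))" using fin by (simp add: bump_mass_def)
  have [measurable]: "bump 1 0 \<in> borel_measurable (borel :: 'a measure)" by measurable
  have "(\<integral>\<^sup>+x. ennreal (bump e c (x::'a)) \<partial>lborel) = (\<integral>\<^sup>+x. ennreal (bump 1 0 ((1 / e) *\<^sub>R (x - c))) \<partial>lborel)"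
    using e by (intro nn_integral_cong) (simp add: bump_def power2_eq_square)
  also have "\<dots> = (\<integral>\<^sup>+x. (\<lambda>z. ennreal (bump 1 0 (z - c))) (c + (1 / e) *\<^sub>R (x - c)) \<partial>lborel)" by simp
  also have "\<dots> = ennreal (1 / (1 / e) ^ DIM('a)) * (\<integral>\<^sup>+z. ennreal (bump 1 0 (z - c)) \<partial>lborel)"
    using e by (intro nn_integral_dilation) auto
  also have "(\<integral>\<^sup>+z. ennreal (bump 1 0 (z - c)) \<partial>lborel) = ?I"
  proof -
    have "?I = (\<integral>\<^sup>+z. ennreal (bump 1 0 z) \<partial>distr lborel borel (\<lambda>z. - c + z))"
      by (subst lborel_distr_plus) simp
    also have "\<dots> = (\<integral>\<^sup>+z. ennreal (bump 1 0 (z - c)) \<partial>lborel)" by (subst nn_integral_distr) auto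
    finally show ?thesis by simp
  qed
  finally show "(\<integral>\<^sup>+x. ennreal (bump e c (x::'a)) \<partial>lborel) = ennreal (e ^ DIM('a) * bump_mass TYPE('a))"
    using e pos unfolding I by (simp add: power_divide ennreal_mult[symmetric])
qed

section \<open>Smeared functions and their derivatives\<close>

lemma integrable_mult_kernel:
  fixes F :: "'a::euclidean_space \<Rightarrow> real"
  assumes F: "locally_integrable F" and [measurable]: "k \<in> borel_measurable borel"
    and k: "\<And>y. \<bar>k y\<bar> \<le> M" "\<And>y. y \<notin> cball 0 R \<Longrightarrow> k y = 0"
  shows "integrable lebesgue (\<lambda>y. F y * k y)"
proof (rule Bochner_Integration.integrable_bound)
  have [measurable]: "F \<in> borel_measurable lebesgue" using F by (simp add: locally_integrable_def)
  have kl [measurable]: "k \<in> borel_measurable lebesgue" by (rule measurable_completion) simp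
  have "F absolutely_integrable_on cball 0 R" using F by (simp add: locally_integrable_def)
  then have "integrable lebesgue (\<lambda>y. indicator (cball 0 R) y *\<^sub>R F y)" by (simp add: set_integrable_def)
  then show "integrable lebesgue (\<lambda>y. M * (indicator (cball 0 R) y *\<^sub>R F y))" by (rule integrable_mult_right)
  show "(\<lambda>y. F y * k y) \<in> borel_measurable lebesgue" by measurable
  have "norm (F y * k y) \<le> norm (M * (indicator (cball 0 R) y *\<^sub>R F y))" for y
  proof (cases "y \<in> cball 0 R")
    case True
    have "\<bar>F y\<bar> * \<bar>k y\<bar> \<le> \<bar>F y\<bar> * \<bar>M\<bar>" using k(1)[of y] by (intro mult_left_mono) auto
    then show ?thesis using True by (simp add: abs_mult mult.commute)
  qed (use k(2) in simp)
  then show "AE y in lebesgue. norm (F y * k y) \<le> norm (M * (indicator (cball 0 R) y *\<^sub>R F y))" by simp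
qed

lemma integrable_truncation:
  fixes F :: "'a::euclidean_space \<Rightarrow> real"
  assumes F: "locally_integrable F"
  shows "integrable lebesgue (\<lambda>y. C * (\<bar>F y\<bar> * indicator (cball 0 R) y))"
proof -
  have "integrable lebesgue (\<lambda>y. F y * indicator (cball 0 R) y)"
    by (rule integrable_mult_kernel[OF F, where M=1 and R=R]) auto
  from integrable_norm[OF this] have "integrable lebesgue (\<lambda>y. \<bar>F y\<bar> * indicator (cball 0 R) y)"
    by (simp add: abs_mult indicator_def)
  then show ?thesis by (rule integrable_mult_right)
qed

lemma far_from_center: 
  fixes y z :: "'a::real_normed_vector"
  shows "norm z + e \<le> R \<Longrightarrow> y \<notin> cball 0 R \<Longrightarrow> e \<le> norm (y - z)"
  using norm_triangle_ineq[of "y - z" z] by simp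

lemma bump_integrable:
  fixes F :: "'a::euclidean_space \<Rightarrow> real"
  assumes "locally_integrable F" "e > 0"
  shows "integrable lebesgue (\<lambda>y. F y * bump e z y)"
proof (rule integrable_mult_kernel[OF assms(1), where M=1 and R="norm z + e"])
  show "bump e z y = 0" if "y \<notin> cball 0 (norm z + e)" for y
    using far_from_center[OF _ that, of z e] assms(2) by (intro bump_outside) auto
  show "\<bar>bump e z y\<bar> \<le> 1" for y using bump_nonneg[of e z y] bump_le_1[of e z y] by simp
qed measurable

text \<open>Convolution with the bump before normalisation; the normalising factor is constant in
  \<open>x\<close> and is attached only where limits are taken.\<close>

definition smear :: "real \<Rightarrow> ('a::euclidean_space \<Rightarrow> real) \<Rightarrow> 'a \<Rightarrow> real" where
  "smear e F x = (LINT y|lebesgue. F y * bump e x y)"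

lemma continuous_smear:
  fixes F :: "'a::euclidean_space \<Rightarrow> real"
  assumes F: "locally_integrable F" and e: "e > 0"
  shows "continuous_on UNIV (smear e F)"
  unfolding continuous_on_sequentially comp_def
proof (intro ballI allI impI, elim conjE)
  fix X :: "nat \<Rightarrow> 'a" and x assume X: "X \<longlonglongrightarrow> x"
  obtain B where B: "\<And>i. norm (X i) \<le> B"
    using Bseq_def convergent_imp_Bseq X convergentI by (metis)
  define R where "R = max B (norm x) + e"
  have [measurable]: "F \<in> borel_measurable lebesgue" using F by (simp add: locally_integrable_def)
  have bm [measurable]: "bump e z \<in> borel_measurable lebesgue" for z :: 'a
    by (rule measurable_completion) (simp, measurable)
  show "(\<lambda>i. smear e F (X i)) \<longlonglongrightarrow> smear e F x"
    unfolding smear_def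
  proof (rule integral_dominated_convergence[where w="\<lambda>y. 1 * (\<bar>F y\<bar> * indicator (cball 0 R) y)"])
    show "integrable lebesgue (\<lambda>y. 1 * (\<bar>F y\<bar> * indicator (cball 0 R) y))" by (rule integrable_truncation[OF F])
    have "(\<lambda>i. bump e (X i) y) \<longlonglongrightarrow> bump e x y" for y
      using continuous_bump[of "\<lambda>x. x" "\<lambda>_. y" e] X
      by (simp add: continuous_on_sequentially comp_def)
    then show "AE y in lebesgue. (\<lambda>i. F y * bump e (X i) y) \<longlonglongrightarrow> F y * bump e x y"
      by (intro always_eventually allI tendsto_mult tendsto_const)
    show "AE y in lebesgue. norm (F y * bump e (X i) y) \<le> 1 * (\<bar>F y\<bar> * indicator (cball 0 R) y)" for i
    proof (intro always_eventually allI)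
      fix y
      show "norm (F y * bump e (X i) y) \<le> 1 * (\<bar>F y\<bar> * indicator (cball 0 R) y)"
      proof (cases "y \<in> cball 0 R")
        case True
        then show ?thesis using mult_left_mono[OF bump_le_1[of e "X i" y], of "\<bar>F y\<bar>"] bump_nonneg[of e "X i" y]
          by (simp add: abs_mult)
      next
        case False
        have "norm (X i) + e \<le> R" using B[of i] by (simp add: R_def)
        then have "bump e (X i) y = 0" using far_from_center[OF _ False] e by (intro bump_outside) auto
        then show ?thesis by simp
      qed
    qed
  qed measurable
qed

text \<open>The argument of \<open>flat 2\<close> is at most 1, so \<open>flat_le\<close> bounds
  that factor by (2 + 2)! = 24. Inside the support, \<open>y - z\<close> has norm below
  \<open>e\<close>, which leaves 2 / e from the other factor.\<close>

lemma bump_slope_le: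
  assumes e: "e > 0"
  shows "\<bar>flat 2 (1 - (y - z) \<bullet> (y - z) / e\<^sup>2) * ((2 / e\<^sup>2) * ((y - z) \<bullet> v))\<bar> \<le> 48 / e * norm (v :: 'a::euclidean_space)"
proof (cases "norm (y - z) \<ge> e")
  case True
  then show ?thesis using bump_eq_0[OF e True, of 2] e by simp
next
  case False
  let ?s = "1 - (y - z) \<bullet> (y - z) / e\<^sup>2"
  have s: "?s \<le> 1" by simp
  have "flat 2 ?s \<le> 24"
  proof (cases "?s > 0")
    case True
    have "flat 2 ?s \<le> fact (2 + 2) * ?s ^ 2" by (rule flat_le[OF True])
    also have "\<dots> \<le> 24 * 1" using True s by (intro mult_mono power_le_one) (auto simp: fact_numeral)
    finally show ?thesis by simp
  qed (simp add: flat_def)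
  moreover have "\<bar>(y - z) \<bullet> v\<bar> \<le> e * norm v"
    using Cauchy_Schwarz_ineq2[of "y - z" v] mult_right_mono[of "norm (y - z)" e "norm v"] False by simp
  ultimately have "flat 2 ?s * \<bar>(2 / e\<^sup>2) * ((y - z) \<bullet> v)\<bar> \<le> 24 * ((2 / e\<^sup>2) * (e * norm v))"
    using e by (intro mult_mono) (auto simp: abs_mult intro!: divide_right_mono)
  then show ?thesis using e flat_nonneg[of 2 ?s] by (simp add: abs_mult power2_eq_square)
qed

text \<open>Differentiation under the integral falls on the centre of the bump. A derivative in the
  centre is minus a derivative in the integration variable, where the bump is a test function, so
  the weak gradient takes it over.\<close>

lemma smear_gradient:
  fixes f :: "'a::euclidean_space \<Rightarrow> real"
  assumes f: "locally_integrable f" and g: "has_gradient (dist_of f) g" and e: "e > 0"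
  shows "((\<lambda>t. smear e f (x + t *\<^sub>R v)) has_real_derivative
    (\<Sum>b\<in>Basis. (v \<bullet> b) * smear e (\<lambda>y. g y \<bullet> b) (x + t *\<^sub>R v))) (at t)"
proof -
  define z where "z = x + t *\<^sub>R v"
  \<comment> \<open>The derivative of \<open>bump e u y\<close> in the centre \<open>u\<close>, in
    direction \<open>w\<close>. It has the opposite sign to the expression in
    \<open>iter_partial_bump\<close>, matching the minus sign in
    \<open>dist_partial\<close>.\<close>
  define slope where "slope u y w = flat 2 (1 - (y - u) \<bullet> (y - u) / e\<^sup>2) * ((2 / e\<^sup>2) * ((y - u) \<bullet> w))" for u y w :: 'a
  have [measurable]: "f \<in> borel_measurable lebesgue" using f by (simp add: locally_integrable_def)
  have [measurable]: "flat 2 \<in> borel_measurable borel" by (rule borel_measurable_continuous_onI[OF continuous_flat])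
  have slope_b: "slope u w' \<in> borel_measurable borel \<and> (\<lambda>y. slope u y w) \<in> borel_measurable borel" for u w w'
    unfolding slope_def by measurable
  have slope_l [measurable]: "(\<lambda>y. slope u y w) \<in> borel_measurable lebesgue" for u w
    by (rule measurable_completion) (use slope_b in simp)
  have bm [measurable]: "bump e z \<in> borel_measurable lebesgue" for z :: 'a
    by (rule measurable_completion) (simp, measurable)
  have slope_le: "\<bar>slope u y w\<bar> \<le> 48 / e * norm w" for u y w unfolding slope_def by (rule bump_slope_le[OF e])
  have slope_0: "slope u y w = 0" if "y \<notin> cball 0 R" "norm u + e \<le> R" for u y w R
    unfolding slope_def using bump_eq_0[OF e far_from_center[OF that(2,1)], of 2] by simp
  have deriv: "((\<lambda>t. bump e (x + t *\<^sub>R v) y) has_real_derivative slope (x + t *\<^sub>R v) y v) (at t)" for t y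
  proof -
    have "((\<lambda>t. x + t *\<^sub>R v) has_derivative (\<lambda>h. h *\<^sub>R v)) (at t)"
      by (auto intro!: derivative_eq_intros)
    from has_derivative_compose[OF this has_derivative_flat_ball[of 0 y e "x + t *\<^sub>R v"]]
    have "((\<lambda>t. bump e y (x + t *\<^sub>R v)) has_derivative (\<lambda>h. h * slope (x + t *\<^sub>R v) y v)) (at t)"
      unfolding bump_def slope_def
      by (simp add: inner_diff_left inner_diff_right inner_add_left inner_add_right inner_commute algebra_simps numeral_2_eq_2)
    then show ?thesis by (simp add: has_field_derivative_def bump_commute[of e _ y] mult.commute[of _ "slope _ _ _"] mult_commute_abs)
  qed
  have "((\<lambda>h. (smear e f (x + (t + h) *\<^sub>R v) - smear e f z) / h) \<longlongrightarrow> (LINT y|lebesgue. f y * slope z y v)) (at 0)"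
    unfolding tendsto_at_iff_sequentially comp_def
  proof (intro allI impI)
    fix H :: "nat \<Rightarrow> real" assume Hne: "\<forall>i. H i \<in> UNIV - {0}" and H: "H \<longlonglongrightarrow> 0"
    obtain B where B: "\<And>i. norm (H i) \<le> B" using Bseq_def convergent_imp_Bseq H convergentI by metis
    \<comment> \<open>All centres occurring along the bounded sequence \<open>H\<close> have their
      bumps supported in the ball of this radius, which yields a common integrable majorant.\<close>
    define R where "R = norm x + (\<bar>t\<bar> + \<bar>B\<bar>) * norm v + e"
    have R: "norm (x + s *\<^sub>R v) + e \<le> R" if "\<bar>s\<bar> \<le> \<bar>t\<bar> + \<bar>B\<bar>" for s
    proof -
      have "norm (x + s *\<^sub>R v) \<le> norm x + \<bar>s\<bar> * norm v" using norm_triangle_ineq[of x "s *\<^sub>R v"] by simp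
      also have "\<dots> \<le> norm x + (\<bar>t\<bar> + \<bar>B\<bar>) * norm v" using that by (intro add_left_mono mult_right_mono) auto
      finally show ?thesis by (simp add: R_def)
    qed
    have quot: "(smear e f (x + (t + H i) *\<^sub>R v) - smear e f z) / H i =
        (LINT y|lebesgue. f y * ((bump e (x + (t + H i) *\<^sub>R v) y - bump e z y) / H i))" for i
    proof -
      have "smear e f (x + (t + H i) *\<^sub>R v) - smear e f z = (LINT y|lebesgue. f y * bump e (x + (t + H i) *\<^sub>R v) y - f y * bump e z y)"
        unfolding smear_def by (rule Bochner_Integration.integral_diff[symmetric]) (intro bump_integrable[OF f e])+
      then show ?thesis by (simp flip: Bochner_Integration.integral_divide_zero add: right_diff_distrib diff_divide_distrib)
    qed
    show "(\<lambda>i. (smear e f (x + (t + H i) *\<^sub>R v) - smear e f z) / H i) \<longlonglongrightarrow> (LINT y|lebesgue. f y * slope z y v)"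
      unfolding quot
    proof (rule integral_dominated_convergence[where w="\<lambda>y. (48 / e * norm v) * (\<bar>f y\<bar> * indicator (cball 0 R) y)"])
      show "integrable lebesgue (\<lambda>y. (48 / e * norm v) * (\<bar>f y\<bar> * indicator (cball 0 R) y))" by (rule integrable_truncation[OF f])
      have "(\<lambda>i. (bump e (x + (t + H i) *\<^sub>R v) y - bump e z y) / H i) \<longlonglongrightarrow> slope z y v" for y
        using deriv[of y t] H Hne unfolding DERIV_def tendsto_at_iff_sequentially comp_def z_def by blast
      then show "AE y in lebesgue. (\<lambda>i. f y * ((bump e (x + (t + H i) *\<^sub>R v) y - bump e z y) / H i)) \<longlonglongrightarrow> f y * slope z y v"
        by (intro always_eventually allI tendsto_mult tendsto_const)
      show "AE y in lebesgue. norm (f y * ((bump e (x + (t + H i) *\<^sub>R v) y - bump e z y) / H i)) \<le> (48 / e * norm v) * (\<bar>f y\<bar> * indicator (cball 0 R) y)" for i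
      proof (intro always_eventually allI)
        fix y
        have h: "H i \<noteq> 0" using Hne by auto
        show "norm (f y * ((bump e (x + (t + H i) *\<^sub>R v) y - bump e z y) / H i)) \<le> (48 / e * norm v) * (\<bar>f y\<bar> * indicator (cball 0 R) y)"
        proof (cases "y \<in> cball 0 R")
          case True
          \<comment> \<open>Mean value inequality: the difference quotients of the bump are bounded
            by the bound on \<open>slope\<close>, uniformly in the step.\<close>
          have "norm (bump e (x + (t + H i) *\<^sub>R v) y - bump e (x + t *\<^sub>R v) y) \<le> (48 / e * norm v) * norm (t + H i - t)"
            by (rule field_differentiable_bound[OF convex_UNIV, of "\<lambda>t. bump e (x + t *\<^sub>R v) y" "\<lambda>t. slope (x + t *\<^sub>R v) y v"])
              (use deriv slope_le in auto)
          then have "\<bar>(bump e (x + (t + H i) *\<^sub>R v) y - bump e z y) / H i\<bar> \<le> 48 / e * norm v"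
            using h by (simp add: z_def abs_divide divide_le_eq)
          then have "\<bar>f y\<bar> * \<bar>(bump e (x + (t + H i) *\<^sub>R v) y - bump e z y) / H i\<bar> \<le> \<bar>f y\<bar> * (48 / e * norm v)"
            by (rule mult_left_mono) simp
          then show ?thesis using True by (simp only: real_norm_def abs_mult indicator_simps mult_1_right mult.commute[of "48 / e * norm v"])
        next
          case False
          have "\<bar>t + H i\<bar> \<le> \<bar>t\<bar> + \<bar>B\<bar>" using B[of i] abs_triangle_ineq[of t "H i"] by simp
          then have "bump e (x + (t + H i) *\<^sub>R v) y = 0" by (intro bump_outside e far_from_center[OF R False])
          moreover have "bump e z y = 0" unfolding z_def by (intro bump_outside e far_from_center[OF R False]) simp
          ultimately show ?thesis using False by simp
        qed
      qed
    qed measurable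
  qed
  moreover have "(LINT y|lebesgue. f y * slope z y v) = (\<Sum>b\<in>Basis. (v \<bullet> b) * smear e (\<lambda>y. g y \<bullet> b) z)"
  proof -
    have slope_sum: "slope z y v = (\<Sum>b\<in>Basis. (v \<bullet> b) * slope z y b)" for y
    proof -
      have "(y - z) \<bullet> v = (\<Sum>b\<in>Basis. (v \<bullet> b) * ((y - z) \<bullet> b))"
        by (subst euclidean_inner) (simp add: mult.commute)
      then show ?thesis unfolding slope_def by (simp add: sum_distrib_left mult_ac)
    qed
    have int: "integrable lebesgue (\<lambda>y. f y * slope z y b)" for b
      by (rule integrable_mult_kernel[OF f, where M="48 / e * norm b" and R="norm z + e"])
        (use slope_b slope_le slope_0 in auto)
    have "(LINT y|lebesgue. f y * slope z y v) = (LINT y|lebesgue. (\<Sum>b\<in>Basis. (v \<bullet> b) * (f y * slope z y b)))"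
      unfolding slope_sum by (intro Bochner_Integration.integral_cong refl) (simp add: sum_distrib_left mult_ac)
    also have "\<dots> = (\<Sum>b\<in>Basis. (v \<bullet> b) * (LINT y|lebesgue. f y * slope z y b))"
      by (subst Bochner_Integration.integral_sum) (auto intro!: integrable_mult_right int)
    also have "\<dots> = (\<Sum>b\<in>Basis. (v \<bullet> b) * smear e (\<lambda>y. g y \<bullet> b) z)"
    proof (intro sum.cong refl arg_cong2[where f="(*)"])
      fix b :: 'a assume b: "b \<in> Basis"
      have "dist_partial b (dist_of f) (bump e z) = dist_of (\<lambda>y. g y \<bullet> b) (bump e z)"
        using g b test_function_bump[OF e] unfolding has_gradient_def by blast
      moreover have "dist_partial b (dist_of f) (bump e z) = (LINT y|lebesgue. f y * slope z y b)"
        unfolding dist_partial_def dist_of_def iter_partial_bump slope_def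
        by (simp add: inner_diff_left inner_commute algebra_simps flip: Bochner_Integration.integral_minus)
      ultimately show "(LINT y|lebesgue. f y * slope z y b) = smear e (\<lambda>y. g y \<bullet> b) z"
        by (simp add: smear_def dist_of_def)
    qed
    finally show ?thesis .
  qed
  ultimately show ?thesis unfolding DERIV_def z_def by simp
qed

text \<open>Along a segment in direction \<open>v\<close> the derivative of the smeared function is
  the smeared component of \<open>g\<close> along \<open>v\<close>, hence at most the norm of
  \<open>v\<close> times the smeared norm of \<open>g\<close>. The one-dimensional estimate
  \<open>level_set_measure_le\<close> then gives the localised inequality for every set of levels at
  once. \<open>G\<close> is a Borel representative, as \<open>g\<close> itself is only Lebesgue
  measurable.\<close>

lemma smear_upper_gradient:
  fixes f :: "'a::euclidean_space \<Rightarrow> real"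
  assumes f: "locally_integrable f" and g: "has_gradient (dist_of f) g" and e: "e > 0" and c: "c \<ge> 0"
    and [measurable]: "G \<in> borel_measurable borel" and G: "AE y in lborel. ennreal (norm (g y)) = G y"
  shows "upper_gradient (\<lambda>x. c * smear e f x) (\<lambda>x. \<integral>\<^sup>+y. ennreal (c * bump e x y) * G y \<partial>lborel)"
proof -
  define Ge where "Ge x = (\<integral>\<^sup>+y. ennreal (c * bump e x y) * G y \<partial>lborel)" for x
  have [measurable]: "Ge \<in> borel_measurable borel" unfolding Ge_def by measurable
  define D where "D v z = (\<Sum>b\<in>Basis. (v \<bullet> b) * smear e (\<lambda>y. g y \<bullet> b) z)" for v z
  have gl: "locally_integrable (\<lambda>y. g y \<bullet> b)" if "b \<in> Basis" for b using g that by (simp add: has_gradient_def)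
  have cont: "continuous_on UNIV (smear e f)" by (rule continuous_smear[OF f e])
  have Dcont: "continuous_on UNIV (D v)" for v
    unfolding D_def by (intro continuous_intros continuous_smear gl e)
  have D_le: "ennreal \<bar>c * D v z\<bar> \<le> ennreal (norm v) * Ge z" for v z
  proof -
    have int: "integrable lebesgue (\<lambda>y. (g y \<bullet> b) * bump e z y)" if "b \<in> Basis" for b
      by (rule bump_integrable[OF gl[OF that] e])
    have sum_eq: "(\<Sum>b\<in>Basis. (v \<bullet> b) * ((g y \<bullet> b) * bump e z y)) = (g y \<bullet> v) * bump e z y" for y
      by (subst euclidean_inner[of "g y" v]) (simp add: sum_distrib_left mult_ac)
    have "D v z = (\<Sum>b\<in>Basis. (LINT y|lebesgue. (v \<bullet> b) * ((g y \<bullet> b) * bump e z y)))"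
      unfolding D_def smear_def by simp
    also have "\<dots> = (LINT y|lebesgue. (\<Sum>b\<in>Basis. (v \<bullet> b) * ((g y \<bullet> b) * bump e z y)))"
      by (rule Bochner_Integration.integral_sum[symmetric]) (intro integrable_mult_right int)
    also have "\<dots> = (LINT y|lebesgue. (g y \<bullet> v) * bump e z y)"
      by (simp only: sum_eq)
    finally have Deq: "D v z = (LINT y|lebesgue. (g y \<bullet> v) * bump e z y)" .
    have "integrable lebesgue (\<lambda>y. (\<Sum>b\<in>Basis. (v \<bullet> b) * ((g y \<bullet> b) * bump e z y)))"
      by (intro Bochner_Integration.integrable_sum integrable_mult_right int)
    then have "integrable lebesgue (\<lambda>y. (g y \<bullet> v) * bump e z y)" by (simp only: sum_eq)
    then have "ennreal (norm (LINT y|lebesgue. (g y \<bullet> v) * bump e z y)) \<le> (\<integral>\<^sup>+y. ennreal (norm ((g y \<bullet> v) * bump e z y)) \<partial>lebesgue)"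
      by (rule integral_norm_bound_ennreal)
    also have "\<dots> \<le> (\<integral>\<^sup>+y. ennreal (norm v) * (ennreal (bump e z y) * ennreal (norm (g y))) \<partial>lebesgue)"
    proof (rule nn_integral_mono)
      fix y
      have "\<bar>g y \<bullet> v\<bar> * \<bar>bump e z y\<bar> \<le> (norm (g y) * norm v) * bump e z y"
        using bump_nonneg[of e z y] Cauchy_Schwarz_ineq2[of "g y" v] by (simp add: mult_right_mono)
      then have "ennreal (norm ((g y \<bullet> v) * bump e z y)) \<le> ennreal (norm v * (bump e z y * norm (g y)))"
        by (intro ennreal_leI) (simp add: abs_mult mult_ac)
      then show "ennreal (norm ((g y \<bullet> v) * bump e z y)) \<le> ennreal (norm v) * (ennreal (bump e z y) * ennreal (norm (g y)))"
        by (simp add: ennreal_mult bump_nonneg)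
    qed
    also have "\<dots> = (\<integral>\<^sup>+y. ennreal (norm v) * (ennreal (bump e z y) * G y) \<partial>lborel)"
      unfolding nn_integral_completion by (rule nn_integral_cong_AE) (use G in eventually_elim, simp)
    finally have "ennreal \<bar>D v z\<bar> \<le> (\<integral>\<^sup>+y. ennreal (norm v) * (ennreal (bump e z y) * G y) \<partial>lborel)"
      by (simp add: Deq)
    then have "ennreal c * ennreal \<bar>D v z\<bar> \<le> ennreal c * (\<integral>\<^sup>+y. ennreal (norm v) * (ennreal (bump e z y) * G y) \<partial>lborel)"
      by (rule mult_left_mono) simp
    also have "\<dots> = (\<integral>\<^sup>+y. ennreal c * (ennreal (norm v) * (ennreal (bump e z y) * G y)) \<partial>lborel)"
      by (rule nn_integral_cmult[symmetric]) measurable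
    also have "\<dots> = (\<integral>\<^sup>+y. ennreal (norm v) * (ennreal (c * bump e z y) * G y) \<partial>lborel)"
      using c by (intro nn_integral_cong) (simp add: ennreal_mult bump_nonneg mult_ac)
    also have "\<dots> = ennreal (norm v) * Ge z"
      unfolding Ge_def by (rule nn_integral_cmult) measurable
    finally show ?thesis using c by (simp add: abs_mult ennreal_mult)
  qed
  have "emeasure lborel (b \<inter> {\<alpha>..\<beta>}) \<le> ennreal (norm (x - y)) *
          (\<integral>\<^sup>+t\<in>{0..1}. indicator b (c * smear e f (x + t *\<^sub>R (y - x))) * Ge (x + t *\<^sub>R (y - x)) \<partial>lborel)"
    if b: "b \<in> sets borel" and \<alpha>: "min (c * smear e f x) (c * smear e f y) \<le> \<alpha>" and \<beta>: "\<beta> \<le> max (c * smear e f x) (c * smear e f y)"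
    for x y \<alpha> \<beta> b
  proof -
    note [measurable] = b borel_measurable_continuous_onI[OF cont]
    have "emeasure lborel (b \<inter> {\<alpha>..\<beta>}) \<le> (\<integral>\<^sup>+t\<in>{0..1}. indicator b (c * smear e f (x + t *\<^sub>R (y - x))) * ennreal \<bar>c * D (y - x) (x + t *\<^sub>R (y - x))\<bar> \<partial>lborel)"
    proof (rule level_set_measure_le[where g="\<lambda>t. c * smear e f (x + t *\<^sub>R (y - x))" and g'="\<lambda>t. c * D (y - x) (x + t *\<^sub>R (y - x))"])
      show "((\<lambda>t. c * smear e f (x + t *\<^sub>R (y - x))) has_real_derivative c * D (y - x) (x + t *\<^sub>R (y - x))) (at t)" for t
        unfolding D_def by (intro DERIV_cmult smear_gradient[OF f g e])
      show "continuous_on UNIV (\<lambda>t. c * D (y - x) (x + t *\<^sub>R (y - x)))"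
        by (intro continuous_on_mult continuous_on_const continuous_on_compose2[OF Dcont] continuous_intros) auto
    qed (use b \<alpha> \<beta> in auto)
    also have "\<dots> \<le> (\<integral>\<^sup>+t. ennreal (norm (x - y)) * (indicator b (c * smear e f (x + t *\<^sub>R (y - x))) * Ge (x + t *\<^sub>R (y - x)) * indicator {0..1} t) \<partial>lborel)"
    proof (rule nn_integral_mono)
      fix t
      show "indicator b (c * smear e f (x + t *\<^sub>R (y - x))) * ennreal \<bar>c * D (y - x) (x + t *\<^sub>R (y - x))\<bar> * indicator {0..1} t
        \<le> ennreal (norm (x - y)) * (indicator b (c * smear e f (x + t *\<^sub>R (y - x))) * Ge (x + t *\<^sub>R (y - x)) * indicator {0..1} t)"
        using D_le[of "y - x" "x + t *\<^sub>R (y - x)"] by (auto simp: indicator_def norm_minus_commute)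
    qed
    also have "\<dots> = ennreal (norm (x - y)) *
          (\<integral>\<^sup>+t\<in>{0..1}. indicator b (c * smear e f (x + t *\<^sub>R (y - x))) * Ge (x + t *\<^sub>R (y - x)) \<partial>lborel)"
      by (rule nn_integral_cmult) measurable
    finally show ?thesis .
  qed
  then show ?thesis
    unfolding upper_gradient_def Ge_def[symmetric] using cont by (auto intro!: continuous_intros)
qed

text \<open>Tonelli lets the mollifier act on \<open>u\<close> instead of \<open>G\<close>. The bump
  is at most 1 and supported in a ball of radius \<open>e\<close>, so the result is controlled by
  \<open>maximal u\<close> with a constant in which \<open>e\<close> cancels.\<close>

lemma smear_maximal_le:
  assumes [measurable]: "G \<in> borel_measurable borel" "u \<in> borel_measurable borel" and e: "e > 0"
    and c: "c = 1 / (e ^ DIM('a) * bump_mass TYPE('a))"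
  shows "(\<integral>\<^sup>+x. (\<integral>\<^sup>+y. ennreal (c * bump e x y) * G y \<partial>lborel) * u x \<partial>lborel) \<le>
    ennreal (2 ^ DIM('a) / bump_mass TYPE('a)) * (\<integral>\<^sup>+y. G y * maximal u (y :: 'a::euclidean_space) \<partial>lborel)"
proof -
  have c0: "c > 0" using e bump_mass(1)[where 'a='a] by (simp add: c)
  have "(\<integral>\<^sup>+x. (\<integral>\<^sup>+y. ennreal (c * bump e x y) * G y \<partial>lborel) * u x \<partial>lborel) =
     (\<integral>\<^sup>+x. (\<integral>\<^sup>+y. ennreal (c * bump e x y) * G y * u x \<partial>lborel) \<partial>lborel)"
    by (intro nn_integral_cong nn_integral_multc[symmetric]) measurable
  also have "\<dots> = (\<integral>\<^sup>+y. (\<integral>\<^sup>+x. ennreal (c * bump e x y) * G y * u x \<partial>lborel) \<partial>lborel)"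
    by (rule lborel_pair.Fubini') measurable
  also have "\<dots> \<le> (\<integral>\<^sup>+y. ennreal (2 ^ DIM('a) / bump_mass TYPE('a)) * (G y * maximal u y) \<partial>lborel)"
  proof (rule nn_integral_mono)
    fix y
    have "(\<integral>\<^sup>+x. ennreal (c * bump e x y) * G y * u x \<partial>lborel) \<le> (\<integral>\<^sup>+x. (ennreal c * G y) * (u x * indicator (cball y e) x) \<partial>lborel)"
    proof (rule nn_integral_mono)
      fix x
      show "ennreal (c * bump e x y) * G y * u x \<le> (ennreal c * G y) * (u x * indicator (cball y e) x)"
      proof (cases "x \<in> cball y e")
        case True
        have "ennreal (c * bump e x y) \<le> ennreal c" using c0 bump_le_1[of e x y] by (intro ennreal_leI) simp
        then have "ennreal (c * bump e x y) * (G y * u x) \<le> ennreal c * (G y * u x)" by (rule mult_right_mono) simp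
        then show ?thesis using True by (simp add: mult_ac)
      next
        case False
        then have "bump e x y = 0" using e by (intro bump_outside) (auto simp: dist_norm)
        then show ?thesis by simp
      qed
    qed
    also have "\<dots> = (ennreal c * G y) * (\<integral>\<^sup>+x\<in>cball y e. u x \<partial>lborel)" by (rule nn_integral_cmult) measurable
    also have "\<dots> \<le> (ennreal c * G y) * (ennreal ((2 * e) ^ DIM('a)) * maximal u y)"
      using e by (intro mult_left_mono ball_le_maximal) auto
    also have "\<dots> = (ennreal c * ennreal ((2 * e) ^ DIM('a))) * (G y * maximal u y)" by (simp add: mult_ac)
    also have "ennreal c * ennreal ((2 * e) ^ DIM('a)) = ennreal (2 ^ DIM('a) / bump_mass TYPE('a))"
      using c0 e by (subst ennreal_mult[symmetric]) (auto simp: c power_mult_distrib)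
    finally show "(\<integral>\<^sup>+x. ennreal (c * bump e x y) * G y * u x \<partial>lborel) \<le> ennreal (2 ^ DIM('a) / bump_mass TYPE('a)) * (G y * maximal u y)" .
  qed
  also have "\<dots> = ennreal (2 ^ DIM('a) / bump_mass TYPE('a)) * (\<integral>\<^sup>+y. G y * maximal u y \<partial>lborel)"
    by (rule nn_integral_cmult) measurable
  finally show ?thesis .
qed

section \<open>Approximation in L1 and almost everywhere\<close>

lemma nn_integral_tendsto_0:
  fixes h :: "nat \<Rightarrow> 'a \<Rightarrow> real"
  assumes [measurable]: "\<And>k. h k \<in> borel_measurable M" "w \<in> borel_measurable M"
    and b: "\<And>k. AE x in M. \<bar>h k x\<bar> \<le> w x" and w: "(\<integral>\<^sup>+x. ennreal (w x) \<partial>M) < \<infinity>"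
    and lim: "AE x in M. (\<lambda>k. h k x) \<longlonglongrightarrow> 0"
  shows "(\<lambda>k. \<integral>\<^sup>+x. ennreal \<bar>h k x\<bar> \<partial>M) \<longlonglongrightarrow> 0"
proof -
  have "(\<lambda>k. \<integral>\<^sup>+x. ennreal \<bar>h k x\<bar> \<partial>M) \<longlonglongrightarrow> (\<integral>\<^sup>+x. 0 \<partial>M)"
  proof (rule nn_integral_dominated_convergence[where w="\<lambda>x. ennreal (w x)"])
    show "AE x in M. ennreal \<bar>h k x\<bar> \<le> ennreal (w x)" for k
      using b[of k] by eventually_elim (rule ennreal_leI)
    show "AE x in M. (\<lambda>k. ennreal \<bar>h k x\<bar>) \<longlonglongrightarrow> 0"
      using lim
    proof eventually_elim
      case (elim x)
      have "(\<lambda>k. ennreal \<bar>h k x\<bar>) \<longlonglongrightarrow> ennreal \<bar>0\<bar>" by (intro tendsto_ennrealI tendsto_rabs elim)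
      then show ?case by simp
    qed
  qed (use w in auto)
  then show ?thesis by simp
qed

text \<open>Cutting off large values costs little by dominated convergence. The cut-off function is
  then approximated through continuous functions converging almost everywhere to \<open>f\<close> on
  the ball; cutting these at the same height supplies the majorant for a second application of
  dominated convergence.\<close>

lemma L1_continuous_approx:
  fixes f :: "'a::euclidean_space \<Rightarrow> real"
  assumes [measurable]: "f \<in> borel_measurable borel" and fin: "(\<integral>\<^sup>+x\<in>cball 0 R. ennreal \<bar>f x\<bar> \<partial>lborel) < \<infinity>" and \<delta>: "\<delta> > 0"
  obtains g where "continuous_on UNIV g" "(\<integral>\<^sup>+x\<in>cball 0 R. ennreal \<bar>f x - g x\<bar> \<partial>lborel) < ennreal \<delta>"
proof -
  define B where "B = cball (0::'a) R"
  have [measurable]: "B \<in> sets borel" by (simp add: B_def)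
  define cut where "cut A s = max (- A) (min A s)" for A s :: real
  have "(\<lambda>k. \<integral>\<^sup>+x. ennreal \<bar>indicator B x * (f x - cut (real k) (f x))\<bar> \<partial>lborel) \<longlonglongrightarrow> 0"
  proof (rule nn_integral_tendsto_0[where w="\<lambda>x. indicator B x * \<bar>f x\<bar>"])
    show "AE x in lborel. \<bar>indicator B x * (f x - cut (real k) (f x))\<bar> \<le> indicator B x * \<bar>f x\<bar>" for k
      by (auto simp: cut_def indicator_def)
    have "(\<lambda>k. indicator B x * (f x - cut (real k) (f x))) \<longlonglongrightarrow> 0" for x
    proof (rule tendsto_eventually)
      obtain N :: nat where "\<bar>f x\<bar> \<le> real N" using real_arch_simple by blast
      then have "indicator B x * (f x - cut (real k) (f x)) = 0" if "k \<ge> N" for k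
        using that by (auto simp: cut_def max_def min_def)
      then show "\<forall>\<^sub>F k in sequentially. indicator B x * (f x - cut (real k) (f x)) = 0"
        using eventually_sequentially by blast
    qed
    then show "AE x in lborel. (\<lambda>k. indicator B x * (f x - cut (real k) (f x))) \<longlonglongrightarrow> 0" by simp
    show "(\<integral>\<^sup>+x. ennreal (indicator B x * \<bar>f x\<bar>) \<partial>lborel) < \<infinity>"
      using fin by (simp add: B_def ennreal_indicator ennreal_mult mult.commute)
  qed (auto simp: cut_def)
  then have "\<forall>\<^sub>F k in sequentially. (\<integral>\<^sup>+x. ennreal \<bar>indicator B x * (f x - cut (real k) (f x))\<bar> \<partial>lborel) < ennreal (\<delta> / 2)"
    using \<delta> by (intro order_tendstoD) auto
  then obtain k where k: "(\<integral>\<^sup>+x. ennreal \<bar>indicator B x * (f x - cut (real k) (f x))\<bar> \<partial>lborel) < ennreal (\<delta> / 2)"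
    using eventually_happens'[OF sequentially_bot] by blast
  define A where "A = real k"
  have "f measurable_on B"
    by (subst measurable_on_iff_borel_measurable) (auto intro!: measurable_restrict_space1 measurable_completion)
  then obtain N h where N: "negligible N" and hc: "\<And>i. continuous_on UNIV (h i)"
    and hl: "\<And>x. x \<notin> N \<Longrightarrow> (\<lambda>i. h i x) \<longlonglongrightarrow> (if x \<in> B then f x else 0)"
    unfolding measurable_on_def by blast
  have [measurable]: "h i \<in> borel_measurable borel" for i by (rule borel_measurable_continuous_onI[OF hc])
  have "(\<lambda>i. \<integral>\<^sup>+x. ennreal \<bar>indicator B x * (cut A (f x) - cut A (h i x))\<bar> \<partial>lborel) \<longlonglongrightarrow> 0"
  proof (rule nn_integral_tendsto_0[where w="\<lambda>x. indicator B x * (2 * A)"])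
    show "AE x in lborel. \<bar>indicator B x * (cut A (f x) - cut A (h i x))\<bar> \<le> indicator B x * (2 * A)" for i
      by (auto simp: cut_def indicator_def A_def)
    have "AE x in lborel. x \<notin> N"
      using N by (simp add: negligible_iff_null_sets null_sets_completion_iff2 AE_lebesgue_iff_lborel[symmetric] AE_not_in)
    then show "AE x in lborel. (\<lambda>i. indicator B x * (cut A (f x) - cut A (h i x))) \<longlonglongrightarrow> 0"
    proof eventually_elim
      case (elim x)
      show ?case
      proof (cases "x \<in> B")
        case True
        then have "(\<lambda>i. cut A (h i x)) \<longlonglongrightarrow> cut A (f x)" unfolding cut_def using hl[OF elim] by (intro tendsto_intros) simp
        then have "(\<lambda>i. cut A (f x) - cut A (h i x)) \<longlonglongrightarrow> cut A (f x) - cut A (f x)" by (intro tendsto_intros)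
        then show ?thesis using True by simp
      qed simp
    qed
    have "(\<integral>\<^sup>+x. ennreal (indicator B x * (2 * A)) \<partial>lborel) = ennreal (2 * A) * emeasure lborel B"
      by (subst nn_integral_cmult_indicator[symmetric]) (auto intro!: nn_integral_cong simp: indicator_def)
    also have "\<dots> < \<infinity>" using emeasure_lborel_cball_finite[of "0::'a" R] by (simp add: B_def ennreal_mult_less_top)
    finally show "(\<integral>\<^sup>+x. ennreal (indicator B x * (2 * A)) \<partial>lborel) < \<infinity>" .
  qed (auto simp: cut_def)
  then have "\<forall>\<^sub>F i in sequentially. (\<integral>\<^sup>+x. ennreal \<bar>indicator B x * (cut A (f x) - cut A (h i x))\<bar> \<partial>lborel) < ennreal (\<delta> / 2)"
    using \<delta> by (intro order_tendstoD) auto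
  then obtain i where i: "(\<integral>\<^sup>+x. ennreal \<bar>indicator B x * (cut A (f x) - cut A (h i x))\<bar> \<partial>lborel) < ennreal (\<delta> / 2)"
    using eventually_happens'[OF sequentially_bot] by blast
  show ?thesis
  proof (rule that[of "\<lambda>x. cut A (h i x)"])
    show "continuous_on UNIV (\<lambda>x. cut A (h i x))" unfolding cut_def by (intro continuous_intros hc)
    have [measurable]: "cut A \<in> borel_measurable borel" unfolding cut_def by measurable
    have "(\<integral>\<^sup>+x\<in>cball 0 R. ennreal \<bar>f x - cut A (h i x)\<bar> \<partial>lborel) \<le>
      (\<integral>\<^sup>+x. ennreal \<bar>indicator B x * (f x - cut A (f x))\<bar> + ennreal \<bar>indicator B x * (cut A (f x) - cut A (h i x))\<bar> \<partial>lborel)"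
      by (intro nn_integral_mono) (auto simp: B_def indicator_def simp flip: ennreal_plus intro!: ennreal_leI)
    also have "\<dots> = (\<integral>\<^sup>+x. ennreal \<bar>indicator B x * (f x - cut A (f x))\<bar> \<partial>lborel) + (\<integral>\<^sup>+x. ennreal \<bar>indicator B x * (cut A (f x) - cut A (h i x))\<bar> \<partial>lborel)"
      by (rule nn_integral_add) measurable
    also have "\<dots> < ennreal (\<delta> / 2) + ennreal (\<delta> / 2)"
      using k i unfolding A_def by (rule add_strict_mono)
    also have "\<dots> = ennreal \<delta>" using \<delta> by (simp flip: ennreal_plus)
    finally show "(\<integral>\<^sup>+x\<in>cball 0 R. ennreal \<bar>f x - cut A (h i x)\<bar> \<partial>lborel) < ennreal \<delta>" .
  qed
qed

text \<open>The function is compared with a continuous \<open>g\<close>. The L1 error enters twice,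
  directly and smeared, and smearing does not increase it; the oscillation of \<open>g\<close> over
  distance \<open>e\<close> is small by uniform continuity. Each of the three contributions is at
  most \<open>\<delta>\<close> / 4.\<close>

lemma smear_L1_approx:
  fixes f f0 :: "'a::euclidean_space \<Rightarrow> real"
  assumes f: "locally_integrable f" and [measurable]: "f0 \<in> borel_measurable borel" and ae: "AE y in lborel. f y = f0 y"
    and \<delta>: "\<delta> > 0"
  obtains e where "e > 0"
    "(\<integral>\<^sup>+x\<in>cball 0 R. ennreal \<bar>1 / (e ^ DIM('a) * bump_mass TYPE('a)) * smear e f x - f0 x\<bar> \<partial>lborel) \<le> ennreal \<delta>"
proof -
  have ae': "AE y in lebesgue. f y = f0 y" using ae by (simp add: AE_lebesgue_iff_lborel)
  have "f absolutely_integrable_on cball 0 (R + 1)" using f by (simp add: locally_integrable_def)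
  then have "(\<integral>\<^sup>+x. ennreal (norm (indicator (cball 0 (R + 1)) x *\<^sub>R f x)) \<partial>lebesgue) < \<infinity>"
    by (simp add: set_integrable_def integrable_iff_bounded)
  also have "(\<integral>\<^sup>+x. ennreal (norm (indicator (cball 0 (R + 1)) x *\<^sub>R f x)) \<partial>lebesgue) = (\<integral>\<^sup>+x\<in>cball 0 (R + 1). ennreal \<bar>f0 x\<bar> \<partial>lborel)"
    unfolding nn_integral_completion by (rule nn_integral_cong_AE) (use ae in eventually_elim, auto simp: indicator_def)
  finally obtain g where gc: "continuous_on UNIV g"
    and gd: "(\<integral>\<^sup>+x\<in>cball 0 (R + 1). ennreal \<bar>f0 x - g x\<bar> \<partial>lborel) < ennreal (\<delta> / 4)"
    using L1_continuous_approx[of f0 "R + 1" "\<delta> / 4"] \<delta> by auto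
  have [measurable]: "g \<in> borel_measurable borel" by (rule borel_measurable_continuous_onI[OF gc])
  define vol where "vol = measure lborel (cball (0::'a) R)"
  have vol: "emeasure lborel (cball (0::'a) R) = ennreal vol" "vol \<ge> 0"
    using emeasure_lborel_cball_finite[of "0::'a" R] by (auto simp: vol_def emeasure_eq_ennreal_measure)
  define \<omega> where "\<omega> = \<delta> / (4 * (vol + 1))"
  have \<omega>: "\<omega> > 0" "\<omega> * vol \<le> \<delta> / 4" using \<delta> vol(2) by (auto simp: \<omega>_def field_simps)
  have "uniformly_continuous_on (cball 0 (R + 1)) g"
    by (intro compact_uniformly_continuous continuous_on_subset[OF gc]) auto
  then obtain d where d: "d > 0" "\<And>x y. x \<in> cball 0 (R + 1) \<Longrightarrow> y \<in> cball 0 (R + 1) \<Longrightarrow> dist y x < d \<Longrightarrow> dist (g y) (g x) < \<omega>"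
    using \<omega>(1) unfolding uniformly_continuous_on_def by meson
  \<comment> \<open>Below the modulus of continuity, and at most 1 so that points near the ball of
    radius \<open>R\<close> stay in the ball of radius \<open>R + 1\<close>.\<close>
  define e where "e = min (d / 2) 1"
  have e: "e > 0" "e < d" "e \<le> 1" using d(1) by (auto simp: e_def)
  define c where "c = 1 / (e ^ DIM('a) * bump_mass TYPE('a))"
  have c: "c > 0" using e bump_mass(1)[where 'a='a] by (simp add: c_def)
  have mass: "(\<integral>\<^sup>+y. ennreal (c * bump e x y) \<partial>lborel) = 1" for x :: 'a
  proof -
    have "(\<integral>\<^sup>+y. ennreal (c * bump e x y) \<partial>lborel) = (\<integral>\<^sup>+y. ennreal c * ennreal (bump e x y) \<partial>lborel)"
      using c by (simp add: ennreal_mult bump_nonneg)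
    also have "\<dots> = ennreal c * (\<integral>\<^sup>+y. ennreal (bump e x y) \<partial>lborel)" by (rule nn_integral_cmult) measurable
    also have "\<dots> = 1" using e bump_mass(1)[where 'a='a] unfolding bump_mass(2)[OF e(1)]
      by (subst ennreal_mult[symmetric]) (auto simp: c_def)
    finally show ?thesis .
  qed
  have mass': "(\<integral>\<^sup>+x. ennreal (c * bump e x y) \<partial>lborel) = 1" for y :: 'a
    using mass[of y] by (simp add: bump_commute[of e _ y])
  have pointwise: "ennreal \<bar>c * smear e f x - f0 x\<bar> \<le> (\<integral>\<^sup>+y. ennreal (c * bump e x y) * ennreal \<bar>f0 y - f0 x\<bar> \<partial>lborel)" for x
  proof -
    have one: "locally_integrable (\<lambda>_. 1 :: real)" 
      by (auto simp: locally_integrable_def absolutely_integrable_on_const lmeasurable_compact)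
    have ib: "integrable lebesgue (bump e x)" using bump_integrable[OF one e(1), of x] by simp
    have if': "integrable lebesgue (\<lambda>y. f y * bump e x y)" by (rule bump_integrable[OF f e(1)])
    have "c * (LINT y|lebesgue. bump e x y) = 1"
    proof -
      have "(LINT y|lebesgue. c * bump e x y) = enn2real (\<integral>\<^sup>+y. ennreal (c * bump e x y) \<partial>lebesgue)"
        using c ib by (intro integral_eq_nn_integral) (auto simp: bump_nonneg)
      then show ?thesis by (simp add: nn_integral_completion mass)
    qed
    then have "c * smear e f x - f0 x = c * (LINT y|lebesgue. f y * bump e x y) - f0 x * (c * (LINT y|lebesgue. bump e x y))"
      by (simp add: smear_def)
    also have "\<dots> = (LINT y|lebesgue. c * (f y * bump e x y) - f0 x * c * bump e x y)"
      using if' ib by (subst Bochner_Integration.integral_diff) auto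
    also have "\<dots> = (LINT y|lebesgue. (c * bump e x y) * (f y - f0 x))"
      by (simp add: algebra_simps)
    finally have eq: "c * smear e f x - f0 x = (LINT y|lebesgue. (c * bump e x y) * (f y - f0 x))" .
    have "integrable lebesgue (\<lambda>y. c * (f y * bump e x y) - f0 x * c * bump e x y)"
      using if' ib by (intro Bochner_Integration.integrable_diff integrable_mult_right)
    then have "integrable lebesgue (\<lambda>y. (c * bump e x y) * (f y - f0 x))" by (simp add: algebra_simps)
    then have "ennreal (norm (LINT y|lebesgue. (c * bump e x y) * (f y - f0 x))) \<le> (\<integral>\<^sup>+y. ennreal (norm ((c * bump e x y) * (f y - f0 x))) \<partial>lebesgue)"
      by (rule integral_norm_bound_ennreal)
    also have "\<dots> = (\<integral>\<^sup>+y. ennreal (c * bump e x y) * ennreal \<bar>f0 y - f0 x\<bar> \<partial>lborel)"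
      unfolding nn_integral_completion
      by (rule nn_integral_cong_AE) (use ae in \<open>eventually_elim, insert c, simp add: abs_mult ennreal_mult bump_nonneg\<close>)
    finally show ?thesis by (simp add: eq)
  qed
  let ?B = "cball (0::'a) R" and ?B1 = "cball (0::'a) (R + 1)"
  have split: "indicator ?B x * (ennreal (c * bump e x y) * ennreal \<bar>f0 y - f0 x\<bar>) \<le>
      ennreal (c * bump e x y) * (ennreal \<bar>f0 y - g y\<bar> * indicator ?B1 y)
      + ennreal (c * bump e x y) * (ennreal \<omega> * indicator ?B x)
      + ennreal (c * bump e x y) * (ennreal \<bar>f0 x - g x\<bar> * indicator ?B1 x)" for x y
  proof (cases "x \<in> ?B \<and> norm (y - x) < e")
    case True
    then have x: "x \<in> ?B1" by auto
    have "norm y \<le> norm x + norm (y - x)" using norm_triangle_ineq[of x "y - x"] by simp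
    then have y: "y \<in> ?B1" using True e by auto
    have "dist (g y) (g x) < \<omega>" using d(2)[OF x y] True e by (simp add: dist_norm)
    then have "\<bar>f0 y - f0 x\<bar> \<le> \<bar>f0 y - g y\<bar> + \<omega> + \<bar>f0 x - g x\<bar>" by (simp add: dist_real_def)
    then have "ennreal \<bar>f0 y - f0 x\<bar> \<le> ennreal (\<bar>f0 y - g y\<bar> + \<omega> + \<bar>f0 x - g x\<bar>)" by (rule ennreal_leI)
    also have "\<dots> = ennreal \<bar>f0 y - g y\<bar> + ennreal \<omega> + ennreal \<bar>f0 x - g x\<bar>" using \<omega> by simp
    finally have "ennreal (c * bump e x y) * ennreal \<bar>f0 y - f0 x\<bar> \<le> ennreal (c * bump e x y) * (ennreal \<bar>f0 y - g y\<bar> + ennreal \<omega> + ennreal \<bar>f0 x - g x\<bar>)"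
      by (rule mult_left_mono) simp
    then show ?thesis using True x y by (simp add: distrib_left)
  next
    case False
    then have "indicator ?B x * ennreal (c * bump e x y) = 0"
      using bump_outside[OF e(1), of y x] by (auto simp: indicator_def)
    then have "indicator ?B x * (ennreal (c * bump e x y) * ennreal \<bar>f0 y - f0 x\<bar>) = 0" by auto
    then show ?thesis by (metis zero_le)
  qed
  have "(\<integral>\<^sup>+x\<in>?B. ennreal \<bar>c * smear e f x - f0 x\<bar> \<partial>lborel) \<le>
    (\<integral>\<^sup>+x. (\<integral>\<^sup>+y. indicator ?B x * (ennreal (c * bump e x y) * ennreal \<bar>f0 y - f0 x\<bar>) \<partial>lborel) \<partial>lborel)"
  proof (rule nn_integral_mono)
    fix x
    have "ennreal \<bar>c * smear e f x - f0 x\<bar> * indicator ?B x \<le> indicator ?B x * (\<integral>\<^sup>+y. ennreal (c * bump e x y) * ennreal \<bar>f0 y - f0 x\<bar> \<partial>lborel)"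
      using pointwise[of x] by (simp add: indicator_def)
    also have "\<dots> = (\<integral>\<^sup>+y. indicator ?B x * (ennreal (c * bump e x y) * ennreal \<bar>f0 y - f0 x\<bar>) \<partial>lborel)"
      by (rule nn_integral_cmult[symmetric]) measurable
    finally show "ennreal \<bar>c * smear e f x - f0 x\<bar> * indicator ?B x \<le> (\<integral>\<^sup>+y. indicator ?B x * (ennreal (c * bump e x y) * ennreal \<bar>f0 y - f0 x\<bar>) \<partial>lborel)" .
  qed
  also have "\<dots> \<le> (\<integral>\<^sup>+x. (\<integral>\<^sup>+y. ennreal (c * bump e x y) * (ennreal \<bar>f0 y - g y\<bar> * indicator ?B1 y)
      + ennreal (c * bump e x y) * (ennreal \<omega> * indicator ?B x)
      + ennreal (c * bump e x y) * (ennreal \<bar>f0 x - g x\<bar> * indicator ?B1 x) \<partial>lborel) \<partial>lborel)"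
    by (intro nn_integral_mono split)
  also have "\<dots> = (\<integral>\<^sup>+x. (\<integral>\<^sup>+y. ennreal (c * bump e x y) * (ennreal \<bar>f0 y - g y\<bar> * indicator ?B1 y) \<partial>lborel)
      + ennreal \<omega> * indicator ?B x + ennreal \<bar>f0 x - g x\<bar> * indicator ?B1 x \<partial>lborel)"
    by (intro nn_integral_cong) (simp add: nn_integral_add nn_integral_multc mass)
  also have "\<dots> = (\<integral>\<^sup>+x. (\<integral>\<^sup>+y. ennreal (c * bump e x y) * (ennreal \<bar>f0 y - g y\<bar> * indicator ?B1 y) \<partial>lborel) \<partial>lborel)
      + ennreal \<omega> * emeasure lborel ?B + (\<integral>\<^sup>+x\<in>?B1. ennreal \<bar>f0 x - g x\<bar> \<partial>lborel)"
    by (simp add: nn_integral_add nn_integral_cmult_indicator)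
  also have "(\<integral>\<^sup>+x. (\<integral>\<^sup>+y. ennreal (c * bump e x y) * (ennreal \<bar>f0 y - g y\<bar> * indicator ?B1 y) \<partial>lborel) \<partial>lborel) =
     (\<integral>\<^sup>+y. (\<integral>\<^sup>+x. ennreal (c * bump e x y) * (ennreal \<bar>f0 y - g y\<bar> * indicator ?B1 y) \<partial>lborel) \<partial>lborel)"
    by (rule lborel_pair.Fubini') measurable
  also have "\<dots> = (\<integral>\<^sup>+y\<in>?B1. ennreal \<bar>f0 y - g y\<bar> \<partial>lborel)"
    by (intro nn_integral_cong) (simp add: nn_integral_multc mass')
  also have "ennreal \<omega> * emeasure lborel ?B = ennreal (\<omega> * vol)" using \<omega> vol by (simp add: ennreal_mult)
  also have "(\<integral>\<^sup>+y\<in>?B1. ennreal \<bar>f0 y - g y\<bar> \<partial>lborel) + ennreal (\<omega> * vol) + (\<integral>\<^sup>+x\<in>?B1. ennreal \<bar>f0 x - g x\<bar> \<partial>lborel) \<le>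
    ennreal (\<delta> / 4) + ennreal (\<delta> / 4) + ennreal (\<delta> / 4)"
    using gd \<omega> by (intro add_mono ennreal_leI) auto
  also have "\<dots> = ennreal (\<delta> / 4 + \<delta> / 4 + \<delta> / 4)" using \<delta> by (simp flip: ennreal_plus)
  also have "\<dots> \<le> ennreal \<delta>" using \<delta> by (intro ennreal_leI) simp
  finally show ?thesis using that[OF e(1)] by (simp add: c_def)
qed

text \<open>With error at most 2^-k on the ball of radius k, the errors are summable, so their sum
  is finite almost everywhere; each point belongs to all but finitely many of the balls.\<close>

lemma smear_AE_approx:
  fixes f f0 :: "'a::euclidean_space \<Rightarrow> real"
  assumes f: "locally_integrable f" and [measurable]: "f0 \<in> borel_measurable borel" and ae: "AE y in lborel. f y = f0 y"
  obtains e :: "nat \<Rightarrow> real" where "\<And>k. e k > 0"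
    "AE x in lborel. (\<lambda>k. 1 / (e k ^ DIM('a) * bump_mass TYPE('a)) * smear (e k) f x) \<longlonglongrightarrow> f0 x"
proof -
  have "\<exists>e>0. (\<integral>\<^sup>+x\<in>cball 0 (real k). ennreal \<bar>1 / (e ^ DIM('a) * bump_mass TYPE('a)) * smear e f x - f0 x\<bar> \<partial>lborel) \<le> ennreal ((1/2) ^ k)" for k
    by (rule smear_L1_approx[OF assms, of "(1/2) ^ k" "real k"]) auto
  then obtain e where e: "\<And>k. e k > 0"
    "\<And>k. (\<integral>\<^sup>+x\<in>cball 0 (real k). ennreal \<bar>1 / (e k ^ DIM('a) * bump_mass TYPE('a)) * smear (e k) f x - f0 x\<bar> \<partial>lborel) \<le> ennreal ((1/2) ^ k)"
    by metis
  define F where "F k x = 1 / (e k ^ DIM('a) * bump_mass TYPE('a)) * smear (e k) f x" for k x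
  have [measurable]: "smear (e k) f \<in> borel_measurable borel" for k
    by (rule borel_measurable_continuous_onI[OF continuous_smear[OF f e(1)]])
  have [measurable]: "F k \<in> borel_measurable borel" for k unfolding F_def by measurable
  have "(\<integral>\<^sup>+x. (\<Sum>k. ennreal \<bar>F k x - f0 x\<bar> * indicator (cball 0 (real k)) x) \<partial>lborel)
     = (\<Sum>k. \<integral>\<^sup>+x\<in>cball 0 (real k). ennreal \<bar>F k x - f0 x\<bar> \<partial>lborel)"
    by (rule nn_integral_suminf) measurable
  also have "\<dots> \<le> (\<Sum>k. ennreal ((1/2) ^ k))" unfolding F_def by (intro suminf_le e(2)) auto
  also have "\<dots> = ennreal (\<Sum>k. (1/2) ^ k)" by (rule suminf_ennreal2) (auto intro: summable_geometric)
  also have "\<dots> < \<infinity>" by simp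
  finally have "AE x in lborel. (\<Sum>k. ennreal \<bar>F k x - f0 x\<bar> * indicator (cball 0 (real k)) x) \<noteq> \<infinity>"
    by (intro nn_integral_PInf_AE) (auto simp: less_top)
  then have "AE x in lborel. (\<lambda>k. F k x) \<longlonglongrightarrow> f0 x"
  proof eventually_elim
    case (elim x)
    have eq: "ennreal \<bar>F k x - f0 x\<bar> * indicator (cball 0 (real k)) x = ennreal (\<bar>F k x - f0 x\<bar> * indicator (cball 0 (real k)) x)" for k
      by (simp add: indicator_def)
    have "summable (\<lambda>k. \<bar>F k x - f0 x\<bar> * indicator (cball 0 (real k)) x)"
      using elim unfolding eq by (intro summable_suminf_not_top) (auto simp: indicator_def)
    then have "(\<lambda>k. \<bar>F k x - f0 x\<bar> * indicator (cball 0 (real k)) x) \<longlonglongrightarrow> 0" by (rule summable_LIMSEQ_zero)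
    moreover obtain N :: nat where N: "norm x \<le> real N" using real_arch_simple by blast
    have "\<forall>\<^sub>F k in sequentially. \<bar>F k x - f0 x\<bar> * indicator (cball 0 (real k)) x = \<bar>F k x - f0 x\<bar>"
      using eventually_ge_at_top[of N] by eventually_elim (use N in \<open>auto simp: indicator_def\<close>)
    ultimately have "(\<lambda>k. \<bar>F k x - f0 x\<bar>) \<longlonglongrightarrow> 0" by (simp cong: tendsto_cong add: tendsto_cong)
    then show ?case by (simp add: tendsto_rabs_zero_iff LIM_zero_iff)
  qed
  then show ?thesis using that e(1) unfolding F_def by blast
qed

section \<open>Passage to Sobolev functions\<close>

lemma borel_measurable_bad_pairs:
  fixes h :: "'a::euclidean_space \<Rightarrow> real"
  assumes [measurable]: "h \<in> borel_measurable borel"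
  shows "(\<lambda>p. indicator {p. l * norm (fst p - snd p) powr a < \<bar>h (fst p) - h (snd p)\<bar>} p *
      ennreal (norm (fst p - snd p) powr q)) \<in> borel_measurable (borel \<Otimes>\<^sub>M borel)"
  by measurable

text \<open>The maximal function is iterated once more, as mollifying the gradient moves the average to \<open>w\<close>.\<close>

lemma weak_estimate_Sobolev:
  fixes \<gamma> :: real
  assumes \<gamma>: "\<gamma> < -1 \<or> \<gamma> > 0"
  obtains K where "K > 0"
    "\<And>(f :: 'a::euclidean_space \<Rightarrow> real) g w l. locally_integrable f \<Longrightarrow> has_gradient (dist_of f) g \<Longrightarrow> w \<in> borel_measurable borel \<Longrightarrow> l > 0 \<Longrightarrow>
      (\<integral>\<^sup>+x. w x * E_integral \<gamma> l \<gamma> f x \<partial>lborel)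
      \<le> ennreal (K / l) * ((\<integral>\<^sup>+z. ennreal (norm (g z)) * maximal (maximal w) z \<partial>lborel) +
          (\<integral>\<^sup>+z. ennreal (norm (g z)) * maximal (maximal (maximal w)) z \<partial>lborel))"
proof -
  define core where "core K \<longleftrightarrow> (\<forall>(f :: 'a \<Rightarrow> real) G w l. upper_gradient f G \<longrightarrow> w \<in> borel_measurable borel \<longrightarrow> l > 0 \<longrightarrow>
      (\<integral>\<^sup>+x. (\<integral>\<^sup>+y. w x * (indicator {p. l * norm (fst p - snd p) powr (1 + \<gamma>) < \<bar>f (fst p) - f (snd p)\<bar>} (x, y) *
          ennreal (norm (x - y) powr (\<gamma> - DIM('a)))) \<partial>lborel) \<partial>lborel)
      \<le> ennreal (K / l) * ((\<integral>\<^sup>+z. G z * maximal w z \<partial>lborel) + (\<integral>\<^sup>+z. G z * maximal (maximal w) z \<partial>lborel)))" for K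
  have "\<exists>K>0. core K"
  proof (cases "\<gamma> > 0")
    case True
    show ?thesis
    proof (rule weak_estimate_pos[OF True, where 'a='a])
      fix K assume "K > 0" and "\<And>(f :: 'a \<Rightarrow> real) G w l. upper_gradient f G \<Longrightarrow> w \<in> borel_measurable borel \<Longrightarrow> l > 0 \<Longrightarrow>
        (\<integral>\<^sup>+x. (\<integral>\<^sup>+y. w x * (indicator {p. l * norm (fst p - snd p) powr (1 + \<gamma>) < \<bar>f (fst p) - f (snd p)\<bar>} (x, y) *
          ennreal (norm (x - y) powr (\<gamma> - DIM('a)))) \<partial>lborel) \<partial>lborel)
      \<le> ennreal (K / l) * ((\<integral>\<^sup>+z. G z * maximal w z \<partial>lborel) + (\<integral>\<^sup>+z. G z * maximal (maximal w) z \<partial>lborel))"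
      then show ?thesis unfolding core_def by (intro exI[of _ K]) simp
    qed
  next
    case False
    then have neg: "\<gamma> < -1" using \<gamma> by simp
    show ?thesis
    proof (rule weak_estimate_neg[OF neg, where 'a='a])
      fix K assume "K > 0" and "\<And>(f :: 'a \<Rightarrow> real) G w l. upper_gradient f G \<Longrightarrow> w \<in> borel_measurable borel \<Longrightarrow> l > 0 \<Longrightarrow>
        (\<integral>\<^sup>+x. (\<integral>\<^sup>+y. w x * (indicator {p. l * norm (fst p - snd p) powr (1 + \<gamma>) < \<bar>f (fst p) - f (snd p)\<bar>} (x, y) *
          ennreal (norm (x - y) powr (\<gamma> - DIM('a)))) \<partial>lborel) \<partial>lborel)
      \<le> ennreal (K / l) * ((\<integral>\<^sup>+z. G z * maximal w z \<partial>lborel) + (\<integral>\<^sup>+z. G z * maximal (maximal w) z \<partial>lborel))"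
      then show ?thesis unfolding core_def by (intro exI[of _ K]) simp
    qed
  qed
  then obtain K where K: "K > 0" "core K" by blast
  define b where "b = 2 ^ DIM('a) / bump_mass TYPE('a)"
  have b: "b > 0" using bump_mass(1)[where 'a='a] by (simp add: b_def)
  show ?thesis
  proof (rule that[of "K * b"])
    show "K * b > 0" using K b by simp
    fix f :: "'a \<Rightarrow> real" and g and w :: "'a \<Rightarrow> ennreal" and l :: real
    assume f: "locally_integrable f" and g: "has_gradient (dist_of f) g" and [measurable]: "w \<in> borel_measurable borel" and l: "l > 0"
    have "f \<in> borel_measurable lebesgue" using f by (simp add: locally_integrable_def)
    \<comment> \<open>Product measurability is needed for functions of two points, so
      \<open>f\<close> is replaced by a Borel function. By Tonelli, null sets in either variable do
      not change the integrals.\<close>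
    then obtain f0 where f0 [measurable]: "f0 \<in> borel_measurable borel" and ae: "AE x in lborel. f x = f0 x"
      using completion_ex_borel_measurable_real[of f lborel] by auto
    have gm: "g \<in> borel_measurable lebesgue"
      using g by (subst borel_measurable_euclidean_space) (simp add: has_gradient_def locally_integrable_def)
    then have "(\<lambda>x. norm (g x)) \<in> borel_measurable lebesgue" by simp
    then obtain G0 where G0: "G0 \<in> borel_measurable borel" "AE x in lborel. norm (g x) = G0 x"
      using completion_ex_borel_measurable_real[of "\<lambda>x. norm (g x)" lborel] by auto
    define G where "G x = ennreal (G0 x)" for x
    have [measurable]: "G \<in> borel_measurable borel" using G0(1) unfolding G_def by measurable
    have G: "AE x in lborel. ennreal (norm (g x)) = G x" using G0(2) unfolding G_def by eventually_elim simp
    obtain e where e: "\<And>k. e k > 0"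
      "AE x in lborel. (\<lambda>k. 1 / (e k ^ DIM('a) * bump_mass TYPE('a)) * smear (e k) f x) \<longlonglongrightarrow> f0 x"
      by (rule smear_AE_approx[OF f f0 ae]) blast
    define c where "c k = 1 / (e k ^ DIM('a) * bump_mass TYPE('a))" for k
    define F where "F k x = c k * smear (e k) f x" for k x
    define Gk where "Gk k x = (\<integral>\<^sup>+y. ennreal (c k * bump (e k) x y) * G y \<partial>lborel)" for k x
    have c0: "c k \<ge> 0" for k using e(1)[of k] bump_mass(1)[where 'a='a] by (simp add: c_def)
    have ug: "upper_gradient (F k) (Gk k)" for k
      unfolding F_def Gk_def by (rule smear_upper_gradient[OF f g e(1) c0 _ G]) measurable
    have lim: "AE x in lborel. (\<lambda>k. F k x) \<longlonglongrightarrow> f0 x" using e(2) unfolding F_def c_def .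
    define S where "S = (\<integral>\<^sup>+z. G z * maximal (maximal w) z \<partial>lborel) + (\<integral>\<^sup>+z. G z * maximal (maximal (maximal w)) z \<partial>lborel)"
    define ker where "ker x y = ennreal (norm (x - y) powr (\<gamma> - DIM('a)))" for x y :: 'a
    define J where "J h p = indicator {p. l * norm (fst p - snd p) powr (1 + \<gamma>) < \<bar>h (fst p) - h (snd p)\<bar>} p * ker (fst p) (snd p)"
      for h :: "'a \<Rightarrow> real" and p
    have Jm: "J h \<in> borel_measurable (borel \<Otimes>\<^sub>M borel)" if "h \<in> borel_measurable borel" for h
      unfolding J_def ker_def by (rule borel_measurable_bad_pairs[OF that])
    have Jm1: "(\<lambda>y. J h (x, y)) \<in> borel_measurable lborel" if "h \<in> borel_measurable borel" for h x
      using measurable_compose[OF measurable_Pair1' Jm[OF that], of x] by simp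
    define H where "H h x y = w x * J h (x, y)" for h x y
    have HN: "(\<integral>\<^sup>+y. H h x y \<partial>lborel) = w x * (\<integral>\<^sup>+y. J h (x, y) \<partial>lborel)" if "h \<in> borel_measurable borel" for h x
      unfolding H_def by (rule nn_integral_cmult[OF Jm1[OF that]])
    have bound: "(\<integral>\<^sup>+x. (\<integral>\<^sup>+y. H (F k) x y \<partial>lborel) \<partial>lborel) \<le> ennreal (K * b / l) * S" for k
    proof -
      have "(\<integral>\<^sup>+x. (\<integral>\<^sup>+y. H (F k) x y \<partial>lborel) \<partial>lborel) \<le>
         ennreal (K / l) * ((\<integral>\<^sup>+z. Gk k z * maximal w z \<partial>lborel) + (\<integral>\<^sup>+z. Gk k z * maximal (maximal w) z \<partial>lborel))"
        using K(2) ug[of k] l unfolding core_def H_def J_def ker_def by simp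
      also have "\<dots> \<le> ennreal (K / l) * (ennreal b * (\<integral>\<^sup>+z. G z * maximal (maximal w) z \<partial>lborel) + ennreal b * (\<integral>\<^sup>+z. G z * maximal (maximal (maximal w)) z \<partial>lborel))"
        unfolding Gk_def b_def by (intro mult_left_mono add_mono smear_maximal_le e(1) c_def) auto
      also have "\<dots> = ennreal (K * b / l) * S"
        using K(1) b l by (simp add: S_def distrib_left[symmetric] mult.assoc[symmetric] ennreal_mult[symmetric])
      finally show ?thesis .
    qed
    have "(\<integral>\<^sup>+x. w x * E_integral \<gamma> l \<gamma> f x \<partial>lborel) = (\<integral>\<^sup>+x. (\<integral>\<^sup>+y. H f0 x y \<partial>lborel) \<partial>lborel)"
    proof (rule nn_integral_cong_AE)
      show "AE x in lborel. w x * E_integral \<gamma> l \<gamma> f x = (\<integral>\<^sup>+y. H f0 x y \<partial>lborel)"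
        using ae
      proof eventually_elim
        case (elim x)
        have "E_integral \<gamma> l \<gamma> f x = (\<integral>\<^sup>+y. J f0 (x, y) \<partial>lborel)"
          unfolding E_integral_def nn_integral_completion
        proof (rule nn_integral_cong_AE)
          show "AE y in lborel. indicator (E_set l \<gamma> f) (x, y) * ennreal (norm (x - y) powr (\<gamma> - real DIM('a))) = J f0 (x, y)"
            using ae by eventually_elim (auto simp: E_set_def J_def ker_def indicator_def elim)
        qed
        then show ?case using HN[OF f0] by simp
      qed
    qed
    \<comment> \<open>Lower semicontinuity: where the mollifications converge at both points, a pair
      satisfying the strict inequality in the limit satisfies it for all late \<open>k\<close>.
      Fatou is then used in each variable in turn.\<close>
    also have "\<dots> \<le> (\<integral>\<^sup>+x. (\<integral>\<^sup>+y. liminf (\<lambda>k. H (F k) x y) \<partial>lborel) \<partial>lborel)"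
    proof (rule nn_integral_mono_AE)
      show "AE x in lborel. (\<integral>\<^sup>+y. H f0 x y \<partial>lborel) \<le> (\<integral>\<^sup>+y. liminf (\<lambda>k. H (F k) x y) \<partial>lborel)"
        using lim
      proof eventually_elim
        case x: (elim x)
        show ?case
        proof (rule nn_integral_mono_AE)
          show "AE y in lborel. H f0 x y \<le> liminf (\<lambda>k. H (F k) x y)"
            using lim
          proof eventually_elim
            case y: (elim y)
            show ?case
            proof (cases "l * norm (x - y) powr (1 + \<gamma>) < \<bar>f0 x - f0 y\<bar>")
              case True
              have "(\<lambda>k. \<bar>F k x - F k y\<bar>) \<longlonglongrightarrow> \<bar>f0 x - f0 y\<bar>" by (intro tendsto_intros x y)
              then have "\<forall>\<^sub>F k in sequentially. l * norm (x - y) powr (1 + \<gamma>) < \<bar>F k x - F k y\<bar>"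
                using True by (rule order_tendstoD)
              then have "\<forall>\<^sub>F k in sequentially. H f0 x y \<le> H (F k) x y"
                by eventually_elim (simp add: H_def J_def True)
              then show ?thesis by (rule Liminf_bounded)
            qed (simp add: H_def J_def)
          qed
        qed
      qed
    qed
    also have "\<dots> \<le> (\<integral>\<^sup>+x. liminf (\<lambda>k. \<integral>\<^sup>+y. H (F k) x y \<partial>lborel) \<partial>lborel)"
    proof (rule nn_integral_mono)
      fix x
      have "H (F k) x \<in> borel_measurable lborel" for k
      proof -
        note [measurable] = Jm1[OF upper_gradientD(1)[OF ug[of k]], of x]
        show ?thesis unfolding H_def by measurable
      qed
      then show "(\<integral>\<^sup>+y. liminf (\<lambda>k. H (F k) x y) \<partial>lborel) \<le> liminf (\<lambda>k. \<integral>\<^sup>+y. H (F k) x y \<partial>lborel)"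
        by (rule nn_integral_liminf)
    qed
    also have "\<dots> \<le> liminf (\<lambda>k. \<integral>\<^sup>+x. (\<integral>\<^sup>+y. H (F k) x y \<partial>lborel) \<partial>lborel)"
    proof (rule nn_integral_liminf)
      fix k
      have "J (F k) \<in> borel_measurable (lborel \<Otimes>\<^sub>M lborel)"
        using Jm[OF upper_gradientD(1)[OF ug[of k]]]
        by (simp add: measurable_cong_sets[OF sets_pair_measure_cong[OF sets_lborel sets_lborel] refl])
      note [measurable] = lborel.borel_measurable_nn_integral_fst[OF this]
      have "(\<lambda>x. w x * (\<integral>\<^sup>+y. J (F k) (x, y) \<partial>lborel)) \<in> borel_measurable lborel" by measurable
      then show "(\<lambda>x. \<integral>\<^sup>+y. H (F k) x y \<partial>lborel) \<in> borel_measurable lborel"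
        unfolding HN[OF upper_gradientD(1)[OF ug]] .
    qed
    also have "\<dots> \<le> liminf (\<lambda>k::nat. ennreal (K * b / l) * S)"
      by (intro Liminf_mono always_eventually allI bound)
    also have "\<dots> = ennreal (K * b / l) * S" by (simp add: Liminf_const)
    also have "S = (\<integral>\<^sup>+z. ennreal (norm (g z)) * maximal (maximal w) z \<partial>lborel) + (\<integral>\<^sup>+z. ennreal (norm (g z)) * maximal (maximal (maximal w)) z \<partial>lborel)"
      unfolding S_def by (intro arg_cong2[where f="(+)"] nn_integral_cong_AE) (use G in \<open>eventually_elim, simp\<close>)+
    finally show "(\<integral>\<^sup>+x. w x * E_integral \<gamma> l \<gamma> f x \<partial>lborel)
      \<le> ennreal (K * b / l) * ((\<integral>\<^sup>+z. ennreal (norm (g z)) * maximal (maximal w) z \<partial>lborel) +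
          (\<integral>\<^sup>+z. ennreal (norm (g z)) * maximal (maximal (maximal w)) z \<partial>lborel))" .
  qed
qed

section \<open>Duality\<close>

text \<open>The associate norm extended to \<open>ennreal\<close>-valued weights, so that it can be
  evaluated at \<open>maximal w\<close> before anything is known about finiteness.\<close>

definition dual_norm :: "(('a::euclidean_space \<Rightarrow> real) \<Rightarrow> ennreal) \<Rightarrow> ('a \<Rightarrow> ennreal) \<Rightarrow> ennreal" where
  "dual_norm X w = (SUP g \<in> {g \<in> borel_measurable lebesgue. X g = 1}. \<integral>\<^sup>+x. w x * ennreal \<bar>g x\<bar> \<partial>lebesgue)"

lemma associate_norm_eq: "associate_norm X h = dual_norm X (\<lambda>x. ennreal \<bar>h x\<bar>)"
  by (simp add: associate_norm_def dual_norm_def abs_mult ennreal_mult)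

lemma dual_norm_cong_AE:
  assumes "AE x in lebesgue. v x = w x"
  shows "dual_norm X v = dual_norm X w"
  unfolding dual_norm_def
  by (intro SUP_cong refl nn_integral_cong_AE) (use assms in eventually_elim, simp)

lemma dual_norm_mono:
  assumes "\<And>x. v x \<le> w x"
  shows "dual_norm X v \<le> dual_norm X w"
  unfolding dual_norm_def by (intro SUP_mono' nn_integral_mono mult_right_mono assms) auto

lemma (in quasi_banach_function_space) Hoelder:
  assumes [measurable]: "g \<in> borel_measurable lebesgue" "w \<in> borel_measurable lebesgue" and fin: "X g < top"
  shows "(\<integral>\<^sup>+x. w x * ennreal \<bar>g x\<bar> \<partial>lebesgue) \<le> dual_norm X w * X g"
proof (cases "X g = 0")
  case True
  then have ae: "AE x in lebesgue. g x = 0" by (intro norm_eq_0D) auto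
  have "(\<integral>\<^sup>+x. w x * ennreal \<bar>g x\<bar> \<partial>lebesgue) = (\<integral>\<^sup>+(x::'a). 0 \<partial>lebesgue)"
  proof (rule nn_integral_cong_AE)
    show "AE x in lebesgue. w x * ennreal \<bar>g x\<bar> = 0" using ae by eventually_elim simp
  qed
  then show ?thesis by simp
next
  case False
  define r where "r = enn2real (X g)"
  have r: "X g = ennreal r" "r > 0"
    using False fin by (auto simp: r_def enn2real_positive_iff zero_less_iff_neq_zero less_top)
  have "X (\<lambda>x. (1 / r) * g x) = 1"
    using r by (subst norm_scale) (auto simp: ennreal_mult[symmetric] simp flip: ennreal_1)
  then have "(\<integral>\<^sup>+x. w x * ennreal \<bar>(1 / r) * g x\<bar> \<partial>lebesgue) \<le> dual_norm X w"
    unfolding dual_norm_def by (intro SUP_upper) auto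
  then have "(\<integral>\<^sup>+x. w x * ennreal \<bar>(1 / r) * g x\<bar> \<partial>lebesgue) * ennreal r \<le> dual_norm X w * X g"
    unfolding r by (rule mult_right_mono) simp
  also have "(\<integral>\<^sup>+x. w x * ennreal \<bar>(1 / r) * g x\<bar> \<partial>lebesgue) * ennreal r = (\<integral>\<^sup>+x. w x * ennreal \<bar>(1 / r) * g x\<bar> * ennreal r \<partial>lebesgue)"
    by (rule nn_integral_multc[symmetric]) measurable
  also have "\<dots> = (\<integral>\<^sup>+x. w x * ennreal \<bar>g x\<bar> \<partial>lebesgue)"
    using r by (intro nn_integral_cong) (simp add: mult.assoc abs_mult ennreal_mult[symmetric])
  finally show ?thesis .
qed

section \<open>The unit ball of the space and separating weights\<close>

lemma integrable_bounded_support: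
  fixes u :: "'a::euclidean_space \<Rightarrow> real"
  assumes [measurable]: "u \<in> borel_measurable lebesgue" and u: "\<And>x. \<bar>u x\<bar> \<le> M" "\<And>x. x \<notin> ball 0 R \<Longrightarrow> u x = 0"
  shows "integrable lebesgue u"
proof (rule Bochner_Integration.integrable_bound)
  have "emeasure lebesgue (ball (0::'a) R) < \<infinity>" using emeasure_lborel_ball_finite[of "0::'a" R] by simp
  then show "integrable lebesgue (\<lambda>x. M * indicator (ball (0::'a) R) x)"
    by (intro integrable_mult_right integrable_real_indicator) auto
  have "norm (u x) \<le> norm (M * indicator (ball 0 R) x)" for x
    using u(1)[of x] u(2)[of x] by (cases "x \<in> ball 0 R") auto
  then show "AE x in lebesgue. norm (u x) \<le> norm (M * indicator (ball 0 R) x)" by simp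
qed measurable

context ball_banach_function_space
begin

lemma norm_zero: "X (\<lambda>_. 0) = 0"
  using norm_scale[of "\<lambda>_. 0" 0] by simp

lemma norm_bounded_support_finite:
  assumes [measurable]: "u \<in> borel_measurable lebesgue" and u: "\<And>x. \<bar>u x\<bar> \<le> M" "\<And>x. x \<notin> ball 0 R \<Longrightarrow> u x = 0" and R: "R > 0"
  shows "X u < top"
proof -
  have [measurable]: "ball (0::'a) R \<in> sets lebesgue" by simp
  have "X u \<le> X (\<lambda>x. M * indicator (ball 0 R) x)"
  proof (rule norm_mono)
    have "\<bar>u x\<bar> \<le> \<bar>M * indicator (ball 0 R) x\<bar>" for x using u(1)[of x] u(2)[of x] by (cases "x \<in> ball 0 R") auto
    then show "AE x in lebesgue. \<bar>u x\<bar> \<le> \<bar>M * indicator (ball 0 R) x\<bar>" by simp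
  qed measurable
  also have "\<dots> = ennreal \<bar>M\<bar> * X (indicator (ball 0 R))" by (rule norm_scale) measurable
  also have "\<dots> < top" using indicator_ball[OF R, of 0] by (auto simp: fspace_def ennreal_mult_less_top)
  finally show ?thesis .
qed

lemma norm_convex:
  assumes a: "a \<in> borel_measurable lebesgue" "X a \<le> 1" and b: "b \<in> borel_measurable lebesgue" "X b \<le> 1" and t: "0 \<le> t" "t \<le> 1"
  shows "X (\<lambda>x. (1 - t) * a x + t * b x) \<le> 1"
proof -
  have sa: "X (\<lambda>x. (1 - t) * a x) = ennreal (1 - t) * X a" using norm_scale[OF a(1), of "1 - t"] t by simp
  have sb: "X (\<lambda>x. t * b x) = ennreal t * X b" using norm_scale[OF b(1), of t] t by simp
  have fin: "X a < top" "X b < top" using a(2) b(2) by (auto intro: le_less_trans)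
  have "X (\<lambda>x. (1 - t) * a x + t * b x) \<le> X (\<lambda>x. (1 - t) * a x) + X (\<lambda>x. t * b x)"
  proof (rule triangle)
    show "(\<lambda>x. (1 - t) * a x) \<in> fspace X" using a(1) fin unfolding fspace_def mem_Collect_eq sa by (auto simp: ennreal_mult_less_top)
    show "(\<lambda>x. t * b x) \<in> fspace X" using b(1) fin unfolding fspace_def mem_Collect_eq sb by (auto simp: ennreal_mult_less_top)
  qed
  also have "\<dots> \<le> ennreal (1 - t) * 1 + ennreal t * 1"
    unfolding sa sb by (intro add_mono mult_left_mono a b) auto
  also have "\<dots> = 1" using t by (simp flip: ennreal_plus)
  finally show ?thesis .
qed

text \<open>The functional separating $\varphi$ from the unit ball is found by projecting $\varphi$ onto
  the closed convex set $\{0 \le g \le \varphi, \|g\|_X \le 1\}$ in $L^2$. The minimizing sequence is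
  chosen so fast that it converges almost everywhere.\<close>

lemma separation:
  assumes \<phi> [measurable]: "\<phi> \<in> borel_measurable lebesgue" and \<phi>b: "\<And>x. 0 \<le> \<phi> x" "\<And>x. \<phi> x \<le> A" "\<And>x. x \<notin> ball 0 R \<Longrightarrow> \<phi> x = 0"
    and big: "X \<phi> > 1"
  obtains h c where "h \<in> borel_measurable lebesgue" "\<And>x. 0 \<le> h x" "c > 0"
    "\<And>g. g \<in> borel_measurable lebesgue \<Longrightarrow> X g \<le> 1 \<Longrightarrow> (\<integral>\<^sup>+x. ennreal (h x) * ennreal \<bar>g x\<bar> \<partial>lebesgue) \<le> ennreal c"
    "ennreal c < (\<integral>\<^sup>+x. ennreal (h x) * ennreal (\<phi> x) \<partial>lebesgue)"
proof -
  define B where "B = ball (0::'a) R"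
  have [measurable]: "B \<in> sets lebesgue" by (simp add: B_def)
  \<comment> \<open>The bounds 0 and \<open>\<phi>\<close> keep all competitors bounded with common
    bounded support, so that every integral below is finite.\<close>
  define K where "K = {g \<in> borel_measurable lebesgue. (\<forall>x. 0 \<le> g x \<and> g x \<le> \<phi> x) \<and> X g \<le> 1}"
  have KD: "g \<in> borel_measurable lebesgue" "0 \<le> g x" "g x \<le> \<phi> x" "X g \<le> 1" if "g \<in> K" for g x
    using that by (auto simp: K_def)
  have A: "A \<ge> 0" using \<phi>b(1,2)[of undefined] by linarith
  have int: "integrable lebesgue u" if "u \<in> borel_measurable lebesgue" "\<And>x. \<bar>u x\<bar> \<le> M" "\<And>x. x \<notin> B \<Longrightarrow> u x = 0" for u :: "'a \<Rightarrow> real" and M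
    by (rule integrable_bounded_support[of u M R]) (use that in \<open>auto simp: B_def\<close>)
  have sq_le: "\<bar>(a - b)\<^sup>2\<bar> \<le> A\<^sup>2" if "0 \<le> a" "a \<le> A" "0 \<le> b" "b \<le> A" for a b :: real
    using that by (simp add: abs_le_square_iff[symmetric] abs_le_iff)
  have diff_int: "integrable lebesgue (\<lambda>x. (a x - b x)\<^sup>2)"
    if [measurable]: "a \<in> borel_measurable lebesgue" "b \<in> borel_measurable lebesgue"
      and ab: "\<And>x. 0 \<le> a x \<and> a x \<le> \<phi> x" "\<And>x. 0 \<le> b x \<and> b x \<le> \<phi> x" for a b
  proof (rule int[where M="A\<^sup>2"])
    fix x
    show "\<bar>(a x - b x)\<^sup>2\<bar> \<le> A\<^sup>2" using ab(1)[of x] ab(2)[of x] \<phi>b(2)[of x] by (intro sq_le) auto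
    show "(a x - b x)\<^sup>2 = 0" if "x \<notin> B" using ab(1)[of x] ab(2)[of x] \<phi>b(3)[of x] that by (simp add: B_def)
  qed measurable
  define Q where "Q g = (LINT x|lebesgue. (\<phi> x - g x)\<^sup>2)" for g
  have Qint: "integrable lebesgue (\<lambda>x. (\<phi> x - g x)\<^sup>2)" if "g \<in> K" for g
    using KD[OF that] \<phi>b by (intro diff_int) auto
  define d where "d = Inf (Q ` K)"
  have zero: "(\<lambda>_. 0) \<in> K" using \<phi>b by (simp add: K_def norm_zero)
  have bdd: "bdd_below (Q ` K)" unfolding bdd_below_def Q_def by (intro exI[of _ 0]) (auto intro: Bochner_Integration.integral_nonneg)
  have d_le: "d \<le> Q g" if "g \<in> K" for g unfolding d_def using that bdd by (intro cInf_lower) auto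
  \<comment> \<open>The rate 16^-k gives squared distances of successive terms of at most 4 * 16^-k,
    fast enough to survive the factor 2^k introduced in the passage to L1.\<close>
  have "\<exists>g\<in>K. Q g < d + (1/16) ^ k" for k :: nat
  proof -
    have "\<exists>q\<in>Q ` K. q < d + (1/16) ^ k" unfolding d_def by (rule cInf_lessD) (use zero in auto)
    then show ?thesis by blast
  qed
  then obtain G where G: "\<And>k. G k \<in> K" "\<And>k. Q (G k) < d + (1/16) ^ k" by metis
  note [measurable] = KD(1)[OF G(1)]
  \<comment> \<open>Parallelogram identity: the midpoint of two near-minimisers lies in
    \<open>K\<close> and cannot undercut the infimum \<open>d\<close>, which forces them to be
    close.\<close>
  have step: "(LINT x|lebesgue. (G k x - G (Suc k) x)\<^sup>2) \<le> 4 * (1/16) ^ k" for k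
  proof -
    define m where "m x = (1 - 1/2) * G k x + 1/2 * G (Suc k) x" for x
    have mK: "m \<in> K"
    proof -
      have "X m \<le> 1" unfolding m_def by (rule norm_convex) (use KD[OF G(1)] in auto)
      moreover have "0 \<le> m x \<and> m x \<le> \<phi> x" for x
        using KD(2,3)[OF G(1)[of k], of x] KD(2,3)[OF G(1)[of "Suc k"], of x] by (simp add: m_def)
      ultimately show ?thesis unfolding K_def m_def by simp
    qed
    have i: "integrable lebesgue (\<lambda>x. (G k x - G (Suc k) x)\<^sup>2)"
      using KD[OF G(1)] by (intro diff_int) auto
    have "(LINT x|lebesgue. (\<phi> x - G k x)\<^sup>2 / 2 + (\<phi> x - G (Suc k) x)\<^sup>2 / 2 - (\<phi> x - m x)\<^sup>2) =
       (LINT x|lebesgue. (G k x - G (Suc k) x)\<^sup>2 / 4)"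
      by (intro Bochner_Integration.integral_cong refl) (simp add: m_def power2_eq_square field_simps)
    moreover have "(LINT x|lebesgue. (\<phi> x - G k x)\<^sup>2 / 2 + (\<phi> x - G (Suc k) x)\<^sup>2 / 2 - (\<phi> x - m x)\<^sup>2) = Q (G k) / 2 + Q (G (Suc k)) / 2 - Q m"
      using Qint[OF G(1)[of k]] Qint[OF G(1)[of "Suc k"]] Qint[OF mK] unfolding Q_def
      by (simp add: Bochner_Integration.integral_diff Bochner_Integration.integral_add)
    ultimately have "(LINT x|lebesgue. (G k x - G (Suc k) x)\<^sup>2) / 4 = Q (G k) / 2 + Q (G (Suc k)) / 2 - Q m" by simp
    also have "\<dots> \<le> (1/16) ^ k / 2 + (1/16) ^ Suc k / 2"
      using G(2)[of k] G(2)[of "Suc k"] d_le[OF mK] by linarith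
    also have "\<dots> \<le> (1/16) ^ k" by simp
    finally show ?thesis by simp
  qed
  define v where "v = measure lebesgue B"
  have v: "emeasure lebesgue B = ennreal v" unfolding v_def B_def
    using emeasure_lborel_ball_finite[of "0::'a" R] by (intro emeasure_eq_ennreal_measure) (simp add: less_top[symmetric])
  \<comment> \<open>On the support, a is at most 2^k * a^2 + 2^-k by completing the square. The
    first term is controlled by \<open>step\<close>, the second by the measure of \<open>B\<close>;
    both are summable in \<open>k\<close>.\<close>
  have L1: "(\<integral>\<^sup>+x. ennreal \<bar>G k x - G (Suc k) x\<bar> \<partial>lebesgue) \<le> ennreal ((4 + v) * (1/2) ^ k)" for k
  proof -
    have i: "integrable lebesgue (\<lambda>x. (G k x - G (Suc k) x)\<^sup>2)"
      using KD[OF G(1)] by (intro diff_int) auto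
    have "(\<integral>\<^sup>+x. ennreal \<bar>G k x - G (Suc k) x\<bar> \<partial>lebesgue) \<le>
       (\<integral>\<^sup>+x. ennreal (2 ^ k) * ennreal ((G k x - G (Suc k) x)\<^sup>2) + ennreal ((1/2) ^ k) * indicator B x \<partial>lebesgue)"
    proof (rule nn_integral_mono)
      fix x
      show "ennreal \<bar>G k x - G (Suc k) x\<bar> \<le> ennreal (2 ^ k) * ennreal ((G k x - G (Suc k) x)\<^sup>2) + ennreal ((1/2) ^ k) * indicator B x"
      proof (cases "x \<in> B")
        case True
        define a where "a = \<bar>G k x - G (Suc k) x\<bar>"
        have "0 \<le> (2 ^ k * a - 1)\<^sup>2" by simp
        then have "2 * (2 ^ k * a) \<le> 2 ^ k * (2 ^ k * a\<^sup>2) + 1" by (simp add: power2_eq_square algebra_simps)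
        then have "2 ^ k * (2 * a) \<le> 2 ^ k * (2 ^ k * a\<^sup>2 + (1/2) ^ k)" by (simp add: algebra_simps power_divide)
        then have "2 * a \<le> 2 ^ k * a\<^sup>2 + (1/2) ^ k" by simp
        moreover have "a \<ge> 0" by (simp add: a_def)
        ultimately have "a \<le> 2 ^ k * a\<^sup>2 + (1/2) ^ k" by linarith
        then have "ennreal a \<le> ennreal (2 ^ k * a\<^sup>2 + (1/2) ^ k)" by (rule ennreal_leI)
        also have "\<dots> = ennreal (2 ^ k) * ennreal (a\<^sup>2) + ennreal ((1/2) ^ k)" by (simp add: ennreal_mult)
        finally show ?thesis using True by (simp add: a_def)
      next
        case False
        then have "G k x = 0" "G (Suc k) x = 0"
          using \<phi>b(3)[of x] KD(2,3)[OF G(1)[of k], of x] KD(2,3)[OF G(1)[of "Suc k"], of x] by (auto simp: B_def)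
        then show ?thesis by simp
      qed
    qed
    also have "\<dots> = ennreal (2 ^ k) * (\<integral>\<^sup>+x. ennreal ((G k x - G (Suc k) x)\<^sup>2) \<partial>lebesgue) + ennreal ((1/2) ^ k) * ennreal v"
      by (simp add: nn_integral_add nn_integral_cmult nn_integral_cmult_indicator v)
    also have "(\<integral>\<^sup>+x. ennreal ((G k x - G (Suc k) x)\<^sup>2) \<partial>lebesgue) = ennreal (LINT x|lebesgue. (G k x - G (Suc k) x)\<^sup>2)"
      by (rule nn_integral_eq_integral[OF i]) simp
    also have "ennreal (2 ^ k) * \<dots> \<le> ennreal (2 ^ k) * ennreal (4 * (1/16) ^ k)"
      by (intro mult_left_mono ennreal_leI step) simp
    also have "\<dots> = ennreal (4 * (1/8) ^ k)"
    proof -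
      have "(2::real) ^ k * (1/16) ^ k = (1/8) ^ k" by (simp flip: power_mult_distrib)
      then show ?thesis by (simp add: ennreal_mult[symmetric])
    qed
    also have "\<dots> \<le> ennreal (4 * (1/2) ^ k)" by (intro ennreal_leI mult_left_mono power_mono) auto
    also have "ennreal (4 * (1/2) ^ k) + ennreal ((1/2) ^ k) * ennreal v = ennreal ((4 + v) * (1/2) ^ k)"
      by (simp add: v_def ennreal_mult[symmetric] ennreal_plus[symmetric] algebra_simps del: ennreal_plus)
    finally show ?thesis by (simp add: add_right_mono)
  qed
  \<comment> \<open>The lower limit is defined at every point and measurable; it is identified with
    the limit almost everywhere afterwards.\<close>
  define g0 where "g0 x = enn2real (liminf (\<lambda>k. ennreal (G k x)))" for x
  have [measurable]: "g0 \<in> borel_measurable lebesgue" unfolding g0_def by measurable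
  have li_le: "liminf (\<lambda>k. ennreal (G k x)) \<le> ennreal (\<phi> x)" for x
  proof -
    have "liminf (\<lambda>k. ennreal (G k x)) \<le> liminf (\<lambda>k::nat. ennreal (\<phi> x))"
      by (intro Liminf_mono always_eventually allI ennreal_leI KD(3) G(1))
    then show ?thesis by (simp add: Liminf_const)
  qed
  have li_fin: "liminf (\<lambda>k. ennreal (G k x)) < top" for x using li_le[of x] by (rule le_less_trans) simp
  have g0b: "0 \<le> g0 x \<and> g0 x \<le> \<phi> x" for x
    using enn2real_mono[OF li_le[of x]] \<phi>b(1)[of x] by (simp add: g0_def)
  have Xg0: "X g0 \<le> 1"
  proof -
    \<comment> \<open>Infima of tails increase to the lower limit, so the Fatou property applies to
      them, while each is dominated by a member of \<open>K\<close>.\<close>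
    define r where "r k x = enn2real (INF j\<in>{k..}. ennreal (G j x))" for k x
    have [measurable]: "r k \<in> borel_measurable lebesgue" for k unfolding r_def by measurable
    have inf_le: "(INF j\<in>{k..}. ennreal (G j x)) \<le> ennreal (G k x)" for k x by (rule INF_lower) simp
    have inf_fin: "(INF j\<in>{k..}. ennreal (G j x)) < top" for k x by (rule le_less_trans[OF inf_le]) simp
    have inc: "incseq (\<lambda>k. INF j\<in>{k..}. ennreal (G j x))" for x
      by (intro monoI INF_superset_mono) auto
    have limI: "(\<lambda>k. INF j\<in>{k..}. ennreal (G j x)) \<longlonglongrightarrow> liminf (\<lambda>k. ennreal (G k x))" for x
      unfolding liminf_SUP_INF by (rule LIMSEQ_SUP[OF inc])
    have lim: "(\<lambda>k. r k x) \<longlonglongrightarrow> g0 x" for x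
      unfolding r_def g0_def
      by (intro tendsto_enn2real) (simp_all add: ennreal_enn2real[OF li_fin[of x]] limI)
    have "incseq (\<lambda>k. r k x)" for x
      unfolding r_def using inc[of x] inf_fin by (auto simp: incseq_def intro!: enn2real_mono)
    then have "(\<lambda>k. X (r k)) \<longlonglongrightarrow> X g0"
      using norm_Fatou[of r g0] lim by (simp add: r_def)
    moreover have "X (r k) \<le> 1" for k
    proof -
      have "r k x \<le> G k x" for x
        using enn2real_mono[OF inf_le[where k=k and x=x]] KD(2)[OF G(1)] by (simp add: r_def)
      then have "\<bar>r k x\<bar> \<le> \<bar>G k x\<bar>" for x using enn2real_nonneg by (simp add: r_def abs_of_nonneg order_trans[of 0 "r k x"])
      then have "X (r k) \<le> X (G k)" by (intro norm_mono) auto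
      then show ?thesis using KD(4)[OF G(1)[of k]] by (rule order_trans)
    qed
    ultimately show ?thesis by (auto intro: LIMSEQ_le_const2)
  qed
  have g0K: "g0 \<in> K" using g0b Xg0 by (simp add: K_def)
  have conv: "AE x in lebesgue. (\<lambda>k. G k x) \<longlonglongrightarrow> g0 x"
  proof -
    have "(\<integral>\<^sup>+x. (\<Sum>k. ennreal \<bar>G k x - G (Suc k) x\<bar>) \<partial>lebesgue) = (\<Sum>k. \<integral>\<^sup>+x. ennreal \<bar>G k x - G (Suc k) x\<bar> \<partial>lebesgue)"
      by (rule nn_integral_suminf) measurable
    also have "\<dots> \<le> (\<Sum>k. ennreal ((4 + v) * (1/2) ^ k))" by (intro suminf_le L1) auto
    also have "\<dots> = ennreal (\<Sum>k. (4 + v) * (1/2) ^ k)"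
      by (rule suminf_ennreal2) (auto simp: v_def intro!: summable_mult summable_geometric)
    also have "\<dots> < \<infinity>" by simp
    finally have "AE x in lebesgue. (\<Sum>k. ennreal \<bar>G k x - G (Suc k) x\<bar>) \<noteq> \<infinity>"
      by (intro nn_integral_PInf_AE) (auto simp: less_top)
    then show ?thesis
    proof eventually_elim
      case (elim x)
      have "summable (\<lambda>k. \<bar>G k x - G (Suc k) x\<bar>)"
        using elim by (intro summable_suminf_not_top) auto
      moreover have "\<bar>G k x - G (Suc k) x\<bar> = \<bar>G (Suc k) x - G k x\<bar>" for k by (rule abs_minus_commute)
      ultimately have "summable (\<lambda>k. \<bar>G (Suc k) x - G k x\<bar>)" by simp
      then have "summable (\<lambda>k. G (Suc k) x - G k x)" by (rule summable_rabs_cancel)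
      then have "convergent (\<lambda>n. \<Sum>k<n. G (Suc k) x - G k x)" by (simp add: summable_iff_convergent)
      moreover have "(\<Sum>k<n. G (Suc k) x - G k x) = G n x - G 0 x" for n
        by (rule sum_lessThan_telescope[of "\<lambda>k. G k x"])
      ultimately have "convergent (\<lambda>n. G n x - G 0 x)" by simp
      then have "convergent (\<lambda>n. G n x)" by (simp only: convergent_diff_const_right_iff)
      then obtain l where l: "(\<lambda>n. G n x) \<longlonglongrightarrow> l" unfolding convergent_def by blast
      then have "(\<lambda>n. ennreal (G n x)) \<longlonglongrightarrow> ennreal l" by (rule tendsto_ennrealI)
      then have "liminf (\<lambda>n. ennreal (G n x)) = ennreal l" by (rule lim_imp_Liminf[rotated]) simp
      moreover have "l \<ge> 0" by (rule LIMSEQ_le_const[OF l]) (use KD(2)[OF G(1)] in auto)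
      ultimately have "g0 x = l" by (simp add: g0_def)
      then show ?case using l by simp
    qed
  qed
  have Qg0: "Q g0 = d"
  proof (rule antisym)
    have "(\<lambda>k. Q (G k)) \<longlonglongrightarrow> Q g0" unfolding Q_def
    proof (rule integral_dominated_convergence[where w="\<lambda>x. A\<^sup>2 * indicator B x"])
      show "integrable lebesgue (\<lambda>x. A\<^sup>2 * indicator B x :: real)"
        by (rule int[where M="A\<^sup>2"]) (auto simp: indicator_def)
      show "AE x in lebesgue. (\<lambda>k. (\<phi> x - G k x)\<^sup>2) \<longlonglongrightarrow> (\<phi> x - g0 x)\<^sup>2"
        using conv by eventually_elim (intro tendsto_intros)
      show "AE x in lebesgue. norm ((\<phi> x - G k x)\<^sup>2) \<le> A\<^sup>2 * indicator B x" for k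
      proof (intro always_eventually allI)
        fix x
        show "norm ((\<phi> x - G k x)\<^sup>2) \<le> A\<^sup>2 * indicator B x"
        proof (cases "x \<in> B")
          case True
          then show ?thesis using sq_le[of "\<phi> x" "G k x"] \<phi>b(1,2)[of x] KD(2,3)[OF G(1)[of k], of x] by simp
        next
          case False
          then show ?thesis using \<phi>b(3)[of x] KD(2,3)[OF G(1)[of k], of x] by (simp add: B_def)
        qed
      qed
    qed measurable
    moreover have "(\<lambda>k. d + (1/16) ^ k) \<longlonglongrightarrow> d + 0" by (intro tendsto_intros LIMSEQ_realpow_zero) auto
    ultimately show "Q g0 \<le> d"
      using G(2) by (intro LIMSEQ_le[of "\<lambda>k. Q (G k)" _ "\<lambda>k. d + (1/16) ^ k"]) (auto intro: less_imp_le)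
    show "d \<le> Q g0" by (rule d_le[OF g0K])
  qed
  define h where "h x = \<phi> x - g0 x" for x
  have [measurable]: "h \<in> borel_measurable lebesgue" unfolding h_def by measurable
  have hb: "0 \<le> h x" "h x \<le> A" for x using g0b[of x] \<phi>b(2)[of x] by (auto simp: h_def)
  have h0: "h x = 0" if "x \<notin> B" for x using g0b[of x] \<phi>b(3)[of x] that by (auto simp: h_def B_def)
  have g00: "g0 x = 0" if "x \<notin> B" for x using g0b[of x] \<phi>b(3)[of x] that by (auto simp: B_def)
  have dh: "d = (LINT x|lebesgue. (h x)\<^sup>2)" using Qg0 by (simp add: Q_def h_def)
  have ih2: "integrable lebesgue (\<lambda>x. (h x)\<^sup>2)" using Qint[OF g0K] by (simp add: h_def)
  have prod_int: "integrable lebesgue (\<lambda>x. h x * u x)"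
    if [measurable]: "u \<in> borel_measurable lebesgue" and "\<And>x. \<bar>u x\<bar> \<le> M" for u M
    by (rule int[where M="A * M"]) (use hb h0 A that in \<open>auto simp: abs_mult intro!: mult_mono\<close>)
  define c0 where "c0 = (LINT x|lebesgue. h x * g0 x)"
  have c0: "c0 \<ge> 0" unfolding c0_def by (intro Bochner_Integration.integral_nonneg) (use hb g0b in auto)
  have g0A: "\<bar>g0 x\<bar> \<le> A" for x using g0b[of x] \<phi>b(2)[of x] by simp
  have bounded_case: "(LINT x|lebesgue. h x * u x) \<le> c0"
    if [measurable]: "u \<in> borel_measurable lebesgue" and u: "\<And>x. 0 \<le> u x" "\<And>x. u x \<le> M" "\<And>x. x \<notin> B \<Longrightarrow> u x = 0" and Xu: "X u \<le> 1" for u M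
  proof -
    have iu: "integrable lebesgue (\<lambda>x. (u x - g0 x)\<^sup>2)"
    proof (rule int[where M="(M + A)\<^sup>2"])
      fix x
      have "\<bar>u x - g0 x\<bar> \<le> M + A" using u(1,2)[of x] g0A[of x] by linarith
      then show "\<bar>(u x - g0 x)\<^sup>2\<bar> \<le> (M + A)\<^sup>2" using power_mono[of "\<bar>u x - g0 x\<bar>" "M + A" 2] by simp
    qed (auto simp: u g00)
    define V where "V = (LINT x|lebesgue. (u x - g0 x)\<^sup>2)"
    have ihu: "integrable lebesgue (\<lambda>x. h x * (u x - g0 x))"
    proof (rule prod_int[where M="M + A"])
      show "\<bar>u x - g0 x\<bar> \<le> M + A" for x using u(1,2)[of x] g0A[of x] by linarith
    qed measurable
    have small: "2 * (LINT x|lebesgue. h x * (u x - g0 x)) \<le> t * V" if t: "0 < t" "t \<le> 1" for t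
    proof -
      \<comment> \<open>A convex combination may leave the order interval below
        \<open>\<phi>\<close>; taking the minimum with \<open>\<phi>\<close> restores membership in
        \<open>K\<close> and does not increase the distance to \<open>\<phi>\<close>. Minimality of
        \<open>g0\<close>, divided by \<open>t\<close> and with \<open>t\<close> tending to 0, gives
        the variational inequality.\<close>
      define y where "y x = min (\<phi> x) ((1 - t) * g0 x + t * u x)" for x
      have yK: "y \<in> K"
      proof -
        have nn: "0 \<le> (1 - t) * g0 x + t * u x" for x using t g0b[of x] u(1)[of x] by simp
        have "X y \<le> X (\<lambda>x. (1 - t) * g0 x + t * u x)"
          unfolding y_def using nn \<phi>b(1) by (intro norm_mono) auto
        also have "\<dots> \<le> 1" using t Xg0 Xu by (intro norm_convex) auto
        finally show ?thesis unfolding K_def y_def using nn \<phi>b(1) by auto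
      qed
      have "d \<le> Q y" by (rule d_le[OF yK])
      also have "Q y \<le> (LINT x|lebesgue. (h x)\<^sup>2 - (2 * t) * (h x * (u x - g0 x)) + t\<^sup>2 * (u x - g0 x)\<^sup>2)"
        unfolding Q_def
      proof (rule Bochner_Integration.integral_mono[OF Qint[OF yK]])
        show "integrable lebesgue (\<lambda>x. (h x)\<^sup>2 - (2 * t) * (h x * (u x - g0 x)) + t\<^sup>2 * (u x - g0 x)\<^sup>2)"
          by (intro Bochner_Integration.integrable_add Bochner_Integration.integrable_diff integrable_mult_right ih2 ihu iu)
        fix x
        have "\<bar>\<phi> x - y x\<bar> \<le> \<bar>h x - t * (u x - g0 x)\<bar>" by (auto simp: y_def h_def min_def algebra_simps)
        then have "(\<phi> x - y x)\<^sup>2 \<le> (h x - t * (u x - g0 x))\<^sup>2" by (simp add: abs_le_square_iff)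
        also have "\<dots> = (h x)\<^sup>2 - (2 * t) * (h x * (u x - g0 x)) + t\<^sup>2 * (u x - g0 x)\<^sup>2"
          by (simp add: power2_eq_square algebra_simps)
        finally show "(\<phi> x - y x)\<^sup>2 \<le> (h x)\<^sup>2 - (2 * t) * (h x * (u x - g0 x)) + t\<^sup>2 * (u x - g0 x)\<^sup>2" .
      qed
      also have "\<dots> = d - (2 * t) * (LINT x|lebesgue. h x * (u x - g0 x)) + t\<^sup>2 * V"
        unfolding dh V_def using ih2 ihu iu
        by (simp add: Bochner_Integration.integral_add Bochner_Integration.integral_diff del: Bochner_Integration.integral_mult_right_zero add: Bochner_Integration.integral_mult_right)
      finally have "t * (2 * (LINT x|lebesgue. h x * (u x - g0 x))) \<le> t * (t * V)" by (simp add: power2_eq_square)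
      then show ?thesis using t by simp
    qed
    have "V \<ge> 0" unfolding V_def by (intro Bochner_Integration.integral_nonneg) auto
    have "2 * (LINT x|lebesgue. h x * (u x - g0 x)) \<le> 0"
    proof (rule field_le_epsilon)
      fix \<epsilon> :: real assume \<epsilon>: "\<epsilon> > 0"
      define t where "t = min 1 (\<epsilon> / (V + 1))"
      have t: "0 < t" "t \<le> 1" using \<epsilon> \<open>V \<ge> 0\<close> by (auto simp: t_def)
      have "t * V \<le> \<epsilon> / (V + 1) * V" using \<open>V \<ge> 0\<close> by (intro mult_right_mono) (auto simp: t_def)
      also have "\<dots> \<le> \<epsilon>" using \<open>V \<ge> 0\<close> \<epsilon> by (simp add: field_simps)
      finally show "2 * (LINT x|lebesgue. h x * (u x - g0 x)) \<le> 0 + \<epsilon>" using small[OF t] by simp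
    qed
    moreover have "(LINT x|lebesgue. h x * (u x - g0 x)) = (LINT x|lebesgue. h x * u x) - c0"
    proof -
      have "integrable lebesgue (\<lambda>x. h x * u x)" by (rule prod_int[where M=M]) (use u in auto)
      moreover have "integrable lebesgue (\<lambda>x. h x * g0 x)" by (rule prod_int[where M=A]) (use g0A in auto)
      ultimately show ?thesis unfolding c0_def by (simp add: right_diff_distrib)
    qed
    ultimately show ?thesis by simp
  qed
  have general: "(\<integral>\<^sup>+x. ennreal (h x) * ennreal \<bar>g x\<bar> \<partial>lebesgue) \<le> ennreal c0"
    if [measurable]: "g \<in> borel_measurable lebesgue" and Xg: "X g \<le> 1" for g
  proof -
    define u where "u k x = min \<bar>g x\<bar> (real k) * indicator B x" for k :: nat and x
    have [measurable]: "u k \<in> borel_measurable lebesgue" for k unfolding u_def by measurable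
    have ub: "0 \<le> u k x" "u k x \<le> real k" "x \<notin> B \<Longrightarrow> u k x = 0" "u k x \<le> \<bar>g x\<bar>" for k x
      by (auto simp: u_def indicator_def)
    have "ennreal (h x) * ennreal \<bar>g x\<bar> = (SUP k. ennreal (h x) * ennreal (u k x))" for x
    proof (rule antisym)
      obtain N :: nat where "\<bar>g x\<bar> \<le> real N" using real_arch_simple by blast
      then have "ennreal (h x) * ennreal \<bar>g x\<bar> = ennreal (h x) * ennreal (u N x)"
        using h0[of x] by (cases "x \<in> B") (auto simp: u_def)
      then show "ennreal (h x) * ennreal \<bar>g x\<bar> \<le> (SUP k. ennreal (h x) * ennreal (u k x))" by (intro SUP_upper2[of N]) auto
      show "(SUP k. ennreal (h x) * ennreal (u k x)) \<le> ennreal (h x) * ennreal \<bar>g x\<bar>"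
        by (intro SUP_least mult_left_mono ennreal_leI ub) simp
    qed
    then have "(\<integral>\<^sup>+x. ennreal (h x) * ennreal \<bar>g x\<bar> \<partial>lebesgue) = (\<integral>\<^sup>+x. (SUP k. ennreal (h x) * ennreal (u k x)) \<partial>lebesgue)" by simp
    also have "\<dots> = (SUP k. \<integral>\<^sup>+x. ennreal (h x) * ennreal (u k x) \<partial>lebesgue)"
    proof (rule nn_integral_monotone_convergence_SUP)
      show "incseq (\<lambda>k x. ennreal (h x) * ennreal (u k x))"
        by (intro monoI le_funI mult_left_mono ennreal_leI) (auto simp: u_def indicator_def)
    qed measurable
    also have "\<dots> \<le> ennreal c0"
    proof (rule SUP_least)
      fix k
      have "X (u k) \<le> X g" using ub by (intro norm_mono) auto
      then have "X (u k) \<le> 1" using Xg by simp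
      then have le: "(LINT x|lebesgue. h x * u k x) \<le> c0" by (intro bounded_case[where M="real k"] ub) auto
      have "(\<integral>\<^sup>+x. ennreal (h x) * ennreal (u k x) \<partial>lebesgue) = (\<integral>\<^sup>+x. ennreal (h x * u k x) \<partial>lebesgue)"
        using hb ub by (simp add: ennreal_mult)
      also have "\<dots> = ennreal (LINT x|lebesgue. h x * u k x)"
      proof (rule nn_integral_eq_integral)
        show "integrable lebesgue (\<lambda>x. h x * u k x)" by (rule prod_int[where M="real k"]) (use ub in auto)
      qed (use hb ub in auto)
      finally show "(\<integral>\<^sup>+x. ennreal (h x) * ennreal (u k x) \<partial>lebesgue) \<le> ennreal c0" using le by (simp add: ennreal_leI)
    qed
    finally show ?thesis .
  qed
  have dpos: "d > 0"
  proof (rule ccontr)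
    assume "\<not> d > 0"
    moreover have "0 \<le> (LINT x|lebesgue. (h x)\<^sup>2)" by (rule Bochner_Integration.integral_nonneg) simp
    ultimately have "(LINT x|lebesgue. (h x)\<^sup>2) = 0" using dh by linarith
    then have "AE x in lebesgue. (h x)\<^sup>2 = 0" using integral_nonneg_eq_0_iff_AE[OF ih2] by auto
    then have "AE x in lebesgue. \<bar>\<phi> x\<bar> \<le> \<bar>g0 x\<bar>" by eventually_elim (simp add: h_def)
    then have "X \<phi> \<le> X g0" by (intro norm_mono) auto
    then show False using big Xg0 by (meson leD order_trans)
  qed
  show ?thesis
  \<comment> \<open>The pairing with \<open>h\<close> is at most \<open>c0\<close> on the unit ball
    and equals c0 + d at \<open>\<phi>\<close>. The midpoint c0 + d/2 separates strictly and is
    positive even if \<open>c0\<close> vanishes.\<close>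
  proof (rule that[of h "c0 + d / 2"])
    show "c0 + d / 2 > 0" using c0 dpos by simp
    show "(\<integral>\<^sup>+x. ennreal (h x) * ennreal \<bar>g x\<bar> \<partial>lebesgue) \<le> ennreal (c0 + d / 2)"
      if "g \<in> borel_measurable lebesgue" "X g \<le> 1" for g
      using general[OF that] by (rule order_trans) (use dpos in \<open>auto intro: ennreal_leI\<close>)
    have i1: "integrable lebesgue (\<lambda>x. h x * g0 x)" by (rule prod_int[where M=A]) (use g0A in auto)
    have "(\<integral>\<^sup>+x. ennreal (h x) * ennreal (\<phi> x) \<partial>lebesgue) = (\<integral>\<^sup>+x. ennreal (h x * \<phi> x) \<partial>lebesgue)"
      using hb \<phi>b by (simp add: ennreal_mult)
    also have "\<dots> = (\<integral>\<^sup>+x. ennreal (h x * g0 x + (h x)\<^sup>2) \<partial>lebesgue)"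
      by (intro nn_integral_cong arg_cong[where f=ennreal]) (simp add: h_def power2_eq_square algebra_simps)
    also have "\<dots> = ennreal (LINT x|lebesgue. h x * g0 x + (h x)\<^sup>2)"
      by (rule nn_integral_eq_integral) (use i1 ih2 hb g0b in auto)
    also have "(LINT x|lebesgue. h x * g0 x + (h x)\<^sup>2) = c0 + d" using i1 ih2 by (simp add: c0_def dh)
    finally show "ennreal (c0 + d / 2) < (\<integral>\<^sup>+x. ennreal (h x) * ennreal (\<phi> x) \<partial>lebesgue)"
      using c0 dpos by (simp add: ennreal_less_iff)
  qed (use hb in auto)
qed


text \<open>The Fatou property reduces the claim to bounded functions of bounded support. If the
  norm of such a truncation exceeded \<open>L\<close>, the separating function, rescaled by 1/c and
  replaced by a Borel representative, would be an admissible weight violating the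
  assumption.\<close>

lemma norm_le_duality:
  assumes F [measurable]: "F \<in> borel_measurable lebesgue" and F0: "\<And>x. 0 \<le> F x"
    and le: "\<And>w. w \<in> borel_measurable borel \<Longrightarrow> dual_norm X w \<le> 1 \<Longrightarrow> (\<integral>\<^sup>+x. ennreal (F x) * w x \<partial>lebesgue) \<le> L"
  shows "X F \<le> L"
proof (rule ccontr)
  assume "\<not> X F \<le> L"
  then have XF: "L < X F" by simp
  define Fm where "Fm m x = min (F x) (real m) * indicator (ball 0 (real m)) x" for m :: nat and x
  have [measurable]: "ball (0::'a) (real m) \<in> sets lebesgue" for m by simp
  have [measurable]: "Fm m \<in> borel_measurable lebesgue" for m unfolding Fm_def by measurable
  have "(\<lambda>m. X (Fm m)) \<longlonglongrightarrow> X F"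
  proof -
    have inc: "incseq (\<lambda>m. Fm m x)" for x
    proof (rule monoI)
      fix m n :: nat assume mn: "m \<le> n"
      then have "ball (0::'a) (real m) \<subseteq> ball 0 (real n)" by (simp add: subset_ball)
      then show "Fm m x \<le> Fm n x" using mn F0[of x] by (auto simp: Fm_def indicator_def)
    qed
    have "(\<lambda>m. Fm m x) \<longlonglongrightarrow> F x" for x
    proof (rule tendsto_eventually)
      obtain N :: nat where N: "max (F x) (norm x + 1) \<le> real N" using real_arch_simple by blast
      have "Fm m x = F x" if "m \<ge> N" for m
      proof -
        have "max (F x) (norm x + 1) \<le> real m" using N that by (meson le_trans of_nat_mono order_trans)
        then show ?thesis by (simp add: Fm_def)
      qed
      then show "\<forall>\<^sub>F m in sequentially. Fm m x = F x" using eventually_sequentially by blast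
    qed
    then show ?thesis using norm_Fatou[of Fm F] inc F0 by (simp add: Fm_def)
  qed
  then have "\<forall>\<^sub>F m in sequentially. L < X (Fm m)" using XF by (rule order_tendstoD)
  then have "\<forall>\<^sub>F m in sequentially. L < X (Fm m) \<and> m \<ge> 1" using eventually_ge_at_top[of 1] by (rule eventually_conj)
  then obtain m where m: "L < X (Fm m)" "m \<ge> 1" using eventually_happens'[OF sequentially_bot] by blast
  have Fmb: "0 \<le> Fm m x" "Fm m x \<le> real m" "x \<notin> ball 0 (real m) \<Longrightarrow> Fm m x = 0" "Fm m x \<le> F x" for x
    using F0[of x] by (auto simp: Fm_def indicator_def)
  have fin: "X (Fm m) < top"
    by (rule norm_bounded_support_finite[where M="real m" and R="real m"]) (use Fmb m in auto)
  \<comment> \<open>An intermediate value is positive and finite even when \<open>L\<close> is 0, so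
    the truncation can be divided by it and still has norm above 1.\<close>
  obtain b where b: "L < b" "b < X (Fm m)" using dense[OF m(1)] by blast
  define \<beta> where "\<beta> = enn2real b"
  have \<beta>: "b = ennreal \<beta>" "\<beta> > 0"
    using b fin by (auto simp: \<beta>_def enn2real_positive_iff less_top intro: le_less_trans[OF zero_le])
  define \<phi> where "\<phi> x = (1 / \<beta>) * Fm m x" for x
  have [measurable]: "\<phi> \<in> borel_measurable lebesgue" unfolding \<phi>_def by measurable
  have "X \<phi> = ennreal (1 / \<beta>) * X (Fm m)" unfolding \<phi>_def using \<beta> by (subst norm_scale) auto
  moreover have "ennreal (1 / \<beta>) * ennreal \<beta> < ennreal (1 / \<beta>) * X (Fm m)"
    using b \<beta> by (intro ennreal_mult_strict_left_mono) auto
  moreover have "ennreal (1 / \<beta>) * ennreal \<beta> = 1" using \<beta>(2) by (simp add: ennreal_mult[symmetric])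
  ultimately have big: "X \<phi> > 1" by simp
  obtain h c where h: "h \<in> borel_measurable lebesgue" "\<And>x. 0 \<le> h x" "c > 0"
    "\<And>g. g \<in> borel_measurable lebesgue \<Longrightarrow> X g \<le> 1 \<Longrightarrow> (\<integral>\<^sup>+x. ennreal (h x) * ennreal \<bar>g x\<bar> \<partial>lebesgue) \<le> ennreal c"
    "ennreal c < (\<integral>\<^sup>+x. ennreal (h x) * ennreal (\<phi> x) \<partial>lebesgue)"
  proof (rule separation[of \<phi> "(1 / \<beta>) * real m" "real m"])
    show "\<phi> x \<le> (1 / \<beta>) * real m" for x unfolding \<phi>_def using Fmb(2)[of x] \<beta>(2) by (intro mult_left_mono) auto
    show "0 \<le> \<phi> x" for x unfolding \<phi>_def using Fmb(1)[of x] \<beta>(2) by simp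
    show "\<phi> x = 0" if "x \<notin> ball 0 (real m)" for x using Fmb(3)[OF that] by (simp add: \<phi>_def)
  qed (use big in auto)
  note [measurable] = h(1)
  obtain h0 where h0: "h0 \<in> borel_measurable borel" "AE x in lborel. h x = h0 x"
    using completion_ex_borel_measurable_real[OF h(1)] by auto
  define w where "w x = ennreal (1 / c) * ennreal (h0 x)" for x
  have [measurable]: "w \<in> borel_measurable borel" using h0(1) unfolding w_def by measurable
  have wae: "AE x in lebesgue. w x = ennreal (1 / c) * ennreal (h x)"
    unfolding AE_lebesgue_iff_lborel using h0(2) by eventually_elim (simp add: w_def)
  have "dual_norm X w \<le> 1" unfolding dual_norm_def
  proof (rule SUP_least)
    fix g assume "g \<in> {g \<in> borel_measurable lebesgue. X g = 1}"
    then have [measurable]: "g \<in> borel_measurable lebesgue" and Xg: "X g \<le> 1" by auto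
    have "(\<integral>\<^sup>+x. w x * ennreal \<bar>g x\<bar> \<partial>lebesgue) = (\<integral>\<^sup>+x. ennreal (1 / c) * (ennreal (h x) * ennreal \<bar>g x\<bar>) \<partial>lebesgue)"
      by (rule nn_integral_cong_AE) (use wae in eventually_elim, simp add: mult.assoc)
    also have "\<dots> = ennreal (1 / c) * (\<integral>\<^sup>+x. ennreal (h x) * ennreal \<bar>g x\<bar> \<partial>lebesgue)"
      by (rule nn_integral_cmult) measurable
    also have "\<dots> \<le> ennreal (1 / c) * ennreal c" by (intro mult_left_mono h(4) Xg) auto
    also have "\<dots> = 1" using h(3) by (simp add: ennreal_mult[symmetric])
    finally show "(\<integral>\<^sup>+x. w x * ennreal \<bar>g x\<bar> \<partial>lebesgue) \<le> 1" .
  qed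
  then have "(\<integral>\<^sup>+x. ennreal (F x) * w x \<partial>lebesgue) \<le> L" by (intro le) auto
  moreover have "ennreal \<beta> \<le> (\<integral>\<^sup>+x. ennreal (F x) * w x \<partial>lebesgue)"
  proof -
    have "ennreal \<beta> = ennreal (\<beta> / c) * ennreal c" using h(3) \<beta>(2) by (simp add: ennreal_mult[symmetric])
    also have "\<dots> \<le> ennreal (\<beta> / c) * (\<integral>\<^sup>+x. ennreal (h x) * ennreal (\<phi> x) \<partial>lebesgue)"
      by (intro mult_left_mono less_imp_le[OF h(5)]) simp
    also have "\<dots> = (\<integral>\<^sup>+x. ennreal (\<beta> / c) * (ennreal (h x) * ennreal (\<phi> x)) \<partial>lebesgue)"
      by (rule nn_integral_cmult[symmetric]) measurable
    also have "\<dots> \<le> (\<integral>\<^sup>+x. ennreal (F x) * w x \<partial>lebesgue)"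
    proof (rule nn_integral_mono_AE)
      show "AE x in lebesgue. ennreal (\<beta> / c) * (ennreal (h x) * ennreal (\<phi> x)) \<le> ennreal (F x) * w x"
        using wae
      proof eventually_elim
        case (elim x)
        have "\<beta> / c * (h x * \<phi> x) = (1 / c * h x) * Fm m x" using \<beta>(2) by (simp add: \<phi>_def)
        also have "\<dots> \<le> (1 / c * h x) * F x" using h(2)[of x] h(3) Fmb(4)[of x] by (intro mult_left_mono) auto
        finally have "ennreal (\<beta> / c * (h x * \<phi> x)) \<le> ennreal ((1 / c * h x) * F x)" by (rule ennreal_leI)
        moreover have "0 \<le> \<phi> x" using Fmb(1)[of x] \<beta>(2) by (simp add: \<phi>_def)
        moreover have "ennreal (\<beta> / c) * (ennreal (h x) * ennreal (\<phi> x)) = ennreal (\<beta> / c * (h x * \<phi> x))"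
          using h(2)[of x] h(3) \<beta>(2) \<open>0 \<le> \<phi> x\<close> by (simp add: ennreal_mult[symmetric])
        moreover have "ennreal (F x) * w x = ennreal ((1 / c * h x) * F x)"
          using h(2)[of x] h(3) F0[of x] by (simp add: elim ennreal_mult[symmetric] mult_ac)
        ultimately show ?case by simp
      qed
    qed
    finally show ?thesis .
  qed
  ultimately show False using b(1) \<beta>(1) by (meson leD order_trans)
qed

text \<open>Local integrability in dual form: it provides admissible weights that are positive on a
  given ball, with which finiteness almost everywhere can be tested.\<close>

lemma dual_norm_indicator_finite:
  assumes r: "r > 0"
  obtains C where "C > 0" "dual_norm X (\<lambda>x. ennreal (1 / C) * indicator (ball z r) x) \<le> 1"
proof -
  obtain C where C: "C > 0" "\<And>f. f \<in> fspace X \<Longrightarrow> (\<integral>\<^sup>+x\<in>ball z r. ennreal \<bar>f x\<bar> \<partial>lebesgue) \<le> ennreal C * X f"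
    using integral_ball[OF r, of z] by blast
  have [measurable]: "ball z r \<in> sets lebesgue" by simp
  have "dual_norm X (\<lambda>x. ennreal (1 / C) * indicator (ball z r) x) \<le> 1" unfolding dual_norm_def
  proof (rule SUP_least)
    fix g assume "g \<in> {g \<in> borel_measurable lebesgue. X g = 1}"
    then have [measurable]: "g \<in> borel_measurable lebesgue" and Xg: "X g = 1" by auto
    have "(\<integral>\<^sup>+x. ennreal (1 / C) * indicator (ball z r) x * ennreal \<bar>g x\<bar> \<partial>lebesgue)
       = ennreal (1 / C) * (\<integral>\<^sup>+x\<in>ball z r. ennreal \<bar>g x\<bar> \<partial>lebesgue)"
      by (subst nn_integral_cmult[symmetric]) (auto simp: mult_ac)
    also have "\<dots> \<le> ennreal (1 / C) * (ennreal C * X g)"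
      by (intro mult_left_mono C(2)) (auto simp: fspace_def Xg)
    also have "\<dots> = 1" using C(1) by (simp add: Xg ennreal_mult[symmetric])
    finally show "(\<integral>\<^sup>+x. ennreal (1 / C) * indicator (ball z r) x * ennreal \<bar>g x\<bar> \<partial>lebesgue) \<le> 1" .
  qed
  then show ?thesis using that C(1) by blast
qed

text \<open>\<open>enorm\<close> is infinite as soon as the function is infinite on a set of
  positive measure. The weights supported on balls exclude this when \<open>L\<close> is finite, and
  real-valued duality takes over.\<close>

lemma enorm_le_duality:
  assumes F [measurable]: "F \<in> borel_measurable lebesgue"
    and le: "\<And>w. w \<in> borel_measurable borel \<Longrightarrow> dual_norm X w \<le> 1 \<Longrightarrow> (\<integral>\<^sup>+x. F x * w x \<partial>lebesgue) \<le> L"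
  shows "enorm X F \<le> L"
proof (cases "L = top")
  case False
  have fin_ball: "AE x in lebesgue. x \<in> ball 0 (real (Suc k)) \<longrightarrow> F x < top" for k
  proof -
    obtain C where C: "C > 0" "dual_norm X (\<lambda>x. ennreal (1 / C) * indicator (ball 0 (real (Suc k))) x) \<le> 1"
      by (rule dual_norm_indicator_finite[of "real (Suc k)" 0]) auto
    have [measurable]: "ball (0::'a) (real (Suc k)) \<in> sets lebesgue" "ball (0::'a) (real (Suc k)) \<in> sets borel" by simp_all
    have "(\<integral>\<^sup>+x. F x * (ennreal (1 / C) * indicator (ball 0 (real (Suc k))) x) \<partial>lebesgue) \<le> L"
      by (rule le) (use C in measurable)
    then have "(\<integral>\<^sup>+x. F x * (ennreal (1 / C) * indicator (ball 0 (real (Suc k))) x) \<partial>lebesgue) \<noteq> \<infinity>"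
      using False by (auto simp: top_unique)
    then have "AE x in lebesgue. F x * (ennreal (1 / C) * indicator (ball 0 (real (Suc k))) x) \<noteq> \<infinity>"
      by (rule nn_integral_PInf_AE[rotated]) measurable
    then show ?thesis
    proof eventually_elim
      case (elim x)
      show ?case
      proof
        assume "x \<in> ball 0 (real (Suc k))"
        then have "F x * ennreal (1 / C) \<noteq> top" using elim by simp
        then show "F x < top" using C(1) by (auto simp: less_top[symmetric] ennreal_top_mult)
      qed
    qed
  qed
  have "AE x in lebesgue. \<forall>k. x \<in> ball 0 (real (Suc k)) \<longrightarrow> F x < top" unfolding AE_all_countable using fin_ball by blast
  then have ae: "AE x in lebesgue. F x < top"
  proof eventually_elim
    case (elim x)
    obtain N :: nat where "norm x \<le> real N" using real_arch_simple by blast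
    then have "x \<in> ball 0 (real (Suc N))" by simp
    then show ?case using elim by blast
  qed
  have "X (\<lambda>x. enn2real (F x)) \<le> L"
  proof (rule norm_le_duality)
    fix w :: "'a \<Rightarrow> ennreal" assume w: "w \<in> borel_measurable borel" "dual_norm X w \<le> 1"
    have "(\<integral>\<^sup>+x. ennreal (enn2real (F x)) * w x \<partial>lebesgue) = (\<integral>\<^sup>+x. F x * w x \<partial>lebesgue)"
      by (rule nn_integral_cong_AE) (use ae in eventually_elim, simp)
    then show "(\<integral>\<^sup>+x. ennreal (enn2real (F x)) * w x \<partial>lebesgue) \<le> L" using le[OF w] by simp
  qed auto
  then show ?thesis using ae by (simp add: enorm_def)
qed simp

text \<open>Indicators of balls have finite norm, so Hoelder makes the weight integrable on each
  ball.\<close>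

lemma dual_norm_finite_AE:
  assumes [measurable]: "w \<in> borel_measurable lebesgue" and fin: "dual_norm X w < top"
  shows "AE x in lebesgue. w x < top"
proof -
  have fin_ball: "AE x in lebesgue. x \<in> ball 0 (real (Suc k)) \<longrightarrow> w x < top" for k
  proof -
    let ?B = "ball (0::'a) (real (Suc k))"
    have [measurable]: "?B \<in> sets lebesgue" by simp
    have "indicator ?B \<in> fspace X" by (rule indicator_ball) simp
    then have Xf: "X (indicator ?B) < top" by (simp add: fspace_def)
    have "(\<integral>\<^sup>+x. w x * ennreal \<bar>indicator ?B x\<bar> \<partial>lebesgue) \<le> dual_norm X w * X (indicator ?B)"
      by (rule Hoelder[OF _ _ Xf]) measurable
    also have "\<dots> < top" using fin Xf by (simp only: ennreal_mult_less_top) simp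
    finally have "(\<integral>\<^sup>+x. w x * ennreal \<bar>indicator ?B x\<bar> \<partial>lebesgue) \<noteq> \<infinity>" by (simp only: infinity_ennreal_def less_top)
    then have "AE x in lebesgue. w x * ennreal \<bar>indicator ?B x\<bar> \<noteq> \<infinity>"
      by (rule nn_integral_PInf_AE[rotated]) measurable
    then show ?thesis by eventually_elim (auto simp: less_top indicator_def)
  qed
  have "AE x in lebesgue. \<forall>k. x \<in> ball 0 (real (Suc k)) \<longrightarrow> w x < top" unfolding AE_all_countable using fin_ball by blast
  then show ?thesis
  proof eventually_elim
    case (elim x)
    obtain N :: nat where "norm x \<le> real N" using real_arch_simple by blast
    then have "x \<in> ball 0 (real (Suc N))" by simp
    then show ?case using elim by blast
  qed
qed

text \<open>A weight of finite dual norm is almost everywhere a real function, to which the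
  hypothesis applies; finiteness of \<open>enorm\<close> then makes \<open>maximal w\<close> finite
  almost everywhere. The constant is raised to at least 1 so that an infinite dual norm gives an
  infinite right-hand side, whatever \<open>C\<close> is.\<close>

lemma dual_norm_maximal_le:
  assumes C: "\<And>f. f \<in> fspace (associate_norm X) \<Longrightarrow> enorm (associate_norm X) (HL_maximal f) \<le> ennreal C * associate_norm X f"
    and [measurable]: "w \<in> borel_measurable borel"
  shows "dual_norm X (maximal w) \<le> ennreal (max C 1) * dual_norm X w"
proof (cases "dual_norm X w = top")
  case True
  then show ?thesis by (simp add: ennreal_mult_top)
next
  case False
  have wl [measurable]: "w \<in> borel_measurable lebesgue" by (rule measurable_completion) simp
  have ae: "AE x in lebesgue. w x < top" by (rule dual_norm_finite_AE) (use False in \<open>auto simp: less_top\<close>)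
  define h where "h x = enn2real (w x)" for x
  have hw: "AE x in lebesgue. ennreal \<bar>h x\<bar> = w x" using ae by eventually_elim (simp add: h_def)
  have ah: "associate_norm X h = dual_norm X w" unfolding associate_norm_eq by (rule dual_norm_cong_AE[OF hw])
  have "h \<in> borel_measurable lebesgue" unfolding h_def by measurable
  then have "h \<in> fspace (associate_norm X)" unfolding fspace_def using False by (simp add: ah less_top)
  then have le: "enorm (associate_norm X) (HL_maximal h) \<le> ennreal C * dual_norm X w" unfolding ah[symmetric] by (rule C)
  have HL: "HL_maximal h = maximal w"
    unfolding HL_maximal_eq by (rule maximal_cong_AE) (use hw in \<open>simp add: AE_lebesgue_iff_lborel\<close>)
  have "enorm (associate_norm X) (HL_maximal h) < top"
    using le by (rule le_less_trans) (use False in \<open>simp add: ennreal_mult_less_top less_top\<close>)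
  then have fin: "AE x in lebesgue. maximal w x < top" and
    eq: "enorm (associate_norm X) (HL_maximal h) = associate_norm X (\<lambda>x. enn2real (maximal w x))"
    unfolding HL by (auto simp: enorm_def split: if_splits)
  have "associate_norm X (\<lambda>x. enn2real (maximal w x)) = dual_norm X (maximal w)"
    unfolding associate_norm_eq by (rule dual_norm_cong_AE) (use fin in eventually_elim, simp)
  then have "dual_norm X (maximal w) \<le> ennreal C * dual_norm X w" using le eq by simp
  also have "\<dots> \<le> ennreal (max C 1) * dual_norm X w" by (intro mult_right_mono ennreal_leI) auto
  finally show ?thesis .
qed

end

section \<open>Endpoint boundedness\<close>

text \<open>The tangent inequality for exp at 0 is used at (1 - \<open>\<theta>\<close>) ln s and at
  -\<open>\<theta>\<close> ln s; with weights \<open>\<theta>\<close> and 1 -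
  \<open>\<theta>\<close> the linear terms cancel, and multiplication by
  \<open>s powr \<theta>\<close> gives the claim.\<close>

lemma Young_powr:
  fixes s \<theta> :: real
  assumes "s \<ge> 0" "0 < \<theta>" "\<theta> < 1"
  shows "s powr \<theta> \<le> \<theta> * s + (1 - \<theta>)"
proof (cases "s = 0")
  case False
  then have s: "s > 0" using assms by simp
  have e1: "s = s powr \<theta> * exp ((1 - \<theta>) * ln s)" "1 = s powr \<theta> * exp (- \<theta> * ln s)"
    using s by (simp_all add: powr_def flip: exp_add) (simp_all add: algebra_simps)
  have "1 = \<theta> * (1 + (1 - \<theta>) * ln s) + (1 - \<theta>) * (1 + (- \<theta> * ln s))" by (simp add: algebra_simps)
  also have "\<dots> \<le> \<theta> * exp ((1 - \<theta>) * ln s) + (1 - \<theta>) * exp (- \<theta> * ln s)"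
    using assms by (intro add_mono mult_left_mono exp_ge_add_one_self) auto
  finally have "s powr \<theta> * 1 \<le> s powr \<theta> * (\<theta> * exp ((1 - \<theta>) * ln s) + (1 - \<theta>) * exp (- \<theta> * ln s))"
    by (rule mult_left_mono) simp
  also have "\<dots> = \<theta> * (s powr \<theta> * exp ((1 - \<theta>) * ln s)) + (1 - \<theta>) * (s powr \<theta> * exp (- \<theta> * ln s))"
    by (simp add: algebra_simps)
  also have "\<dots> = \<theta> * s + (1 - \<theta>)" by (simp only: e1[symmetric] mult_1_right)
  finally show ?thesis by simp
qed (use assms in simp)

lemma epowr_eq_1D: "epowr x a = 1 \<Longrightarrow> a > 0 \<Longrightarrow> x = 1"
proof -
  assume e: "epowr x a = 1" and a: "a > 0"
  have x: "x \<noteq> top" using e by (auto simp: epowr_def)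
  then have "enn2real x powr a = 1" using e by (simp add: epowr_def)
  moreover have "enn2real x = (enn2real x powr a) powr (1 / a)" using a by (simp add: powr_powr)
  ultimately have "enn2real x = 1" by simp
  then show "x = 1" using x by (metis ennreal_1 ennreal_enn2real less_top)
qed

lemma epowr_le:
  assumes "x \<le> ennreal r" "r \<ge> 0" "a \<ge> 0"
  shows "epowr x a \<le> ennreal (r powr a)"
proof -
  have x: "x \<noteq> top" using assms(1) by (auto simp: top_unique)
  have "enn2real x \<le> r" using enn2real_mono[OF assms(1)] assms(2) by simp
  then have "enn2real x powr a \<le> r powr a" using assms(3) enn2real_nonneg by (intro powr_mono2) auto
  then show ?thesis using x by (simp add: epowr_def ennreal_leI)
qed

context ball_banach_function_space
begin

text \<open>If \<open>g\<close> has norm 1 in the power space, then |g|^(1/\<open>\<theta>\<close>)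
  has norm 1 in \<open>X\<close>, and Young bounds |g| pointwise by \<open>\<theta>\<close> times
  this power plus 1 - \<open>\<theta>\<close>. For integrable \<open>w\<close> the additional term
  disappears as \<open>\<theta>\<close> tends to 1.\<close>

lemma dual_power_norm_le:
  assumes \<theta>: "0 < \<theta>" "\<theta> < 1" and [measurable]: "w \<in> borel_measurable lebesgue"
  shows "dual_norm (power_norm X (1 / \<theta>)) w \<le> ennreal \<theta> * dual_norm X w + ennreal (1 - \<theta>) * (\<integral>\<^sup>+x. w x \<partial>lebesgue)"
  unfolding dual_norm_def[of "power_norm X (1 / \<theta>)"]
proof (rule SUP_least)
  fix g assume "g \<in> {g \<in> borel_measurable lebesgue. power_norm X (1 / \<theta>) g = 1}"
  then have [measurable]: "g \<in> borel_measurable lebesgue" and g: "power_norm X (1 / \<theta>) g = 1" by auto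
  define G where "G x = \<bar>g x\<bar> powr (1 / \<theta>)" for x
  have [measurable]: "G \<in> borel_measurable lebesgue" unfolding G_def by measurable
  have XG: "X G = 1" using g \<theta> unfolding power_norm_def G_def by (auto dest: epowr_eq_1D)
  have "(\<integral>\<^sup>+x. w x * ennreal \<bar>g x\<bar> \<partial>lebesgue) \<le> (\<integral>\<^sup>+x. ennreal \<theta> * (w x * ennreal \<bar>G x\<bar>) + ennreal (1 - \<theta>) * w x \<partial>lebesgue)"
  proof (rule nn_integral_mono)
    fix x
    have "\<bar>g x\<bar> = G x powr \<theta>" using \<theta> by (simp add: G_def powr_powr)
    also have "\<dots> \<le> \<theta> * G x + (1 - \<theta>)" using \<theta> by (intro Young_powr) (auto simp: G_def)
    finally have "ennreal \<bar>g x\<bar> \<le> ennreal (\<theta> * \<bar>G x\<bar> + (1 - \<theta>))" by (intro ennreal_leI) (simp add: G_def)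
    also have "\<dots> = ennreal \<theta> * ennreal \<bar>G x\<bar> + ennreal (1 - \<theta>)" using \<theta> by (simp add: ennreal_mult)
    finally have "w x * ennreal \<bar>g x\<bar> \<le> w x * (ennreal \<theta> * ennreal \<bar>G x\<bar> + ennreal (1 - \<theta>))" by (rule mult_left_mono) simp
    then show "w x * ennreal \<bar>g x\<bar> \<le> ennreal \<theta> * (w x * ennreal \<bar>G x\<bar>) + ennreal (1 - \<theta>) * w x"
      by (simp add: distrib_left mult_ac)
  qed
  also have "\<dots> = ennreal \<theta> * (\<integral>\<^sup>+x. w x * ennreal \<bar>G x\<bar> \<partial>lebesgue) + ennreal (1 - \<theta>) * (\<integral>\<^sup>+x. w x \<partial>lebesgue)"
    by (simp add: nn_integral_add nn_integral_cmult)
  also have "(\<integral>\<^sup>+x. w x * ennreal \<bar>G x\<bar> \<partial>lebesgue) \<le> dual_norm X w"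
    unfolding dual_norm_def by (rule SUP_upper) (simp add: XG)
  finally show "(\<integral>\<^sup>+x. w x * ennreal \<bar>g x\<bar> \<partial>lebesgue) \<le> ennreal \<theta> * dual_norm X w + ennreal (1 - \<theta>) * (\<integral>\<^sup>+x. w x \<partial>lebesgue)"
    by (simp add: add_right_mono mult_left_mono)
qed

text \<open>For values of modulus at most \<open>N\<close>, raising to the power
  1/\<open>\<theta>\<close> costs at most the factor N^(1/\<open>\<theta>\<close> - 1). The
  resulting bound tends to 1 as \<open>\<theta>\<close> tends to 1, for fixed
  \<open>N\<close>.\<close>

lemma power_norm_truncation_le:
  assumes [measurable]: "g \<in> borel_measurable lebesgue" and g: "\<And>x. \<bar>g x\<bar> \<le> N" "X g \<le> 1" and \<theta>: "0 < \<theta>" "\<theta> < 1" and N: "N \<ge> 1"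
  shows "power_norm X (1 / \<theta>) g \<le> ennreal (N powr (1 - \<theta>))"
proof -
  have "X (\<lambda>x. \<bar>g x\<bar> powr (1 / \<theta>)) \<le> X (\<lambda>x. N powr (1 / \<theta> - 1) * g x)"
  proof (rule norm_mono)
    have "\<bar>\<bar>g x\<bar> powr (1 / \<theta>)\<bar> \<le> \<bar>N powr (1 / \<theta> - 1) * g x\<bar>" for x
    proof (cases "g x = 0")
      case False
      have "\<bar>g x\<bar> powr (1 / \<theta>) = \<bar>g x\<bar> powr (1 / \<theta> - 1) * \<bar>g x\<bar>"
        using False powr_add[of "\<bar>g x\<bar>" "1 / \<theta> - 1" 1] by simp
      also have "\<dots> \<le> N powr (1 / \<theta> - 1) * \<bar>g x\<bar>"
        using g(1)[of x] \<theta> by (intro mult_right_mono powr_mono2) auto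
      finally show ?thesis by (simp add: abs_mult)
    qed simp
    then show "AE x in lebesgue. \<bar>\<bar>g x\<bar> powr (1 / \<theta>)\<bar> \<le> \<bar>N powr (1 / \<theta> - 1) * g x\<bar>" by simp
  qed measurable
  also have "\<dots> = ennreal (N powr (1 / \<theta> - 1)) * X g" by (subst norm_scale) auto
  also have "\<dots> \<le> ennreal (N powr (1 / \<theta> - 1)) * 1" by (intro mult_left_mono g) simp
  finally have "power_norm X (1 / \<theta>) g \<le> ennreal ((N powr (1 / \<theta> - 1)) powr (1 / (1 / \<theta>)))"
    unfolding power_norm_def using \<theta> by (intro epowr_le) auto
  also have "(N powr (1 / \<theta> - 1)) powr (1 / (1 / \<theta>)) = N powr (1 - \<theta>)"
    using \<theta> by (simp add: powr_powr algebra_simps)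
  finally show ?thesis .
qed

text \<open>For truncations the norms of $X^{1/\theta_m}$ and its associate space are controlled by those
  of $X$ in the limit, so that endpoint boundedness is no more general than boundedness.\<close>

lemma endpoint_dual_bounded:
  assumes "endpoint_bounded_on_associate X"
  obtains A where "A \<ge> 1" "\<And>w. w \<in> borel_measurable borel \<Longrightarrow> dual_norm X (maximal w) \<le> ennreal A * dual_norm X w"
proof -
  obtain \<theta> :: "nat \<Rightarrow> real" and L where \<theta>: "\<And>m. 0 < \<theta> m" "\<And>m. \<theta> m < 1" "\<theta> \<longlonglongrightarrow> 1"
    and bb: "\<And>m. ball_banach_function_space (power_norm X (1 / \<theta> m))"
    and L: "L < top" "(\<lambda>m. op_norm (associate_norm (power_norm X (1 / \<theta> m))) HL_maximal) \<longlonglongrightarrow> L"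
    using assms unfolding endpoint_bounded_on_associate_def by auto
  \<comment> \<open>Strictly above the limit, so that it bounds the operator norms for all late
    m.\<close>
  define A where "A = max (enn2real L + 1) 1"
  have A: "A \<ge> 1" by (simp add: A_def)
  have "L < ennreal A"
  proof -
    have "L = ennreal (enn2real L)" using L(1) by simp
    also have "\<dots> < ennreal A" 
    proof (rule ennreal_lessI)
      show "0 < A" using A by linarith
      show "enn2real L < A" by (simp add: A_def)
    qed
    finally show ?thesis .
  qed
  then have ev: "\<forall>\<^sub>F m in sequentially. op_norm (associate_norm (power_norm X (1 / \<theta> m))) HL_maximal < ennreal A"
    using order_tendstoD(2)[OF L(2)] by blast
  have ev2: "\<forall>\<^sub>F m in sequentially. \<forall>w \<in> borel_measurable borel.
      dual_norm (power_norm X (1 / \<theta> m)) (maximal w) \<le> ennreal A * dual_norm (power_norm X (1 / \<theta> m)) w"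
    using ev
  proof eventually_elim
    case (elim m)
    let ?Y = "power_norm X (1 / \<theta> m)"
    interpret Y: ball_banach_function_space ?Y by (rule bb)
    obtain C where C: "C < ennreal A" "\<And>f. f \<in> fspace (associate_norm ?Y) \<Longrightarrow> enorm (associate_norm ?Y) (HL_maximal f) \<le> C * associate_norm ?Y f"
      using elim unfolding op_norm_def Inf_less_iff by auto
    have "enorm (associate_norm ?Y) (HL_maximal f) \<le> ennreal A * associate_norm ?Y f" if "f \<in> fspace (associate_norm ?Y)" for f
      using C(2)[OF that] mult_right_mono[OF less_imp_le[OF C(1)], of "associate_norm ?Y f"] by simp
    from Y.dual_norm_maximal_le[OF this] show ?case using A by (simp add: max_def)
  qed
  have main: "dual_norm X (maximal w) \<le> ennreal A * dual_norm X w"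
    if [measurable]: "w \<in> borel_measurable borel" and fin: "dual_norm X w < top" "(\<integral>\<^sup>+x. w x \<partial>lebesgue) < top" for w
  proof -
    have wl [measurable]: "w \<in> borel_measurable lebesgue" by (rule measurable_completion) simp
    have ml [measurable]: "maximal w \<in> borel_measurable lebesgue" by (rule measurable_completion) simp
    define a where "a = enn2real (dual_norm X w)"
    define i where "i = enn2real (\<integral>\<^sup>+x. w x \<partial>lebesgue)"
    have ai: "dual_norm X w = ennreal a" "(\<integral>\<^sup>+x. w x \<partial>lebesgue) = ennreal i" "a \<ge> 0" "i \<ge> 0"
      using fin by (auto simp: a_def i_def)
    show ?thesis unfolding dual_norm_def[of X "maximal w"]
    proof (rule SUP_least)
      fix g assume "g \<in> {g \<in> borel_measurable lebesgue. X g = 1}"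
      then have [measurable]: "g \<in> borel_measurable lebesgue" and Xg: "X g = 1" by auto
      define u where "u N x = min \<bar>g x\<bar> (real N)" for N :: nat and x
      have [measurable]: "u N \<in> borel_measurable lebesgue" for N unfolding u_def by measurable
      \<comment> \<open>Hoelder in the power space is applied to a truncation of \<open>g\<close>,
        since only there the two norms of \<open>g\<close> are comparable. The limit in
        \<open>m\<close> is taken for fixed \<open>N\<close>, and \<open>N\<close> is sent to
        infinity afterwards.\<close>
      have trunc: "(\<integral>\<^sup>+x. maximal w x * ennreal \<bar>u N x\<bar> \<partial>lebesgue) \<le> ennreal A * dual_norm X w" if N: "N \<ge> 1" for N
      proof -
        have Xu: "X (u N) \<le> 1" unfolding Xg[symmetric] by (intro norm_mono) (auto simp: u_def)
        have ub: "\<bar>u N x\<bar> \<le> real N" for x by (auto simp: u_def)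
        have "\<forall>\<^sub>F m in sequentially. (\<integral>\<^sup>+x. maximal w x * ennreal \<bar>u N x\<bar> \<partial>lebesgue) \<le> ennreal ((A * (\<theta> m * a + (1 - \<theta> m) * i)) * real N powr (1 - \<theta> m))"
          using ev2
        proof eventually_elim
          case (elim m)
          let ?Y = "power_norm X (1 / \<theta> m)"
          interpret Y: ball_banach_function_space ?Y by (rule bb)
          have Yu: "?Y (u N) \<le> ennreal (real N powr (1 - \<theta> m))"
            using N by (intro power_norm_truncation_le ub Xu \<theta>) auto
          have "(\<integral>\<^sup>+x. maximal w x * ennreal \<bar>u N x\<bar> \<partial>lebesgue) \<le> dual_norm ?Y (maximal w) * ?Y (u N)"
            by (rule Y.Hoelder) (use le_less_trans[OF Yu] in auto)
          also have "\<dots> \<le> (ennreal A * dual_norm ?Y w) * ennreal (real N powr (1 - \<theta> m))"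
            using elim Yu by (intro mult_mono) auto
          also have "\<dots> \<le> (ennreal A * (ennreal (\<theta> m) * ennreal a + ennreal (1 - \<theta> m) * ennreal i)) * ennreal (real N powr (1 - \<theta> m))"
            unfolding ai(1,2)[symmetric] by (intro mult_right_mono mult_left_mono dual_power_norm_le \<theta> wl) auto
          also have "\<dots> = ennreal ((A * (\<theta> m * a + (1 - \<theta> m) * i)) * real N powr (1 - \<theta> m))"
            using A ai \<theta>(1)[of m] \<theta>(2)[of m] by (simp add: ennreal_mult ennreal_plus)
          finally show ?case .
        qed
        moreover have "(\<lambda>m. ennreal ((A * (\<theta> m * a + (1 - \<theta> m) * i)) * real N powr (1 - \<theta> m))) \<longlonglongrightarrow>
            ennreal ((A * (1 * a + (1 - 1) * i)) * real N powr (1 - 1))"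
          using N by (intro tendsto_ennrealI tendsto_intros \<theta>(3)) auto
        ultimately have "(\<integral>\<^sup>+x. maximal w x * ennreal \<bar>u N x\<bar> \<partial>lebesgue) \<le> ennreal ((A * (1 * a + (1 - 1) * i)) * real N powr (1 - 1))"
          by (intro tendsto_lowerbound[OF _ _ sequentially_bot]) auto
        also have "\<dots> = ennreal A * dual_norm X w" using N A ai by (simp add: ennreal_mult)
        finally show ?thesis .
      qed
      have "maximal w x * ennreal \<bar>g x\<bar> = (SUP N. maximal w x * ennreal \<bar>u N x\<bar>)" for x
      proof (rule antisym)
        obtain N :: nat where "\<bar>g x\<bar> \<le> real N" using real_arch_simple by blast
        then show "maximal w x * ennreal \<bar>g x\<bar> \<le> (SUP N. maximal w x * ennreal \<bar>u N x\<bar>)"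
          by (intro SUP_upper2[of N]) (auto simp: u_def)
        show "(SUP N. maximal w x * ennreal \<bar>u N x\<bar>) \<le> maximal w x * ennreal \<bar>g x\<bar>"
          by (intro SUP_least mult_left_mono ennreal_leI) (auto simp: u_def)
      qed
      then have "(\<integral>\<^sup>+x. maximal w x * ennreal \<bar>g x\<bar> \<partial>lebesgue) = (\<integral>\<^sup>+x. (SUP N. maximal w x * ennreal \<bar>u N x\<bar>) \<partial>lebesgue)" by simp
      also have "\<dots> = (SUP N. \<integral>\<^sup>+x. maximal w x * ennreal \<bar>u N x\<bar> \<partial>lebesgue)"
      proof (rule nn_integral_monotone_convergence_SUP)
        show "incseq (\<lambda>N x. maximal w x * ennreal \<bar>u N x\<bar>)"
          by (intro monoI le_funI mult_left_mono ennreal_leI) (auto simp: u_def)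
      qed measurable
      also have "\<dots> \<le> ennreal A * dual_norm X w"
      proof (rule SUP_least)
        fix N
        have "(\<integral>\<^sup>+x. maximal w x * ennreal \<bar>u N x\<bar> \<partial>lebesgue) \<le> (\<integral>\<^sup>+x. maximal w x * ennreal \<bar>u (Suc N) x\<bar> \<partial>lebesgue)"
          by (intro nn_integral_mono mult_left_mono ennreal_leI) (auto simp: u_def)
        then show "(\<integral>\<^sup>+x. maximal w x * ennreal \<bar>u N x\<bar> \<partial>lebesgue) \<le> ennreal A * dual_norm X w" using trunc[of "Suc N"] by simp
      qed
      finally show "(\<integral>\<^sup>+x. maximal w x * ennreal \<bar>g x\<bar> \<partial>lebesgue) \<le> ennreal A * dual_norm X w" .
    qed
  qed
  have "dual_norm X (maximal w) \<le> ennreal A * dual_norm X w" if [measurable]: "w \<in> borel_measurable borel" for w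
  proof (cases "dual_norm X w = top")
    case True
    then show ?thesis using A by (simp add: ennreal_mult_top)
  next
    case False
    have wl [measurable]: "w \<in> borel_measurable lebesgue" by (rule measurable_completion) simp
    have wfin: "AE x in lborel. w x < top" 
      unfolding AE_lebesgue_iff_lborel[symmetric] by (rule dual_norm_finite_AE) (use False in \<open>auto simp: less_top\<close>)
    \<comment> \<open>Truncation in height and support makes the weight integrable, as
      \<open>main\<close> requires; \<open>maximal_SUP\<close> returns to \<open>w\<close>.\<close>
    define v where "v N x = min (w x) (of_nat N) * indicator (ball 0 (real N)) x" for N :: nat and x
    have [measurable]: "ball (0::'a) (real N) \<in> sets borel" for N by simp
    have vb [measurable]: "v N \<in> borel_measurable borel" for N unfolding v_def by measurable
    have vl [measurable]: "v N \<in> borel_measurable lebesgue" for N by (rule measurable_completion) simp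
    have v_le: "v N x \<le> w x" for N x by (auto simp: v_def indicator_def)
    have inc: "incseq v"
    proof (intro monoI le_funI)
      fix M N :: nat and x assume MN: "M \<le> N"
      then have "ball (0::'a) (real M) \<subseteq> ball 0 (real N)" by (simp add: subset_ball)
      moreover have "min (w x) (of_nat M) \<le> min (w x) (of_nat N)"
        by (rule min.mono[OF order_refl of_nat_mono[OF MN]])
      ultimately show "v M x \<le> v N x"
        by (auto simp: v_def indicator_def)
    qed
    have "AE x in lborel. w x = (SUP N. v N x)"
      using wfin
    proof eventually_elim
      case (elim x)
      obtain N :: nat where N: "max (enn2real (w x)) (norm x + 1) \<le> real N" using real_arch_simple by blast
      have "w x = ennreal (enn2real (w x))" using elim by simp
      also have "\<dots> \<le> of_nat N" using N by (simp add: ennreal_of_nat_eq_real_of_nat ennreal_leI)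
      finally have "v N x = w x" using N by (simp add: v_def min_absorb1)
      then show ?case by (intro antisym SUP_upper2[of N] SUP_least v_le) auto
    qed
    then have "maximal w = maximal (\<lambda>x. SUP N. v N x)" by (rule maximal_cong_AE)
    then have meq: "maximal w x = (SUP N. maximal (v N) x)" for x using maximal_SUP[OF vb inc] by simp
    have bound: "dual_norm X (maximal (v N)) \<le> ennreal A * dual_norm X w" for N
    proof -
      have dv: "dual_norm X (v N) \<le> dual_norm X w" by (intro dual_norm_mono v_le)
      have "(\<integral>\<^sup>+x. v N x \<partial>lebesgue) \<le> (\<integral>\<^sup>+x. of_nat N * indicator (ball (0::'a) (real N)) x \<partial>lebesgue)"
        by (intro nn_integral_mono) (auto simp: v_def indicator_def)
      also have "\<dots> = of_nat N * emeasure lborel (ball (0::'a) (real N))"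
        unfolding nn_integral_completion by (rule nn_integral_cmult_indicator) simp
      also have "\<dots> < top" using emeasure_lborel_ball_finite[of "0::'a" "real N"] by (simp add: ennreal_mult_less_top ennreal_of_nat_eq_real_of_nat)
      finally have "dual_norm X (maximal (v N)) \<le> ennreal A * dual_norm X (v N)"
        using dv False by (intro main vb) (auto simp: less_top intro: le_less_trans)
      also have "\<dots> \<le> ennreal A * dual_norm X w" by (intro mult_left_mono dv) simp
      finally show ?thesis .
    qed
    have minc: "incseq (\<lambda>N. maximal (v N) x)" for x
      using inc by (intro monoI maximal_mono) (auto dest!: monoD le_funD)
    show ?thesis unfolding dual_norm_def[of X "maximal w"]
    proof (rule SUP_least)
      fix g assume g: "g \<in> {g \<in> borel_measurable lebesgue. X g = 1}"
      then have [measurable]: "g \<in> borel_measurable lebesgue" by auto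
      have mvl [measurable]: "maximal (v N) \<in> borel_measurable lebesgue" for N by (rule measurable_completion) simp
      have "(\<integral>\<^sup>+x. maximal w x * ennreal \<bar>g x\<bar> \<partial>lebesgue) = (\<integral>\<^sup>+x. (SUP N. maximal (v N) x * ennreal \<bar>g x\<bar>) \<partial>lebesgue)"
        by (simp add: meq SUP_mult_right_ennreal)
      also have "\<dots> = (SUP N. \<integral>\<^sup>+x. maximal (v N) x * ennreal \<bar>g x\<bar> \<partial>lebesgue)"
      proof (rule nn_integral_monotone_convergence_SUP)
        show "incseq (\<lambda>N x. maximal (v N) x * ennreal \<bar>g x\<bar>)"
          using minc by (intro monoI le_funI mult_right_mono) (auto dest: monoD)
      qed measurable
      also have "\<dots> \<le> ennreal A * dual_norm X w"
      proof (rule SUP_least)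
        fix N
        have "(\<integral>\<^sup>+x. maximal (v N) x * ennreal \<bar>g x\<bar> \<partial>lebesgue) \<le> dual_norm X (maximal (v N))"
          unfolding dual_norm_def by (rule SUP_upper[OF g])
        then show "(\<integral>\<^sup>+x. maximal (v N) x * ennreal \<bar>g x\<bar> \<partial>lebesgue) \<le> ennreal A * dual_norm X w"
          using bound[of N] by (rule order_trans)
      qed
      finally show "(\<integral>\<^sup>+x. maximal w x * ennreal \<bar>g x\<bar> \<partial>lebesgue) \<le> ennreal A * dual_norm X w" .
    qed
  qed
  then show ?thesis using that A by blast
qed

end

section \<open>Interpolation\<close>

lemma borel_measurable_completion_cong_AE:
  assumes f: "f \<in> borel_measurable (completion M)" and ae: "AE x in completion M. f x = g x"
  shows "g \<in> borel_measurable (completion M)"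
proof (rule measurableI)
  fix S :: "'b set" assume S: "S \<in> sets borel"
  obtain N where N: "N \<in> null_sets (completion M)" "{x \<in> space (completion M). f x \<noteq> g x} \<subseteq> N"
    using ae by (auto simp: eventually_ae_filter)
  have eq: "g -` S \<inter> space (completion M) = ((f -` S \<inter> space (completion M)) - N) \<union> (g -` S \<inter> space (completion M) \<inter> N)"
    using N(2) by force
  have "g -` S \<inter> space (completion M) \<inter> N \<in> null_sets (completion M)"
    by (rule null_sets_completion_subset[OF _ N(1)]) auto
  then show "g -` S \<inter> space (completion M) \<in> sets (completion M)"
    using N(1) by (subst eq) (intro sets.Un sets.Diff measurable_sets[OF f S] null_setsD2)
qed simp

lemma E_integral_eq:
  "E_integral \<gamma> l b f x = (\<integral>\<^sup>+y. indicator {p. l * norm (fst p - snd p) powr (1 + b) < \<bar>f (fst p) - f (snd p)\<bar>} (x, y) *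
      ennreal (norm (fst (x, y) - snd (x, y)) powr (\<gamma> - DIM('a))) \<partial>lborel)"
  for x :: "'a::euclidean_space"
  unfolding E_integral_def nn_integral_completion
  by (intro nn_integral_cong) (auto simp: E_set_def indicator_def)

lemma E_integral_cong_AE:
  fixes f f0 :: "'a::euclidean_space \<Rightarrow> real"
  assumes ae: "AE x in lborel. f x = f0 x"
  shows "AE x in lborel. E_integral \<gamma> l b f x = E_integral \<gamma> l b f0 x"
  using ae
proof eventually_elim
  case x: (elim x)
  show ?case
    unfolding E_integral_def nn_integral_completion
    by (rule nn_integral_cong_AE) (use ae in \<open>eventually_elim, auto simp: E_set_def indicator_def x\<close>)
qed

lemma borel_measurable_pair_section_integral:
  assumes "J \<in> borel_measurable (borel \<Otimes>\<^sub>M borel)"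
  shows "(\<lambda>x :: 'a::euclidean_space. \<integral>\<^sup>+y. J (x, y :: 'b::euclidean_space) \<partial>lborel) \<in> borel_measurable borel"
    and "(\<lambda>y. J (x, y)) \<in> borel_measurable lborel" and "(\<lambda>x. J (x, y)) \<in> borel_measurable lborel"
proof -
  have J: "J \<in> borel_measurable (lborel \<Otimes>\<^sub>M lborel)"
    using assms by (simp add: measurable_cong_sets[OF sets_pair_measure_cong[OF sets_lborel sets_lborel] refl])
  show "(\<lambda>x. \<integral>\<^sup>+y. J (x, y) \<partial>lborel) \<in> borel_measurable borel"
    using lborel.borel_measurable_nn_integral_fst[OF J] by simp
  show "(\<lambda>y. J (x, y)) \<in> borel_measurable lborel" "(\<lambda>x. J (x, y)) \<in> borel_measurable lborel"
    using measurable_compose[OF measurable_Pair1' J, of x] measurable_compose[OF measurable_Pair2' J, of y] by simp_all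
qed

lemma lebesgue_ex_borel:
  fixes f :: "'a::euclidean_space \<Rightarrow> real"
  assumes "f \<in> borel_measurable lebesgue"
  obtains f0 where "f0 \<in> borel_measurable borel" "AE x in lborel. f x = f0 x"
  using completion_ex_borel_measurable_real[OF assms] by auto

lemma borel_measurable_E_integral:
  fixes f :: "'a::euclidean_space \<Rightarrow> real"
  assumes "f \<in> borel_measurable lebesgue"
  shows "E_integral \<gamma> l b f \<in> borel_measurable lebesgue"
proof -
  obtain f0 where f0: "f0 \<in> borel_measurable borel" "AE x in lborel. f x = f0 x"
    using lebesgue_ex_borel[OF assms] .
  have "E_integral \<gamma> l b f0 \<in> borel_measurable borel"
    unfolding E_integral_eq[abs_def] by (rule borel_measurable_pair_section_integral(1)[OF borel_measurable_bad_pairs[OF f0(1)]])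
  then have "E_integral \<gamma> l b f0 \<in> borel_measurable lebesgue" by (intro measurable_completion) simp
  moreover have "AE x in lebesgue. E_integral \<gamma> l b f0 x = E_integral \<gamma> l b f x"
    unfolding AE_lebesgue_iff_lborel using E_integral_cong_AE[OF f0(2), of \<gamma> l b] by eventually_elim simp
  ultimately show ?thesis by (rule borel_measurable_completion_cong_AE)
qed

lemma E_integral_AE_const:
  fixes f :: "'a::euclidean_space \<Rightarrow> real"
  assumes ae: "AE x in lborel. AE y in lborel. f x = f y" and l: "l \<ge> 0"
  shows "AE x in lborel. E_integral \<gamma> l b f x = 0"
  using ae
proof eventually_elim
  case (elim x)
  have "E_integral \<gamma> l b f x = (\<integral>\<^sup>+(y::'a). 0 \<partial>lborel)"
    unfolding E_integral_def nn_integral_completion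
  proof (rule nn_integral_cong_AE)
    show "AE y in lborel. indicator (E_set l b f) (x, y) * ennreal (norm (x - y) powr (\<gamma> - real DIM('a))) = 0"
      using elim by eventually_elim (use l in \<open>auto simp: E_set_def indicator_def not_less\<close>)
  qed
  then show ?case by simp
qed

text \<open>Two points are far apart in value only if one of the values is large compared with the
  distance, and the kernel bound applies from either side.\<close>

lemma pair_level_estimate:
  fixes \<gamma> P :: real
  assumes \<gamma>: "\<gamma> \<noteq> 0" and P: "P \<ge> 1"
  obtains K where "K > 0"
    "\<And>(f :: 'a::euclidean_space \<Rightarrow> real) w \<tau>. f \<in> borel_measurable borel \<Longrightarrow> w \<in> borel_measurable borel \<Longrightarrow> \<tau> > 0 \<Longrightarrow>
      (\<integral>\<^sup>+x. (\<integral>\<^sup>+y. w x * (indicator {p. \<tau> * norm (fst p - snd p) powr (\<gamma> / P) < \<bar>f (fst p) - f (snd p)\<bar>} (x, y) *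
          ennreal (norm (fst (x, y) - snd (x, y)) powr (\<gamma> - DIM('a)))) \<partial>lborel) \<partial>lborel)
      \<le> ennreal (K * (2 / \<tau>) powr P) * ((\<integral>\<^sup>+x. ennreal (\<bar>f x\<bar> powr P) * w x \<partial>lborel) + (\<integral>\<^sup>+x. ennreal (\<bar>f x\<bar> powr P) * maximal w x \<partial>lborel))"
proof -
  define kb where "kb K \<longleftrightarrow> (\<forall>w T y. w \<in> borel_measurable borel \<longrightarrow> T > 0 \<longrightarrow>
      (\<integral>\<^sup>+x. indicator {x. norm (x - y) powr \<gamma> \<le> T} x * ennreal (norm (x - y) powr (\<gamma> - DIM('a))) * w x \<partial>lborel)
      \<le> ennreal (K * T) * maximal w (y :: 'a))" for K
  have "\<exists>K>0. kb K"
  proof (rule kernel_bound[OF \<gamma>, where 'a='a])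
    fix C assume C: "C > 0" "\<And>w T y. w \<in> borel_measurable borel \<Longrightarrow> T > 0 \<Longrightarrow>
      (\<integral>\<^sup>+x. indicator {x. norm (x - y) powr \<gamma> \<le> T} x * ennreal (norm (x - y) powr (\<gamma> - DIM('a))) * w x \<partial>lborel)
      \<le> ennreal (C * T) * maximal w (y :: 'a)"
    then show ?thesis unfolding kb_def by (intro exI[of _ C]) simp
  qed
  then obtain K where K: "K > 0" "kb K" by blast
  show ?thesis
  proof (rule that[OF K(1)])
    fix f :: "'a \<Rightarrow> real" and w :: "'a \<Rightarrow> ennreal" and \<tau> :: real
    assume [measurable]: "f \<in> borel_measurable borel" "w \<in> borel_measurable borel" and \<tau>: "\<tau> > 0"
    \<comment> \<open>Chosen so that \<open>\<tau>\<close> * r^(\<open>\<gamma>\<close>/P) < 2 |f x|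
      implies that r^\<open>\<gamma>\<close> is at most \<open>T x\<close>; this uses P > 0 only,
      hence works for both signs of \<open>\<gamma>\<close>. \<open>D\<close> also requires a
      nonzero value of \<open>f\<close>, which makes \<open>T\<close> positive as the kernel bound
      demands.\<close>
    define T where "T x = (2 * \<bar>f x\<bar> / \<tau>) powr P" for x
    have Teq: "T x = (2 / \<tau>) powr P * \<bar>f x\<bar> powr P" for x
      using \<tau> by (simp add: T_def powr_mult[symmetric])
    define ker where "ker x y = ennreal (norm (x - y) powr (\<gamma> - DIM('a)))" for x y :: 'a
    have [measurable]: "(\<lambda>p. ker (fst p) (snd p)) \<in> borel_measurable (borel \<Otimes>\<^sub>M borel)" unfolding ker_def by measurable
    define D where "D = {p. f (fst p) \<noteq> 0 \<and> norm (snd p - fst p :: 'a) powr \<gamma> \<le> T (fst p)}"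
    define I1 where "I1 p = w (fst p) * (indicator D p * ker (snd p) (fst p))" for p
    define I2 where "I2 p = w (fst p) * (indicator D (snd p, fst p) * ker (fst p) (snd p))" for p
    have [measurable]: "T \<in> borel_measurable borel" unfolding T_def by measurable
    have Dm: "(\<lambda>p. indicator D p :: ennreal) \<in> borel_measurable (borel \<Otimes>\<^sub>M borel)" unfolding D_def by measurable
    have Dm': "(\<lambda>p. indicator D (snd p, fst p) :: ennreal) \<in> borel_measurable (borel \<Otimes>\<^sub>M borel)"
      by (rule measurable_compose[OF _ Dm]) measurable
    have I1 [measurable]: "I1 \<in> borel_measurable (borel \<Otimes>\<^sub>M borel)"
      unfolding I1_def ker_def using Dm by measurable
    have I2 [measurable]: "I2 \<in> borel_measurable (borel \<Otimes>\<^sub>M borel)"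
      unfolding I2_def ker_def using Dm' by measurable
    have le: "w x * (indicator {p. \<tau> * norm (fst p - snd p) powr (\<gamma> / P) < \<bar>f (fst p) - f (snd p)\<bar>} (x, y) *
          ennreal (norm (fst (x, y) - snd (x, y)) powr (\<gamma> - DIM('a)))) \<le> I1 (x, y) + I2 (x, y)" for x y
    proof (cases "\<tau> * norm (x - y) powr (\<gamma> / P) < \<bar>f x - f y\<bar>")
      case True
      have key: "(z, z') \<in> D" if z: "\<tau> * norm (x - y) powr (\<gamma> / P) < 2 * \<bar>f z\<bar>" and n: "norm (z' - z) = norm (x - y)" for z z'
      proof -
        have fz: "f z \<noteq> 0" 
        proof -
          have "0 \<le> \<tau> * norm (x - y) powr (\<gamma> / P)" using \<tau> by simp
          then show ?thesis using z by auto
        qed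
        have "norm (x - y) powr (\<gamma> / P) \<le> 2 * \<bar>f z\<bar> / \<tau>" using z \<tau> by (simp add: field_simps)
        then have "(norm (x - y) powr (\<gamma> / P)) powr P \<le> T z" unfolding T_def using P by (intro powr_mono2) auto
        then show ?thesis using fz n P by (simp add: D_def powr_powr)
      qed
      have "\<bar>f x - f y\<bar> \<le> \<bar>f x\<bar> + \<bar>f y\<bar>" by simp
      then have "\<tau> * norm (x - y) powr (\<gamma> / P) < 2 * \<bar>f x\<bar> \<or> \<tau> * norm (x - y) powr (\<gamma> / P) < 2 * \<bar>f y\<bar>"
        using True by linarith
      then have "(x, y) \<in> D \<or> (y, x) \<in> D" using key[of x y] key[of y x] by (auto simp: norm_minus_commute)
      then have "w x * ker x y \<le> I1 (x, y) + I2 (x, y)"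
        by (auto simp: I1_def I2_def ker_def norm_minus_commute)
      then show ?thesis using True by (simp add: ker_def)
    qed simp
    have i1: "(\<integral>\<^sup>+x. (\<integral>\<^sup>+y. I1 (x, y) \<partial>lborel) \<partial>lborel) \<le> ennreal (K * (2 / \<tau>) powr P) * (\<integral>\<^sup>+x. ennreal (\<bar>f x\<bar> powr P) * w x \<partial>lborel)"
    proof -
      have "(\<integral>\<^sup>+x. (\<integral>\<^sup>+y. I1 (x, y) \<partial>lborel) \<partial>lborel) \<le> (\<integral>\<^sup>+x. ennreal (K * (2 / \<tau>) powr P) * (ennreal (\<bar>f x\<bar> powr P) * w x) \<partial>lborel)"
      proof (rule nn_integral_mono)
        fix x
        show "(\<integral>\<^sup>+y. I1 (x, y) \<partial>lborel) \<le> ennreal (K * (2 / \<tau>) powr P) * (ennreal (\<bar>f x\<bar> powr P) * w x)"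
        proof (cases "f x = 0")
          case False
          then have T0: "T x > 0" using \<tau> by (simp add: T_def)
          have "(\<integral>\<^sup>+y. I1 (x, y) \<partial>lborel) = (\<integral>\<^sup>+y. w x * (indicator {y. norm (y - x) powr \<gamma> \<le> T x} y * ennreal (norm (y - x) powr (\<gamma> - DIM('a))) * 1) \<partial>lborel)"
            using False by (intro nn_integral_cong) (simp add: I1_def D_def ker_def indicator_def)
          also have "\<dots> = w x * (\<integral>\<^sup>+y. indicator {y. norm (y - x) powr \<gamma> \<le> T x} y * ennreal (norm (y - x) powr (\<gamma> - DIM('a))) * 1 \<partial>lborel)"
            by (rule nn_integral_cmult) measurable
          also have "\<dots> \<le> w x * (ennreal (K * T x) * maximal (\<lambda>_. 1) x)"
            using K(2)[unfolded kb_def, rule_format, of "\<lambda>_. 1" "T x" x] T0 by (intro mult_left_mono) auto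
          also have "\<dots> \<le> w x * (ennreal (K * T x) * 1)" by (intro mult_left_mono maximal_one_le) auto
          also have "\<dots> = ennreal (K * (2 / \<tau>) powr P) * (ennreal (\<bar>f x\<bar> powr P) * w x)"
            using K(1) by (simp add: Teq ennreal_mult mult_ac)
          finally show ?thesis .
        qed (simp add: I1_def D_def)
      qed
      also have "\<dots> = ennreal (K * (2 / \<tau>) powr P) * (\<integral>\<^sup>+x. ennreal (\<bar>f x\<bar> powr P) * w x \<partial>lborel)"
        by (rule nn_integral_cmult) measurable
      finally show ?thesis .
    qed
    have i2: "(\<integral>\<^sup>+x. (\<integral>\<^sup>+y. I2 (x, y) \<partial>lborel) \<partial>lborel) \<le> ennreal (K * (2 / \<tau>) powr P) * (\<integral>\<^sup>+x. ennreal (\<bar>f x\<bar> powr P) * maximal w x \<partial>lborel)"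
    proof -
      have "I2 \<in> borel_measurable (lborel \<Otimes>\<^sub>M lborel)"
        using I2 by (simp add: measurable_cong_sets[OF sets_pair_measure_cong[OF sets_lborel sets_lborel] refl])
      then have "(\<integral>\<^sup>+x. (\<integral>\<^sup>+y. I2 (x, y) \<partial>lborel) \<partial>lborel) = (\<integral>\<^sup>+y. (\<integral>\<^sup>+x. I2 (x, y) \<partial>lborel) \<partial>lborel)"
        by (rule lborel_pair.Fubini[symmetric])
      also have "\<dots> \<le> (\<integral>\<^sup>+y. ennreal (K * (2 / \<tau>) powr P) * (ennreal (\<bar>f y\<bar> powr P) * maximal w y) \<partial>lborel)"
      proof (rule nn_integral_mono)
        fix y
        show "(\<integral>\<^sup>+x. I2 (x, y) \<partial>lborel) \<le> ennreal (K * (2 / \<tau>) powr P) * (ennreal (\<bar>f y\<bar> powr P) * maximal w y)"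
        proof (cases "f y = 0")
          case False
          then have T0: "T y > 0" using \<tau> by (simp add: T_def)
          have "(\<integral>\<^sup>+x. I2 (x, y) \<partial>lborel) = (\<integral>\<^sup>+x. indicator {x. norm (x - y) powr \<gamma> \<le> T y} x * ennreal (norm (x - y) powr (\<gamma> - DIM('a))) * w x \<partial>lborel)"
            using False by (intro nn_integral_cong) (simp add: I2_def D_def ker_def indicator_def mult_ac)
          also have "\<dots> \<le> ennreal (K * T y) * maximal w y"
            using K(2)[unfolded kb_def, rule_format, of w "T y" y] T0 by simp
          also have "\<dots> = ennreal (K * (2 / \<tau>) powr P) * (ennreal (\<bar>f y\<bar> powr P) * maximal w y)"
            using K(1) by (simp add: Teq ennreal_mult mult_ac)
          finally show ?thesis .
        qed (simp add: I2_def D_def)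
      qed
      also have "\<dots> = ennreal (K * (2 / \<tau>) powr P) * (\<integral>\<^sup>+x. ennreal (\<bar>f x\<bar> powr P) * maximal w x \<partial>lborel)"
        by (rule nn_integral_cmult) measurable
      finally show ?thesis .
    qed
    note [measurable] = borel_measurable_pair_section_integral[OF I1] borel_measurable_pair_section_integral[OF I2]
    have "(\<integral>\<^sup>+x. (\<integral>\<^sup>+y. w x * (indicator {p. \<tau> * norm (fst p - snd p) powr (\<gamma> / P) < \<bar>f (fst p) - f (snd p)\<bar>} (x, y) *
          ennreal (norm (fst (x, y) - snd (x, y)) powr (\<gamma> - DIM('a)))) \<partial>lborel) \<partial>lborel)
      \<le> (\<integral>\<^sup>+x. (\<integral>\<^sup>+y. I1 (x, y) + I2 (x, y) \<partial>lborel) \<partial>lborel)"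
      by (intro nn_integral_mono le)
    also have "\<dots> = (\<integral>\<^sup>+x. (\<integral>\<^sup>+y. I1 (x, y) \<partial>lborel) + (\<integral>\<^sup>+y. I2 (x, y) \<partial>lborel) \<partial>lborel)"
      by (intro nn_integral_cong nn_integral_add) measurable
    also have "\<dots> = (\<integral>\<^sup>+x. (\<integral>\<^sup>+y. I1 (x, y) \<partial>lborel) \<partial>lborel) + (\<integral>\<^sup>+x. (\<integral>\<^sup>+y. I2 (x, y) \<partial>lborel) \<partial>lborel)"
      by (intro nn_integral_add) measurable
    also have "\<dots> \<le> ennreal (K * (2 / \<tau>) powr P) * (\<integral>\<^sup>+x. ennreal (\<bar>f x\<bar> powr P) * w x \<partial>lborel) +
        ennreal (K * (2 / \<tau>) powr P) * (\<integral>\<^sup>+x. ennreal (\<bar>f x\<bar> powr P) * maximal w x \<partial>lborel)"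
      by (intro add_mono i1 i2)
    finally show "(\<integral>\<^sup>+x. (\<integral>\<^sup>+y. w x * (indicator {p. \<tau> * norm (fst p - snd p) powr (\<gamma> / P) < \<bar>f (fst p) - f (snd p)\<bar>} (x, y) *
          ennreal (norm (fst (x, y) - snd (x, y)) powr (\<gamma> - DIM('a)))) \<partial>lborel) \<partial>lborel)
      \<le> ennreal (K * (2 / \<tau>) powr P) * ((\<integral>\<^sup>+x. ennreal (\<bar>f x\<bar> powr P) * w x \<partial>lborel) + (\<integral>\<^sup>+x. ennreal (\<bar>f x\<bar> powr P) * maximal w x \<partial>lborel))"
      by (simp add: distrib_left)
  qed
qed

section \<open>The weak estimate tested on weights, and degenerate cases\<close>

lemma sobolev_functionsD:
  assumes "f \<in> sobolev_functions X"
  shows "locally_integrable f" "f \<in> borel_measurable lebesgue" "has_gradient (dist_of f) (grad f)"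
    "(\<lambda>x. norm (grad f x)) \<in> borel_measurable lebesgue" "X (\<lambda>x. norm (grad f x)) < top"
proof -
  show l: "locally_integrable f" using assms by (simp add: sobolev_functions_def)
  then show "f \<in> borel_measurable lebesgue" by (simp add: locally_integrable_def)
  have "\<exists>g. has_gradient (dist_of f) g" using assms by (simp add: sobolev_functions_def homogeneous_sobolev_def)
  then show "has_gradient (dist_of f) (grad f)" unfolding dist_gradient_def by (rule someI_ex)
  show "(\<lambda>x. norm (grad f x)) \<in> borel_measurable lebesgue" "X (\<lambda>x. norm (grad f x)) < top"
    using assms by (auto simp: sobolev_functions_def homogeneous_sobolev_def fspace_def)
qed

context ball_banach_function_space
begin

lemma enorm_AE_zero:
  assumes [measurable]: "F \<in> borel_measurable lebesgue" and ae: "AE x in lborel. F x = 0"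
  shows "enorm X F = 0"
proof -
  have ae': "AE x in lebesgue. F x = 0" using ae by (simp add: AE_lebesgue_iff_lborel)
  have "X (\<lambda>x. enn2real (F x)) \<le> X (\<lambda>_. 0)"
  proof (rule norm_mono)
    show "AE x in lebesgue. \<bar>enn2real (F x)\<bar> \<le> \<bar>0\<bar>" using ae' by eventually_elim simp
  qed measurable
  moreover have "AE x in lebesgue. F x < top" using ae' by eventually_elim simp
  ultimately show ?thesis by (simp add: enorm_def norm_zero)
qed

lemma enorm_zeroD:
  assumes [measurable]: "F \<in> borel_measurable lebesgue" and z: "enorm X F = 0"
  shows "AE x in lborel. F x = 0"
proof -
  have fin: "AE x in lebesgue. F x < top" and "X (\<lambda>x. enn2real (F x)) = 0"
    using z by (auto simp: enorm_def split: if_splits)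
  then have "AE x in lebesgue. enn2real (F x) = 0" by (intro norm_eq_0D) auto
  with fin have "AE x in lebesgue. F x = 0" by eventually_elim (auto simp: enn2real_eq_0_iff)
  then show ?thesis by (simp add: AE_lebesgue_iff_lborel)
qed


lemma dual_norm_maximal_bounded:
  assumes "bounded_operator (associate_norm X) HL_maximal \<or> endpoint_bounded_on_associate X"
  obtains A where "A \<ge> 1" "\<And>w. w \<in> borel_measurable borel \<Longrightarrow> dual_norm X (maximal w) \<le> ennreal A * dual_norm X w"
  using assms
proof
  assume "bounded_operator (associate_norm X) HL_maximal"
  then obtain C where C: "\<And>f. f \<in> fspace (associate_norm X) \<Longrightarrow> enorm (associate_norm X) (HL_maximal f) \<le> ennreal C * associate_norm X f"
    unfolding bounded_operator_def by blast
  show thesis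
    by (rule that[of "max C 1"]) (use dual_norm_maximal_le[OF C] in auto)
next
  assume "endpoint_bounded_on_associate X"
  then show thesis by (rule endpoint_dual_bounded) (rule that)
qed

lemma Hoelder_lborel:
  assumes g: "g \<in> borel_measurable lebesgue" "X g < top" and w: "w \<in> borel_measurable borel" "dual_norm X w \<le> ennreal a"
  shows "(\<integral>\<^sup>+x. ennreal \<bar>g x\<bar> * w x \<partial>lborel) \<le> ennreal a * X g"
proof -
  have wl: "w \<in> borel_measurable lebesgue" by (rule measurable_completion) (simp add: w)
  have "(\<integral>\<^sup>+x. ennreal \<bar>g x\<bar> * w x \<partial>lborel) = (\<integral>\<^sup>+x. w x * ennreal \<bar>g x\<bar> \<partial>lebesgue)"
    by (simp add: nn_integral_completion mult.commute)
  also have "\<dots> \<le> dual_norm X w * X g" by (rule Hoelder[OF g(1) wl g(2)])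
  also have "\<dots> \<le> ennreal a * X g" by (intro mult_right_mono w) simp
  finally show ?thesis .
qed

text \<open>Hoelder against the twice and three times iterated maximal function; each iteration
  costs a factor \<open>A\<close> in the dual norm.\<close>

lemma weak_estimate_dual:
  assumes \<gamma>: "\<gamma> < -1 \<or> \<gamma> > 0"
    and A: "A \<ge> 1" "\<And>w. w \<in> borel_measurable borel \<Longrightarrow> dual_norm X (maximal w) \<le> ennreal A * dual_norm X w"
  obtains K where "K > 0"
    "\<And>f l w. f \<in> sobolev_functions X \<Longrightarrow> l > 0 \<Longrightarrow> w \<in> borel_measurable borel \<Longrightarrow> dual_norm X w \<le> 1 \<Longrightarrow>
      (\<integral>\<^sup>+x. w x * E_integral \<gamma> l \<gamma> f x \<partial>lborel) \<le> ennreal (K / l) * X (\<lambda>x. norm (grad f x))"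
proof (rule weak_estimate_Sobolev[OF \<gamma>, where 'a='a])
  fix K assume K: "K > 0" "\<And>(f :: 'a \<Rightarrow> real) g w l. locally_integrable f \<Longrightarrow> has_gradient (dist_of f) g \<Longrightarrow> w \<in> borel_measurable borel \<Longrightarrow> l > 0 \<Longrightarrow>
      (\<integral>\<^sup>+x. w x * E_integral \<gamma> l \<gamma> f x \<partial>lborel)
      \<le> ennreal (K / l) * ((\<integral>\<^sup>+z. ennreal (norm (g z)) * maximal (maximal w) z \<partial>lborel) +
          (\<integral>\<^sup>+z. ennreal (norm (g z)) * maximal (maximal (maximal w)) z \<partial>lborel))"
  show thesis
  proof (rule that)
    show "0 < K * (A * A + A * A * A)" using K(1) A(1) by (intro mult_pos_pos add_pos_pos) auto
    fix f and l :: real and w :: "'a \<Rightarrow> ennreal"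
    assume f: "f \<in> sobolev_functions X" and l: "l > 0" and w: "w \<in> borel_measurable borel" "dual_norm X w \<le> 1"
    note f' = sobolev_functionsD[OF f]
    have d1: "dual_norm X (maximal w) \<le> ennreal A"
      using order_trans[OF A(2)[OF w(1)] mult_left_mono[OF w(2)]] by simp
    have d2: "dual_norm X (maximal (maximal w)) \<le> ennreal (A * A)"
      using order_trans[OF A(2)[OF borel_measurable_maximal] mult_left_mono[OF d1]] A(1) by (simp add: ennreal_mult)
    have d3: "dual_norm X (maximal (maximal (maximal w))) \<le> ennreal (A * A * A)"
      using order_trans[OF A(2)[OF borel_measurable_maximal] mult_left_mono[OF d2]] A(1) by (simp add: ennreal_mult mult_ac)
    have H: "(\<integral>\<^sup>+x. ennreal (norm (grad f x)) * u x \<partial>lborel) \<le> ennreal a * X (\<lambda>x. norm (grad f x))"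
      if "u \<in> borel_measurable borel" "dual_norm X u \<le> ennreal a" for u a
      using Hoelder_lborel[OF f'(4,5) that] by simp
    have "(\<integral>\<^sup>+x. w x * E_integral \<gamma> l \<gamma> f x \<partial>lborel) \<le> ennreal (K / l) *
        ((\<integral>\<^sup>+z. ennreal (norm (grad f z)) * maximal (maximal w) z \<partial>lborel) +
          (\<integral>\<^sup>+z. ennreal (norm (grad f z)) * maximal (maximal (maximal w)) z \<partial>lborel))"
      by (rule K(2)[OF f'(1,3) w(1) l])
    also have "\<dots> \<le> ennreal (K / l) * (ennreal (A * A) * X (\<lambda>x. norm (grad f x)) + ennreal (A * A * A) * X (\<lambda>x. norm (grad f x)))"
      by (intro mult_left_mono add_mono H d2 d3) auto
    also have "\<dots> = ennreal (K / l) * ennreal (A * A + A * A * A) * X (\<lambda>x. norm (grad f x))"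
      using A(1) by (simp add: ennreal_plus distrib_right mult.assoc)
    also have "\<dots> = ennreal (K * (A * A + A * A * A) / l) * X (\<lambda>x. norm (grad f x))"
    proof -
      have "K * (A * A + A * A * A) / l = K / l * (A * A + A * A * A)" by simp
      also have "ennreal \<dots> = ennreal (K / l) * ennreal (A * A + A * A * A)"
        by (rule ennreal_mult) (use A(1) K(1) l in auto)
      finally show ?thesis by (simp only:)
    qed
    finally show "(\<integral>\<^sup>+x. w x * E_integral \<gamma> l \<gamma> f x \<partial>lborel) \<le> ennreal (K * (A * A + A * A * A) / l) * X (\<lambda>x. norm (grad f x))" .
  qed
qed

lemma enorm_le_dual_lborel:
  assumes F: "F \<in> borel_measurable lebesgue"
    and le: "\<And>w. w \<in> borel_measurable borel \<Longrightarrow> dual_norm X w \<le> 1 \<Longrightarrow> (\<integral>\<^sup>+x. w x * F x \<partial>lborel) \<le> L"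
  shows "enorm X F \<le> L"
  by (rule enorm_le_duality[OF F]) (use le in \<open>simp add: nn_integral_completion mult.commute\<close>)

lemma enorm_E_integral_const:
  assumes f: "f \<in> borel_measurable lebesgue" and ae: "AE x in lborel. AE y in lborel. f x = f y" and l: "l > 0"
  shows "enorm X (E_integral \<gamma> l b f) = 0"
  by (intro enorm_AE_zero borel_measurable_E_integral f E_integral_AE_const ae) (use l in simp)

lemma enorm_E_integral_AE_0:
  assumes f: "f \<in> borel_measurable lebesgue" and ae: "AE x in lborel. f x = 0" and l: "l > 0"
  shows "enorm X (E_integral \<gamma> l b f) = 0"
proof (rule enorm_E_integral_const[OF f _ l])
  show "AE x in lborel. AE y in lborel. f x = f y"
    using ae
  proof eventually_elim
    case (elim x)
    show ?case using ae by eventually_elim (simp add: elim)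
  qed
qed

text \<open>Off the diagonal the kernel is positive, so a vanishing integral says that almost no
  \<open>y\<close> is bad for the level l. The levels 1 / (k + 1) exhaust all differences.\<close>

lemma AE_const_if_E_integral_zero:
  assumes f: "f \<in> borel_measurable lebesgue" and z: "\<And>l. l > 0 \<Longrightarrow> enorm X (E_integral \<gamma> l b f) = 0"
  shows "AE x in lborel. AE y in lborel. f x = f y"
proof -
  obtain f0 where f0: "f0 \<in> borel_measurable borel" "AE x in lborel. f x = f0 x"
    using lebesgue_ex_borel[OF f] .
  have "AE x in lborel. E_integral \<gamma> (1 / real (Suc k)) b f0 x = 0" for k
  proof -
    have "AE x in lborel. E_integral \<gamma> (1 / real (Suc k)) b f x = 0"
      by (intro enorm_zeroD borel_measurable_E_integral f z) simp
    with E_integral_cong_AE[OF f0(2), of \<gamma> "1 / real (Suc k)" b] show ?thesis by eventually_elim simp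
  qed
  then have "AE x in lborel. \<forall>k. E_integral \<gamma> (1 / real (Suc k)) b f0 x = 0"
    unfolding AE_all_countable by blast
  with f0(2) show ?thesis
  proof eventually_elim
    case (elim x)
    have "AE y in lborel. x \<noteq> y \<longrightarrow> \<bar>f0 x - f0 y\<bar> \<le> 1 / real (Suc k) * norm (x - y) powr (1 + b)" for k
    proof -
      note m = borel_measurable_pair_section_integral(2)[OF borel_measurable_bad_pairs[OF f0(1)]]
      have "AE y in lborel. indicator {p. 1 / real (Suc k) * norm (fst p - snd p) powr (1 + b) < \<bar>f0 (fst p) - f0 (snd p)\<bar>} (x, y) *
          ennreal (norm (fst (x, y) - snd (x, y)) powr (\<gamma> - DIM('a))) = 0"
        using elim(2)[rule_format, of k, unfolded E_integral_eq] by (subst (asm) nn_integral_0_iff_AE[OF m])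
      then show ?thesis by eventually_elim (auto simp: indicator_def split: if_splits)
    qed
    then have "AE y in lborel. \<forall>k. x \<noteq> y \<longrightarrow> \<bar>f0 x - f0 y\<bar> \<le> 1 / real (Suc k) * norm (x - y) powr (1 + b)"
      unfolding AE_all_countable by blast
    with f0(2) show ?case
    proof eventually_elim
      case y: (elim y)
      show ?case
      proof (cases "x = y")
        case False
        have "(\<lambda>k. 1 / real (Suc k) * norm (x - y) powr (1 + b)) \<longlonglongrightarrow> 0 * norm (x - y) powr (1 + b)"
          using LIMSEQ_inverse_real_of_nat by (intro tendsto_mult) (auto simp: divide_inverse)
        then have "\<bar>f0 x - f0 y\<bar> \<le> 0 * norm (x - y) powr (1 + b)"
          by (rule LIMSEQ_le_const) (use y False in auto)
        then show ?thesis using y elim(1) by simp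
      qed simp
    qed
  qed
qed

end

section \<open>Splitting and comparing thresholds\<close>

lemma level_powr_less:
  fixes l M d r a \<sigma> \<theta> :: real
  assumes "l > 0" "M > 0" "0 < \<theta>" "\<theta> < 1" "r > 0" "d \<le> 2 * M" "l * r powr ((1 - \<theta>) * a) < d"
  shows "(l / (2 * M) powr \<theta>) powr (1 / (1 - \<theta>)) * r powr a < d"
proof -
  have d: "d > 0" using assms(1,5,7) by (smt (verit) mult_pos_pos powr_gt_zero)
  \<comment> \<open>One factor is absorbed by the bound 2 M on the difference; the other is solved
    for by taking the power 1 / (1 - \<open>\<theta>\<close>).\<close>
  have "d = d powr (1 - \<theta>) * d powr \<theta>" using d by (simp flip: powr_add)
  also have "\<dots> \<le> d powr (1 - \<theta>) * (2 * M) powr \<theta>"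
    using d assms by (intro mult_left_mono powr_mono2) auto
  finally have "l * r powr ((1 - \<theta>) * a) < d powr (1 - \<theta>) * (2 * M) powr \<theta>" using assms(7) by linarith
  then have "l / (2 * M) powr \<theta> * r powr ((1 - \<theta>) * a) < d powr (1 - \<theta>)"
    using assms(2) by (simp add: field_simps)
  moreover define q where "q = l / (2 * M) powr \<theta>"
  moreover have q: "q > 0" using assms by (simp add: q_def)
  ultimately have "(q * r powr ((1 - \<theta>) * a)) powr (1 / (1 - \<theta>)) < (d powr (1 - \<theta>)) powr (1 / (1 - \<theta>))"
    using assms by (intro powr_less_mono2) auto
  then have "q powr (1 / (1 - \<theta>)) * r powr a < d" using assms d q by (simp add: powr_mult powr_powr)
  then show ?thesis by (simp add: q_def)
qed

text \<open>If \<open>d\<close> were below both thresholds, it would be below their weighted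
  geometric mean, which is exactly the given threshold.\<close>

lemma interpolated_level:
  fixes l1 l2 d :: real
  assumes "l1 > 0" "l2 > 0" "0 < \<theta>" "\<theta> < 1" "r > 0"
    and "l1 powr (1 - \<theta>) * l2 powr \<theta> * r powr ((1 - \<theta>) * a + \<theta> * c) < d"
  shows "l1 * r powr a < d \<or> l2 * r powr c < d"
proof (rule ccontr)
  assume "\<not> ?thesis"
  then have le: "d \<le> l1 * r powr a" "d \<le> l2 * r powr c" by auto
  have d: "d > 0" using assms by (smt (verit) mult_pos_pos powr_gt_zero)
  have "d = d powr (1 - \<theta>) * d powr \<theta>" using d by (simp flip: powr_add)
  also have "\<dots> \<le> (l1 * r powr a) powr (1 - \<theta>) * (l2 * r powr c) powr \<theta>"
    using d assms le by (intro mult_mono powr_mono2) auto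
  also have "\<dots> = l1 powr (1 - \<theta>) * l2 powr \<theta> * r powr ((1 - \<theta>) * a + \<theta> * c)"
    using assms by (simp add: powr_mult powr_powr powr_add mult_ac)
  finally show False using assms(6) by linarith
qed

context ball_banach_function_space
begin

text \<open>The weak estimate is kept in its dual form, so that the interpolation can add a second
  contribution against the same weight before returning to the norm.\<close>

definition weak_bound :: "real \<Rightarrow> real \<Rightarrow> bool" where
  "weak_bound \<gamma> K \<longleftrightarrow> K > 0 \<and> (\<forall>f \<in> sobolev_functions X. \<forall>l>0. \<forall>w \<in> borel_measurable borel. dual_norm X w \<le> 1 \<longrightarrow>
      (\<integral>\<^sup>+x. w x * E_integral \<gamma> l \<gamma> f x \<partial>lborel) \<le> ennreal (K / l) * X (\<lambda>x. norm (grad f x)))"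

text \<open>Covers the case where the gradient factor vanishes. The right-hand side of the
  interpolation inequality is then 0 even if the other factor is infinite, so the left-hand side
  must be shown to vanish.\<close>

lemma AE_const_if_gradient_zero:
  assumes K: "weak_bound \<gamma> K" and f: "f \<in> sobolev_functions X" and z: "X (\<lambda>x. norm (grad f x)) = 0"
  shows "AE x in lborel. AE y in lborel. f x = f y"
proof (rule AE_const_if_E_integral_zero)
  show fm: "f \<in> borel_measurable lebesgue" by (rule sobolev_functionsD[OF f])
  fix l :: real assume "l > 0"
  then have "enorm X (E_integral \<gamma> l \<gamma> f) \<le> 0"
    using K f z by (intro enorm_le_dual_lborel borel_measurable_E_integral fm) (auto simp: weak_bound_def)
  then show "enorm X (E_integral \<gamma> l \<gamma> f) = 0" by simp
qed

text \<open>Differences of \<open>f\<close> are at most 2 M, so a pair that is bad for exponent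
  \<open>b\<close> at level \<open>l\<close> is bad for exponent \<open>\<gamma>\<close> at the
  level \<open>l'\<close>, and the weak estimate alone suffices.\<close>

lemma interpolation_Linfty:
  assumes K: "weak_bound \<gamma> K" and \<theta>: "0 < \<theta>" "\<theta> < 1" and f: "f \<in> sobolev_functions X" and l: "l > 0"
    and b: "1 + b = (1 - \<theta>) * (1 + \<gamma>)"
  shows "ennreal l * epowr (enorm X (E_integral \<gamma> l b f)) (1 - \<theta>)
    \<le> ennreal (K powr (1 - \<theta>) * 2 powr \<theta>) * epowr (Linfty_norm f) \<theta> * epowr (X (\<lambda>x. norm (grad f x))) (1 - \<theta>)"
proof -
  note f' = sobolev_functionsD[OF f]
  have zero: ?thesis if "enorm X (E_integral \<gamma> l b f) = 0"
    using that \<theta> by (simp add: epowr_def)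
  have Kpos: "K > 0" using K by (simp add: weak_bound_def)
  have le: "AE x in lborel. ennreal \<bar>f x\<bar> \<le> Linfty_norm f"
    using esssup_AE[of "\<lambda>x. ennreal \<bar>f x\<bar>" lebesgue] by (simp add: Linfty_norm_def AE_lebesgue_iff_lborel)
  define D where "D = enn2real (X (\<lambda>x. norm (grad f x)))"
  have D: "X (\<lambda>x. norm (grad f x)) = ennreal D" using f'(5) by (simp add: D_def)
  \<comment> \<open>The product 0 times infinity is 0 in \<open>ennreal\<close>; therefore vanishing
    factors are treated before the infinite one, which makes the claim trivial only if the gradient
    factor is positive.\<close>
  consider "Linfty_norm f = 0" | "D = 0" | "Linfty_norm f = top" "D \<noteq> 0" | "Linfty_norm f \<noteq> 0" "Linfty_norm f \<noteq> top" "D \<noteq> 0" by blast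
  then show ?thesis
  proof cases
    case 1
    have "AE x in lborel. f x = 0" using le unfolding 1 by eventually_elim simp
    then show ?thesis by (intro zero enorm_E_integral_AE_0 f' l)
  next
    case 2
    then have "X (\<lambda>x. norm (grad f x)) = 0" using D by simp
    then show ?thesis by (intro zero enorm_E_integral_const f' l AE_const_if_gradient_zero[OF K f])
  next
    case 3
    have "D > 0" using 3 by (simp add: D_def order_less_le)
    then show ?thesis using 3 Kpos D by (simp add: epowr_def ennreal_mult_top ennreal_top_mult)
  next
    case 4
    define M where "M = enn2real (Linfty_norm f)"
    have M: "Linfty_norm f = ennreal M" using 4 by (simp add: M_def less_top)
    have M0: "M > 0" using M 4 by (metis ennreal_0 ennreal_neg not_less)
    have D0: "D > 0" using 4 by (simp add: D_def order_less_le)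
    define l' where "l' = (l / (2 * M) powr \<theta>) powr (1 / (1 - \<theta>))"
    have l': "l' > 0" using l M0 by (simp add: l'_def)
    have le': "AE x in lborel. \<bar>f x\<bar> \<le> M" using le unfolding M by eventually_elim (use M0 in simp)
    have cmp: "AE x in lborel. E_integral \<gamma> l b f x \<le> E_integral \<gamma> l' \<gamma> f x"
      using le'
    proof eventually_elim
      case (elim x)
      show ?case unfolding E_integral_def nn_integral_completion
      proof (rule nn_integral_mono_AE)
        show "AE y in lborel. indicator (E_set l b f) (x, y) * ennreal (norm (x - y) powr (\<gamma> - real DIM('a)))
            \<le> indicator (E_set l' \<gamma> f) (x, y) * ennreal (norm (x - y) powr (\<gamma> - real DIM('a)))"
          using le'
        proof eventually_elim
          case y: (elim y)
          have "(x, y) \<in> E_set l' \<gamma> f" if "(x, y) \<in> E_set l b f"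
          proof -
            have "\<bar>f x - f y\<bar> \<le> 2 * M" using elim y by linarith
            then show ?thesis using that level_powr_less[OF l M0 \<theta>, of "norm (x - y)" "\<bar>f x - f y\<bar>" "1 + \<gamma>"]
              by (simp add: E_set_def b l'_def)
          qed
          then show ?case by (auto simp: indicator_def)
        qed
      qed
    qed
    have "enorm X (E_integral \<gamma> l b f) \<le> ennreal (K / l' * D)"
    proof (rule enorm_le_dual_lborel[OF borel_measurable_E_integral[OF f'(2)]])
      fix w :: "'a \<Rightarrow> ennreal" assume w: "w \<in> borel_measurable borel" "dual_norm X w \<le> 1"
      have "(\<integral>\<^sup>+x. w x * E_integral \<gamma> l b f x \<partial>lborel) \<le> (\<integral>\<^sup>+x. w x * E_integral \<gamma> l' \<gamma> f x \<partial>lborel)"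
        by (rule nn_integral_mono_AE) (use cmp in \<open>eventually_elim, auto intro: mult_left_mono\<close>)
      also have "\<dots> \<le> ennreal (K / l') * X (\<lambda>x. norm (grad f x))"
        using K f l' w by (auto simp: weak_bound_def)
      finally show "(\<integral>\<^sup>+x. w x * E_integral \<gamma> l b f x \<partial>lborel) \<le> ennreal (K / l' * D)"
        using ennreal_mult[of "K / l'" D] D0 Kpos l' by (simp add: D del: times_divide_eq_left)
    qed
    then have "epowr (enorm X (E_integral \<gamma> l b f)) (1 - \<theta>) \<le> ennreal ((K / l' * D) powr (1 - \<theta>))"
      using Kpos l' D0 \<theta> by (intro epowr_le) auto
    then have "ennreal l * epowr (enorm X (E_integral \<gamma> l b f)) (1 - \<theta>) \<le> ennreal l * ennreal ((K / l' * D) powr (1 - \<theta>))"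
      by (intro mult_left_mono) auto
    also have "\<dots> = ennreal (l * (K / l' * D) powr (1 - \<theta>))" using l by (simp add: ennreal_mult)
    also have "l' powr (1 - \<theta>) = l / (2 * M) powr \<theta>" using l M0 \<theta> by (simp add: l'_def powr_powr)
    then have "l * (K / l' * D) powr (1 - \<theta>) = K powr (1 - \<theta>) * 2 powr \<theta> * M powr \<theta> * D powr (1 - \<theta>)"
      using l l' M0 D0 Kpos by (simp add: powr_mult powr_divide)
    also have "ennreal \<dots> = ennreal (K powr (1 - \<theta>) * 2 powr \<theta>) * epowr (Linfty_norm f) \<theta> * epowr (X (\<lambda>x. norm (grad f x))) (1 - \<theta>)"
      using M0 D0 by (simp add: M D epowr_def ennreal_mult)
    finally show ?thesis .
  qed
qed


text \<open>By \<open>interpolated_level\<close> a bad pair is bad for \<open>l1\<close> with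
  exponent 1 + \<open>\<gamma>\<close>, the weak estimate, or for \<open>l2\<close> with exponent
  \<open>\<gamma>\<close> / P, the estimate by the size of \<open>f\<close>. Only a product of
  powers of the two levels is prescribed, so one degree of freedom is left for optimisation.\<close>

lemma interpolation_power_dual:
  assumes K: "weak_bound \<gamma> K" and \<gamma>: "\<gamma> \<noteq> 0" and P: "P \<ge> 1"
    and A: "A \<ge> 1" "\<And>w. w \<in> borel_measurable borel \<Longrightarrow> dual_norm X (maximal w) \<le> ennreal A * dual_norm X w"
    and \<theta>: "0 < \<theta>" "\<theta> < 1" and b: "1 + b = (1 - \<theta>) * (1 + \<gamma>) + \<theta> * (\<gamma> / P)"
  obtains C where "C > 0"
    "\<And>f l1 l2. f \<in> sobolev_functions X \<Longrightarrow> l1 > 0 \<Longrightarrow> l2 > 0 \<Longrightarrow> X (\<lambda>x. \<bar>f x\<bar> powr P) < top \<Longrightarrow>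
      enorm X (E_integral \<gamma> (l1 powr (1 - \<theta>) * l2 powr \<theta>) b f)
      \<le> ennreal (C / l1) * X (\<lambda>x. norm (grad f x)) + ennreal (C / l2 powr P) * X (\<lambda>x. \<bar>f x\<bar> powr P)"
proof (rule pair_level_estimate[OF \<gamma> P, where 'a='a])
  fix K2 assume K2: "K2 > 0" "\<And>(f :: 'a \<Rightarrow> real) w \<tau>. f \<in> borel_measurable borel \<Longrightarrow> w \<in> borel_measurable borel \<Longrightarrow> \<tau> > 0 \<Longrightarrow>
      (\<integral>\<^sup>+x. (\<integral>\<^sup>+y. w x * (indicator {p. \<tau> * norm (fst p - snd p) powr (\<gamma> / P) < \<bar>f (fst p) - f (snd p)\<bar>} (x, y) *
          ennreal (norm (fst (x, y) - snd (x, y)) powr (\<gamma> - DIM('a)))) \<partial>lborel) \<partial>lborel)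
      \<le> ennreal (K2 * (2 / \<tau>) powr P) * ((\<integral>\<^sup>+x. ennreal (\<bar>f x\<bar> powr P) * w x \<partial>lborel) + (\<integral>\<^sup>+x. ennreal (\<bar>f x\<bar> powr P) * maximal w x \<partial>lborel))"
  have K0: "K > 0" using K by (simp add: weak_bound_def)
  define B where "B = K2 * 2 powr P * (1 + A)"
  have B0: "B > 0" using K2(1) A(1) by (simp add: B_def)
  show thesis
  proof (rule that)
    show "K + B > 0" using K0 B0 by simp
    fix f and l1 l2 :: real
    assume f: "f \<in> sobolev_functions X" and l1: "l1 > 0" and l2: "l2 > 0" and fin: "X (\<lambda>x. \<bar>f x\<bar> powr P) < top"
    define l where "l = l1 powr (1 - \<theta>) * l2 powr \<theta>"
    note f' = sobolev_functionsD[OF f]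
    have fP: "(\<lambda>x. \<bar>f x\<bar> powr P) \<in> borel_measurable lebesgue" using f'(2) by measurable
    obtain f0 where f0 [measurable]: "f0 \<in> borel_measurable borel" and ae: "AE x in lborel. f x = f0 x"
      using lebesgue_ex_borel[OF f'(2)] .
    define J where "J p = indicator {p. l2 * norm (fst p - snd p) powr (\<gamma> / P) < \<bar>f0 (fst p) - f0 (snd p)\<bar>} p *
      ennreal (norm (fst p - snd p) powr (\<gamma> - DIM('a)))" for p
    have J: "J \<in> borel_measurable (borel \<Otimes>\<^sub>M borel)" unfolding J_def by (rule borel_measurable_bad_pairs[OF f0])
    note Jm [measurable] = borel_measurable_pair_section_integral[OF J]
    have Em [measurable]: "E_integral \<gamma> r c f0 \<in> borel_measurable borel" for r c
      unfolding E_integral_eq[abs_def] by (rule borel_measurable_pair_section_integral(1)[OF borel_measurable_bad_pairs[OF f0]])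
    have split: "E_integral \<gamma> l b f0 x \<le> E_integral \<gamma> l1 \<gamma> f0 x + (\<integral>\<^sup>+y. J (x, y) \<partial>lborel)" for x
    proof -
      note m [measurable] = borel_measurable_pair_section_integral(2)[OF borel_measurable_bad_pairs[OF f0]]
      have "E_integral \<gamma> l b f0 x \<le> (\<integral>\<^sup>+y. (indicator {p. l1 * norm (fst p - snd p) powr (1 + \<gamma>) < \<bar>f0 (fst p) - f0 (snd p)\<bar>} (x, y) *
          ennreal (norm (fst (x, y) - snd (x, y)) powr (\<gamma> - DIM('a)))) + J (x, y) \<partial>lborel)"
        unfolding E_integral_eq
      proof (rule nn_integral_mono)
        fix y
        have "l1 * norm (x - y) powr (1 + \<gamma>) < \<bar>f0 x - f0 y\<bar> \<or> l2 * norm (x - y) powr (\<gamma> / P) < \<bar>f0 x - f0 y\<bar>"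
          if "l * norm (x - y) powr (1 + b) < \<bar>f0 x - f0 y\<bar>" "x \<noteq> y"
          using interpolated_level[OF l1 l2 \<theta>, of "norm (x - y)" "1 + \<gamma>" "\<gamma> / P" "\<bar>f0 x - f0 y\<bar>"] that
          by (simp add: l_def b)
        then show "indicator {p. l * norm (fst p - snd p) powr (1 + b) < \<bar>f0 (fst p) - f0 (snd p)\<bar>} (x, y) *
            ennreal (norm (fst (x, y) - snd (x, y)) powr (\<gamma> - DIM('a)))
          \<le> indicator {p. l1 * norm (fst p - snd p) powr (1 + \<gamma>) < \<bar>f0 (fst p) - f0 (snd p)\<bar>} (x, y) *
            ennreal (norm (fst (x, y) - snd (x, y)) powr (\<gamma> - DIM('a))) + J (x, y)"
          by (cases "x = y") (auto simp: J_def indicator_def)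
      qed
      also have "\<dots> = E_integral \<gamma> l1 \<gamma> f0 x + (\<integral>\<^sup>+y. J (x, y) \<partial>lborel)"
        unfolding E_integral_eq by (rule nn_integral_add[OF m Jm(2)])
      finally show ?thesis .
    qed
    show "enorm X (E_integral \<gamma> (l1 powr (1 - \<theta>) * l2 powr \<theta>) b f)
      \<le> ennreal ((K + B) / l1) * X (\<lambda>x. norm (grad f x)) + ennreal ((K + B) / l2 powr P) * X (\<lambda>x. \<bar>f x\<bar> powr P)"
      unfolding l_def[symmetric]
    proof (rule enorm_le_dual_lborel[OF borel_measurable_E_integral[OF f'(2)]])
      fix w :: "'a \<Rightarrow> ennreal" assume w [measurable]: "w \<in> borel_measurable borel" and w1: "dual_norm X w \<le> 1"
      have power: "(\<integral>\<^sup>+x. ennreal (\<bar>f0 x\<bar> powr P) * u x \<partial>lborel) \<le> ennreal a * X (\<lambda>x. \<bar>f x\<bar> powr P)"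
        if "u \<in> borel_measurable borel" "dual_norm X u \<le> ennreal a" for u a
      proof -
        have "(\<integral>\<^sup>+x. ennreal (\<bar>f0 x\<bar> powr P) * u x \<partial>lborel) = (\<integral>\<^sup>+x. ennreal \<bar>\<bar>f x\<bar> powr P\<bar> * u x \<partial>lborel)"
          by (rule nn_integral_cong_AE) (use ae in \<open>eventually_elim, simp\<close>)
        also have "\<dots> \<le> ennreal a * X (\<lambda>x. \<bar>f x\<bar> powr P)" by (rule Hoelder_lborel[OF fP fin that])
        finally show ?thesis .
      qed
      have mw: "dual_norm X (maximal w) \<le> ennreal A"
        using order_trans[OF A(2)[OF w] mult_left_mono[OF w1]] by simp
      have "(\<integral>\<^sup>+x. w x * E_integral \<gamma> l b f x \<partial>lborel) = (\<integral>\<^sup>+x. w x * E_integral \<gamma> l b f0 x \<partial>lborel)"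
        by (rule nn_integral_cong_AE) (use E_integral_cong_AE[OF ae, of \<gamma> l b] in \<open>eventually_elim, simp\<close>)
      also have "\<dots> \<le> (\<integral>\<^sup>+x. w x * E_integral \<gamma> l1 \<gamma> f0 x + w x * (\<integral>\<^sup>+y. J (x, y) \<partial>lborel) \<partial>lborel)"
        by (intro nn_integral_mono) (simp add: distrib_left[symmetric] mult_left_mono split)
      also have "\<dots> = (\<integral>\<^sup>+x. w x * E_integral \<gamma> l1 \<gamma> f0 x \<partial>lborel) + (\<integral>\<^sup>+x. w x * (\<integral>\<^sup>+y. J (x, y) \<partial>lborel) \<partial>lborel)"
        by (rule nn_integral_add) measurable
      also have "(\<integral>\<^sup>+x. w x * E_integral \<gamma> l1 \<gamma> f0 x \<partial>lborel) = (\<integral>\<^sup>+x. w x * E_integral \<gamma> l1 \<gamma> f x \<partial>lborel)"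
        by (rule nn_integral_cong_AE) (use E_integral_cong_AE[OF ae, of \<gamma> l1 \<gamma>] in \<open>eventually_elim, simp\<close>)
      also have "\<dots> \<le> ennreal (K / l1) * X (\<lambda>x. norm (grad f x))"
        using K f l1 w w1 by (auto simp: weak_bound_def)
      also have "(\<integral>\<^sup>+x. w x * (\<integral>\<^sup>+y. J (x, y) \<partial>lborel) \<partial>lborel) = (\<integral>\<^sup>+x. (\<integral>\<^sup>+y. w x * J (x, y) \<partial>lborel) \<partial>lborel)"
        by (intro nn_integral_cong nn_integral_cmult[symmetric] Jm)
      also have "\<dots> \<le> ennreal (K2 * (2 / l2) powr P) *
          ((\<integral>\<^sup>+x. ennreal (\<bar>f0 x\<bar> powr P) * w x \<partial>lborel) + (\<integral>\<^sup>+x. ennreal (\<bar>f0 x\<bar> powr P) * maximal w x \<partial>lborel))"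
        unfolding J_def by (rule K2(2)[OF f0 w l2])
      also have "\<dots> \<le> ennreal (K2 * (2 / l2) powr P) * (ennreal 1 * X (\<lambda>x. \<bar>f x\<bar> powr P) + ennreal A * X (\<lambda>x. \<bar>f x\<bar> powr P))"
        using w1 by (intro mult_left_mono add_mono power mw) auto
      also have "\<dots> = ennreal (K2 * (2 / l2) powr P) * ennreal (1 + A) * X (\<lambda>x. \<bar>f x\<bar> powr P)"
        using A(1) by (simp add: distrib_right mult.assoc)
      also have "ennreal (K2 * (2 / l2) powr P) * ennreal (1 + A) = ennreal (K2 * (2 / l2) powr P * (1 + A))"
        by (rule ennreal_mult[symmetric]) (use K2(1) A(1) in auto)
      also have "K2 * (2 / l2) powr P * (1 + A) = B / l2 powr P"
        using l2 by (simp add: B_def powr_divide)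
      finally have "(\<integral>\<^sup>+x. w x * E_integral \<gamma> l b f x \<partial>lborel)
          \<le> ennreal (K / l1) * X (\<lambda>x. norm (grad f x)) + ennreal (B / l2 powr P) * X (\<lambda>x. \<bar>f x\<bar> powr P)"
        by (simp add: add_mono)
      also have "\<dots> \<le> ennreal ((K + B) / l1) * X (\<lambda>x. norm (grad f x)) + ennreal ((K + B) / l2 powr P) * X (\<lambda>x. \<bar>f x\<bar> powr P)"
        using K0 B0 l1 l2 by (intro add_mono mult_right_mono ennreal_leI divide_right_mono) auto
      finally show "(\<integral>\<^sup>+x. w x * E_integral \<gamma> l b f x \<partial>lborel)
          \<le> ennreal ((K + B) / l1) * X (\<lambda>x. norm (grad f x)) + ennreal ((K + B) / l2 powr P) * X (\<lambda>x. \<bar>f x\<bar> powr P)" .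
    qed
  qed
qed

lemma power_norm_finiteD:
  assumes P: "P > 0" and N: "power_norm X P f = ennreal N" "N \<ge> 0"
  shows "X (\<lambda>x. \<bar>f x\<bar> powr P) = ennreal (N powr P)"
proof -
  let ?e = "X (\<lambda>x. \<bar>f x\<bar> powr P)"
  have fin: "?e \<noteq> top" using N by (auto simp: power_norm_def epowr_def)
  then have "ennreal (enn2real ?e powr (1 / P)) = ennreal N" using N by (simp add: power_norm_def epowr_def)
  then have "enn2real ?e powr (1 / P) = N" using N by (simp add: ennreal_inj)
  then have "N powr P = enn2real ?e" using P enn2real_nonneg by (auto simp: powr_powr)
  then show ?thesis using fin by (simp add: less_top)
qed

lemma interpolation_power:
  assumes K: "weak_bound \<gamma> K" and \<gamma>: "\<gamma> \<noteq> 0" and P: "P \<ge> 1"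
    and A: "A \<ge> 1" "\<And>w. w \<in> borel_measurable borel \<Longrightarrow> dual_norm X (maximal w) \<le> ennreal A * dual_norm X w"
    and \<theta>: "0 < \<theta>" "\<theta> < 1" and b: "1 + b = (1 - \<theta>) * (1 + \<gamma>) + \<theta> * (\<gamma> / P)" and \<sigma>: "\<sigma> = 1 - \<theta> + \<theta> / P"
  obtains C where "C > 0"
    "\<And>f l. f \<in> sobolev_functions X \<Longrightarrow> l > 0 \<Longrightarrow> ennreal l * epowr (enorm X (E_integral \<gamma> l b f)) \<sigma>
    \<le> ennreal C * epowr (power_norm X P f) \<theta> * epowr (X (\<lambda>x. norm (grad f x))) (1 - \<theta>)"
proof (rule interpolation_power_dual[OF K \<gamma> P A \<theta> b])
  fix C assume C: "C > 0" "\<And>f l1 l2. f \<in> sobolev_functions X \<Longrightarrow> l1 > 0 \<Longrightarrow> l2 > 0 \<Longrightarrow> X (\<lambda>x. \<bar>f x\<bar> powr P) < top \<Longrightarrow>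
      enorm X (E_integral \<gamma> (l1 powr (1 - \<theta>) * l2 powr \<theta>) b f)
      \<le> ennreal (C / l1) * X (\<lambda>x. norm (grad f x)) + ennreal (C / l2 powr P) * X (\<lambda>x. \<bar>f x\<bar> powr P)"
  have \<sigma>0: "\<sigma> > 0" using \<theta> P by (simp add: \<sigma> add_pos_nonneg)
  show thesis
  proof (rule that)
    show "(2 * C) powr \<sigma> > 0" using C(1) by simp
    fix f and l :: real assume f: "f \<in> sobolev_functions X" and l: "l > 0"
    note f' = sobolev_functionsD[OF f]
    let ?claim = "ennreal l * epowr (enorm X (E_integral \<gamma> l b f)) \<sigma>
      \<le> ennreal ((2 * C) powr \<sigma>) * epowr (power_norm X P f) \<theta> * epowr (X (\<lambda>x. norm (grad f x))) (1 - \<theta>)"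
    have fP: "(\<lambda>x. \<bar>f x\<bar> powr P) \<in> borel_measurable lebesgue" using f'(2) by measurable
    have zero: ?claim if "enorm X (E_integral \<gamma> l b f) = 0" using that by (simp add: epowr_def)
    define D where "D = enn2real (X (\<lambda>x. norm (grad f x)))"
    have D: "X (\<lambda>x. norm (grad f x)) = ennreal D" using f'(5) by (simp add: D_def)
    define N where "N = enn2real (power_norm X P f)"
    consider "power_norm X P f = 0" | "D = 0" | "power_norm X P f = top" "D \<noteq> 0" | "power_norm X P f \<noteq> 0" "power_norm X P f \<noteq> top" "D \<noteq> 0" by blast
    then show ?claim
    proof cases
      case 1
      then have "X (\<lambda>x. \<bar>f x\<bar> powr P) = ennreal (0 powr P)" using P by (intro power_norm_finiteD) auto
      then have "AE x in lebesgue. \<bar>f x\<bar> powr P = 0" by (intro norm_eq_0D fP) simp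
      then have "AE x in lborel. f x = 0" by (simp add: AE_lebesgue_iff_lborel)
      then show ?thesis by (intro zero enorm_E_integral_AE_0 f' l)
    next
      case 2
      then have "X (\<lambda>x. norm (grad f x)) = 0" using D by simp
      then show ?thesis by (intro zero enorm_E_integral_const f' l AE_const_if_gradient_zero[OF K f])
    next
      case 3
      have "D > 0" using 3 by (simp add: D_def order_less_le)
      then show ?thesis using 3 C(1) D by (simp add: epowr_def ennreal_mult_top ennreal_top_mult)
    next
      case 4
      have N: "power_norm X P f = ennreal N" using 4 by (simp add: N_def less_top)
      have N0: "N > 0" using N 4 by (metis ennreal_0 ennreal_neg not_less)
      have D0: "D > 0" using 4 by (simp add: D_def order_less_le)
      have XP: "X (\<lambda>x. \<bar>f x\<bar> powr P) = ennreal (N powr P)"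
        using P N0 by (intro power_norm_finiteD N) auto
      \<comment> \<open>Equal contributions mean l1 = D / t and l2 = N / t^(1/P). The prescribed
        product \<open>l\<close> then determines \<open>t\<close> through \<open>t\<sigma>\<close>,
        and each term becomes C * t.\<close>
      define t where "t = (D powr (1 - \<theta>) * N powr \<theta> / l) powr (1 / \<sigma>)"
      have t0: "t > 0" using D0 N0 l by (simp add: t_def)
      have t\<sigma>: "t powr \<sigma> = D powr (1 - \<theta>) * N powr \<theta> / l" using \<sigma>0 D0 N0 l by (simp add: t_def powr_powr)
      define l1 l2 where "l1 = D / t" and "l2 = N / t powr (1 / P)"
      have l12: "l1 > 0" "l2 > 0" using D0 N0 t0 by (simp_all add: l1_def l2_def)
      have "l1 powr (1 - \<theta>) * l2 powr \<theta> = D powr (1 - \<theta>) * N powr \<theta> / (t powr (1 - \<theta>) * t powr (\<theta> / P))"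
        using D0 N0 t0 by (simp add: l1_def l2_def powr_divide powr_powr)
      also have "t powr (1 - \<theta>) * t powr (\<theta> / P) = t powr \<sigma>" by (simp add: \<sigma> powr_add)
      also have "D powr (1 - \<theta>) * N powr \<theta> / t powr \<sigma> = l" using D0 N0 l by (simp add: t\<sigma>)
      finally have leq: "l1 powr (1 - \<theta>) * l2 powr \<theta> = l" .
      have "enorm X (E_integral \<gamma> l b f) \<le> ennreal (C / l1) * ennreal D + ennreal (C / l2 powr P) * ennreal (N powr P)"
        using C(2)[OF f l12] unfolding leq D XP by simp
      also have "\<dots> = ennreal (C / l1 * D) + ennreal (C / l2 powr P * N powr P)"
        using C(1) l12 D0 by (simp add: ennreal_mult[symmetric])
      also have "C / l1 * D = C * t" using D0 by (simp add: l1_def)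
      also have "C / l2 powr P * N powr P = C * t" using N0 t0 P by (simp add: l2_def powr_divide powr_powr)
      also have "ennreal (C * t) + ennreal (C * t) = ennreal (2 * C * t)" using C(1) t0 by (simp flip: ennreal_plus)
      finally have "epowr (enorm X (E_integral \<gamma> l b f)) \<sigma> \<le> ennreal ((2 * C * t) powr \<sigma>)"
        using C(1) t0 \<sigma>0 by (intro epowr_le) auto
      then have "ennreal l * epowr (enorm X (E_integral \<gamma> l b f)) \<sigma> \<le> ennreal l * ennreal ((2 * C * t) powr \<sigma>)"
        by (intro mult_left_mono) auto
      also have "\<dots> = ennreal (l * (2 * C * t) powr \<sigma>)" using l by (simp add: ennreal_mult)
      also have "l * (2 * C * t) powr \<sigma> = (2 * C) powr \<sigma> * N powr \<theta> * D powr (1 - \<theta>)"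
      proof -
        have "(2 * C * t) powr \<sigma> = (2 * C) powr \<sigma> * t powr \<sigma>" by (rule powr_mult)
        then show ?thesis using l by (simp add: t\<sigma>)
      qed
      also have "ennreal \<dots> = ennreal ((2 * C) powr \<sigma>) * epowr (power_norm X P f) \<theta> * epowr (X (\<lambda>x. norm (grad f x))) (1 - \<theta>)"
        using N0 D0 by (simp add: N D epowr_def ennreal_mult)
      finally show ?thesis .
    qed
  qed
qed

end

theorem theorem6p4:
  fixes X :: "('a::euclidean_space \<Rightarrow> real) \<Rightarrow> ennreal"
    and \<gamma> s \<theta> :: real and p p1 :: ereal
  assumes "\<gamma> \<in> {..< -1} \<union> {0<..}"
    and "s \<in> {0<..<1}" and "\<theta> \<in> {0<..<1}"
    and "p \<in> {1..\<infinity>}" and "p1 \<in> {1..\<infinity>}"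
    and "s = 1 - \<theta>"
    and "1 / p = ereal (1 - \<theta>) + ereal \<theta> / p1"
    and "ball_banach_function_space X"
    and "absolutely_continuous_norm X"
    and "bounded_operator (associate_norm X) HL_maximal \<or>
         (endpoint_bounded_on_associate X \<and> ball_averages_uniformly_bounded X)"
  shows
    "(p1 < \<infinity> \<longrightarrow>
       (\<exists>C::real. C > 0 \<and> (\<forall>f \<in> sobolev_functions X.
          (SUP l \<in> {0<..}. ennreal l *
             epowr (enorm X (E_integral \<gamma> l (\<gamma> / real_of_ereal p + s - 1) f)) (1 / real_of_ereal p))
          \<le> ennreal C * epowr (power_norm X (real_of_ereal p1) f) \<theta>
              * epowr (X (\<lambda>x. norm (grad f x))) (1 - \<theta>)))) \<and>
     (p1 = \<infinity> \<longrightarrow>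
       (\<exists>C::real. C > 0 \<and> (\<forall>f \<in> sobolev_functions X.
          (SUP l \<in> {0<..}. ennreal l *
             epowr (enorm X (E_integral \<gamma> l (\<gamma> / real_of_ereal p + s - 1) f)) (1 / real_of_ereal p))
          \<le> ennreal C * epowr (Linfty_norm f) \<theta>
              * epowr (X (\<lambda>x. norm (grad f x))) (1 - \<theta>))))"
proof -
  interpret ball_banach_function_space X by (rule assms)
  have \<gamma>: "\<gamma> < -1 \<or> \<gamma> > 0" "\<gamma> \<noteq> 0" using assms(1) by auto
  have \<theta>: "0 < \<theta>" "\<theta> < 1" using assms(3) by auto
  obtain A where A: "A \<ge> 1" "\<And>w. w \<in> borel_measurable borel \<Longrightarrow> dual_norm X (maximal w) \<le> ennreal A * dual_norm X w"
    by (rule dual_norm_maximal_bounded) (use assms(10) in auto)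
  have "\<exists>K. weak_bound \<gamma> K"
    by (rule weak_estimate_dual[OF \<gamma>(1) A]) (auto simp: weak_bound_def)
  then obtain K where K: "weak_bound \<gamma> K" by blast
  define \<sigma> where "\<sigma> = 1 / real_of_ereal p"
  define b where "b = \<gamma> / real_of_ereal p + s - 1"
  have b: "1 + b = 1 - \<theta> + \<gamma> * \<sigma>" by (simp add: b_def \<sigma>_def assms(6))
  have \<sigma>: "ereal \<sigma> = 1 / p" if "1 / p = ereal r" "r > 0" for r
    using that assms(4) by (cases p) (auto simp: \<sigma>_def one_ereal_def)
  show ?thesis
    unfolding b_def[symmetric] \<sigma>_def[symmetric]
  proof (intro conjI impI)
    assume "p1 < \<infinity>"
    then obtain P where P: "p1 = ereal P" "P \<ge> 1" using assms(5) by (cases p1) auto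
    have "1 / p = ereal (1 - \<theta> + \<theta> / P)" using assms(7) P by simp
    moreover have "1 - \<theta> + \<theta> / P > 0" using \<theta> P by (simp add: add_pos_nonneg)
    ultimately have \<sigma>': "\<sigma> = 1 - \<theta> + \<theta> / P" using \<sigma> by simp
    \<comment> \<open>The exponent of the level set interpolates between 1 + \<open>\<gamma>\<close>
      for the gradient and \<open>\<gamma>\<close> / P for the function itself; this is where the
      relation between p, p1 and \<open>\<theta>\<close> enters.\<close>
    have b': "1 + b = (1 - \<theta>) * (1 + \<gamma>) + \<theta> * (\<gamma> / P)" unfolding b \<sigma>' by (simp add: algebra_simps)
    show "\<exists>C>0. \<forall>f\<in>sobolev_functions X. (SUP l\<in>{0<..}. ennreal l * epowr (enorm X (E_integral \<gamma> l b f)) \<sigma>)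
        \<le> ennreal C * epowr (power_norm X (real_of_ereal p1) f) \<theta> * epowr (X (\<lambda>x. norm (grad f x))) (1 - \<theta>)"
    proof (rule interpolation_power[OF K \<gamma>(2) P(2) A \<theta> b' \<sigma>'])
      fix C assume C: "C > 0" "\<And>f l. f \<in> sobolev_functions X \<Longrightarrow> l > 0 \<Longrightarrow> ennreal l * epowr (enorm X (E_integral \<gamma> l b f)) \<sigma>
        \<le> ennreal C * epowr (power_norm X P f) \<theta> * epowr (X (\<lambda>x. norm (grad f x))) (1 - \<theta>)"
      then show ?thesis unfolding P(1) by (intro exI[of _ C]) (auto intro!: SUP_least)
    qed
  next
    assume "p1 = \<infinity>"
    then have "1 / p = ereal (1 - \<theta>)" using assms(7) by simp
    then have \<sigma>': "\<sigma> = 1 - \<theta>" using \<sigma> \<theta> by fastforce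
    have b': "1 + b = (1 - \<theta>) * (1 + \<gamma>)" unfolding b \<sigma>' by (simp add: algebra_simps)
    show "\<exists>C>0. \<forall>f\<in>sobolev_functions X. (SUP l\<in>{0<..}. ennreal l * epowr (enorm X (E_integral \<gamma> l b f)) \<sigma>)
        \<le> ennreal C * epowr (Linfty_norm f) \<theta> * epowr (X (\<lambda>x. norm (grad f x))) (1 - \<theta>)"
      unfolding \<sigma>'
      using K by (intro exI[of _ "K powr (1 - \<theta>) * 2 powr \<theta>"] conjI ballI SUP_least interpolation_Linfty[OF K \<theta> _ _ b'])
        (auto simp: weak_bound_def)
  qed
qed

end
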